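(* Let $G$ be a locally compact abelian group with a compact open subgroup $H$, let $\mathcal{C}\subseteq\widehat{G}$ be a set of coset representatives of $\widehat{G}/H^{\perp}$, and let $f\in L^2(G)$. Let $N=\{\eta\in H^{\perp} : \Phi_{\mathcal{C}}(f)(\eta)=0\}$ (defined up to sets of measure $0$). Then for all real constants $A,B>0$ the following are equivalent: (1) the family $\{\tau_{[x],\mathcal{C}}f : [x]\in G/H\}$ is a frame for $V_{\mathcal{C},f}$ with bounds $A$ and $B$, i.e. $$A\,\|g\|_{L^2(G)}^2\le \sum_{[x]\in G/H}|\langle g,\tau_{[x],\mathcal{C}}f\rangle_{L^2(G)}|^2\le B\,\|g\|_{L^2(G)}^2\quad\text{for all } g\in V_{\mathcal{C},f};$$ (2) $A\le \Phi_{\mathcal{C}}(f)(\eta)\le B$ for almost every $\eta\in H^{\perp}\setminus N$. In particular, $\{\tau_{[x],\mathcal{C}}f : [x]\in G/H\}$ is a frame for $V_{\mathcal{C},f}$ if and only if there exist $A,B>0$ such that $A\le\Phi_{\mathcal{C}}(f)\le B$ almost everywhere on $H^{\perp}\setminus N$.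
   Context: $\widehat{G}$ is the dual group of $G$ (written additively), $(x,\gamma)$ denotes the value of the character $\gamma\in\widehat{G}$ at $x\in G$, and $H^{\perp}=\{\gamma\in\widehat{G} : (x,\gamma)=1 \text{ for all } x\in H\}$, a compact open subgroup of $\widehat{G}$. Haar measures $\mu$ on $G$ and $\nu$ on $\widehat{G}$ are normalized by $\mu(H)=1$ and $\nu(H^{\perp})=1$; $H^{\perp}$ carries the restriction of $\nu$, written $d\eta$. The Fourier transform is $\widehat{f}(\gamma)=\int_G f(x)\overline{(x,\gamma)}\,d\mu(x)$ on $L^1(G)\cap L^2(G)$, extended to a unitary map $L^2(G)\to L^2(\widehat{G})$; its inverse is denoted by ${}^\vee$. A set of coset representatives $\mathcal{C}$ of $\widehat{G}/H^{\perp}$ is a subset of $\widehat{G}$ containing exactly one element of each coset of $H^{\perp}$. Each $\gamma\in\widehat{G}$ is written uniquely as $\gamma=\sigma_\gamma+\eta_\gamma$ with $\sigma_\gamma\in\mathcal{C}$, $\eta_\gamma\in H^{\perp}$. For $[x]=x+H\in G/H$, let $w_{[x],\mathcal{C}}(\gamma)=\overline{(x,\eta_\gamma)}$ for $\gamma\in\widehat{G}$ (this depends only on $[x]$ and $\mathcal{C}$). The translation operator $\tau_{[x],\mathcal{C}}:L^2(G)\to L^2(G)$ is $\tau_{[x],\mathcal{C}}f=f*w_{[x],\mathcal{C}}^{\vee}$, i.e. the element of $L^2(G)$ with Fourier transform $\widehat{f}\,w_{[x],\mathcal{C}}$. $V_{\mathcal{C},f}$ is the closed linear span in $L^2(G)$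 of $\{\tau_{[x],\mathcal{C}}f : [x]\in G/H\}$. The spectral symbol is $\Phi_{\mathcal{C}}(f)(\eta)=\sum_{\sigma\in\mathcal{C}}|\widehat{f}(\eta+\sigma)|^2$ for $\eta\in H^{\perp}$; it belongs to $L^1(H^{\perp})$. A family $\{x_j\}_{j\in J}$ in a Hilbert space $V$ is a frame for $V$ if there are $A,B>0$ with $A\|x\|^2\le\sum_{j\in J}|\langle x,x_j\rangle|^2\le B\|x\|^2$ for all $x\in V$. The sets $G/H$ and $\mathcal{C}$ are not assumed countable; sums over them are unordered sums. *)

theory Defs
  imports "HOL-Analysis.Analysis"
begin

section \<open>The dual group\<close>

typedef (overloaded) ('g :: topological_ab_group_add) dual =
  "{\<phi>. continuous_on UNIV (\<phi> :: 'g \<Rightarrow> complex) \<and> (\<forall>x. cmod (\<phi> x) = 1) \<and> (\<forall>x y. \<phi> (x + y) = \<phi> x * \<phi> y)}"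
  morphisms char_app Abs_dual
  by (rule exI[of _ "\<lambda>_. 1"]) simp

setup_lifting type_definition_dual

lemma char_app_continuous: "continuous_on UNIV (char_app \<gamma>)"
  and cmod_char_app [simp]: "cmod (char_app \<gamma> x) = 1"
  and char_app_add_right: "char_app \<gamma> (x + y) = char_app \<gamma> x * char_app \<gamma> y"
  using char_app[of \<gamma>] by auto

lemma char_app_mult_cnj [simp]: "char_app \<gamma> x * cnj (char_app \<gamma> x) = 1"
  by (simp add: complex_norm_square[symmetric])

instantiation dual :: (topological_ab_group_add) ab_group_add
begin

lift_definition zero_dual :: "'a dual" is "\<lambda>_. 1"
  by simp

lift_definition plus_dual :: "'a dual \<Rightarrow> 'a dual \<Rightarrow> 'a dual" is "\<lambda>\<phi> \<psi> x. \<phi> x * \<psi> x"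
  by (auto simp: norm_mult intro: continuous_intros)

lift_definition uminus_dual :: "'a dual \<Rightarrow> 'a dual" is "\<lambda>\<phi> x. cnj (\<phi> x)"
  by (auto intro: continuous_intros)

lift_definition minus_dual :: "'a dual \<Rightarrow> 'a dual \<Rightarrow> 'a dual" is "\<lambda>\<phi> \<psi> x. \<phi> x * cnj (\<psi> x)"
  by (auto simp: norm_mult intro!: continuous_intros)

instance
proof
  fix a b c :: "'a dual"
  show "a + b + c = a + (b + c)" by transfer (simp add: mult.assoc)
  show "a + b = b + a" by transfer (simp add: mult.commute)
  show "0 + a = a" by transfer simp
  show "- a + a = 0"
    by transfer (auto simp: complex_norm_square[symmetric] mult.commute)
  show "a - b = a + - b" by transfer simp
qed

end

lemma char_app_zero [simp]: "char_app 0 x = 1"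
  and char_app_add: "char_app (\<gamma> + \<delta>) x = char_app \<gamma> x * char_app \<delta> x"
  and char_app_uminus: "char_app (- \<gamma>) x = cnj (char_app \<gamma> x)"
  and char_app_diff: "char_app (\<gamma> - \<delta>) x = char_app \<gamma> x * cnj (char_app \<delta> x)"
  by (transfer, simp)+

text \<open>The dual group carries the compact-open topology.\<close>

definition char_subbasis :: "('g :: topological_ab_group_add) dual set set" where
  "char_subbasis = {{\<gamma>. char_app \<gamma> ` K \<subseteq> U} |K U. compact K \<and> open U}"

instantiation dual :: (topological_ab_group_add) topological_space
begin

definition open_dual :: "'a dual set \<Rightarrow> bool" where
  "open_dual = generate_topology char_subbasis"

instance
proof
  show "open (UNIV :: 'a dual set)"
    unfolding open_dual_def by (rule generate_topology.UNIV)
  show "open (S \<inter> T)" if "open S" "open T" for S T :: "'a dual set"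
    using that unfolding open_dual_def by (rule generate_topology.Int)
  show "open (\<Union> K)" if "\<forall>S\<in>K. open S" for K :: "'a dual set set"
    using that unfolding open_dual_def by (intro generate_topology.UN) blast
qed

end

lemma eventually_char_close:
  fixes K :: "('g :: topological_ab_group_add) set"
  assumes "compact K" "e > 0"
  shows "\<forall>\<^sub>F \<gamma> in nhds \<delta>. \<forall>x\<in>K. cmod (char_app \<gamma> x - char_app \<delta> x) < e"
proof -
  let ?d = "char_app \<delta>"
  have cont: "continuous_on K ?d"
    using char_app_continuous continuous_on_subset by blast
  have "compact (?d ` K)"
    using cont assms(1) by (rule compact_continuous_image)
  then obtain Z where Z: "finite Z" "?d ` K \<subseteq> (\<Union>z\<in>Z. ball z (e / 4))"
    using assms(2) unfolding compact_eq_totally_bounded by (meson zero_less_divide_iff zero_less_numeral)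
  define L where "L z = K \<inter> ?d -` cball z (e / 4)" for z
  have "compact (L z)" for z
  proof -
    have "closed (?d -` cball z (e / 4))"
      using char_app_continuous[of \<delta>] by (intro closed_vimage) auto
    then show ?thesis
      unfolding L_def using assms(1) by (rule compact_Int_closed[rotated])
  qed
  moreover have "?d ` L z \<subseteq> ball z (e / 2)" for z
    using assms(2) by (auto simp: L_def)
  ultimately have "\<forall>\<^sub>F \<gamma> in nhds \<delta>. char_app \<gamma> ` L z \<subseteq> ball z (e / 2)" for z
    unfolding eventually_nhds
    by (intro exI[of _ "{\<gamma>. char_app \<gamma> ` L z \<subseteq> ball z (e / 2)}"])
      (auto simp: open_dual_def char_subbasis_def intro!: generate_topology.Basis)
  then have "\<forall>\<^sub>F \<gamma> in nhds \<delta>. \<forall>z\<in>Z. char_app \<gamma> ` L z \<subseteq> ball z (e / 2)"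
    using Z(1) by (simp add: eventually_ball_finite)
  then show ?thesis
  proof (rule eventually_mono, intro ballI)
    fix \<gamma> x assume *: "\<forall>z\<in>Z. char_app \<gamma> ` L z \<subseteq> ball z (e / 2)" and "x \<in> K"
    then obtain z where z: "z \<in> Z" "?d x \<in> ball z (e / 4)"
      using Z(2) by blast
    then have "x \<in> L z"
      using \<open>x \<in> K\<close> by (auto simp: L_def)
    then have "char_app \<gamma> x \<in> ball z (e / 2)"
      using * z(1) by blast
    then have "dist z (char_app \<gamma> x) < e / 2"
      by simp
    moreover have "dist z (?d x) < e / 4"
      using z(2) by simp
    ultimately have "dist (char_app \<gamma> x) (?d x) < e"
      using dist_triangle[of "char_app \<gamma> x" "?d x" z] assms(2) by (simp add: dist_commute)
    then show "cmod (char_app \<gamma> x - ?d x) < e"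
      by (simp add: dist_norm)
  qed
qed

lemma tendsto_dualI:
  fixes f :: "'b \<Rightarrow> ('g :: topological_ab_group_add) dual"
  assumes "\<And>K e. compact K \<Longrightarrow> e > 0 \<Longrightarrow>
    \<forall>\<^sub>F i in F. \<forall>x\<in>K. cmod (char_app (f i) x - char_app l x) < e"
  shows "(f \<longlongrightarrow> l) F"
proof (rule topological_tendstoI)
  fix S :: "'g dual set" assume "open S" "l \<in> S"
  then have "generate_topology char_subbasis S" "l \<in> S"
    by (auto simp: open_dual_def)
  then show "\<forall>\<^sub>F i in F. f i \<in> S"
  proof (induction S)
    case UNIV then show ?case by simp
  next
    case (Int a b) then show ?case by (auto intro: eventually_conj)
  next
    case (UN B)
    then obtain S where "S \<in> B" "l \<in> S" by blast
    with UN have "\<forall>\<^sub>F i in F. f i \<in> S" by blast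
    with \<open>S \<in> B\<close> show ?case by (auto elim!: eventually_mono)
  next
    case (Basis S)
    then obtain K U where S: "S = {\<gamma>. char_app \<gamma> ` K \<subseteq> U}" "compact K" "open U"
      by (auto simp: char_subbasis_def)
    have "compact (char_app l ` K)"
      using S(2) char_app_continuous continuous_on_subset compact_continuous_image by blast
    moreover have "char_app l ` K \<subseteq> U"
      using Basis(2) S(1) by simp
    ultimately obtain e where e: "e > 0" "(\<Union>z\<in>char_app l ` K. ball z e) \<subseteq> U"
      using S(3) compact_subset_open_imp_ball_epsilon_subset by metis
    show ?case
      using assms[OF S(2) e(1)]
    proof (rule eventually_mono)
      fix i assume *: "\<forall>x\<in>K. cmod (char_app (f i) x - char_app l x) < e"
      have "char_app (f i) x \<in> U" if "x \<in> K" for x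
      proof -
        have "char_app (f i) x \<in> ball (char_app l x) e"
          using * that by (simp add: dist_norm norm_minus_commute)
        then show ?thesis using e(2) that by blast
      qed
      then show "f i \<in> S" by (auto simp: S(1))
    qed
  qed
qed

instance dual :: (topological_ab_group_add) topological_ab_group_add
proof
  fix a b :: "'a dual"
  show "LIM x (nhds a \<times>\<^sub>F nhds b). fst x + snd x :> nhds (a + b)"
  proof (rule tendsto_dualI)
    fix K :: "'a set" and e :: real assume K: "compact K" and e: "e > 0"
    have "\<forall>\<^sub>F p in nhds a \<times>\<^sub>F nhds b.
      (\<forall>x\<in>K. cmod (char_app (fst p) x - char_app a x) < e / 2) \<and>
      (\<forall>x\<in>K. cmod (char_app (snd p) x - char_app b x) < e / 2)"
      using eventually_prodI[OF eventually_char_close[OF K, of "e / 2" a] eventually_char_close[OF K, of "e / 2" b]] e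
      by simp
    then show "\<forall>\<^sub>F p in nhds a \<times>\<^sub>F nhds b. \<forall>x\<in>K. cmod (char_app (fst p + snd p) x - char_app (a + b) x) < e"
    proof (rule eventually_mono, intro ballI)
      fix p x
      assume *: "(\<forall>x\<in>K. cmod (char_app (fst p) x - char_app a x) < e / 2) \<and>
          (\<forall>x\<in>K. cmod (char_app (snd p) x - char_app b x) < e / 2)" and x: "x \<in> K"
      have "char_app (fst p + snd p) x - char_app (a + b) x =
        (char_app (fst p) x - char_app a x) * char_app (snd p) x + char_app a x * (char_app (snd p) x - char_app b x)"
        by (simp add: char_app_add algebra_simps)
      also have "cmod \<dots> \<le> cmod (char_app (fst p) x - char_app a x) + cmod (char_app (snd p) x - char_app b x)"
        by (rule order.trans[OF norm_triangle_ineq]) (simp add: norm_mult)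
      also have "\<dots> < e / 2 + e / 2"
        using * x by (intro add_strict_mono) auto
      finally show "cmod (char_app (fst p + snd p) x - char_app (a + b) x) < e"
        by simp
    qed
  qed
  show "(uminus \<longlongrightarrow> - a) (nhds a)"
  proof (rule tendsto_dualI)
    fix K :: "'a set" and e :: real assume K: "compact K" and e: "e > 0"
    have "cmod (char_app (- \<gamma>) x - char_app (- a) x) = cmod (char_app \<gamma> x - char_app a x)" for \<gamma> x
      by (metis char_app_uminus complex_cnj_diff complex_mod_cnj)
    then show "\<forall>\<^sub>F \<gamma> in nhds a. \<forall>x\<in>K. cmod (char_app (- \<gamma>) x - char_app (- a) x) < e"
      using eventually_char_close[OF K e, of a] by simp
  qed
qed


section \<open>Haar measure, subgroups and cosets\<close>

text \<open>A Haar measure is a nonzero translation invariant Radon measure on the Borel sets: finite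
  on compact sets, outer regular on Borel sets and inner regular on open sets. No
  \<open>\<sigma>\<close>-finiteness is assumed.\<close>

definition haar_measure :: "('g :: topological_ab_group_add) measure \<Rightarrow> bool" where
  "haar_measure M \<longleftrightarrow>
     sets M = sets borel \<and>
     emeasure M UNIV \<noteq> 0 \<and>
     (\<forall>a. \<forall>A\<in>sets borel. emeasure M ((\<lambda>x. a + x) ` A) = emeasure M A) \<and>
     (\<forall>K. compact K \<longrightarrow> emeasure M K < \<infinity>) \<and>
     (\<forall>A\<in>sets borel. emeasure M A = (INF U\<in>{U. open U \<and> A \<subseteq> U}. emeasure M U)) \<and>
     (\<forall>U. open U \<longrightarrow> emeasure M U = (SUP K\<in>{K. compact K \<and> K \<subseteq> U}. emeasure M K))"

definition is_subgroup :: "('g :: ab_group_add) set \<Rightarrow> bool" where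
  "is_subgroup H \<longleftrightarrow> 0 \<in> H \<and> (\<forall>x\<in>H. \<forall>y\<in>H. x + y \<in> H) \<and> (\<forall>x\<in>H. - x \<in> H)"

definition cosets :: "('g :: ab_group_add) set \<Rightarrow> 'g set set" where
  "cosets H = range (\<lambda>x. (\<lambda>h. x + h) ` H)"

definition coset_reps :: "('g :: ab_group_add) set \<Rightarrow> 'g set \<Rightarrow> bool" where
  "coset_reps H C \<longleftrightarrow> (\<forall>X\<in>cosets H. \<exists>!c. c \<in> C \<and> c \<in> X)"

definition annihilator :: "('g :: topological_ab_group_add) set \<Rightarrow> 'g dual set" where
  "annihilator H = {\<gamma>. \<forall>x\<in>H. char_app \<gamma> x = 1}"

text \<open>The parts \<open>\<sigma>\<^sub>\<gamma> \<in> C\<close> and \<open>\<eta>\<^sub>\<gamma> \<in> H\<^sup>\<bottom>\<close> of the decomposition \<open>\<gamma> = \<sigma>\<^sub>\<gamma> + \<eta>\<^sub>\<gamma>\<close>.\<close>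

definition sigma_part :: "('g :: topological_ab_group_add) set \<Rightarrow> 'g dual set \<Rightarrow> 'g dual \<Rightarrow> 'g dual" where
  "sigma_part H C \<gamma> = (THE \<sigma>. \<sigma> \<in> C \<and> \<gamma> - \<sigma> \<in> annihilator H)"

definition eta_part :: "('g :: topological_ab_group_add) set \<Rightarrow> 'g dual set \<Rightarrow> 'g dual \<Rightarrow> 'g dual" where
  "eta_part H C \<gamma> = \<gamma> - sigma_part H C \<gamma>"

text \<open>Here \<open>X\<close> is a coset of \<open>H\<close>; \<open>weight_eq\<close> below shows that the chosen representative is irrelevant.\<close>

definition weight :: "('g :: topological_ab_group_add) set \<Rightarrow> 'g dual set \<Rightarrow> 'g set \<Rightarrow> 'g dual \<Rightarrow> complex" where
  "weight H C X \<gamma> = cnj (char_app (eta_part H C \<gamma>) (SOME x. x \<in> X))"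

lemma is_subgroup_annihilator: "is_subgroup (annihilator H)"
  by (auto simp: is_subgroup_def annihilator_def char_app_add char_app_uminus)

lemma sigma_part_eta_part:
  assumes "coset_reps (annihilator H) C"
  shows "sigma_part H C \<gamma> \<in> C" "eta_part H C \<gamma> \<in> annihilator H"
    and "\<gamma> = sigma_part H C \<gamma> + eta_part H C \<gamma>"
proof -
  let ?X = "(\<lambda>h. \<gamma> + h) ` annihilator H"
  have iff: "\<sigma> \<in> ?X \<longleftrightarrow> \<gamma> - \<sigma> \<in> annihilator H" for \<sigma>
  proof
    assume "\<sigma> \<in> ?X"
    then show "\<gamma> - \<sigma> \<in> annihilator H"
      using is_subgroup_annihilator[of H] by (auto simp: is_subgroup_def)
  next
    assume "\<gamma> - \<sigma> \<in> annihilator H"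
    then have "- (\<gamma> - \<sigma>) \<in> annihilator H"
      using is_subgroup_annihilator[of H] unfolding is_subgroup_def by blast
    moreover have "\<sigma> = \<gamma> + - (\<gamma> - \<sigma>)" by simp
    ultimately show "\<sigma> \<in> ?X" by (rule rev_image_eqI)
  qed
  have "?X \<in> cosets (annihilator H)"
    by (auto simp: cosets_def)
  then have "\<exists>!\<sigma>. \<sigma> \<in> C \<and> \<sigma> \<in> ?X"
    using assms by (simp add: coset_reps_def)
  then have "sigma_part H C \<gamma> \<in> C \<and> \<gamma> - sigma_part H C \<gamma> \<in> annihilator H"
    unfolding sigma_part_def iff by (rule theI')
  then show "sigma_part H C \<gamma> \<in> C" "eta_part H C \<gamma> \<in> annihilator H"
    by (auto simp: eta_part_def)
  show "\<gamma> = sigma_part H C \<gamma> + eta_part H C \<gamma>"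
    by (simp add: eta_part_def)
qed

lemma weight_eq:
  assumes "is_subgroup H" "coset_reps (annihilator H) C" "X \<in> cosets H" "x \<in> X"
  shows "weight H C X \<gamma> = cnj (char_app (eta_part H C \<gamma>) x)"
proof -
  obtain a where X: "X = (\<lambda>h. a + h) ` H"
    using assms(3) by (auto simp: cosets_def)
  have "char_app (eta_part H C \<gamma>) y = char_app (eta_part H C \<gamma>) a" if "y \<in> X" for y
    using that sigma_part_eta_part(2)[OF assms(2), of \<gamma>]
    by (auto simp: X char_app_add_right annihilator_def)
  moreover have "(SOME x. x \<in> X) \<in> X"
    using assms(4) by (rule someI)
  ultimately show ?thesis
    using assms(4) by (simp add: weight_def)
qed


section \<open>Square integrable functions, closed spans and frames\<close>

text \<open>Elements of \<open>L\<^sup>2(M)\<close> are represented by functions; all notions below respect equality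
  almost everywhere.\<close>

definition L2 :: "'a measure \<Rightarrow> ('a \<Rightarrow> complex) set" where
  "L2 M = {f \<in> borel_measurable M. integrable M (\<lambda>x. (cmod (f x))\<^sup>2)}"

definition L2_inner :: "'a measure \<Rightarrow> ('a \<Rightarrow> complex) \<Rightarrow> ('a \<Rightarrow> complex) \<Rightarrow> complex" where
  "L2_inner M f g = (\<integral>x. f x * cnj (g x) \<partial>M)"

definition L2_norm :: "'a measure \<Rightarrow> ('a \<Rightarrow> complex) \<Rightarrow> real" where
  "L2_norm M f = sqrt (\<integral>x. (cmod (f x))\<^sup>2 \<partial>M)"

definition L2_closed_span :: "'a measure \<Rightarrow> 'i set \<Rightarrow> ('i \<Rightarrow> 'a \<Rightarrow> complex) \<Rightarrow> ('a \<Rightarrow> complex) set" where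
  "L2_closed_span M J u =
     {g \<in> L2 M. \<forall>\<epsilon>>0. \<exists>F c. finite F \<and> F \<subseteq> J \<and> L2_norm M (\<lambda>x. g x - (\<Sum>j\<in>F. c j * u j x)) < \<epsilon>}"

text \<open>The unordered sums are taken in \<open>[0, \<infinity>]\<close>, so that a divergent sum has the value
  \<open>\<infinity>\<close> (\<^const>\<open>infsum\<close> over the reals would return 0).\<close>

definition L2_frame_with ::
    "'a measure \<Rightarrow> ('a \<Rightarrow> complex) set \<Rightarrow> 'i set \<Rightarrow> ('i \<Rightarrow> 'a \<Rightarrow> complex) \<Rightarrow> real \<Rightarrow> real \<Rightarrow> bool" where
  "L2_frame_with M V J u A B \<longleftrightarrow>
     (\<forall>g\<in>V. ennreal (A * (L2_norm M g)\<^sup>2) \<le> (\<Sum>\<^sub>\<infinity>j\<in>J. ennreal ((cmod (L2_inner M g (u j)))\<^sup>2)) \<and>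
             (\<Sum>\<^sub>\<infinity>j\<in>J. ennreal ((cmod (L2_inner M g (u j)))\<^sup>2)) \<le> ennreal (B * (L2_norm M g)\<^sup>2))"

definition L2_frame :: "'a measure \<Rightarrow> ('a \<Rightarrow> complex) set \<Rightarrow> 'i set \<Rightarrow> ('i \<Rightarrow> 'a \<Rightarrow> complex) \<Rightarrow> bool" where
  "L2_frame M V J u \<longleftrightarrow> (\<exists>A>0. \<exists>B>0. L2_frame_with M V J u A B)"


section \<open>The Fourier transform on \<open>L\<^sup>2\<close>\<close>

definition fourier_integral ::
    "('g :: topological_ab_group_add) measure \<Rightarrow> ('g \<Rightarrow> complex) \<Rightarrow> 'g dual \<Rightarrow> complex" where
  "fourier_integral \<mu> f \<gamma> = (\<integral>x. f x * cnj (char_app \<gamma> x) \<partial>\<mu>)"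

text \<open>The extension by continuity from \<open>L\<^sup>1 \<inter> L\<^sup>2\<close> to \<open>L\<^sup>2\<close>: the transform of \<open>f\<close> is the
  \<open>L\<^sup>2(\<nu>)\<close>-limit of the transforms of functions in \<open>L\<^sup>1 \<inter> L\<^sup>2\<close> tending to \<open>f\<close> in \<open>L\<^sup>2(\<mu>)\<close>. By
  Plancherel's theorem it exists and is unique up to null sets; \<open>SOME\<close> picks a representative.\<close>

definition fourier_L2 ::
    "('g :: topological_ab_group_add) measure \<Rightarrow> 'g dual measure \<Rightarrow> ('g \<Rightarrow> complex) \<Rightarrow> 'g dual \<Rightarrow> complex" where
  "fourier_L2 \<mu> \<nu> f = (SOME F. F \<in> L2 \<nu> \<and>
     (\<exists>s :: nat \<Rightarrow> 'g \<Rightarrow> complex.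
        (\<forall>n. integrable \<mu> (s n) \<and> s n \<in> L2 \<mu> \<and> fourier_integral \<mu> (s n) \<in> L2 \<nu>) \<and>
        (\<lambda>n. L2_norm \<mu> (\<lambda>x. s n x - f x)) \<longlonglongrightarrow> 0 \<and>
        (\<lambda>n. L2_norm \<nu> (\<lambda>\<gamma>. fourier_integral \<mu> (s n) \<gamma> - F \<gamma>)) \<longlonglongrightarrow> 0))"

definition inv_fourier_L2 ::
    "('g :: topological_ab_group_add) measure \<Rightarrow> 'g dual measure \<Rightarrow> ('g dual \<Rightarrow> complex) \<Rightarrow> 'g \<Rightarrow> complex" where
  "inv_fourier_L2 \<mu> \<nu> F = (SOME f. f \<in> L2 \<mu> \<and> (AE \<gamma> in \<nu>. fourier_L2 \<mu> \<nu> f \<gamma> = F \<gamma>))"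


section \<open>Translations, the generated space and the spectral symbol\<close>

text \<open>The function \<open>w\<close> need not have an inverse transform in \<open>L\<^sup>2\<close>, so convolution with it means
  multiplication by \<open>w\<close> on the Fourier side.\<close>

definition translation ::
    "('g :: topological_ab_group_add) measure \<Rightarrow> 'g dual measure \<Rightarrow> 'g set \<Rightarrow> 'g dual set \<Rightarrow> 'g set
      \<Rightarrow> ('g \<Rightarrow> complex) \<Rightarrow> 'g \<Rightarrow> complex" where
  "translation \<mu> \<nu> H C X f = inv_fourier_L2 \<mu> \<nu> (\<lambda>\<gamma>. fourier_L2 \<mu> \<nu> f \<gamma> * weight H C X \<gamma>)"

definition translation_space ::
    "('g :: topological_ab_group_add) measure \<Rightarrow> 'g dual measure \<Rightarrow> 'g set \<Rightarrow> 'g dual set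
      \<Rightarrow> ('g \<Rightarrow> complex) \<Rightarrow> ('g \<Rightarrow> complex) set" where
  "translation_space \<mu> \<nu> H C f = L2_closed_span \<mu> (cosets H) (\<lambda>X. translation \<mu> \<nu> H C X f)"

text \<open>Values in \<open>[0, \<infinity>]\<close>, for the same reason as above.\<close>

definition spectral_symbol ::
    "('g :: topological_ab_group_add) measure \<Rightarrow> 'g dual measure \<Rightarrow> 'g dual set
      \<Rightarrow> ('g \<Rightarrow> complex) \<Rightarrow> 'g dual \<Rightarrow> ennreal" where
  "spectral_symbol \<mu> \<nu> C f \<eta> = (\<Sum>\<^sub>\<infinity>\<sigma>\<in>C. ennreal ((cmod (fourier_L2 \<mu> \<nu> f (\<eta> + \<sigma>)))\<^sup>2))"

end

theory Submission
  imports Defs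
begin

text \<open>
  Characters of \<open>G\<close> separate the points of \<open>H\<close>: for a hermitian continuous function on \<open>H\<close> the
  rescaled convolution powers converge to an idempotent, an idempotent has value at least 1 at 0, so
  there are minimal ones, and these are multiples of characters; characters of \<open>H\<close> extend to \<open>G\<close> by
  Zorn's lemma. With the Stone--Weierstrass theorem this makes the functions \<open>1\<^bsub>X\<^esub> \<sigma>\<close>, for \<open>X\<close> a coset of
  \<open>H\<close> and \<open>\<sigma> \<in> C\<close>, an orthonormal basis of \<open>L\<^sup>2(G)\<close>. Their Fourier transforms form such a basis of the
  dual space, which is Plancherel's theorem.

  Under the Fourier transform the frame vectors become \<open>F(\<gamma>)\<close> times the conjugate of \<open>(x, \<eta>\<^sub>\<gamma>)\<close>,
  and the measure \<open>|F|\<^sup>2 d\<nu>\<close> is pushed forward by \<open>\<gamma> \<mapsto> \<eta>\<^sub>\<gamma>\<close> to \<open>\<Phi> d\<eta>\<close>. For \<open>g = p(\<eta>\<^sub>\<gamma>) F\<close> the norm is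
  therefore \<open>\<integral> |p|\<^sup>2 \<Phi>\<close> and, by Parseval on the annihilator of \<open>H\<close>, the frame sum is \<open>\<integral> |p|\<^sup>2 \<Phi>\<^sup>2\<close>.
  Trigonometric polynomials \<open>p\<close> give the frame inequalities on the span, and indicator functions \<open>p\<close>
  recover the bounds on \<open>\<Phi>\<close>.
\<close>

section \<open>The Hilbert space of square integrable functions\<close>

text \<open>Neither group is assumed second countable or \<sigma>-finite, and
  \<open>cosets H\<close> and \<open>C\<close> may be uncountable. Interchanges of integrals are
  therefore avoided or proved by hand: on the compact subgroup by uniform approximation of a
  continuous kernel, on the whole group by exhausting the countably many cosets that carry a given
  function. Countability rests on outer regularity: a set of finite measure lies in an open set of
  finite measure, and every coset meeting it cuts out an open piece of positive measure.

  The transforms in the statement are chosen by \<open>SOME\<close>. They are handled through a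
  relation that compares coefficients in the two bases and determines either side up to null sets.

  The symbol \<Phi> is only known to be integrable, while Parseval's identity needs \<Phi> times
  \<open>p\<close> to be square integrable. Hence the indicators used as tests live on sets where
  \<Phi> is bounded. They are not trigonometric polynomials, so the lower and upper bounds on \<Phi>
  are read off in the closure of the span; conversely, the upper frame bound is what carries the
  inequalities from the span to its closure.\<close>

lemma borel_measurable_cnj [measurable (raw)]:
  "f \<in> borel_measurable M \<Longrightarrow> (\<lambda>x. cnj (f x)) \<in> borel_measurable M"
  by (rule borel_measurable_continuous_on[where f = cnj]) (intro continuous_intros continuous_on_id)

lemma L2D:
  assumes "f \<in> L2 M"
  shows "f \<in> borel_measurable M" "integrable M (\<lambda>x. (cmod (f x))\<^sup>2)"
  using assms by (auto simp: L2_def)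

lemma L2_mult_integrable:
  assumes "f \<in> L2 M" "g \<in> L2 M"
  shows "integrable M (\<lambda>x. f x * cnj (g x))"
proof (rule Bochner_Integration.integrable_bound[OF Bochner_Integration.integrable_add[OF L2D(2)[OF assms(1)] L2D(2)[OF assms(2)]]])
  show "(\<lambda>x. f x * cnj (g x)) \<in> borel_measurable M"
    using assms by (auto simp: L2_def)
  have "a * b \<le> a\<^sup>2 + b\<^sup>2" if "0 \<le> a" "0 \<le> b" for a b :: real
    using sum_squares_bound[of a b] mult_nonneg_nonneg[OF that] by simp
  then show "AE x in M. norm (f x * cnj (g x)) \<le> norm ((cmod (f x))\<^sup>2 + (cmod (g x))\<^sup>2)"
    by (auto simp: norm_mult)
qed

lemma L2_scale:
  assumes "f \<in> L2 M"
  shows "(\<lambda>x. c * f x) \<in> L2 M"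
  using assms by (auto simp: L2_def norm_mult power_mult_distrib)

lemma L2_add:
  assumes "f \<in> L2 M" "g \<in> L2 M"
  shows "(\<lambda>x. f x + g x) \<in> L2 M"
proof -
  have m: "(\<lambda>x. f x + g x) \<in> borel_measurable M"
    using assms by (auto simp: L2_def)
  have "integrable M (\<lambda>x. (cmod (f x + g x))\<^sup>2)"
  proof (rule Bochner_Integration.integrable_bound)
    show "integrable M (\<lambda>x. 2 * (cmod (f x))\<^sup>2 + 2 * (cmod (g x))\<^sup>2)"
      using assms by (auto simp: L2_def)
    show "(\<lambda>x. (cmod (f x + g x))\<^sup>2) \<in> borel_measurable M"
      using m by measurable
    have "(cmod (a + b))\<^sup>2 \<le> 2 * (cmod a)\<^sup>2 + 2 * (cmod b)\<^sup>2" for a b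
    proof -
      have "(cmod (a + b))\<^sup>2 \<le> (cmod a + cmod b)\<^sup>2"
        by (intro power_mono norm_triangle_ineq) auto
      then show ?thesis
        using sum_squares_bound[of "cmod a" "cmod b"] by (simp add: power2_sum)
    qed
    then show "AE x in M. norm ((cmod (f x + g x))\<^sup>2) \<le> norm (2 * (cmod (f x))\<^sup>2 + 2 * (cmod (g x))\<^sup>2)"
      by auto
  qed
  with m show ?thesis by (simp add: L2_def)
qed

lemma L2_zero [simp]: "(\<lambda>_. 0) \<in> L2 M"
  by (simp add: L2_def)

lemma L2_diff:
  assumes "f \<in> L2 M" "g \<in> L2 M"
  shows "(\<lambda>x. f x - g x) \<in> L2 M"
  using L2_add[OF assms(1) L2_scale[OF assms(2), of "-1"]] by simp

lemma L2_sum: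
  assumes "\<And>i. i \<in> I \<Longrightarrow> u i \<in> L2 M"
  shows "(\<lambda>x. \<Sum>i\<in>I. u i x) \<in> L2 M"
  using assms by (induction I rule: infinite_finite_induct) (auto intro: L2_add)

lemma L2_lincomb:
  assumes "\<And>i. i \<in> I \<Longrightarrow> u i \<in> L2 M"
  shows "(\<lambda>x. \<Sum>i\<in>I. c i * u i x) \<in> L2 M"
  using assms by (intro L2_sum L2_scale)

lemma L2_bounded_mult:
  assumes "f \<in> L2 M" "p \<in> borel_measurable M" "\<And>x. cmod (p x) \<le> b"
  shows "(\<lambda>x. p x * f x) \<in> L2 M"
proof -
  have m: "(\<lambda>x. p x * f x) \<in> borel_measurable M"
    using assms(1,2) by (auto simp: L2_def)
  have "integrable M (\<lambda>x. (cmod (p x * f x))\<^sup>2)"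
  proof (rule Bochner_Integration.integrable_bound)
    show "integrable M (\<lambda>x. b\<^sup>2 * (cmod (f x))\<^sup>2)"
      using assms(1) by (auto simp: L2_def)
    show "(\<lambda>x. (cmod (p x * f x))\<^sup>2) \<in> borel_measurable M"
      using m by measurable
    show "AE x in M. norm ((cmod (p x * f x))\<^sup>2) \<le> norm (b\<^sup>2 * (cmod (f x))\<^sup>2)"
      using assms(3) by (auto simp: norm_mult power_mult_distrib intro!: mult_right_mono power_mono)
  qed
  with m show ?thesis by (simp add: L2_def)
qed

lemma L2_AE_cong:
  assumes "f \<in> L2 M" "g \<in> borel_measurable M" "AE x in M. f x = g x"
  shows "g \<in> L2 M"
proof -
  have "integrable M (\<lambda>x. (cmod (g x))\<^sup>2)"
  proof (rule integrable_cong_AE_imp)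
    show "integrable M (\<lambda>x. (cmod (f x))\<^sup>2)" by (rule L2D[OF assms(1)])
    show "(\<lambda>x. (cmod (g x))\<^sup>2) \<in> borel_measurable M" using assms(2) by measurable
    show "AE x in M. (cmod (f x))\<^sup>2 = (cmod (g x))\<^sup>2" using assms(3) by auto
  qed
  with assms(2) show ?thesis by (simp add: L2_def)
qed

section \<open>Norm, inner product and convergence\<close>

lemma L2_norm_nonneg [simp]: "0 \<le> L2_norm M f"
  by (simp add: L2_norm_def)

lemma L2_norm_power2: "(L2_norm M f)\<^sup>2 = (\<integral>x. (cmod (f x))\<^sup>2 \<partial>M)"
  by (simp add: L2_norm_def)

lemma L2_inner_self: "L2_inner M f f = of_real ((L2_norm M f)\<^sup>2)"
  unfolding L2_norm_power2 L2_inner_def by (simp add: complex_norm_square[symmetric] integral_complex_of_real del: of_real_power)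

lemma L2_norm_AE_cong:
  assumes "f \<in> borel_measurable M" "g \<in> borel_measurable M" "AE x in M. f x = g x"
  shows "L2_norm M f = L2_norm M g"
proof -
  have "(\<integral>x. (cmod (f x))\<^sup>2 \<partial>M) = (\<integral>x. (cmod (g x))\<^sup>2 \<partial>M)"
    using assms by (intro integral_cong_AE) auto
  then show ?thesis by (simp add: L2_norm_def)
qed

lemma L2_inner_AE_cong:
  assumes "f \<in> borel_measurable M" "g \<in> borel_measurable M" "h \<in> borel_measurable M"
    and "AE x in M. g x = h x"
  shows "L2_inner M f g = L2_inner M f h"
  unfolding L2_inner_def using assms by (intro integral_cong_AE) auto

lemma L2_norm_zero_iff:
  assumes "f \<in> L2 M"
  shows "L2_norm M f = 0 \<longleftrightarrow> (AE x in M. f x = 0)"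
proof -
  have "L2_norm M f = 0 \<longleftrightarrow> (\<integral>x. (cmod (f x))\<^sup>2 \<partial>M) = 0"
    by (simp add: L2_norm_def)
  also have "\<dots> \<longleftrightarrow> (AE x in M. (cmod (f x))\<^sup>2 = 0)"
    using assms by (intro integral_nonneg_eq_0_iff_AE) (auto simp: L2_def)
  finally show ?thesis by simp
qed

lemma L2_norm_scale: "L2_norm M (\<lambda>x. c * f x) = cmod c * L2_norm M f"
  by (simp add: L2_norm_def norm_mult power_mult_distrib real_sqrt_mult)

lemma L2_norm_diff_commute: "L2_norm M (\<lambda>x. f x - g x) = L2_norm M (\<lambda>x. g x - f x)"
  by (simp add: L2_norm_def norm_minus_commute)

lemma L2_inner_add_left:
  assumes "f \<in> L2 M" "g \<in> L2 M" "h \<in> L2 M"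
  shows "L2_inner M (\<lambda>x. f x + g x) h = L2_inner M f h + L2_inner M g h"
  unfolding L2_inner_def using assms by (simp add: distrib_right L2_mult_integrable)

lemma L2_inner_scale_left: "L2_inner M (\<lambda>x. c * f x) h = c * L2_inner M f h"
  unfolding L2_inner_def by (simp add: mult.assoc)

lemma L2_inner_cnj: "L2_inner M f g = cnj (L2_inner M g f)"
  unfolding L2_inner_def by (subst Bochner_Integration.integral_cnj[symmetric]) (simp add: mult.commute)

lemma L2_inner_scale_right: "L2_inner M h (\<lambda>x. c * f x) = cnj c * L2_inner M h f"
  unfolding L2_inner_def by (simp add: mult.left_commute)

lemma L2_inner_add_right:
  assumes "f \<in> L2 M" "g \<in> L2 M" "h \<in> L2 M"
  shows "L2_inner M h (\<lambda>x. f x + g x) = L2_inner M h f + L2_inner M h g"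
  unfolding L2_inner_def using assms by (simp add: distrib_left L2_mult_integrable)

lemma L2_inner_diff_left:
  assumes "f \<in> L2 M" "g \<in> L2 M" "h \<in> L2 M"
  shows "L2_inner M (\<lambda>x. f x - g x) h = L2_inner M f h - L2_inner M g h"
  unfolding L2_inner_def using assms by (simp add: left_diff_distrib L2_mult_integrable)

lemma L2_inner_sum_left:
  assumes "\<And>i. i \<in> I \<Longrightarrow> u i \<in> L2 M" "h \<in> L2 M"
  shows "L2_inner M (\<lambda>x. \<Sum>i\<in>I. c i * u i x) h = (\<Sum>i\<in>I. c i * L2_inner M (u i) h)"
  using assms
proof (induction I rule: infinite_finite_induct)
  case (insert i I)
  then show ?case
    by (simp add: L2_inner_add_left L2_scale L2_lincomb L2_inner_scale_left)
qed (auto simp: L2_inner_def)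

lemma L2_norm_add_power2:
  assumes "f \<in> L2 M" "g \<in> L2 M"
  shows "(L2_norm M (\<lambda>x. f x + g x))\<^sup>2 = (L2_norm M f)\<^sup>2 + 2 * Re (L2_inner M f g) + (L2_norm M g)\<^sup>2"
proof -
  have "complex_of_real ((L2_norm M (\<lambda>x. f x + g x))\<^sup>2)
      = L2_inner M f f + L2_inner M f g + (L2_inner M g f + L2_inner M g g)"
    using assms unfolding L2_inner_self[symmetric]
    by (simp add: L2_inner_add_left L2_inner_add_right L2_add)
  also have "L2_inner M g f = cnj (L2_inner M f g)" by (rule L2_inner_cnj)
  also have "L2_inner M f f + L2_inner M f g + (cnj (L2_inner M f g) + L2_inner M g g)
     = of_real ((L2_norm M f)\<^sup>2 + 2 * Re (L2_inner M f g) + (L2_norm M g)\<^sup>2)"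
    unfolding L2_inner_self using complex_add_cnj[of "L2_inner M f g"] by (simp add: algebra_simps)
  finally show ?thesis by (simp only: of_real_eq_iff)
qed

lemma L2_Cauchy_Schwarz:
  assumes "f \<in> L2 M" "g \<in> L2 M"
  shows "cmod (L2_inner M f g) \<le> L2_norm M f * L2_norm M g"
proof (cases "L2_norm M g = 0")
  case True
  then have "AE x in M. g x = 0" using L2_norm_zero_iff[OF assms(2)] by simp
  then have "L2_inner M f g = L2_inner M f (\<lambda>_. 0)"
    using L2D[OF assms(1)] L2D[OF assms(2)] by (intro L2_inner_AE_cong) auto
  also have "\<dots> = 0" by (simp add: L2_inner_def)
  finally show ?thesis by (simp add: True)
next
  case False
  define a where "a = L2_inner M f g"
  define n where "n = (L2_norm M g)\<^sup>2"
  have n: "n > 0" using False by (simp add: n_def)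
  \<comment> \<open>The minimiser of the norm of \<open>f + t g\<close>; for it the expanded square
    is the squared norm of \<open>f\<close> minus \<open>(cmod a)^2 / n\<close>.\<close>
  define t where "t = - a / of_real n"
  have "0 \<le> (L2_norm M (\<lambda>x. f x + t * g x))\<^sup>2" by simp
  also have "\<dots> = (L2_norm M f)\<^sup>2 + 2 * Re (cnj t * a) + (cmod t * L2_norm M g)\<^sup>2"
    using assms by (subst L2_norm_add_power2) (auto simp only: L2_scale L2_norm_scale L2_inner_scale_right a_def)
  also have "(cmod t * L2_norm M g)\<^sup>2 = (cmod t)\<^sup>2 * n"
    by (simp add: power_mult_distrib n_def)
  also have "\<dots> = (cmod a)\<^sup>2 / n"
    using n by (simp add: t_def norm_divide power_divide power2_eq_square)
  also have "cnj t * a = - (a * cnj a) / of_real n" by (simp add: t_def)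
  also have "\<dots> = of_real (- (cmod a)\<^sup>2 / n)"
    unfolding complex_norm_square[symmetric] by simp
  also have "Re \<dots> = - (cmod a)\<^sup>2 / n" by (rule Re_complex_of_real)
  finally have "(cmod a)\<^sup>2 / n \<le> (L2_norm M f)\<^sup>2" by simp
  then have "(cmod a)\<^sup>2 \<le> (L2_norm M f)\<^sup>2 * n"
    using n by (simp add: pos_divide_le_eq)
  then have "(cmod a)\<^sup>2 \<le> (L2_norm M f * L2_norm M g)\<^sup>2"
    by (simp add: n_def power_mult_distrib)
  then have "cmod a \<le> L2_norm M f * L2_norm M g"
    by (rule power2_le_imp_le) (intro mult_nonneg_nonneg L2_norm_nonneg)
  then show ?thesis by (simp only: a_def)
qed

lemma L2_triangle:
  assumes "f \<in> L2 M" "g \<in> L2 M"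
  shows "L2_norm M (\<lambda>x. f x + g x) \<le> L2_norm M f + L2_norm M g"
proof (rule power2_le_imp_le)
  have "Re (L2_inner M f g) \<le> L2_norm M f * L2_norm M g"
    by (rule order_trans[OF complex_Re_le_cmod L2_Cauchy_Schwarz[OF assms]])
  then show "(L2_norm M (\<lambda>x. f x + g x))\<^sup>2 \<le> (L2_norm M f + L2_norm M g)\<^sup>2"
    unfolding L2_norm_add_power2[OF assms] by (simp add: power2_sum)
qed simp

lemma L2_norm_diff_bound:
  assumes "f \<in> L2 M" "g \<in> L2 M"
  shows "\<bar>L2_norm M f - L2_norm M g\<bar> \<le> L2_norm M (\<lambda>x. f x - g x)"
  using L2_triangle[OF L2_diff[OF assms] assms(2)] L2_triangle[OF L2_diff[OF assms(2,1)] assms(1)]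
  by (simp add: L2_norm_diff_commute[of M f g])

lemma L2_norm_tendsto:
  assumes "\<And>n. s n \<in> L2 M" "f \<in> L2 M" "(\<lambda>n. L2_norm M (\<lambda>x. s n x - f x)) \<longlonglongrightarrow> 0"
  shows "(\<lambda>n. L2_norm M (s n)) \<longlonglongrightarrow> L2_norm M f"
proof (rule LIM_zero_cancel, rule tendsto_rabs_zero_cancel)
  show "(\<lambda>n. \<bar>L2_norm M (s n) - L2_norm M f\<bar>) \<longlonglongrightarrow> 0"
    by (rule tendsto_sandwich[OF _ _ tendsto_const assms(3)])
      (auto intro!: always_eventually L2_norm_diff_bound assms)
qed

lemma L2_inner_tendsto:
  assumes "\<And>n. s n \<in> L2 M" "f \<in> L2 M" "g \<in> L2 M" "(\<lambda>n. L2_norm M (\<lambda>x. s n x - f x)) \<longlonglongrightarrow> 0"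
  shows "(\<lambda>n. L2_inner M (s n) g) \<longlonglongrightarrow> L2_inner M f g"
proof (rule LIM_zero_cancel, rule tendsto_norm_zero_cancel)
  have lim: "(\<lambda>n. L2_norm M (\<lambda>x. s n x - f x) * L2_norm M g) \<longlonglongrightarrow> 0"
    using tendsto_mult[OF assms(4) tendsto_const] by simp
  show "(\<lambda>n. norm (L2_inner M (s n) g - L2_inner M f g)) \<longlonglongrightarrow> 0"
    by (rule tendsto_sandwich[OF _ _ tendsto_const lim])
      (auto intro!: always_eventually L2_Cauchy_Schwarz L2_diff assms simp: L2_inner_diff_left[OF assms(1,2,3), symmetric])
qed

text \<open>Membership and norm bound are decided together by one integral in [0, \<infinity>].
  Monotone convergence and Fatou's lemma can thus be applied before integrability of the limit is
  known.\<close>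

lemma L2_norm_le_iff_nn_integral:
  assumes "f \<in> borel_measurable M" "0 \<le> c"
  shows "f \<in> L2 M \<and> L2_norm M f \<le> c \<longleftrightarrow> (\<integral>\<^sup>+x. ennreal ((cmod (f x))\<^sup>2) \<partial>M) \<le> ennreal (c\<^sup>2)" (is "?l \<longleftrightarrow> ?r")
proof
  assume l: ?l
  then have "(\<integral>\<^sup>+x. ennreal ((cmod (f x))\<^sup>2) \<partial>M) = ennreal ((L2_norm M f)\<^sup>2)"
    unfolding L2_norm_power2 by (intro nn_integral_eq_integral) (auto simp: L2_def)
  also have "\<dots> \<le> ennreal (c\<^sup>2)" using l by (intro ennreal_leI power_mono) auto
  finally show ?r .
next
  assume r: ?r
  then have "integrable M (\<lambda>x. (cmod (f x))\<^sup>2)"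
    using assms by (intro integrableI_bounded) (auto simp: le_less_trans)
  then have *: "f \<in> L2 M" using assms by (simp add: L2_def)
  then have "(\<integral>\<^sup>+x. ennreal ((cmod (f x))\<^sup>2) \<partial>M) = ennreal ((L2_norm M f)\<^sup>2)"
    unfolding L2_norm_power2 by (intro nn_integral_eq_integral) (auto simp: L2_def)
  with r have "(L2_norm M f)\<^sup>2 \<le> c\<^sup>2" by simp
  then have "L2_norm M f \<le> c" using assms(2) by (rule power2_le_imp_le)
  with * show ?l by simp
qed

lemma L2_norm_mono:
  assumes "g \<in> L2 M" "f \<in> borel_measurable M" "AE x in M. cmod (f x) \<le> cmod (g x)"
  shows "f \<in> L2 M" "L2_norm M f \<le> L2_norm M g"
proof -
  have "(\<integral>\<^sup>+x. ennreal ((cmod (f x))\<^sup>2) \<partial>M) \<le> (\<integral>\<^sup>+x. ennreal ((cmod (g x))\<^sup>2) \<partial>M)"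
    using assms(3) by (intro nn_integral_mono_AE) (auto intro!: ennreal_leI power_mono)
  also have "\<dots> \<le> ennreal ((L2_norm M g)\<^sup>2)"
    using assms(1) L2_norm_le_iff_nn_integral[of g M "L2_norm M g"] by (auto simp: L2_def)
  finally have "f \<in> L2 M \<and> L2_norm M f \<le> L2_norm M g"
    using L2_norm_le_iff_nn_integral[OF assms(2)] by simp
  then show "f \<in> L2 M" "L2_norm M f \<le> L2_norm M g" by auto
qed

text \<open>Telescoping a fast subsequence: the sum of the increments has finite norm by monotone
  convergence, so it is finite almost everywhere.\<close>

lemma L2_complete_fast:
  assumes u: "\<And>n. u n \<in> L2 M"
    and fast: "\<And>n. L2_norm M (\<lambda>x. u (Suc n) x - u n x) \<le> (1 / 2) ^ n"
  shows "\<exists>F. F \<in> borel_measurable M \<and> (AE x in M. (\<lambda>n. u n x) \<longlonglongrightarrow> F x)"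
proof -
  define d where "d k x = cmod (u (Suc k) x - u k x)" for k x
  define S where "S n x = complex_of_real (\<Sum>k<n. d k x)" for n x
  have um [measurable]: "u n \<in> borel_measurable M" for n using u L2D by blast
  have dm [measurable]: "d k \<in> borel_measurable M" for k unfolding d_def by measurable
  have Sm [measurable]: "S n \<in> borel_measurable M" for n unfolding S_def by measurable
  have d0: "0 \<le> d k x" for k x by (simp add: d_def)
  have S_norm: "cmod (S n x) = (\<Sum>k<n. d k x)" for n x
    unfolding S_def norm_of_real using d0 by (simp add: sum_nonneg)
  have dL: "(\<lambda>x. complex_of_real (d k x)) \<in> L2 M \<and> L2_norm M (\<lambda>x. complex_of_real (d k x)) \<le> (1 / 2) ^ k" for k
  proof -
    have *: "(\<lambda>x. u (Suc k) x - u k x) \<in> L2 M" using u by (intro L2_diff)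
    show ?thesis
      using L2_norm_mono[OF *, of "\<lambda>x. complex_of_real (d k x)"] fast[of k] by (auto simp: d_def)
  qed
  have S_bd: "S n \<in> L2 M \<and> L2_norm M (S n) \<le> (\<Sum>k<n. (1 / 2) ^ k)" for n
  proof (induction n)
    case 0 then show ?case by (simp add: S_def L2_norm_def)
  next
    case (Suc n)
    have "S (Suc n) = (\<lambda>x. S n x + complex_of_real (d n x))" by (auto simp: S_def)
    then show ?case
      using L2_triangle[of "S n" M "\<lambda>x. complex_of_real (d n x)"] L2_add[of "S n" M "\<lambda>x. complex_of_real (d n x)"] Suc dL[of n]
      by auto
  qed
  have S2: "L2_norm M (S n) \<le> 2" for n
  proof -
    have "(\<Sum>k<n. (1 / 2) ^ k) = 2 - 2 * (1 / 2 :: real) ^ n"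
      by (induction n) auto
    also have "\<dots> \<le> 2" by simp
    finally show ?thesis using S_bd[of n] by linarith
  qed
  have "(\<integral>\<^sup>+x. (SUP n. ennreal ((cmod (S n x))\<^sup>2)) \<partial>M) = (SUP n. \<integral>\<^sup>+x. ennreal ((cmod (S n x))\<^sup>2) \<partial>M)"
  proof (rule nn_integral_monotone_convergence_SUP)
    show "incseq (\<lambda>n x. ennreal ((cmod (S n x))\<^sup>2))"
      unfolding S_norm by (auto simp: incseq_Suc_iff le_fun_def d0 sum_nonneg intro!: ennreal_leI power_mono)
  qed measurable
  also have "\<dots> \<le> ennreal (2\<^sup>2)"
    using L2_norm_le_iff_nn_integral[of "S _" M 2] S_bd S2 by (intro SUP_least) auto
  finally have fin: "(\<integral>\<^sup>+x. (SUP n. ennreal ((cmod (S n x))\<^sup>2)) \<partial>M) \<noteq> \<infinity>"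
    using ennreal_less_top[of "2\<^sup>2"] by (auto simp: top_unique)
  have "AE x in M. (SUP n. ennreal ((cmod (S n x))\<^sup>2)) \<noteq> \<infinity>"
    by (rule nn_integral_PInf_AE[OF _ fin]) measurable
  then have "AE x in M. convergent (\<lambda>n. u n x)"
  proof (eventually_elim)
    case (elim x)
    then obtain r where r: "(SUP n. ennreal ((cmod (S n x))\<^sup>2)) = ennreal r" "r \<ge> 0"
      by (cases "(SUP n. ennreal ((cmod (S n x))\<^sup>2))") auto
    have "ennreal ((cmod (S n x))\<^sup>2) \<le> ennreal r" for n
      unfolding r(1)[symmetric] by (rule SUP_upper) simp
    then have "(cmod (S n x))\<^sup>2 \<le> (sqrt r)\<^sup>2" for n using r(2) by simp
    then have "(\<Sum>k<n. d k x) \<le> sqrt r" for n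
      using power2_le_imp_le[of "cmod (S n x)" "sqrt r"] r(2) S_norm by auto
    then have "summable (\<lambda>k. d k x)"
      using d0 by (intro summableI_nonneg_bounded[of _ "sqrt r"]) auto
    then have "summable (\<lambda>k. u (Suc k) x - u k x)"
      unfolding d_def by (rule summable_norm_cancel)
    then have "convergent (\<lambda>n. \<Sum>k<n. u (Suc k) x - u k x)"
      by (simp add: summable_iff_convergent)
    then have "convergent (\<lambda>n. (\<Sum>k<n. u (Suc k) x - u k x) + u 0 x)"
      by (intro convergent_add convergent_const)
    then show ?case by (simp add: sum_lessThan_telescope[of "\<lambda>n. u n x"])
  qed
  then have "AE x in M. (\<lambda>n. u n x) \<longlonglongrightarrow> lim (\<lambda>n. u n x)"
    by (auto simp: convergent_LIMSEQ_iff)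
  moreover have "(\<lambda>x. lim (\<lambda>n. u n x)) \<in> borel_measurable M" by measurable
  ultimately show ?thesis by blast
qed

text \<open>A subsequence with increments below \<open>(1/2)^k\<close> converges almost everywhere.
  Fatou's lemma, applied to the differences from a fixed \<open>s n\<close>, turns the Cauchy
  estimate into an estimate against the limit, which covers the whole sequence and not only the
  subsequence.\<close>

lemma L2_complete:
  assumes s: "\<And>n. s n \<in> L2 M"
    and cauchy: "\<And>e. e > 0 \<Longrightarrow> \<exists>N. \<forall>m\<ge>N. \<forall>n\<ge>N. L2_norm M (\<lambda>x. s m x - s n x) < e"
  shows "\<exists>F. F \<in> L2 M \<and> (\<lambda>n. L2_norm M (\<lambda>x. s n x - F x)) \<longlonglongrightarrow> 0"
proof -
  have "\<forall>k. \<exists>N. \<forall>m\<ge>N. \<forall>n\<ge>N. L2_norm M (\<lambda>x. s m x - s n x) < (1 / 2) ^ k"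
    using cauchy by simp
  then obtain N where N: "\<And>k m n. m \<ge> N k \<Longrightarrow> n \<ge> N k \<Longrightarrow> L2_norm M (\<lambda>x. s m x - s n x) < (1 / 2) ^ k"
    by metis
  \<comment> \<open>Partial sums make \<open>r\<close> increasing whatever \<open>N\<close> is, and
    still give \<open>N k \<le> r k\<close>.\<close>
  define r where "r k = (\<Sum>i\<le>k. N i) + k" for k
  have r1: "N k \<le> r k" for k
    unfolding r_def by (rule trans_le_add1) (simp add: member_le_sum)
  have r2: "r k \<le> r (Suc k)" for k by (simp add: r_def)
  define u where "u k = s (r k)" for k
  have u: "u n \<in> L2 M" for n by (simp add: u_def s)
  have "L2_norm M (\<lambda>x. u (Suc n) x - u n x) \<le> (1 / 2) ^ n" for n
    unfolding u_def using N[of n "r (Suc n)" "r n"] r1[of n] r2[of n] by fastforce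
  then obtain F where F [measurable]: "F \<in> borel_measurable M" and lim: "AE x in M. (\<lambda>n. u n x) \<longlonglongrightarrow> F x"
    using L2_complete_fast[of u M] u by blast
  have sm [measurable]: "s n \<in> borel_measurable M" "u n \<in> borel_measurable M" for n
    using s u L2D by blast+
  have close: "(\<lambda>x. s n x - F x) \<in> L2 M \<and> L2_norm M (\<lambda>x. s n x - F x) \<le> (1 / 2) ^ k" if "n \<ge> N k" for n k
  proof -
    have "(\<integral>\<^sup>+x. ennreal ((cmod (s n x - F x))\<^sup>2) \<partial>M) = (\<integral>\<^sup>+x. liminf (\<lambda>j. ennreal ((cmod (s n x - u j x))\<^sup>2)) \<partial>M)"
    proof (rule nn_integral_cong_AE, use lim in eventually_elim)
      case (elim x)
      have "(\<lambda>j. ennreal ((cmod (s n x - u j x))\<^sup>2)) \<longlonglongrightarrow> ennreal ((cmod (s n x - F x))\<^sup>2)"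
        by (intro tendsto_intros tendsto_ennrealI elim)
      then show ?case by (rule lim_imp_Liminf[OF sequentially_bot, symmetric])
    qed
    also have "\<dots> \<le> liminf (\<lambda>j. \<integral>\<^sup>+x. ennreal ((cmod (s n x - u j x))\<^sup>2) \<partial>M)"
      by (rule nn_integral_liminf) measurable
    also have "\<dots> \<le> ennreal (((1 / 2) ^ k)\<^sup>2)"
    proof (rule Liminf_le)
      show "\<forall>\<^sub>F j in sequentially. (\<integral>\<^sup>+x. ennreal ((cmod (s n x - u j x))\<^sup>2) \<partial>M) \<le> ennreal (((1 / 2) ^ k)\<^sup>2)"
        using eventually_ge_at_top[of k]
      proof eventually_elim
        case (elim j)
        have "r k \<le> r j" using r2 elim by (rule lift_Suc_mono_le)
        then have "L2_norm M (\<lambda>x. s n x - u j x) \<le> (1 / 2) ^ k"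
          unfolding u_def using N[of k n "r j"] that r1[of k] by fastforce
        moreover have "(\<lambda>x. s n x - u j x) \<in> L2 M" using s u by (intro L2_diff)
        ultimately show ?case
          using L2_norm_le_iff_nn_integral[of "\<lambda>x. s n x - u j x" M "(1 / 2) ^ k"] by auto
      qed
    qed simp
    finally show ?thesis
      using L2_norm_le_iff_nn_integral[of "\<lambda>x. s n x - F x" M "(1 / 2) ^ k"] by auto
  qed
  have FL: "F \<in> L2 M"
    using L2_diff[OF s[of "N 0"] conjunct1[OF close[of 0 "N 0"]]] by simp
  have "(\<lambda>n. L2_norm M (\<lambda>x. s n x - F x)) \<longlonglongrightarrow> 0"
  proof (rule LIMSEQ_I)
    fix e :: real assume "e > 0"
    then obtain k where "(1 / 2) ^ k < e" using real_arch_pow_inv[of e "1/2"] by auto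
    then show "\<exists>no. \<forall>n\<ge>no. norm (L2_norm M (\<lambda>x. s n x - F x) - 0) < e"
      using close[of k] by (intro exI[of _ "N k"]) fastforce
  qed
  with FL show ?thesis by blast
qed

subsection \<open>Orthonormal families\<close>

definition orthonormal :: "'a measure \<Rightarrow> 'i set \<Rightarrow> ('i \<Rightarrow> 'a \<Rightarrow> complex) \<Rightarrow> bool" where
  "orthonormal M I e \<longleftrightarrow> (\<forall>i\<in>I. e i \<in> L2 M) \<and> (\<forall>i\<in>I. \<forall>j\<in>I. L2_inner M (e i) (e j) = (if i = j then 1 else 0))"

text \<open>Totality is expressed by a trivial orthogonal complement and not by density of the span,
  because the completeness results for characters produce exactly this; density follows through the
  Riesz-Fischer theorem.\<close>

definition total_family :: "'a measure \<Rightarrow> 'i set \<Rightarrow> ('i \<Rightarrow> 'a \<Rightarrow> complex) \<Rightarrow> bool" where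
  "total_family M I e \<longleftrightarrow> (\<forall>f\<in>L2 M. (\<forall>i\<in>I. L2_inner M f (e i) = 0) \<longrightarrow> (AE x in M. f x = 0))"

lemma orthonormal_inner_lincomb:
  assumes "orthonormal M I e" "J \<subseteq> I" "finite J" "i \<in> I"
  shows "L2_inner M (\<lambda>x. \<Sum>j\<in>J. c j * e j x) (e i) = (if i \<in> J then c i else 0)"
proof -
  have "L2_inner M (\<lambda>x. \<Sum>j\<in>J. c j * e j x) (e i) = (\<Sum>j\<in>J. c j * L2_inner M (e j) (e i))"
    using assms by (intro L2_inner_sum_left) (auto simp: orthonormal_def)
  also have "\<dots> = (\<Sum>j\<in>J. if j = i then c j else 0)"
    using assms by (intro sum.cong) (auto simp: orthonormal_def)
  finally show ?thesis using assms(3) by simp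
qed

lemma orthonormal_norm_lincomb:
  assumes "orthonormal M I e" "J \<subseteq> I" "finite J"
  shows "(L2_norm M (\<lambda>x. \<Sum>j\<in>J. c j * e j x))\<^sup>2 = (\<Sum>j\<in>J. (cmod (c j))\<^sup>2)"
proof -
  let ?s = "\<lambda>x. \<Sum>j\<in>J. c j * e j x"
  have s: "?s \<in> L2 M" using assms by (intro L2_lincomb) (auto simp: orthonormal_def)
  have "complex_of_real ((L2_norm M ?s)\<^sup>2) = (\<Sum>j\<in>J. c j * L2_inner M (e j) ?s)"
    unfolding L2_inner_self[symmetric] using assms s
    by (intro L2_inner_sum_left) (auto simp: orthonormal_def)
  also have "\<dots> = (\<Sum>j\<in>J. of_real ((cmod (c j))\<^sup>2))"
  proof (rule sum.cong)
    fix j assume j: "j \<in> J"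
    then have "L2_inner M (e j) ?s = cnj (c j)"
      using assms(2) by (subst L2_inner_cnj) (subst orthonormal_inner_lincomb[OF assms], auto)
    then show "c j * L2_inner M (e j) ?s = of_real ((cmod (c j))\<^sup>2)"
      by (simp only: complex_norm_square)
  qed simp
  also have "\<dots> = of_real (\<Sum>j\<in>J. (cmod (c j))\<^sup>2)" by simp
  finally show ?thesis by (simp only: of_real_eq_iff)
qed

lemma Bessel:
  assumes "orthonormal M I e" "J \<subseteq> I" "finite J" "f \<in> L2 M"
  shows "(L2_norm M (\<lambda>x. f x - (\<Sum>j\<in>J. L2_inner M f (e j) * e j x)))\<^sup>2
      = (L2_norm M f)\<^sup>2 - (\<Sum>j\<in>J. (cmod (L2_inner M f (e j)))\<^sup>2)"
    and "(\<Sum>j\<in>J. (cmod (L2_inner M f (e j)))\<^sup>2) \<le> (L2_norm M f)\<^sup>2"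
proof -
  let ?c = "\<lambda>j. L2_inner M f (e j)"
  let ?s = "\<lambda>x. \<Sum>j\<in>J. - ?c j * e j x"
  have s: "?s \<in> L2 M" using assms by (intro L2_lincomb) (auto simp: orthonormal_def)
  have "cnj (L2_inner M f ?s) = (\<Sum>j\<in>J. - ?c j * L2_inner M (e j) f)"
    unfolding L2_inner_cnj[of M f ?s, symmetric] L2_inner_cnj[of M ?s f, symmetric] using assms
    by (intro L2_inner_sum_left) (auto simp: orthonormal_def)
  also have "\<dots> = (\<Sum>j\<in>J. - of_real ((cmod (?c j))\<^sup>2))"
    by (intro sum.cong refl, subst L2_inner_cnj) (simp add: complex_norm_square del: of_real_power)
  finally have "cnj (L2_inner M f ?s) = of_real (- (\<Sum>j\<in>J. (cmod (?c j))\<^sup>2))"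
    by (simp only: sum_negf of_real_minus of_real_sum)
  from arg_cong[OF this, of Re] have "Re (L2_inner M f ?s) = - (\<Sum>j\<in>J. (cmod (?c j))\<^sup>2)"
    by (simp only: cnj.simps Re_complex_of_real)
  moreover have "(\<lambda>x. f x + ?s x) = (\<lambda>x. f x - (\<Sum>j\<in>J. ?c j * e j x))"
    by (simp add: sum_negf)
  ultimately show *: "(L2_norm M (\<lambda>x. f x - (\<Sum>j\<in>J. ?c j * e j x)))\<^sup>2 = (L2_norm M f)\<^sup>2 - (\<Sum>j\<in>J. (cmod (?c j))\<^sup>2)"
    using L2_norm_add_power2[OF assms(4) s] orthonormal_norm_lincomb[OF assms(1-3), of "\<lambda>j. - ?c j"] by simp
  have "0 \<le> (L2_norm M (\<lambda>x. f x - (\<Sum>j\<in>J. ?c j * e j x)))\<^sup>2" by simp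
  then show "(\<Sum>j\<in>J. (cmod (?c j))\<^sup>2) \<le> (L2_norm M f)\<^sup>2" unfolding * by simp
qed

text \<open>The index set may be uncountable, so the series is summed along finite sets
  \<open>J n\<close> whose coefficient sums come within \<open>1/(n+1)\<close> of the supremum. By
  orthogonality the squared norm of a difference of partial sums is a difference of such sums, so
  the partial sums are Cauchy. The sets \<open>J n\<close> are part of the conclusion because the
  same sets later serve as partial sums in a second Hilbert space.\<close>

theorem Riesz_Fischer:
  assumes on: "orthonormal M I e"
    and bd: "\<And>J. finite J \<Longrightarrow> J \<subseteq> I \<Longrightarrow> (\<Sum>j\<in>J. (cmod (c j))\<^sup>2) \<le> b"
  shows "\<exists>F J. F \<in> L2 M \<and> (\<forall>i\<in>I. L2_inner M F (e i) = c i) \<and> (\<forall>n::nat. finite (J n) \<and> J n \<subseteq> I)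
      \<and> (\<lambda>n. L2_norm M (\<lambda>x. (\<Sum>j\<in>J n. c j * e j x) - F x)) \<longlonglongrightarrow> 0"
proof -
  define Q where "Q J = (\<Sum>j\<in>J. (cmod (c j))\<^sup>2)" for J
  define P where "P = {J. finite J \<and> J \<subseteq> I}"
  define S where "S = (SUP J\<in>P. Q J)"
  have P0: "{} \<in> P" by (simp add: P_def)
  have bdd: "bdd_above (Q ` P)" using bd by (auto simp: P_def Q_def bdd_above_def)
  have QS: "Q J \<le> S" if "J \<in> P" for J unfolding S_def using that bdd by (rule cSUP_upper)
  have "\<exists>J\<in>P. S - inverse (Suc n) < Q J" for n
    unfolding S_def using P0 bdd by (subst less_cSUP_iff[symmetric]) auto
  then obtain J' where J': "\<And>n. J' n \<in> P" "\<And>n. S - inverse (Suc n) < Q (J' n)" by metis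
  \<comment> \<open>Unions make the sets nested, so that a difference of partial sums is itself a
    sum over a finite set.\<close>
  define J where "J n = (\<Union>i\<le>n. J' i)" for n
  have JP: "J n \<in> P" for n using J'(1) by (auto simp: J_def P_def)
  have Jmono: "J m \<subseteq> J n" if "m \<le> n" for m n using that by (force simp: J_def)
  have Qmono: "Q A \<le> Q B" if "A \<subseteq> B" "B \<in> P" for A B
    unfolding Q_def using that by (intro sum_mono2) (auto simp: P_def)
  have QJ: "S - inverse (Suc n) < Q (J n)" for n
    using J'(2)[of n] Qmono[of "J' n" "J n"] JP[of n] by (force simp: J_def)
  define s where "s n x = (\<Sum>j\<in>J n. c j * e j x)" for n x
  have sL: "s n \<in> L2 M" for n
    unfolding s_def using on JP by (intro L2_lincomb) (auto simp: orthonormal_def P_def)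
  have tail: "(L2_norm M (\<lambda>x. s n x - s m x))\<^sup>2 < inverse (Suc m)" if "m \<le> n" for m n
  proof -
    have "(\<lambda>x. s n x - s m x) = (\<lambda>x. \<Sum>j\<in>J n - J m. c j * e j x)"
      unfolding s_def using Jmono[OF that] JP[of n] by (auto simp: sum_diff P_def)
    then have "(L2_norm M (\<lambda>x. s n x - s m x))\<^sup>2 = Q (J n - J m)"
      unfolding Q_def using on JP[of n] by (auto simp: P_def intro!: orthonormal_norm_lincomb)
    also have "\<dots> = Q (J n) - Q (J m)"
      unfolding Q_def using Jmono[OF that] JP[of n] by (auto simp: sum_diff P_def)
    also have "\<dots> < inverse (Suc m)" using QS[OF JP[of n]] QJ[of m] by linarith
    finally show ?thesis .
  qed
  have "\<exists>F. F \<in> L2 M \<and> (\<lambda>n. L2_norm M (\<lambda>x. s n x - F x)) \<longlonglongrightarrow> 0"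
  proof (rule L2_complete[OF sL])
    fix \<epsilon> :: real assume "\<epsilon> > 0"
    then obtain N where N: "inverse (real (Suc N)) < \<epsilon>\<^sup>2" using reals_Archimedean[of "\<epsilon>\<^sup>2"] by auto
    have le: "L2_norm M (\<lambda>x. s n x - s m x) < \<epsilon>" if "N \<le> m" "m \<le> n" for m n
    proof (rule power2_less_imp_less)
      have "inverse (real (Suc m)) \<le> inverse (real (Suc N))" using that by (intro le_imp_inverse_le) auto
      then show "(L2_norm M (\<lambda>x. s n x - s m x))\<^sup>2 < \<epsilon>\<^sup>2" using tail[OF that(2)] N by linarith
    qed (use \<open>\<epsilon> > 0\<close> in simp)
    have "L2_norm M (\<lambda>x. s n x - s m x) < \<epsilon>" if "N \<le> m" "N \<le> n" for m n
      using le[of m n] le[of n m] that by (cases "m \<le> n") (auto simp: L2_norm_diff_commute[of M "s n" "s m"])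
    then show "\<exists>N. \<forall>m\<ge>N. \<forall>n\<ge>N. L2_norm M (\<lambda>x. s m x - s n x) < \<epsilon>" by blast
  qed
  then obtain F where F: "F \<in> L2 M" "(\<lambda>n. L2_norm M (\<lambda>x. s n x - F x)) \<longlonglongrightarrow> 0" by blast
  have "L2_inner M F (e i) = c i" if i: "i \<in> I" for i
  proof -
    have "(\<lambda>n. L2_inner M (s n) (e i)) \<longlonglongrightarrow> L2_inner M F (e i)"
      using on i by (intro L2_inner_tendsto sL F) (auto simp: orthonormal_def)
    moreover have eq: "L2_inner M (s n) (e i) = (if i \<in> J n then c i else 0)" for n
      unfolding s_def using JP[of n] by (intro orthonormal_inner_lincomb[OF on _ _ i]) (auto simp: P_def)
    have "(\<lambda>n. L2_inner M (s n) (e i)) \<longlonglongrightarrow> c i"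
    proof (cases "\<exists>n. i \<in> J n")
      case True
      then obtain n where "i \<in> J n" ..
      then have "\<forall>\<^sub>F m in sequentially. L2_inner M (s m) (e i) = c i"
        using Jmono by (auto simp: eq eventually_sequentially intro!: exI[of _ n])
      then show ?thesis by (rule tendsto_eventually)
    next
      \<comment> \<open>An index missed by every \<open>J n\<close> could be added to
        \<open>J n\<close> without exceeding the supremum, which \<open>J n\<close> misses by less
        than \<open>1/(n+1)\<close>; its coefficient is therefore 0.\<close>
      case False
      have "(cmod (c i))\<^sup>2 \<le> inverse (Suc n)" for n
      proof -
        have "Q (insert i (J n)) = (cmod (c i))\<^sup>2 + Q (J n)"
          unfolding Q_def using False JP[of n] by (auto simp: P_def)
        moreover have "insert i (J n) \<in> P" using JP[of n] i by (auto simp: P_def)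
        ultimately show ?thesis using QS[of "insert i (J n)"] QJ[of n] by linarith
      qed
      then have "(cmod (c i))\<^sup>2 \<le> 0"
        using LIMSEQ_inverse_real_of_nat by (intro LIMSEQ_le_const) auto
      then have "c i = 0" by simp
      then have "L2_inner M (s n) (e i) = c i" for n using eq[of n] by simp
      then show ?thesis by simp
    qed
    ultimately show ?thesis using LIMSEQ_unique by blast
  qed
  moreover have "finite (J n) \<and> J n \<subseteq> I" for n using JP[of n] by (simp add: P_def)
  ultimately show ?thesis
    using F by (intro exI[of _ F] exI[of _ J]) (simp add: s_def[abs_def])
qed

text \<open>By Bessel's inequality the Riesz-Fischer theorem applies to the coefficients of
  \<open>f\<close> itself. It yields a function with the same coefficients, and totality identifies
  that function with \<open>f\<close> almost everywhere.\<close>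

lemma orthonormal_total_expansion:
  assumes on: "orthonormal M I e" and tot: "total_family M I e" and f: "f \<in> L2 M"
  shows "\<exists>J. (\<forall>n::nat. finite (J n) \<and> J n \<subseteq> I)
      \<and> (\<lambda>n. L2_norm M (\<lambda>x. (\<Sum>j\<in>J n. L2_inner M f (e j) * e j x) - f x)) \<longlonglongrightarrow> 0"
proof -
  have "\<exists>F J. F \<in> L2 M \<and> (\<forall>i\<in>I. L2_inner M F (e i) = L2_inner M f (e i)) \<and> (\<forall>n::nat. finite (J n) \<and> J n \<subseteq> I)
      \<and> (\<lambda>n. L2_norm M (\<lambda>x. (\<Sum>j\<in>J n. L2_inner M f (e j) * e j x) - F x)) \<longlonglongrightarrow> 0"
    using Bessel(2)[OF on _ _ f] by (intro Riesz_Fischer[OF on]) auto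
  then obtain F J where F: "F \<in> L2 M" "\<forall>i\<in>I. L2_inner M F (e i) = L2_inner M f (e i)"
    and J: "\<forall>n::nat. finite (J n) \<and> J n \<subseteq> I"
    and lim: "(\<lambda>n. L2_norm M (\<lambda>x. (\<Sum>j\<in>J n. L2_inner M f (e j) * e j x) - F x)) \<longlonglongrightarrow> 0"
    by blast
  have "\<forall>i\<in>I. L2_inner M (\<lambda>x. F x - f x) (e i) = 0"
    using F f on by (auto simp: L2_inner_diff_left orthonormal_def)
  then have ae: "AE x in M. F x - f x = 0"
    using tot[unfolded total_family_def, rule_format, OF L2_diff[OF F(1) f]] by simp
  have "L2_norm M (\<lambda>x. (\<Sum>j\<in>J n. L2_inner M f (e j) * e j x) - F x)
      = L2_norm M (\<lambda>x. (\<Sum>j\<in>J n. L2_inner M f (e j) * e j x) - f x)" for n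
  proof (rule L2_norm_AE_cong)
    have "(\<lambda>x. \<Sum>j\<in>J n. L2_inner M f (e j) * e j x) \<in> L2 M"
      using J on by (intro L2_lincomb) (auto simp: orthonormal_def)
    then show "(\<lambda>x. (\<Sum>j\<in>J n. L2_inner M f (e j) * e j x) - F x) \<in> borel_measurable M"
      "(\<lambda>x. (\<Sum>j\<in>J n. L2_inner M f (e j) * e j x) - f x) \<in> borel_measurable M"
      using F(1) f by (auto simp: L2_def)
    show "AE x in M. (\<Sum>j\<in>J n. L2_inner M f (e j) * e j x) - F x = (\<Sum>j\<in>J n. L2_inner M f (e j) * e j x) - f x"
      using ae by eventually_elim simp
  qed
  with J lim show ?thesis by auto
qed

text \<open>In [0, \<infinity>] an unordered sum is the supremum of its finite partial sums. This
  form reduces estimates of frame sums to finite ones.\<close>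

lemma infsum_ennreal_le_iff:
  fixes f :: "'i \<Rightarrow> ennreal"
  shows "(\<Sum>\<^sub>\<infinity>j\<in>I. f j) \<le> b \<longleftrightarrow> (\<forall>J. finite J \<longrightarrow> J \<subseteq> I \<longrightarrow> (\<Sum>j\<in>J. f j) \<le> b)"
proof -
  have "(\<Sum>\<^sub>\<infinity>j\<in>I. f j) = (SUP J\<in>{J. finite J \<and> J \<subseteq> I}. sum f J)"
    by (rule nonneg_infsum_complete) simp
  then show ?thesis by (auto simp: SUP_le_iff)
qed

text \<open>One inequality is Bessel's. For the other, the remainder in Bessel's identity along the
  sets \<open>J n\<close> tends to 0, so finite partial sums come arbitrarily close to the squared
  norm, whatever the cardinality of \<open>I\<close>.\<close>

theorem Parseval:
  assumes on: "orthonormal M I e" and tot: "total_family M I e" and f: "f \<in> L2 M"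
  shows "(\<Sum>\<^sub>\<infinity>i\<in>I. ennreal ((cmod (L2_inner M f (e i)))\<^sup>2)) = ennreal ((L2_norm M f)\<^sup>2)"
proof (rule antisym)
  let ?c = "\<lambda>j. L2_inner M f (e j)"
  show "(\<Sum>\<^sub>\<infinity>i\<in>I. ennreal ((cmod (?c i))\<^sup>2)) \<le> ennreal ((L2_norm M f)\<^sup>2)"
    unfolding infsum_ennreal_le_iff using Bessel(2)[OF on _ _ f] by (auto simp: ennreal_leI)
  obtain J where J: "\<And>n::nat. finite (J n) \<and> J n \<subseteq> I"
    and lim: "(\<lambda>n. L2_norm M (\<lambda>x. (\<Sum>j\<in>J n. ?c j * e j x) - f x)) \<longlonglongrightarrow> 0"
    using orthonormal_total_expansion[OF on tot f] by blast
  have "(\<lambda>n. (L2_norm M f)\<^sup>2 - (L2_norm M (\<lambda>x. (\<Sum>j\<in>J n. ?c j * e j x) - f x))\<^sup>2) \<longlonglongrightarrow> (L2_norm M f)\<^sup>2 - 0\<^sup>2"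
    by (intro tendsto_intros lim)
  moreover have "(L2_norm M f)\<^sup>2 - (L2_norm M (\<lambda>x. (\<Sum>j\<in>J n. ?c j * e j x) - f x))\<^sup>2 = (\<Sum>j\<in>J n. (cmod (?c j))\<^sup>2)" for n
    using Bessel(1)[OF on _ _ f, of "J n"] J[of n]
    by (simp add: L2_norm_diff_commute[of M "\<lambda>x. \<Sum>j\<in>J n. ?c j * e j x" f])
  ultimately have "(\<lambda>n. ennreal (\<Sum>j\<in>J n. (cmod (?c j))\<^sup>2)) \<longlonglongrightarrow> ennreal ((L2_norm M f)\<^sup>2)"
    by (intro tendsto_ennrealI) simp
  moreover have "ennreal (\<Sum>j\<in>J n. (cmod (?c j))\<^sup>2) \<le> (\<Sum>\<^sub>\<infinity>i\<in>I. ennreal ((cmod (?c i))\<^sup>2))" for n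
    using J[of n] infsum_ennreal_le_iff[of "\<lambda>i. ennreal ((cmod (?c i))\<^sup>2)" I "\<Sum>\<^sub>\<infinity>i\<in>I. ennreal ((cmod (?c i))\<^sup>2)"]
    by simp
  ultimately show "ennreal ((L2_norm M f)\<^sup>2) \<le> (\<Sum>\<^sub>\<infinity>i\<in>I. ennreal ((cmod (?c i))\<^sup>2))"
    by (intro LIMSEQ_le_const2) auto
qed

section \<open>Haar measure on a group with a compact open subgroup\<close>

text \<open>Interpreted twice, for the group with \<open>H\<close> and for the dual group with the
  annihilator of \<open>H\<close>, so that integration over cosets and completeness of separating
  families are proved once for both sides.\<close>

locale compact_open_haar =
  fixes M :: "'a::{topological_ab_group_add,t2_space} measure" and K :: "'a set"
  assumes haar: "haar_measure M" and subgroup: "is_subgroup K"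
    and cpt: "compact K" and opn: "open K" and unit: "emeasure M K = 1"
begin

lemma sets_M [simp, measurable_cong]: "sets M = sets borel"
  using haar by (simp add: haar_measure_def)

lemma space_M [simp]: "space M = UNIV"
  using sets_eq_imp_space_eq[OF sets_M] by simp

lemma measurable_M [simp]: "measurable M N = measurable borel N"
  by (rule measurable_cong_sets) simp_all

lemma K_zero: "0 \<in> K" and K_add: "x \<in> K \<Longrightarrow> y \<in> K \<Longrightarrow> x + y \<in> K"
  and K_minus: "x \<in> K \<Longrightarrow> - x \<in> K"
  using subgroup by (auto simp: is_subgroup_def)

lemma K_diff: "x \<in> K \<Longrightarrow> y \<in> K \<Longrightarrow> x - y \<in> K"
  using K_add[OF _ K_minus, of x y] by simp

lemma K_diff_commute: "x - y \<in> K \<longleftrightarrow> y - x \<in> K"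
  using K_minus[of "x - y"] K_minus[of "y - x"] by auto

lemma K_add_iff: "x \<in> K \<Longrightarrow> x + y \<in> K \<longleftrightarrow> y \<in> K" "x \<in> K \<Longrightarrow> y + x \<in> K \<longleftrightarrow> y \<in> K"
  using K_add[of x y] K_diff[of "x + y" x] by (auto simp: add.commute)

lemma K_sets [measurable, simp]: "K \<in> sets borel"
  using opn by simp

lemma K_closed: "closed K"
  using cpt by (rule compact_imp_closed)

lemma shift_measurable [measurable]: "(\<lambda>x. a + x :: 'a) \<in> borel_measurable borel"
  by (intro borel_measurable_continuous_onI continuous_intros)

lemma shift_measurable' [measurable]: "(\<lambda>x. x - a :: 'a) \<in> borel_measurable borel"
  by (intro borel_measurable_continuous_onI continuous_intros)

lemma haar_invariant:
  assumes "A \<in> sets borel"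
  shows "emeasure M ((\<lambda>x. a + x) ` A) = emeasure M A"
proof -
  have "\<forall>a. \<forall>A\<in>sets borel. emeasure M ((\<lambda>x. a + x) ` A) = emeasure M A"
    using haar unfolding haar_measure_def by (elim conjE)
  then show ?thesis using assms by (elim allE ballE) auto
qed

lemma haar_outer:
  assumes "A \<in> sets borel"
  shows "emeasure M A = (INF U\<in>{U. open U \<and> A \<subseteq> U}. emeasure M U)"
proof -
  have "\<forall>A\<in>sets borel. emeasure M A = (INF U\<in>{U. open U \<and> A \<subseteq> U}. emeasure M U)"
    using haar unfolding haar_measure_def by (elim conjE)
  then show ?thesis using assms by (rule bspec)
qed

lemma distr_shift: "distr M borel (\<lambda>x. a + x) = M"
proof (rule measure_eqI)
  fix A assume "A \<in> sets (distr M borel (\<lambda>x. a + x))"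
  then have A: "A \<in> sets borel" by simp
  have "(\<lambda>x. a + x) -` A \<inter> space M = (\<lambda>x. - a + x) ` A"
  proof (intro set_eqI iffI)
    fix x assume "x \<in> (\<lambda>x. a + x) -` A \<inter> space M"
    then show "x \<in> (\<lambda>x. - a + x) ` A" by (intro image_eqI[of _ _ "a + x"]) auto
  qed auto
  then show "emeasure (distr M borel (\<lambda>x. a + x)) A = emeasure M A"
    by (subst emeasure_distr[OF _ A]) (simp_all only: measurable_M shift_measurable haar_invariant[OF A])
qed simp

lemma nn_integral_shift:
  assumes [measurable]: "f \<in> borel_measurable borel"
  shows "(\<integral>\<^sup>+x. f (a + x) \<partial>M) = (\<integral>\<^sup>+x. f x \<partial>M)"
  by (subst (2) distr_shift[symmetric, of a], subst nn_integral_distr) auto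

lemma integral_shift:
  fixes f :: "'a \<Rightarrow> complex"
  assumes [measurable]: "f \<in> borel_measurable borel"
  shows "(\<integral>x. f (a + x) \<partial>M) = (\<integral>x. f x \<partial>M)"
  by (subst (2) distr_shift[symmetric, of a], subst integral_distr) auto

lemma integrable_shift_iff:
  fixes f :: "'a \<Rightarrow> 'b::{banach, second_countable_topology}"
  assumes [measurable]: "f \<in> borel_measurable borel"
  shows "integrable M (\<lambda>x. f (a + x)) \<longleftrightarrow> integrable M f"
  by (subst (2) distr_shift[symmetric, of a], subst integrable_distr_eq) auto

lemma AE_shift:
  assumes "AE x in M. P (a + x)"
  shows "AE x in M. P x"
proof -
  obtain N where N': "{x \<in> space M. \<not> P (a + x)} \<subseteq> N" "emeasure M N = 0" "N \<in> sets M"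
    using assms by (rule AE_E)
  then have N: "N \<in> null_sets M" "{x. \<not> P (a + x)} \<subseteq> N" by auto
  have "(\<lambda>x. - a + x) -` N \<in> sets M"
    using measurable_sets[OF shift_measurable[of "- a"], of N] N(1) by (simp add: null_sets_def)
  moreover have "emeasure M ((\<lambda>x. - a + x) -` N) = emeasure (distr M borel (\<lambda>x. - a + x)) N"
    using N(1) by (subst emeasure_distr) (auto simp: null_sets_def)
  ultimately have "(\<lambda>x. - a + x) -` N \<in> null_sets M"
    using N(1) unfolding distr_shift by (auto simp: null_sets_def)
  then show ?thesis
  proof (rule AE_I')
    show "{x \<in> space M. \<not> P x} \<subseteq> (\<lambda>x. - a + x) -` N"
    proof
      fix x assume "x \<in> {x \<in> space M. \<not> P x}"
      then have "- a + x \<in> {x. \<not> P (a + x)}" by simp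
      then show "x \<in> (\<lambda>x. - a + x) -` N" using N(2) by blast
    qed
  qed
qed

text \<open>The normalised Haar measure of \<open>K\<close>, kept as a measure on the whole group:
  integrals over \<open>K\<close> and over its cosets are then related by translations without a
  change of type.\<close>

definition MK :: "'a measure" where
  "MK = density M (\<lambda>x. ennreal (indicator K x))"

lemma sets_MK [simp, measurable_cong]: "sets MK = sets borel"
  by (simp add: MK_def)

lemma space_MK [simp]: "space MK = UNIV"
  by (simp add: MK_def)

lemma measurable_MK [simp]: "measurable MK N = measurable borel N"
  by (rule measurable_cong_sets) simp_all

lemma emeasure_MK: "A \<in> sets borel \<Longrightarrow> emeasure MK A = emeasure M (A \<inter> K)"
proof -
  assume A [measurable]: "A \<in> sets borel"
  have "emeasure MK A = (\<integral>\<^sup>+x. ennreal (indicator K x) * indicator A x \<partial>M)"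
    unfolding MK_def by (subst emeasure_density) auto
  also have "\<dots> = (\<integral>\<^sup>+x. indicator (A \<inter> K) x \<partial>M)"
    by (rule nn_integral_cong) (auto simp: indicator_def)
  finally show ?thesis by simp
qed

sublocale MK: finite_measure MK
  by (rule finite_measureI) (simp add: emeasure_MK unit)

lemma AE_MK: "(AE x in MK. P x) \<longleftrightarrow> (AE x in M. x \<in> K \<longrightarrow> P x)"
  unfolding MK_def by (subst AE_density) (auto simp: indicator_def)

lemma integrable_MK:
  fixes f :: "'a \<Rightarrow> 'b::{banach, second_countable_topology}"
  assumes "f \<in> borel_measurable borel"
  shows "integrable MK f \<longleftrightarrow> integrable M (\<lambda>x. indicator K x *\<^sub>R f x)"
  unfolding MK_def using assms by (subst integrable_density) auto

lemma integral_MK: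
  fixes f :: "'a \<Rightarrow> 'b::{banach, second_countable_topology}"
  assumes "f \<in> borel_measurable borel"
  shows "(\<integral>x. f x \<partial>MK) = (\<integral>x. indicator K x *\<^sub>R f x \<partial>M)"
  unfolding MK_def using assms by (subst integral_density) auto

lemma nn_integral_MK:
  assumes "f \<in> borel_measurable borel"
  shows "(\<integral>\<^sup>+x. f x \<partial>MK) = (\<integral>\<^sup>+x. indicator K x * f x \<partial>M)"
  unfolding MK_def using assms by (subst nn_integral_density) (auto simp: ennreal_indicator)

lemma integral_MK_1: "(\<integral>x. 1 \<partial>MK) = (1::complex)"
  by (simp add: measure_def emeasure_MK unit)

lemma integrable_MK_bounded:
  fixes f :: "'a \<Rightarrow> 'b::{banach, second_countable_topology}"
  assumes "f \<in> borel_measurable borel" "\<And>x. x \<in> K \<Longrightarrow> norm (f x) \<le> b"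
  shows "integrable MK f"
  by (rule MK.integrable_const_bound[of _ b]) (use assms in \<open>auto simp: AE_MK\<close>)

lemma integral_MK_shift:
  fixes f :: "'a \<Rightarrow> complex"
  assumes [measurable]: "f \<in> borel_measurable borel" and a: "a \<in> K"
  shows "(\<integral>x. f (a + x) \<partial>MK) = (\<integral>x. f x \<partial>MK)"
proof -
  have "(\<integral>x. f (a + x) \<partial>MK) = (\<integral>x. indicator K (a + x) *\<^sub>R f (a + x) \<partial>M)"
    by (subst integral_MK) (auto intro!: Bochner_Integration.integral_cong simp: indicator_def K_add_iff(1)[OF a])
  also have "\<dots> = (\<integral>x. f x \<partial>MK)"
    by (subst integral_shift) (auto simp: integral_MK)
  finally show ?thesis .
qed

text \<open>Translating by \<open>a\<close> multiplies the integral by \<open>u a\<close>.\<close>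

lemma integral_char_zero:
  fixes u :: "'a \<Rightarrow> complex"
  assumes [measurable]: "u \<in> borel_measurable borel" and hom: "\<And>x y. u (x + y) = u x * u y"
    and a: "a \<in> K" "u a \<noteq> 1"
  shows "(\<integral>x. u x \<partial>MK) = 0"
proof -
  have "(\<integral>x. u x \<partial>MK) = u a * (\<integral>x. u x \<partial>MK)"
    using integral_MK_shift[OF assms(1) a(1)] by (simp add: hom)
  then have "(1 - u a) * (\<integral>x. u x \<partial>MK) = 0" by (simp add: algebra_simps)
  with a(2) show ?thesis by simp
qed

subsection \<open>Cosets and supports\<close>

lemma coset_conv: "(\<lambda>h. a + h) ` K = {x. x - a \<in> K}"
proof (intro set_eqI iffI)
  fix x assume "x \<in> {x. x - a \<in> K}"
  then show "x \<in> (\<lambda>h. a + h) ` K" by (intro image_eqI[of _ _ "x - a"]) auto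
qed auto

lemma cosets_conv: "cosets K = range (\<lambda>a. {x. x - a \<in> K})"
  by (simp add: cosets_def coset_conv)

lemma cosetE:
  assumes "X \<in> cosets K"
  obtains a where "X = {x. x - a \<in> K}" "a \<in> X"
proof -
  from assms obtain a where "X = {x. x - a \<in> K}" by (auto simp: cosets_conv)
  then show ?thesis using that[of a] K_zero by simp
qed

lemma coset_eqI:
  assumes "X \<in> cosets K" "a \<in> X"
  shows "X = {x. x - a \<in> K}"
proof -
  from assms(1) obtain b where b: "X = {x. x - b \<in> K}" by (rule cosetE)
  have ab: "a - b \<in> K" using assms(2) b by simp
  have "x - b \<in> K \<longleftrightarrow> x - a \<in> K" for x
    using K_add[of "x - a", OF _ ab] K_diff[of "x - b", OF _ ab] by auto
  with b show ?thesis by simp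
qed

lemma coset_mem: "{x. x - a \<in> K} \<in> cosets K" "a \<in> {x. x - a \<in> K}"
  using K_zero by (auto simp: cosets_conv)

lemma coset_eq: "X \<in> cosets K \<Longrightarrow> Y \<in> cosets K \<Longrightarrow> a \<in> X \<Longrightarrow> a \<in> Y \<Longrightarrow> X = Y"
  using coset_eqI by blast

lemma coset_diff:
  assumes "X \<in> cosets K" "x \<in> X" "y \<in> X"
  shows "x - y \<in> K"
  using coset_eqI[OF assms(1,3)] assms(2) by simp

lemma coset_open:
  assumes "X \<in> cosets K"
  shows "open X"
proof -
  obtain a where a: "X = {x. x - a \<in> K}" by (rule cosetE[OF assms])
  have "open ((\<lambda>x. x - a) -` K)"
    by (intro open_vimage opn continuous_intros)
  then show ?thesis unfolding a by (simp add: vimage_def)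
qed

lemma coset_sets: "X \<in> cosets K \<Longrightarrow> X \<in> sets borel"
  using coset_open by (intro borel_open)

text \<open>Finitely many translates of a nonempty open set cover the compact \<open>K\<close>. If
  that set were null, \<open>K\<close> would be null as well.\<close>

lemma open_pos:
  assumes "open U" "u \<in> U"
  shows "emeasure M U > 0"
proof (rule ccontr)
  assume "\<not> ?thesis"
  then have z: "emeasure M U = 0" by simp
  define V where "V k = (\<lambda>x. (u - k) + x) -` U" for k
  have V: "open (V k)" for k unfolding V_def using assms(1) by (intro open_vimage continuous_intros)
  have Vz: "emeasure M (V k) = 0" for k
  proof -
    have "emeasure M (V k) = emeasure (distr M borel (\<lambda>x. (u - k) + x)) U"
      using assms(1) by (subst emeasure_distr) (auto simp: V_def)
    then show ?thesis using z by (simp only: distr_shift)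
  qed
  have "K \<subseteq> (\<Union>k\<in>K. V k)" using assms(2) by (auto simp: V_def)
  then obtain C where C: "C \<subseteq> K" "finite C" "K \<subseteq> (\<Union>k\<in>C. V k)"
    by (rule compactE_image[OF cpt V])
  have "emeasure M K \<le> emeasure M (\<Union>k\<in>C. V k)"
    using C V by (intro emeasure_mono) auto
  also have "\<dots> \<le> (\<Sum>k\<in>C. emeasure M (V k))"
    using C V by (intro emeasure_subadditive_finite) auto
  also have "\<dots> = 0" by (simp add: Vz)
  finally show False by (simp add: unit)
qed

text \<open>Outer regularity encloses \<open>A\<close> in an open \<open>U\<close> of finite
  measure. The traces of the cosets on \<open>U\<close> are disjoint, so their measures are
  summable; a nonempty trace is open and hence of positive measure, so only countably many occur.
  The traces on \<open>A\<close> itself could be null, which is why \<open>U\<close> is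
  needed.\<close>

lemma finite_measure_countable_cosets:
  assumes A: "A \<in> sets borel" "emeasure M A < \<infinity>"
  shows "countable {X \<in> cosets K. X \<inter> A \<noteq> {}}"
proof -
  have "emeasure M A = (INF U\<in>{U. open U \<and> A \<subseteq> U}. emeasure M U)"
    by (rule haar_outer[OF A(1)])
  then obtain U where U: "open U" "A \<subseteq> U" "emeasure M U < \<infinity>"
    using A(2) by (auto simp: INF_less_iff)
  let ?m = "\<lambda>X. measure M (X \<inter> U)"
  have le: "emeasure M (X \<inter> U) \<le> emeasure M U" if "X \<in> cosets K" for X
    using U coset_sets[OF that] by (intro emeasure_mono) auto
  have fin: "emeasure M (X \<inter> U) \<noteq> \<infinity>" if "X \<in> cosets K" for X
    using le_less_trans[OF le[OF that] U(3)] by simp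
  have "?m summable_on cosets K"
  proof (rule nonneg_bdd_above_summable_on)
    show "bdd_above (sum ?m ` {F. F \<subseteq> cosets K \<and> finite F})"
    proof (rule bdd_aboveI2)
      fix F assume "F \<in> {F. F \<subseteq> cosets K \<and> finite F}"
      then have F: "F \<subseteq> cosets K" "finite F" by auto
      have "disjoint_family_on (\<lambda>X. X \<inter> U) F"
        unfolding disjoint_family_on_def using F(1) coset_eq by fastforce
      then have sm: "sum ?m F = measure M (\<Union>X\<in>F. X \<inter> U)"
        using F coset_sets U fin by (intro measure_finite_Union[symmetric]) auto
      have "(\<Union>X\<in>F. X \<inter> U) \<in> sets borel"
        using F U coset_sets by (intro sets.finite_UN) auto
      then have "measure M (\<Union>X\<in>F. X \<inter> U) \<le> measure M U"
        using F U by (intro measure_mono_fmeasurable) (auto simp: fmeasurable_def)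
      then show "sum ?m F \<le> measure M U" by (simp only: sm)
    qed
  qed simp
  then have "countable {X \<in> cosets K. ?m X \<noteq> 0}"
    by (rule summable_countable_real)
  moreover have "{X \<in> cosets K. X \<inter> A \<noteq> {}} \<subseteq> {X \<in> cosets K. ?m X \<noteq> 0}"
  proof (rule subsetI)
    fix X assume "X \<in> {X \<in> cosets K. X \<inter> A \<noteq> {}}"
    then obtain x where X: "X \<in> cosets K" "x \<in> X" "x \<in> A" by auto
    have "emeasure M (X \<inter> U) > 0"
      using X U coset_open by (intro open_pos[of _ x]) auto
    moreover have "emeasure M (X \<inter> U) < \<infinity>" using le[OF X(1)] U(3) by (rule le_less_trans)
    ultimately have "?m X > 0" by (simp add: measure_def enn2real_positive_iff)
    then show "X \<in> {X \<in> cosets K. ?m X \<noteq> 0}" using X(1) by simp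
  qed
  ultimately show ?thesis by (rule countable_subset[rotated])
qed

text \<open>Nonvanishing is meant pointwise and not modulo null sets: outside these cosets the
  function is identically 0.\<close>

definition supp_cosets :: "('a \<Rightarrow> complex) \<Rightarrow> 'a set set" where
  "supp_cosets f = {X \<in> cosets K. \<exists>x\<in>X. f x \<noteq> 0}"

lemma supp_cosets_cosets: "supp_cosets f \<subseteq> cosets K"
  by (auto simp: supp_cosets_def)

text \<open>The set where \<open>f\<close> does not vanish is a countable union of level sets, each
  of finite measure by Markov's inequality. The exponent serves integrable functions with
  \<open>k = 1\<close> and square integrable ones with \<open>k = 2\<close>.\<close>

lemma supp_cosets_countable:
  assumes "integrable M (\<lambda>x. (cmod (f x)) ^ k)" "f \<in> borel_measurable borel" "k > 0"
  shows "countable (supp_cosets f)"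
proof -
  let ?A = "\<lambda>n::nat. {x. inverse (Suc n) \<le> (cmod (f x)) ^ k}"
  have A [measurable]: "?A n \<in> sets borel" for n
    using assms(2) by measurable
  have "emeasure M (?A n) < \<infinity>" for n
  proof -
    have "emeasure M {x \<in> space M. inverse (Suc n) \<le> (cmod (f x)) ^ k}
        \<le> ennreal ((1 / inverse (Suc n)) * (\<integral>x. (cmod (f x)) ^ k \<partial>M))"
      by (rule integral_Markov_inequality[OF assms(1)]) auto
    also have "\<dots> < \<infinity>" by simp
    finally show ?thesis by simp
  qed
  then have "countable (\<Union>n. {X \<in> cosets K. X \<inter> ?A n \<noteq> {}})"
    using A by (intro countable_UN finite_measure_countable_cosets) auto
  moreover have "supp_cosets f \<subseteq> (\<Union>n. {X \<in> cosets K. X \<inter> ?A n \<noteq> {}})"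
  proof
    fix X assume "X \<in> supp_cosets f"
    then obtain x where x: "X \<in> cosets K" "x \<in> X" "f x \<noteq> 0" by (auto simp: supp_cosets_def)
    then obtain n where "inverse (Suc n) < (cmod (f x)) ^ k"
      using reals_Archimedean[of "(cmod (f x)) ^ k"] by auto
    then have "x \<in> X \<inter> ?A n" using x(2) by simp
    with x(1) show "X \<in> (\<Union>n. {X \<in> cosets K. X \<inter> ?A n \<noteq> {}})" by blast
  qed
  ultimately show ?thesis by (rule countable_subset[rotated])
qed

lemma supp_cosets_L2:
  assumes "f \<in> L2 M"
  shows "countable (supp_cosets f)"
  using assms by (intro supp_cosets_countable[of f 2]) (auto simp: L2_def)

text \<open>Null sets attached to uncountably many cosets cannot simply be united. Outside the
  countably many cosets of its support \<open>f\<close> is 0 at every point, so only countably many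
  null sets matter.\<close>

lemma AE_zero_cosets:
  assumes f: "f \<in> L2 M" and z: "\<And>X. X \<in> cosets K \<Longrightarrow> AE x in M. x \<in> X \<longrightarrow> f x = 0"
  shows "AE x in M. f x = 0"
proof -
  have "AE x in M. \<forall>X\<in>supp_cosets f. x \<in> X \<longrightarrow> f x = 0"
    using supp_cosets_cosets by (intro AE_ball_countable' supp_cosets_L2[OF f] z) auto
  then show ?thesis
  proof eventually_elim
    case (elim x)
    show ?case
    proof (rule ccontr)
      assume "f x \<noteq> 0"
      then have "{y. y - x \<in> K} \<in> supp_cosets f"
        using coset_mem[of x] by (auto simp: supp_cosets_def intro!: exI[of _ x])
      then show False using elim coset_mem[of x] \<open>f x \<noteq> 0\<close> by auto
    qed
  qed
qed

subsection \<open>Separating families of characters\<close>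

inductive_set cspan :: "('b \<Rightarrow> complex) set \<Rightarrow> ('b \<Rightarrow> complex) set" for X where
  scale: "u \<in> X \<Longrightarrow> (\<lambda>x. c * u x) \<in> cspan X"
| add: "p \<in> cspan X \<Longrightarrow> q \<in> cspan X \<Longrightarrow> (\<lambda>x. p x + q x) \<in> cspan X"

lemma cspan_scale:
  assumes "p \<in> cspan X"
  shows "(\<lambda>x. c * p x) \<in> cspan X"
  using assms
proof induction
  case (scale u d)
  then show ?case using cspan.scale[of u X "c * d"] by (simp add: mult.assoc)
next
  case (add p q)
  then show ?case using cspan.add[of "\<lambda>x. c * p x" X "\<lambda>x. c * q x"] by (simp add: distrib_left)
qed

lemma cspan_mult:
  assumes X: "\<And>u v. u \<in> X \<Longrightarrow> v \<in> X \<Longrightarrow> (\<lambda>x. u x * v x) \<in> X"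
    and "p \<in> cspan X" "q \<in> cspan X"
  shows "(\<lambda>x. p x * q x) \<in> cspan X"
  using assms(2,3)
proof induction
  case (scale u c)
  have "(\<lambda>x. u x * q x) \<in> cspan X"
    using scale(2)
  proof induction
    case (scale v d)
    show ?case using cspan.scale[OF X[OF \<open>u \<in> X\<close> scale], of d] by (simp add: mult.left_commute)
  next
    case (add p q)
    then show ?case using cspan.add[of "\<lambda>x. u x * p x" X "\<lambda>x. u x * q x"] by (simp add: distrib_left)
  qed
  then show ?case using cspan_scale[of "\<lambda>x. u x * q x" X c] by (simp add: mult.assoc)
next
  case (add p p')
  then show ?case using cspan.add[of "\<lambda>x. p x * q x" X "\<lambda>x. p' x * q x"] by (simp add: distrib_right)
qed

lemma cspan_continuous:
  assumes "\<And>u. u \<in> X \<Longrightarrow> continuous_on S u" "p \<in> cspan X"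
  shows "continuous_on S p"
  using assms(2)
proof induction
  case (scale u c)
  then show ?case by (intro continuous_intros assms(1))
next
  case (add p q)
  then show ?case by (intro continuous_intros)
qed

text \<open>The hypotheses of the Stone-Weierstrass theorem on \<open>K\<close>, except that sums
  are left out: a family of characters is closed under products and conjugation, and its span is the
  algebra.\<close>

definition separating :: "('a \<Rightarrow> complex) set \<Rightarrow> bool" where
  "separating X \<longleftrightarrow> (\<forall>u\<in>X. continuous_on UNIV u) \<and> (\<lambda>_. 1) \<in> X
     \<and> (\<forall>u\<in>X. \<forall>v\<in>X. (\<lambda>x. u x * v x) \<in> X) \<and> (\<forall>u\<in>X. (\<lambda>x. cnj (u x)) \<in> X)
     \<and> (\<forall>x\<in>K. \<forall>y\<in>K. x \<noteq> y \<longrightarrow> (\<exists>u\<in>X. u x \<noteq> u y))"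

lemma separatingD:
  assumes "separating X"
  shows "u \<in> X \<Longrightarrow> continuous_on UNIV u" "(\<lambda>_. 1) \<in> X"
    "u \<in> X \<Longrightarrow> v \<in> X \<Longrightarrow> (\<lambda>x. u x * v x) \<in> X" "u \<in> X \<Longrightarrow> (\<lambda>x. cnj (u x)) \<in> X"
    "x \<in> K \<Longrightarrow> y \<in> K \<Longrightarrow> x \<noteq> y \<Longrightarrow> \<exists>u\<in>X. u x \<noteq> u y"
  using assms by (auto simp: separating_def)

text \<open>The approximation is carried out with real functions, so the ring consists of the real
  functions whose complexification lies in the span. Closure of \<open>X\<close> under conjugation
  puts real and imaginary parts of its members there, and one of the two separates the given
  points.\<close>

lemma separating_function_ring:
  assumes X: "separating X"
  shows "function_ring_on {r. continuous_on K r \<and> (\<exists>p\<in>cspan X. \<forall>x. p x = complex_of_real (r x))} K"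
proof
  fix x y assume xy: "x \<in> K" "y \<in> K" "x \<noteq> y"
  then have "\<exists>u\<in>X. u x \<noteq> u y" by (rule separatingD(5)[OF X])
  then obtain u where u: "u \<in> X" "u x \<noteq> u y" by blast
  have cu: "(\<lambda>x. cnj (u x)) \<in> X" by (rule separatingD(4)[OF X u(1)])
  have cont: "continuous_on K u"
    by (rule continuous_on_subset[OF separatingD(1)[OF X u(1)]]) simp
  have re: "(\<lambda>x. complex_of_real (Re (u x))) \<in> cspan X"
  proof -
    have "(\<lambda>x. 1 / 2 * u x + 1 / 2 * cnj (u x)) \<in> cspan X"
      by (intro cspan.intros u cu)
    moreover have "(\<lambda>x. 1 / 2 * u x + 1 / 2 * cnj (u x)) = (\<lambda>x. complex_of_real (Re (u x)))"
      by (auto simp: complex_eq_iff)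
    ultimately show ?thesis by simp
  qed
  have im: "(\<lambda>x. complex_of_real (Im (u x))) \<in> cspan X"
  proof -
    have "(\<lambda>x. (- \<i> / 2) * u x + (\<i> / 2) * cnj (u x)) \<in> cspan X"
      by (intro cspan.intros u cu)
    moreover have "(\<lambda>x. (- \<i> / 2) * u x + (\<i> / 2) * cnj (u x)) = (\<lambda>x. complex_of_real (Im (u x)))"
      by (auto simp: complex_eq_iff)
    ultimately show ?thesis by simp
  qed
  have "Re (u x) \<noteq> Re (u y) \<or> Im (u x) \<noteq> Im (u y)" using u(2) by (simp add: complex_eq_iff)
  then show "\<exists>f\<in>{r. continuous_on K r \<and> (\<exists>p\<in>cspan X. \<forall>x. p x = complex_of_real (r x))}. f x \<noteq> f y"
  proof
    assume "Re (u x) \<noteq> Re (u y)"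
    then show ?thesis using re cont by (intro bexI[of _ "\<lambda>x. Re (u x)"]) (auto intro!: continuous_intros)
  next
    assume "Im (u x) \<noteq> Im (u y)"
    then show ?thesis using im cont by (intro bexI[of _ "\<lambda>x. Im (u x)"]) (auto intro!: continuous_intros)
  qed
next
  fix f g
  assume "f \<in> {r. continuous_on K r \<and> (\<exists>p\<in>cspan X. \<forall>x. p x = complex_of_real (r x))}"
    "g \<in> {r. continuous_on K r \<and> (\<exists>p\<in>cspan X. \<forall>x. p x = complex_of_real (r x))}"
  then obtain p q where p: "continuous_on K f" "p \<in> cspan X" "\<And>x. p x = complex_of_real (f x)"
    and q: "continuous_on K g" "q \<in> cspan X" "\<And>x. q x = complex_of_real (g x)" by blast
  show "(\<lambda>x. f x + g x) \<in> {r. continuous_on K r \<and> (\<exists>p\<in>cspan X. \<forall>x. p x = complex_of_real (r x))}"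
    using p q by (auto intro!: continuous_intros bexI[OF _ cspan.add[OF p(2) q(2)]])
  have "(\<lambda>x. p x * q x) \<in> cspan X"
    by (intro cspan_mult separatingD(3)[OF X] p(2) q(2))
  then show "(\<lambda>x. f x * g x) \<in> {r. continuous_on K r \<and> (\<exists>p\<in>cspan X. \<forall>x. p x = complex_of_real (r x))}"
    using p q by (auto intro!: continuous_intros bexI[of _ "\<lambda>x. p x * q x"])
next
  fix c :: real
  have "(\<lambda>x. complex_of_real c * 1) \<in> cspan X"
    by (intro cspan.scale separatingD(2)[OF X])
  then show "(\<lambda>_. c) \<in> {r. continuous_on K r \<and> (\<exists>p\<in>cspan X. \<forall>x. p x = complex_of_real (r x))}"
    by (auto intro!: bexI[of _ "\<lambda>x. complex_of_real c * 1"])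
qed (use cpt in auto)

section \<open>Approximation of indicators and completeness of separating families\<close>

lemma outer_approx:
  assumes E: "E \<in> sets borel" "E \<subseteq> K" and d: "d > 0"
  obtains U where "open U" "E \<subseteq> U" "emeasure M (U - E) < ennreal d"
proof -
  have fin: "emeasure M E < \<infinity>"
    using emeasure_mono[of E K M] E unit by (simp add: less_top[symmetric] top_unique)
      (metis ennreal_one_neq_top top_unique)
  have "emeasure M E < emeasure M E + ennreal d"
    using fin d by (cases "emeasure M E") (auto simp: ennreal_plus[symmetric] ennreal_less_iff simp del: ennreal_plus)
  moreover have "emeasure M E = (INF U\<in>{U. open U \<and> E \<subseteq> U}. emeasure M U)"
    by (rule haar_outer[OF E(1)])
  ultimately obtain U where U: "open U" "E \<subseteq> U" "emeasure M U < emeasure M E + ennreal d"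
    by (auto simp: INF_less_iff)
  have "emeasure M U = emeasure M E + emeasure M (U - E)"
    using U E by (subst plus_emeasure) (auto simp: Un_absorb1)
  then have "emeasure M (U - E) < ennreal d"
    using U(3) fin by (cases "emeasure M E") (auto simp: ennreal_add_left_cancel_less)
  with U show ?thesis using that by blast
qed

text \<open>Stone--Weierstrass separates a compact set inside \<open>E\<close> from the complement of an open set
  around \<open>E\<close>; Borel--Cantelli turns the approximation in measure into one almost everywhere.\<close>

lemma cspan_approx_indicator:
  assumes X: "separating X" and E [measurable]: "E \<in> sets borel" "E \<subseteq> K"
  obtains p :: "nat \<Rightarrow> 'a \<Rightarrow> complex" where "\<And>n. p n \<in> cspan X" "\<And>n x. x \<in> K \<Longrightarrow> cmod (p n x) \<le> 1"
    "AE x in MK. (\<lambda>n. p n x) \<longlonglongrightarrow> indicator E x"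
proof -
  interpret R: function_ring_on "{r. continuous_on K r \<and> (\<exists>p\<in>cspan X. \<forall>x. p x = complex_of_real (r x))}" K
    by (rule separating_function_ring[OF X])
  \<comment> \<open>Starting at 1/2 keeps \<open>e n\<close> strictly below 1, as the separating
    function requires; the geometric decay makes the measures of the exceptional sets
    summable.\<close>
  define e :: "nat \<Rightarrow> real" where "e n = (1 / 2) ^ Suc n" for n
  have e: "0 < e n" "e n < 1" for n
    by (simp_all add: e_def power_Suc_less_one del: power_Suc)
  define Q where "Q n p D \<longleftrightarrow> p \<in> cspan X \<and> (\<forall>x\<in>K. cmod (p x) \<le> 1) \<and> D \<in> sets borel
      \<and> measure MK D \<le> 2 * e n \<and> (\<forall>x\<in>K - D. cmod (p x - indicator E x) \<le> e n)" for n p D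
  have "\<exists>p D. Q n p D" for n
  proof -
    obtain U where U: "open U" "E \<subseteq> U" "emeasure M (U - E) < ennreal (e n)"
      using outer_approx[OF E e(1)] by blast
    \<comment> \<open>\<open>W\<close> is a neighbourhood of the complement of \<open>E\<close> in
      \<open>K\<close>, so \<open>K - W\<close> is the compact set inside \<open>E\<close>. The
      approximation can fail only on the intersection of \<open>U\<close> and \<open>W\<close>,
      whose part in \<open>K\<close> has measure at most \<open>2 * e n\<close>.\<close>
    obtain W where W: "open W" "K - E \<subseteq> W" "emeasure M (W - (K - E)) < ennreal (e n)"
      using outer_approx[of "K - E" "e n"] e(1) E by auto
    have "\<exists>f\<in>{r. continuous_on K r \<and> (\<exists>p\<in>cspan X. \<forall>x. p x = complex_of_real (r x))}.
        f ` K \<subseteq> {0..1} \<and> (\<forall>x\<in>K - U. f x < e n) \<and> (\<forall>x\<in>K - W. f x > 1 - e n)"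
    proof (rule R.two)
      show "closed (K - U)" "closed (K - W)" using K_closed U(1) W(1) by (auto intro: closed_Diff)
      show "(K - U) \<inter> (K - W) = {}" using U(2) W(2) by blast
    qed (use e in auto)
    then obtain f p where f: "f ` K \<subseteq> {0..1}" "\<forall>x\<in>K - U. f x < e n" "\<forall>x\<in>K - W. f x > 1 - e n"
      and p: "p \<in> cspan X" "\<And>x. p x = complex_of_real (f x)" by blast
    have bd: "0 \<le> f x \<and> f x \<le> 1" if "x \<in> K" for x using f(1) that by auto
    have "measure MK (U \<inter> W) \<le> 2 * e n"
    proof -
      have "emeasure MK (U \<inter> W) = emeasure M (U \<inter> W \<inter> K)" using U W by (simp add: emeasure_MK)
      also have "\<dots> \<le> emeasure M ((U - E) \<union> (W - (K - E)))"
        using U W by (intro emeasure_mono) auto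
      also have "\<dots> \<le> emeasure M (U - E) + emeasure M (W - (K - E))"
        using U W by (intro emeasure_subadditive) auto
      also have "\<dots> \<le> ennreal (e n) + ennreal (e n)" using U(3) W(3) by (intro add_mono) auto
      also have "\<dots> = ennreal (2 * e n)" using e(1)[of n] by (simp add: ennreal_plus[symmetric] del: ennreal_plus)
      finally show ?thesis using e(1)[of n] by (simp add: MK.emeasure_eq_measure)
    qed
    moreover have "cmod (p x - indicator E x) \<le> e n" if "x \<in> K - U \<inter> W" for x
    proof (cases "x \<in> U")
      case True
      then have "x \<in> K - W" using that by auto
      moreover from this have "x \<in> E" using W(2) by auto
      ultimately have *: "f x > 1 - e n" "f x \<le> 1" "indicator E x = (1::complex)" using f(3) bd by auto
      then have "p x - indicator E x = complex_of_real (f x - 1)" by (simp add: p)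
      then have "cmod (p x - indicator E x) = \<bar>f x - 1\<bar>" by (simp only: norm_of_real)
      then show ?thesis using * by linarith
    next
      case False
      then have "x \<in> K - U" "x \<notin> E" using that U(2) by auto
      then show ?thesis using f(2) bd[of x] by (force simp: p)
    qed
    moreover have "cmod (p x) \<le> 1" if "x \<in> K" for x using bd[OF that] by (simp add: p)
    ultimately show ?thesis unfolding Q_def using p(1) U(1) W(1) by (intro exI[of _ p] exI[of _ "U \<inter> W"]) auto
  qed
  then obtain p D where "\<And>n. Q n (p n) (D n)" by metis
  then have p: "\<And>n. p n \<in> cspan X" "\<And>n x. x \<in> K \<Longrightarrow> cmod (p n x) \<le> 1"
    and D: "\<And>n. D n \<in> sets borel" "\<And>n. measure MK (D n) \<le> 2 * e n"
    and pD: "\<And>n x. x \<in> K - D n \<Longrightarrow> cmod (p n x - indicator E x) \<le> e n"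
    unfolding Q_def by blast+
  have "AE x in MK. \<forall>\<^sub>F n in sequentially. x \<in> space MK - D n"
  proof (rule borel_cantelli_AE1)
    show "summable (\<lambda>n. measure MK (D n))"
    proof (rule summable_comparison_test')
      show "summable (\<lambda>n. 2 * e n)" unfolding e_def power_Suc by (intro summable_mult summable_geometric) auto
      show "norm (measure MK (D n)) \<le> 2 * e n" if "n \<ge> 0" for n using D(2) by simp
    qed
  qed (use D in \<open>auto simp: less_top[symmetric]\<close>)
  moreover have "AE x in MK. x \<in> K" by (simp add: AE_MK)
  ultimately have "AE x in MK. (\<lambda>n. p n x) \<longlonglongrightarrow> indicator E x"
  proof eventually_elim
    case (elim x)
    have "(\<lambda>n. (1 / 2 :: real) ^ Suc n) \<longlonglongrightarrow> 0"
      by (rule LIMSEQ_Suc) (intro LIMSEQ_realpow_zero, auto)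
    then have "e \<longlonglongrightarrow> 0" unfolding e_def[abs_def] .
    moreover have "\<forall>\<^sub>F n in sequentially. norm (p n x - indicator E x) \<le> e n"
      using elim(1) by eventually_elim (use pD elim(2) in auto)
    ultimately have "(\<lambda>n. p n x - indicator E x) \<longlonglongrightarrow> 0" by (rule Lim_null_comparison[rotated])
    then show ?case by (simp add: LIM_zero_iff)
  qed
  with p(1,2) show ?thesis by (rule that)
qed

lemma cspan_measurable: "separating X \<Longrightarrow> p \<in> cspan X \<Longrightarrow> p \<in> borel_measurable borel"
  by (rule borel_measurable_continuous_onI, rule cspan_continuous) (rule separatingD(1))

lemma continuous_bounded_K:
  assumes "continuous_on UNIV (u :: 'a \<Rightarrow> complex)"
  obtains b where "b \<ge> 0" "\<And>x. x \<in> K \<Longrightarrow> cmod (u x) \<le> b"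
proof -
  have "compact (u ` K)"
    using assms cpt continuous_on_subset by (intro compact_continuous_image) auto
  then obtain b where "\<forall>y\<in>u ` K. norm y \<le> b" using compact_imp_bounded bounded_iff by metis
  then show ?thesis using that[of "max b 0"] by force
qed

text \<open>The approximations of the indicator are bounded by 1 on \<open>K\<close>, so
  \<open>cmod (f x)\<close> dominates the integrands and the vanishing of the integrals against the
  span passes to the limit although \<open>f\<close> is merely integrable.\<close>

lemma separating_complete_set:
  assumes X: "separating X" and f: "integrable MK f" and z: "\<And>u. u \<in> X \<Longrightarrow> (\<integral>x. f x * u x \<partial>MK) = 0"
    and E: "E \<in> sets borel"
  shows "(\<integral>x. f x * indicator E x \<partial>MK) = 0"
proof -
  have fm [measurable]: "f \<in> borel_measurable borel" using borel_measurable_integrable[OF f] by simp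
  have ip: "integrable MK (\<lambda>x. f x * p x) \<and> (\<integral>x. f x * p x \<partial>MK) = 0" if "p \<in> cspan X" for p
    using that
  proof induction
    case (scale u c)
    have cu: "continuous_on UNIV u" by (rule separatingD(1)[OF X scale])
    then have um [measurable]: "u \<in> borel_measurable borel" by (rule borel_measurable_continuous_onI)
    obtain b where b: "b \<ge> 0" "\<And>x. x \<in> K \<Longrightarrow> cmod (u x) \<le> b" using continuous_bounded_K[OF cu] by blast
    have "integrable MK (\<lambda>x. f x * u x)"
    proof (rule Bochner_Integration.integrable_bound)
      show "integrable MK (\<lambda>x. b * f x)" using f by simp
      show "AE x in MK. norm (f x * u x) \<le> norm (b * f x)"
        unfolding AE_MK using b by (auto simp: norm_mult mult.commute[of b] intro!: mult_left_mono)
    qed simp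
    then have "integrable MK (\<lambda>x. c * (f x * u x))" by simp
    moreover have "(\<integral>x. c * (f x * u x) \<partial>MK) = 0" using z[OF scale] by simp
    ultimately show ?case by (simp add: mult.left_commute)
  next
    case (add p q)
    then show ?case by (simp add: distrib_left)
  qed
  have "E \<inter> K \<in> sets borel" "E \<inter> K \<subseteq> K" using E by auto
  then obtain p where p: "\<And>n. p n \<in> cspan X" "\<And>n x. x \<in> K \<Longrightarrow> cmod (p n x) \<le> 1"
    "AE x in MK. (\<lambda>n. p n x) \<longlonglongrightarrow> indicator (E \<inter> K) x"
    by (rule cspan_approx_indicator[OF X]) (rule that)
  have pm: "p n \<in> borel_measurable borel" for n using cspan_measurable[OF X p(1)] .
  have "(\<lambda>n. \<integral>x. f x * p n x \<partial>MK) \<longlonglongrightarrow> (\<integral>x. f x * indicator E x \<partial>MK)"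
  proof (rule integral_dominated_convergence[where w = "\<lambda>x. cmod (f x)"])
    have "AE x in MK. x \<in> K" by (simp add: AE_MK)
    with p(3) show "AE x in MK. (\<lambda>n. f x * p n x) \<longlonglongrightarrow> f x * indicator E x"
    proof eventually_elim
      case (elim x)
      have "(\<lambda>n. f x * p n x) \<longlonglongrightarrow> f x * indicator (E \<inter> K) x"
        by (intro tendsto_mult tendsto_const elim(1))
      moreover have "indicator (E \<inter> K) x = (indicator E x :: complex)"
        using elim(2) by (simp add: indicator_def)
      ultimately show ?case by simp
    qed
    show "AE x in MK. cmod (f x * p n x) \<le> cmod (f x)" for n
      unfolding AE_MK using p(2) by (auto simp: norm_mult mult_left_le)
  qed (use f pm E in auto)
  moreover have "(\<integral>x. f x * p n x \<partial>MK) = 0" for n using ip[OF p(1)] by simp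
  ultimately show ?thesis by (simp add: LIMSEQ_const_iff)
qed

lemma AE_zero_if_set_integrals_zero:
  fixes h :: "'a \<Rightarrow> real"
  assumes h: "integrable MK h" and z: "\<And>E. E \<in> sets borel \<Longrightarrow> (\<integral>x. h x * indicator E x \<partial>MK) = 0"
  shows "AE x in MK. h x = 0"
proof -
  have hm [measurable]: "h \<in> borel_measurable borel" using borel_measurable_integrable[OF h] by simp
  have "(\<integral>x. \<bar>h x\<bar> \<partial>MK) = (\<integral>x. h x * indicator {x. 0 \<le> h x} x - h x * indicator {x. h x < 0} x \<partial>MK)"
    by (intro Bochner_Integration.integral_cong) (auto simp: indicator_def)
  also have "\<dots> = (\<integral>x. h x * indicator {x. 0 \<le> h x} x \<partial>MK) - (\<integral>x. h x * indicator {x. h x < 0} x \<partial>MK)"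
    using h by (intro Bochner_Integration.integral_diff integrable_real_mult_indicator) auto
  also have "\<dots> = 0" by (simp add: z)
  finally have "AE x in MK. \<bar>h x\<bar> = 0"
    using h by (subst (asm) integral_nonneg_eq_0_iff_AE) auto
  then show ?thesis by simp
qed

text \<open>Vanishing integrals over all Borel sets force the real and imaginary parts to vanish.
  This is the common source of totality for the three orthonormal systems used: on the group, on the
  dual group and on the annihilator.\<close>

theorem separating_complete:
  assumes X: "separating X" and f: "integrable MK f" and z: "\<And>u. u \<in> X \<Longrightarrow> (\<integral>x. f x * u x \<partial>MK) = 0"
  shows "AE x in MK. f x = 0"
proof -
  have ind: "integrable MK (\<lambda>x. f x * indicator E x)" if "E \<in> sets borel" for E
    using that borel_measurable_integrable[OF f]
    by (intro Bochner_Integration.integrable_bound[OF f]) (auto simp: indicator_def)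
  have fE: "(\<integral>x. f x * indicator E x \<partial>MK) = 0" if "E \<in> sets borel" for E
    using separating_complete_set[OF X f z that] .
  have "AE x in MK. Re (f x) = 0"
  proof (rule AE_zero_if_set_integrals_zero)
    fix E :: "'a set" assume E: "E \<in> sets borel"
    have "(\<integral>x. Re (f x * indicator E x) \<partial>MK) = Re (\<integral>x. f x * indicator E x \<partial>MK)"
      by (rule integral_Re[OF ind[OF E]])
    moreover have "(\<lambda>x. Re (f x * indicator E x)) = (\<lambda>x. Re (f x) * indicator E x)"
      by (auto simp: indicator_def)
    ultimately show "(\<integral>x. Re (f x) * indicator E x \<partial>MK) = 0"
      using fE[OF E] by simp
  qed (use f in simp)
  moreover have "AE x in MK. Im (f x) = 0"
  proof (rule AE_zero_if_set_integrals_zero)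
    fix E :: "'a set" assume E: "E \<in> sets borel"
    have "(\<integral>x. Im (f x * indicator E x) \<partial>MK) = Im (\<integral>x. f x * indicator E x \<partial>MK)"
      by (rule integral_Im[OF ind[OF E]])
    moreover have "(\<lambda>x. Im (f x * indicator E x)) = (\<lambda>x. Im (f x) * indicator E x)"
      by (auto simp: indicator_def)
    ultimately show "(\<integral>x. Im (f x) * indicator E x \<partial>MK) = 0"
      using fE[OF E] by simp
  qed (use f in simp)
  ultimately show ?thesis by eventually_elim (simp add: complex_eq_iff)
qed

end

section \<open>Characters of a compact group\<close>

text \<open>In the application \<open>c n\<close> is the squared norm of a convolution power with
  \<open>n + 1\<close> factors. By convexity the ratios of successive terms increase, and being
  bounded they converge to some \<open>l\<close>; hence \<open>c n / l ^ Suc n\<close> decreases.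
  The doubling hypothesis keeps this quotient at least 1, so that the limit of the rescaled powers
  cannot be zero.\<close>

lemma log_convex_growth:
  fixes c :: "nat \<Rightarrow> real"
  assumes pos: "\<And>n. c n > 0" and convex: "\<And>n. (c (Suc n))\<^sup>2 \<le> c n * c (Suc (Suc n))"
    and bd: "\<And>n. c (Suc n) \<le> b * c n" and sub: "\<And>n. c (2 * n + 1) \<le> (c n)\<^sup>2"
  shows "\<exists>l>0. \<exists>d\<ge>1. (\<lambda>n. c n / l ^ Suc n) \<longlonglongrightarrow> d"
proof -
  define r where "r n = c (Suc n) / c n" for n
  have rpos: "r n > 0" for n using pos by (simp add: r_def)
  have rSuc: "r n \<le> r (Suc n)" for n
    using convex[of n] pos[of n] pos[of "Suc n"] by (simp add: r_def field_simps power2_eq_square)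
  then have rmono: "r m \<le> r n" if "m \<le> n" for m n using that by (rule lift_Suc_mono_le)
  have rb: "r n \<le> b" for n using bd[of n] pos[of n] by (simp add: r_def field_simps)
  obtain l where l: "r \<longlonglongrightarrow> l" "\<And>i. r i \<le> l"
  proof (rule incseq_convergent[of r b])
    show "incseq r" using rSuc by (simp add: incseq_Suc_iff)
  qed (use rb that in auto)
  have lpos: "l > 0" using rpos[of 0] l(2)[of 0] by linarith
  have lower: "c i * r i ^ m \<le> c (i + m)" for i m
  proof (induction m)
    case (Suc m)
    have "c i * r i ^ Suc m = (c i * r i ^ m) * r i" by simp
    also have "\<dots> \<le> c (i + m) * r (i + m)"
      using Suc rmono[of i "i + m"] rpos[of i] pos[of "i + m"] by (intro mult_mono) (auto simp: less_imp_le)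
    also have "\<dots> = c (i + Suc m)" using pos[of "i + m"] by (simp add: r_def)
    finally show ?case .
  qed simp
  \<comment> \<open>The index reached from \<open>n\<close> by \<open>j\<close> steps
    \<open>n \<mapsto> 2 * n + 1\<close>; such a step doubles \<open>n + 1\<close>.\<close>
  define m where "m n j = 2 ^ j * (n + 1) - (1::nat)" for n j
  have m1: "m n j + 1 = 2 ^ j * (n + 1)" for n j
  proof -
    have "0 < 2 ^ j * (n + 1)" by simp
    then show ?thesis unfolding m_def by linarith
  qed
  have upper: "c (m n j) \<le> c n ^ 2 ^ j" for n j
  proof (induction j)
    case 0
    then show ?case by (simp add: m_def)
  next
    case (Suc j)
    have "m n (Suc j) = 2 * m n j + 1" using m1[of n j] m1[of n "Suc j"] by simp
    then have "c (m n (Suc j)) \<le> (c (m n j))\<^sup>2" using sub by simp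
    also have "\<dots> \<le> (c n ^ 2 ^ j)\<^sup>2" using Suc pos by (intro power_mono) (auto simp: less_imp_le)
    finally show ?case by (simp add: power_mult[symmetric] mult.commute)
  qed
  \<comment> \<open>From \<open>i\<close> on, \<open>c\<close> grows at least by the factor
    \<open>r i\<close> per step. If \<open>c n\<close> were below \<open>r i ^ Suc n\<close>,
    iterated doubling would put \<open>c (m n j)\<close> below that growth by the factor
    \<open>q ^ 2 ^ j\<close>, which eventually exceeds the fixed constant
    \<open>r i ^ Suc i / c i\<close>.\<close>
  have key: "r i ^ Suc n \<le> c n" for i n
  proof (rule ccontr)
    assume "\<not> ?thesis"
    then have gt: "c n < r i ^ Suc n" by simp
    define q where "q = r i ^ Suc n / c n"
    have q: "q > 1" using gt pos[of n] by (simp add: q_def)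
    obtain j0 where j0: "r i ^ Suc i / c i < q ^ j0" using real_arch_pow[OF q] by blast
    define j where "j = j0 + i"
    have j2: "j \<le> 2 ^ j" using less_exp[of j] by simp
    have "i \<le> 2 ^ j * (n + 1) - 1"
    proof -
      have "j + 1 \<le> 2 ^ j" using less_exp[of j] by (simp add: Suc_le_eq del: less_exp)
      also have "(2::nat) ^ j \<le> 2 ^ j * (n + 1)" by simp
      finally show ?thesis by (simp add: j_def)
    qed
    then have "i \<le> m n j" by (simp add: m_def)
    then have "c i * r i ^ (m n j - i) \<le> c (m n j)" using lower[of i "m n j - i"] by simp
    also have "\<dots> \<le> c n ^ 2 ^ j" by (rule upper)
    finally have "c i * r i ^ (m n j - i) * r i ^ Suc i \<le> c n ^ 2 ^ j * r i ^ Suc i"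
      using rpos[of i] by (intro mult_right_mono) auto
    also have "c i * r i ^ (m n j - i) * r i ^ Suc i = c i * r i ^ (m n j + 1)"
      using \<open>i \<le> m n j\<close> by (simp add: power_add[symmetric] mult.assoc del: power_Suc)
    also have "r i ^ (m n j + 1) = (r i ^ Suc n) ^ 2 ^ j"
      unfolding m1 power_mult[symmetric] by (simp add: mult.commute)
    finally have "(r i ^ Suc n) ^ 2 ^ j / c n ^ 2 ^ j \<le> r i ^ Suc i / c i"
      using pos[of i] pos[of n] by (simp add: field_simps)
    then have "q ^ 2 ^ j \<le> r i ^ Suc i / c i" by (simp add: q_def power_divide)
    moreover have "j0 \<le> 2 ^ j" by (rule le_trans[OF _ j2]) (simp add: j_def)
    then have "q ^ j0 \<le> q ^ 2 ^ j" using q by (intro power_increasing) auto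
    ultimately show False using j0 by linarith
  qed
  have cl: "l ^ Suc n \<le> c n" for n
    using l(1) key by (intro LIMSEQ_le_const2[of "\<lambda>i. r i ^ Suc n"] tendsto_power) auto
  define d where "d n = c n / l ^ Suc n" for n
  have d1: "1 \<le> d n" for n using cl[of n] lpos by (simp add: d_def)
  have "d (Suc n) \<le> d n" for n
  proof -
    have "c (Suc n) \<le> l * c n" using l(2)[of n] pos[of n] by (simp add: r_def field_simps)
    then show ?thesis using lpos by (simp add: d_def field_simps)
  qed
  then have "decseq d" by (simp add: decseq_Suc_iff)
  then obtain D where D: "d \<longlonglongrightarrow> D"
    using d1 by (elim decseq_convergent) auto
  then have "D \<ge> 1" using d1 by (intro LIMSEQ_le_const) auto
  with D lpos show ?thesis unfolding d_def by blast
qed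

section \<open>Integration of continuous functions over the compact subgroup\<close>

context compact_open_haar
begin

lemma measure_MK_UNIV [simp]: "measure MK UNIV = 1"
  by (simp add: measure_def emeasure_MK unit)

lemma integral_MK_bound:
  fixes f :: "'a \<Rightarrow> complex"
  assumes "0 \<le> b" "\<And>x. x \<in> K \<Longrightarrow> cmod (f x) \<le> b"
  shows "cmod (\<integral>x. f x \<partial>MK) \<le> b"
proof -
  have ae: "AE x in MK. cmod (f x) \<le> b" using assms(2) by (simp add: AE_MK)
  show ?thesis
  proof (cases "integrable MK f")
    case True
    have "cmod (\<integral>x. f x \<partial>MK) \<le> (\<integral>x. cmod (f x) \<partial>MK)" by (rule integral_norm_bound)
    also have "\<dots> \<le> (\<integral>x. b \<partial>MK)" using True ae by (intro integral_mono_AE) auto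
    finally show ?thesis by simp
  qed (use assms(1) in \<open>simp add: not_integrable_integral_eq\<close>)
qed

lemma uniform_on_compact:
  fixes F :: "'a \<Rightarrow> 'a \<Rightarrow> complex"
  assumes F: "continuous_on UNIV (\<lambda>p. F (fst p) (snd p))" and e: "e > 0"
  obtains U where "open U" "a \<in> U" "\<And>x y. x \<in> U \<Longrightarrow> y \<in> K \<Longrightarrow> cmod (F x y - F a y) < e"
proof -
  have "continuous_on UNIV (\<lambda>p. F (fst (a, snd p)) (snd (a, snd p)))"
    by (rule continuous_on_compose2[OF F]) (auto intro!: continuous_intros)
  then have Fa: "continuous_on UNIV (\<lambda>p::'a \<times> 'a. F a (snd p))" by simp
  define W where "W = {p. cmod (F (fst p) (snd p) - F a (snd p)) < e}"
  have W: "open W" unfolding W_def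
    by (intro open_Collect_less continuous_intros F Fa)
  have "{a} \<times> K \<subseteq> W" using e by (auto simp: W_def)
  from Elementary_Topology.tube_lemma[OF cpt W this]
  obtain U where U: "a \<in> U" "open U" "U \<times> K \<subseteq> W" by (elim exE conjE)
  show ?thesis
  proof (rule that[OF U(2,1)])
    fix x y assume "x \<in> U" "y \<in> K"
    then have "(x, y) \<in> W" using U(3) by auto
    then show "cmod (F x y - F a y) < e" by (simp add: W_def)
  qed
qed

lemma slice_measurable:
  fixes F :: "'a \<Rightarrow> 'a \<Rightarrow> complex"
  assumes F: "continuous_on UNIV (\<lambda>p. F (fst p) (snd p))"
  shows "continuous_on UNIV (F a)" "continuous_on UNIV (\<lambda>x. F x a)"
    "F a \<in> borel_measurable borel" "(\<lambda>x. F x a) \<in> borel_measurable borel"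
proof -
  have "continuous_on UNIV (\<lambda>y. F (fst (a, y)) (snd (a, y)))"
    by (rule continuous_on_compose2[OF F]) (auto intro!: continuous_intros)
  then show 1: "continuous_on UNIV (F a)" by simp
  have "continuous_on UNIV (\<lambda>y. F (fst (y, a)) (snd (y, a)))"
    by (rule continuous_on_compose2[OF F]) (auto intro!: continuous_intros)
  then show 2: "continuous_on UNIV (\<lambda>x. F x a)" by simp
  show "F a \<in> borel_measurable borel" using 1 by (rule borel_measurable_continuous_onI)
  show "(\<lambda>x. F x a) \<in> borel_measurable borel" using 2 by (rule borel_measurable_continuous_onI)
qed

lemma continuous_integrable_MK:
  fixes f :: "'a \<Rightarrow> complex"
  assumes "continuous_on UNIV f"
  shows "integrable MK f"
proof -
  obtain b where "\<And>x. x \<in> K \<Longrightarrow> cmod (f x) \<le> b" using continuous_bounded_K[OF assms] by blast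
  then show ?thesis
    using borel_measurable_continuous_onI[OF assms] by (intro integrable_MK_bounded)
qed

lemma continuous_on_UNIV_I:
  fixes f :: "'a \<Rightarrow> complex"
  assumes "\<And>a e. e > 0 \<Longrightarrow> \<exists>U. open U \<and> a \<in> U \<and> (\<forall>x\<in>U. cmod (f x - f a) \<le> e)"
  shows "continuous_on UNIV f"
proof -
  have "(f \<longlongrightarrow> f a) (at a)" for a
  proof (rule tendstoI)
    fix e :: real assume e: "e > 0"
    then obtain U where U: "open U" "a \<in> U" "\<forall>x\<in>U. cmod (f x - f a) \<le> e / 2"
      using assms[of "e / 2" a] by auto
    then have "dist (f x) (f a) < e" if "x \<in> U" for x
      using that e by (force simp: dist_norm)
    then show "\<forall>\<^sub>F x in at a. dist (f x) (f a) < e"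
      using U(1,2) unfolding eventually_at_topological by (intro exI[of _ U]) auto
  qed
  then show ?thesis by (simp add: continuous_on_def)
qed

lemma continuous_integral:
  fixes F :: "'a \<Rightarrow> 'a \<Rightarrow> complex"
  assumes F: "continuous_on UNIV (\<lambda>p. F (fst p) (snd p))"
  shows "continuous_on UNIV (\<lambda>x. \<integral>y. F x y \<partial>MK)"
proof (rule continuous_on_UNIV_I)
  fix a and e :: real assume e: "e > 0"
  obtain U where U: "open U" "a \<in> U" "\<And>x y. x \<in> U \<Longrightarrow> y \<in> K \<Longrightarrow> cmod (F x y - F a y) < e"
    using uniform_on_compact[OF F e] by blast
  have "cmod ((\<integral>y. F x y \<partial>MK) - (\<integral>y. F a y \<partial>MK)) \<le> e" if "x \<in> U" for x
  proof -
    have "(\<integral>y. F x y \<partial>MK) - (\<integral>y. F a y \<partial>MK) = (\<integral>y. F x y - F a y \<partial>MK)"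
      by (intro Bochner_Integration.integral_diff[symmetric] continuous_integrable_MK slice_measurable[OF F])
    also have "cmod \<dots> \<le> e"
      using U(3)[OF that] e by (intro integral_MK_bound) (auto simp: less_imp_le)
    finally show ?thesis .
  qed
  with U(1,2) show "\<exists>U. open U \<and> a \<in> U \<and> (\<forall>x\<in>U. cmod ((\<integral>y. F x y \<partial>MK) - (\<integral>y. F a y \<partial>MK)) \<le> e)"
    by blast
qed

text \<open>The Borel algebra of a product may be larger than the product of the Borel algebras, so
  iterated integrals are exchanged by approximating with finite sums of products.\<close>

lemma Fubini_continuous:
  fixes F :: "'a \<Rightarrow> 'a \<Rightarrow> complex"
  assumes F: "continuous_on UNIV (\<lambda>p. F (fst p) (snd p))"
  shows "(\<integral>x. (\<integral>y. F x y \<partial>MK) \<partial>MK) = (\<integral>y. (\<integral>x. F x y \<partial>MK) \<partial>MK)"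
proof -
  define I where "I x = (\<integral>y. F x y \<partial>MK)" for x
  define J where "J y = (\<integral>x. F x y \<partial>MK)" for y
  have Ic: "integrable MK I"
    unfolding I_def by (intro continuous_integrable_MK continuous_integral F)
  have F': "continuous_on UNIV (\<lambda>p. F (snd p) (fst p))"
  proof -
    have "continuous_on UNIV (\<lambda>p::'a \<times> 'a. F (fst (snd p, fst p)) (snd (snd p, fst p)))"
      by (rule continuous_on_compose2[OF F]) (auto intro!: continuous_intros)
    then show ?thesis by simp
  qed
  have Jc: "integrable MK J"
    unfolding J_def by (intro continuous_integrable_MK continuous_integral[where F = "\<lambda>y x. F x y"] F')
  have "cmod ((\<integral>x. I x \<partial>MK) - (\<integral>y. J y \<partial>MK)) \<le> e" if e2: "e > 0" for e
  proof -
    define h where "h = e / 2"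
    have h: "h > 0" using e2 by (simp add: h_def)
    define P where "P a U \<longleftrightarrow> open U \<and> a \<in> U \<and> (\<forall>x\<in>U. \<forall>y\<in>K. cmod (F x y - F a y) < h)" for a U
    have "\<exists>U. P a U" for a
      by (rule uniform_on_compact[OF F h, of a]) (auto simp: P_def)
    then obtain U where "\<And>a. P a (U a)" by metis
    then have U: "\<And>a. open (U a)" "\<And>a. a \<in> U a"
      "\<And>a x y. x \<in> U a \<Longrightarrow> y \<in> K \<Longrightarrow> cmod (F x y - F a y) < h"
      unfolding P_def by blast+
    have "K \<subseteq> (\<Union>a\<in>K. U a)" using U(2) by auto
    then obtain C where C: "C \<subseteq> K" "finite C" "K \<subseteq> (\<Union>a\<in>C. U a)"
      by (rule compactE_image[OF cpt U(1)])
    \<comment> \<open>The normalised indicators \<open>w c\<close> form a measurable partition of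
      unity on \<open>K\<close> subordinate to the finite cover.\<close>
    define s where "s x = (\<Sum>c\<in>C. indicator (U c) x :: real)" for x
    have s1: "s x > 0" if x: "x \<in> K" for x
    proof -
      obtain c where c: "c \<in> C" "x \<in> U c" using C(3) x by auto
      have "indicator (U c) x \<le> s x" unfolding s_def using C(2) c(1) by (intro member_le_sum) auto
      then show ?thesis using c(2) by simp
    qed
    define w where "w c x = complex_of_real (indicator (U c) x / s x)" for c x
    have [measurable]: "U c \<in> sets borel" for c using U(1) by simp
    have wm [measurable]: "w c \<in> borel_measurable borel" for c
      unfolding w_def[abs_def] s_def[abs_def] by measurable
    have w0: "w c x = complex_of_real (cmod (w c x))" for c x
    proof -
      have "0 \<le> indicator (U c) x / s x" by (simp add: s_def sum_nonneg)
      then show ?thesis unfolding w_def by (simp only: norm_of_real abs_of_nonneg)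
    qed
    have w1: "(\<Sum>c\<in>C. w c x) = 1" if "x \<in> K" for x
    proof -
      have "(\<Sum>c\<in>C. w c x) = complex_of_real ((\<Sum>c\<in>C. indicator (U c) x) / s x)"
        unfolding w_def by (simp add: sum_divide_distrib)
      then show ?thesis using s1[OF that] by (simp add: s_def[symmetric])
    qed
    have w1': "(\<Sum>c\<in>C. cmod (w c x)) = 1" if "x \<in> K" for x
    proof -
      have "complex_of_real (\<Sum>c\<in>C. cmod (w c x)) = (\<Sum>c\<in>C. w c x)"
        by (simp add: w0[symmetric])
      then show ?thesis using w1[OF that] by (metis of_real_eq_1_iff)
    qed
    have wz: "w c x = 0" if "x \<notin> U c" for c x using that by (simp add: w_def)
    have wle: "cmod (w c x) \<le> 1" if "x \<in> K" "c \<in> C" for c x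
    proof -
      have "cmod (w c x) \<le> (\<Sum>c\<in>C. cmod (w c x))" using C(2) that by (intro member_le_sum) auto
      then show ?thesis using w1'[OF that(1)] by simp
    qed
    have wi: "integrable MK (w c)" if "c \<in> C" for c
      using wle that by (intro integrable_MK_bounded[of _ 1]) auto
    have approx: "cmod (F x y - (\<Sum>c\<in>C. w c x * F c y)) \<le> h" if "x \<in> K" "y \<in> K" for x y
    proof -
      have "F x y = (\<Sum>c\<in>C. w c x) * F x y" using w1[OF that(1)] by simp
      then have "F x y - (\<Sum>c\<in>C. w c x * F c y) = (\<Sum>c\<in>C. w c x * (F x y - F c y))"
        by (simp add: sum_distrib_right right_diff_distrib sum_subtractf)
      also have "cmod \<dots> \<le> (\<Sum>c\<in>C. cmod (w c x) * h)"
      proof (rule sum_norm_le)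
        fix c assume "c \<in> C"
        show "cmod (w c x * (F x y - F c y)) \<le> cmod (w c x) * h"
        proof (cases "x \<in> U c")
          case True
          then show ?thesis using U(3)[OF True that(2)] by (auto simp: norm_mult intro!: mult_left_mono)
        qed (simp add: wz)
      qed
      also have "\<dots> = h" by (simp add: sum_distrib_right[symmetric] w1'[OF that(1)])
      finally show ?thesis .
    qed
    \<comment> \<open>The double integral of the separated kernel, the sum of
      \<open>w c x * F c y\<close> over \<open>c\<close>; it has this value in either order of
      integration.\<close>
    define A where "A = (\<Sum>c\<in>C. (\<integral>x. w c x \<partial>MK) * I c)"
    have Fi: "integrable MK (F x)" "integrable MK (\<lambda>x. F x y)" for x y
      by (intro continuous_integrable_MK slice_measurable[OF F])+
    have "cmod ((\<integral>x. I x \<partial>MK) - A) \<le> h"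
    proof -
      have "(\<integral>x. I x \<partial>MK) - A = (\<integral>x. I x - (\<Sum>c\<in>C. w c x * I c) \<partial>MK)"
        unfolding A_def using Ic wi by simp
      also have "cmod \<dots> \<le> h"
      proof (rule integral_MK_bound)
        fix x assume x: "x \<in> K"
        have "I x - (\<Sum>c\<in>C. w c x * I c) = (\<integral>y. F x y - (\<Sum>c\<in>C. w c x * F c y) \<partial>MK)"
          unfolding I_def using Fi by simp
        also have "cmod \<dots> \<le> h" using approx[OF x] h by (intro integral_MK_bound) auto
        finally show "cmod (I x - (\<Sum>c\<in>C. w c x * I c)) \<le> h" .
      qed (use h in simp)
      finally show ?thesis .
    qed
    moreover have "cmod ((\<integral>y. J y \<partial>MK) - A) \<le> h"
    proof -
      have "A = (\<integral>y. (\<Sum>c\<in>C. (\<integral>x. w c x \<partial>MK) * F c y) \<partial>MK)"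
        unfolding A_def I_def using Fi by simp
      then have "(\<integral>y. J y \<partial>MK) - A = (\<integral>y. J y - (\<Sum>c\<in>C. (\<integral>x. w c x \<partial>MK) * F c y) \<partial>MK)"
        using Jc Fi by simp
      also have "cmod \<dots> \<le> h"
      proof (rule integral_MK_bound)
        fix y assume y: "y \<in> K"
        have "J y - (\<Sum>c\<in>C. (\<integral>x. w c x \<partial>MK) * F c y) = (\<integral>x. F x y - (\<Sum>c\<in>C. w c x * F c y) \<partial>MK)"
          unfolding J_def using Fi wi by simp
        also have "cmod \<dots> \<le> h" using approx[OF _ y] h by (intro integral_MK_bound) auto
        finally show "cmod (J y - (\<Sum>c\<in>C. (\<integral>x. w c x \<partial>MK) * F c y)) \<le> h" .
      qed (use h in simp)
      finally show ?thesis .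
    qed
    ultimately have "cmod ((\<integral>x. I x \<partial>MK) - A) + cmod ((\<integral>y. J y \<partial>MK) - A) \<le> e"
      by (simp add: h_def)
    moreover have "cmod ((\<integral>x. I x \<partial>MK) - (\<integral>y. J y \<partial>MK)) \<le> cmod ((\<integral>x. I x \<partial>MK) - A) + cmod ((\<integral>y. J y \<partial>MK) - A)"
      using norm_triangle_ineq4[of "(\<integral>x. I x \<partial>MK) - A" "(\<integral>y. J y \<partial>MK) - A"] by simp
    ultimately show ?thesis by linarith
  qed
  then have "cmod ((\<integral>x. I x \<partial>MK) - (\<integral>y. J y \<partial>MK)) \<le> 0" by (rule field_le_epsilon) simp
  then show ?thesis by (simp add: I_def J_def)
qed

subsection \<open>The convolution algebra\<close>

text \<open>Continuous functions on \<open>K\<close>, extended by 0. As \<open>K\<close> is both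
  open and closed the extension stays continuous, and translates and convolutions need no
  restriction to a subtype.\<close>

definition CK :: "('a \<Rightarrow> complex) set" where
  "CK = {f. continuous_on UNIV f \<and> (\<forall>x. x \<notin> K \<longrightarrow> f x = 0)}"

definition conv :: "('a \<Rightarrow> complex) \<Rightarrow> ('a \<Rightarrow> complex) \<Rightarrow> 'a \<Rightarrow> complex" where
  "conv f g x = (\<integral>y. f y * g (x - y) \<partial>MK)"

definition adj :: "('a \<Rightarrow> complex) \<Rightarrow> 'a \<Rightarrow> complex" where
  "adj f x = cnj (f (- x))"

lemma CK_continuous: "f \<in> CK \<Longrightarrow> continuous_on UNIV f"
  and CK_supp: "f \<in> CK \<Longrightarrow> x \<notin> K \<Longrightarrow> f x = 0"
  by (auto simp: CK_def)

lemma CK_compose: "f \<in> CK \<Longrightarrow> continuous_on S t \<Longrightarrow> continuous_on S (\<lambda>x. f (t x))"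
  by (rule continuous_on_compose2[OF CK_continuous]) auto

lemma CK_measurable: "f \<in> CK \<Longrightarrow> f \<in> borel_measurable borel"
  by (rule borel_measurable_continuous_onI, rule CK_continuous)

lemma CK_integrable: "f \<in> CK \<Longrightarrow> integrable MK f"
  by (rule continuous_integrable_MK, rule CK_continuous)

lemma CK_mult:
  assumes "f \<in> CK" "continuous_on UNIV g"
  shows "(\<lambda>x. f x * g x) \<in> CK"
  using assms by (auto simp: CK_def intro!: continuous_intros)

lemma CK_L2:
  assumes "f \<in> CK"
  shows "f \<in> L2 MK"
proof -
  have "continuous_on UNIV (\<lambda>x. f x * cnj (f x))"
    by (intro continuous_intros CK_continuous assms)
  then have "integrable MK (\<lambda>x. f x * cnj (f x))" by (rule continuous_integrable_MK)
  then have "integrable MK (\<lambda>x. Re (f x * cnj (f x)))" by (rule integrable_Re)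
  then have "integrable MK (\<lambda>x. (cmod (f x))\<^sup>2)"
    by (simp only: complex_norm_square[symmetric] Re_complex_of_real)
  then show ?thesis
    using CK_measurable[OF assms] by (simp add: L2_def)
qed

lemma CK_add: "f \<in> CK \<Longrightarrow> g \<in> CK \<Longrightarrow> (\<lambda>x. f x + g x) \<in> CK"
  and CK_diff: "f \<in> CK \<Longrightarrow> g \<in> CK \<Longrightarrow> (\<lambda>x. f x - g x) \<in> CK"
  and CK_scale: "f \<in> CK \<Longrightarrow> (\<lambda>x. c * f x) \<in> CK"
  by (auto simp: CK_def intro!: continuous_intros)

lemma K_minus_iff: "- x \<in> K \<longleftrightarrow> x \<in> K"
  using K_minus[of x] K_minus[of "- x"] by auto

lemma CK_adj:
  assumes "f \<in> CK"
  shows "adj f \<in> CK"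
proof -
  have "continuous_on UNIV (\<lambda>x. cnj (f (- x)))"
    by (intro continuous_intros CK_compose[OF assms])
  then show ?thesis using CK_supp[OF assms] by (auto simp: CK_def adj_def[abs_def] K_minus_iff)
qed

lemma CK_shift:
  assumes "f \<in> CK" "a \<in> K"
  shows "(\<lambda>x. f (a + x)) \<in> CK"
proof -
  have "continuous_on UNIV (\<lambda>x. f (a + x))"
    by (intro continuous_intros CK_compose[OF assms(1)])
  then show ?thesis using CK_supp[OF assms(1)] by (auto simp: CK_def K_add_iff[OF assms(2)])
qed

lemma adj_adj [simp]: "adj (adj f) = f"
  by (simp add: adj_def[abs_def])

lemma integral_MK_cong:
  assumes "\<And>x. x \<in> K \<Longrightarrow> f x = g x" "f \<in> borel_measurable borel" "g \<in> borel_measurable borel"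
  shows "(\<integral>x. f x \<partial>MK) = (\<integral>x. (g x :: complex) \<partial>MK)"
  using assms by (intro integral_cong_AE) (auto simp: AE_MK)

text \<open>Inversion invariance is derived from translation invariance. The double average of
  \<open>f (x - y)\<close> over \<open>K\<close> equals the left side when \<open>y\<close> is
  integrated first and the right side when \<open>x\<close> is.\<close>

lemma integral_CK_uminus:
  assumes f: "f \<in> CK"
  shows "(\<integral>y. f (- y) \<partial>MK) = (\<integral>y. f y \<partial>MK)"
proof -
  have c: "continuous_on UNIV (\<lambda>p::'a \<times> 'a. f (fst p - snd p))"
    by (intro CK_compose[OF f] continuous_intros)
  have cy: "continuous_on UNIV (\<lambda>y. f (- y))" by (intro CK_compose[OF f] continuous_intros)
  have c': "continuous_on UNIV (\<lambda>p::'a \<times> 'a. f (snd p - fst p))"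
    by (intro CK_compose[OF f] continuous_intros)
  have "(\<integral>y. f (- y) \<partial>MK) = (\<integral>x. (\<integral>y. f (- y) \<partial>MK) \<partial>MK)"
    using integral_MK_1 by simp
  also have "\<dots> = (\<integral>x. (\<integral>y. f (x - y) \<partial>MK) \<partial>MK)"
  proof (rule integral_MK_cong)
    fix x assume x: "x \<in> K"
    have "(\<integral>y. f (- ((- x) + y)) \<partial>MK) = (\<integral>y. f (- y) \<partial>MK)"
      by (rule integral_MK_shift[OF _ K_minus[OF x]]) (rule borel_measurable_continuous_onI[OF cy])
    then show "(\<integral>y. f (- y) \<partial>MK) = (\<integral>y. f (x - y) \<partial>MK)" by simp
  qed (use borel_measurable_continuous_onI[OF continuous_integral[where F = "\<lambda>x y. f (x - y)", OF c]] in auto)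
  also have "\<dots> = (\<integral>y. (\<integral>x. f (x - y) \<partial>MK) \<partial>MK)"
    by (rule Fubini_continuous[where F = "\<lambda>x y. f (x - y)", OF c])
  also have "\<dots> = (\<integral>y. (\<integral>x. f x \<partial>MK) \<partial>MK)"
  proof (rule integral_MK_cong)
    fix y assume y: "y \<in> K"
    have "(\<integral>x. f (- y + x) \<partial>MK) = (\<integral>x. f x \<partial>MK)"
      by (rule integral_MK_shift[OF CK_measurable[OF f] K_minus[OF y]])
    then show "(\<integral>x. f (x - y) \<partial>MK) = (\<integral>x. f x \<partial>MK)" by simp
  qed (use borel_measurable_continuous_onI[OF continuous_integral[where F = "\<lambda>y x. f (x - y)", OF c']] in auto)
  also have "\<dots> = (\<integral>x. f x \<partial>MK)" using integral_MK_1 by simp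
  finally show ?thesis .
qed

lemma integral_CK_reflect:
  assumes f: "f \<in> CK" and x: "x \<in> K"
  shows "(\<integral>y. f (x - y) \<partial>MK) = (\<integral>y. f y \<partial>MK)"
  using integral_CK_uminus[OF CK_shift[OF f x]] integral_MK_shift[OF CK_measurable[OF f] x] by simp

lemma conv_continuous_integrand:
  assumes "f \<in> CK" "g \<in> CK"
  shows "continuous_on UNIV (\<lambda>p::'a \<times> 'a. f (snd p) * g (fst p - snd p))"
  by (intro continuous_intros CK_compose[OF assms(1)] CK_compose[OF assms(2)])

lemma conv_integrand_CK:
  assumes "f \<in> CK" "g \<in> CK"
  shows "(\<lambda>y. f y * g (x - y)) \<in> CK"
  by (intro CK_mult assms(1) CK_compose[OF assms(2)] continuous_intros)

lemma conv_supp: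
  assumes "f \<in> CK" "g \<in> CK" "x \<notin> K"
  shows "conv f g x = 0"
proof -
  have "f y * g (x - y) = 0" for y
  proof (cases "y \<in> K")
    case True
    then have "x - y \<notin> K" using K_add[of "x - y" y] assms(3) by auto
    then show ?thesis using CK_supp[OF assms(2)] by simp
  qed (simp add: CK_supp[OF assms(1)])
  then show ?thesis by (simp only: conv_def Bochner_Integration.integral_zero)
qed

lemma conv_CK:
  assumes "f \<in> CK" "g \<in> CK"
  shows "conv f g \<in> CK"
  using continuous_integral[where F = "\<lambda>x y. f y * g (x - y)", OF conv_continuous_integrand[OF assms]]
    conv_supp[OF assms] by (simp add: CK_def conv_def[abs_def])

lemma conv_commute:
  assumes "f \<in> CK" "g \<in> CK"
  shows "conv f g = conv g f"
proof
  fix x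
  show "conv f g x = conv g f x"
  proof (cases "x \<in> K")
    case True
    have "conv f g x = (\<integral>y. f (x - y) * g (x - (x - y)) \<partial>MK)"
      unfolding conv_def by (rule integral_CK_reflect[OF conv_integrand_CK[OF assms] True, symmetric])
    then show ?thesis by (simp add: conv_def mult.commute)
  qed (simp add: conv_supp assms)
qed

lemma conv_assoc:
  assumes "f \<in> CK" "g \<in> CK" "h \<in> CK"
  shows "conv (conv f g) h = conv f (conv g h)"
proof
  fix x
  let ?F = "\<lambda>z y. f y * g (z - y) * h (x - z)"
  have c: "continuous_on UNIV (\<lambda>p. ?F (fst p) (snd p))"
    by (intro continuous_intros CK_compose[OF assms(1)] CK_compose[OF assms(2)] CK_compose[OF assms(3)])
  have c2: "continuous_on UNIV (\<lambda>p. ?F (snd p) (fst p))"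
    by (intro continuous_intros CK_compose[OF assms(1)] CK_compose[OF assms(2)] CK_compose[OF assms(3)])
  have "conv (conv f g) h x = (\<integral>z. (\<integral>y. ?F z y \<partial>MK) \<partial>MK)"
    unfolding conv_def by simp
  also have "\<dots> = (\<integral>y. (\<integral>z. ?F z y \<partial>MK) \<partial>MK)" by (rule Fubini_continuous[OF c])
  also have "\<dots> = (\<integral>y. f y * conv g h (x - y) \<partial>MK)"
  proof (rule integral_MK_cong)
    fix y assume y: "y \<in> K"
    have m: "(\<lambda>z. g z * h (x - (y + z))) \<in> borel_measurable borel"
      by (intro borel_measurable_continuous_onI continuous_intros CK_compose[OF assms(2)] CK_compose[OF assms(3)])
    have "(\<integral>z. g (- y + z) * h (x - (y + (- y + z))) \<partial>MK) = (\<integral>z. g z * h (x - (y + z)) \<partial>MK)"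
      by (rule integral_MK_shift[OF m K_minus[OF y]])
    then have "(\<integral>z. g (z - y) * h (x - z) \<partial>MK) = conv g h (x - y)"
      by (simp add: conv_def diff_diff_eq)
    then show "(\<integral>z. ?F z y \<partial>MK) = f y * conv g h (x - y)" by (simp add: mult.assoc)
  next
    show "(\<lambda>y. \<integral>z. ?F z y \<partial>MK) \<in> borel_measurable borel"
      by (rule borel_measurable_continuous_onI[OF continuous_integral[where F = "\<lambda>y z. ?F z y", OF c2]])
    show "(\<lambda>y. f y * conv g h (x - y)) \<in> borel_measurable borel"
      by (rule CK_measurable[OF conv_integrand_CK[OF assms(1) conv_CK[OF assms(2,3)]]])
  qed
  also have "\<dots> = conv f (conv g h) x" by (simp add: conv_def)
  finally show "conv (conv f g) h x = conv f (conv g h) x" .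
qed

lemma conv_add_left:
  assumes "f \<in> CK" "g \<in> CK" "h \<in> CK"
  shows "conv (\<lambda>x. f x + g x) h = (\<lambda>x. conv f h x + conv g h x)"
  unfolding conv_def using CK_integrable[OF conv_integrand_CK] assms by (simp add: distrib_right)

lemma conv_diff_left:
  assumes "f \<in> CK" "g \<in> CK" "h \<in> CK"
  shows "conv (\<lambda>x. f x - g x) h = (\<lambda>x. conv f h x - conv g h x)"
  unfolding conv_def using CK_integrable[OF conv_integrand_CK] assms by (simp add: left_diff_distrib)

lemma conv_scale_left: "conv (\<lambda>x. c * f x) h = (\<lambda>x. c * conv f h x)"
  unfolding conv_def by (simp add: mult.assoc)

lemma conv_scale_right: "conv f (\<lambda>x. c * h x) = (\<lambda>x. c * conv f h x)"
  unfolding conv_def by (simp add: mult.left_commute)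

lemma conv_add_right:
  assumes "f \<in> CK" "g \<in> CK" "h \<in> CK"
  shows "conv h (\<lambda>x. f x + g x) = (\<lambda>x. conv h f x + conv h g x)"
  unfolding conv_commute[OF assms(3) CK_add[OF assms(1,2)]] conv_commute[OF assms(3,1)]
    conv_commute[OF assms(3,2)] by (rule conv_add_left[OF assms])

lemma conv_diff_right:
  assumes "f \<in> CK" "g \<in> CK" "h \<in> CK"
  shows "conv h (\<lambda>x. f x - g x) = (\<lambda>x. conv h f x - conv h g x)"
  unfolding conv_commute[OF assms(3) CK_diff[OF assms(1,2)]] conv_commute[OF assms(3,1)]
    conv_commute[OF assms(3,2)] by (rule conv_diff_left[OF assms])

lemma adj_conv:
  assumes "f \<in> CK" "g \<in> CK"
  shows "adj (conv f g) = conv (adj f) (adj g)"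
proof
  fix x
  let ?u = "\<lambda>y. cnj (f y * g (- x - y))"
  have "continuous_on UNIV ?u"
    by (intro continuous_intros CK_compose[OF assms(1)] CK_compose[OF assms(2)])
  then have u: "?u \<in> CK" using CK_supp[OF assms(1)] by (simp add: CK_def)
  have "adj (conv f g) x = (\<integral>y. ?u y \<partial>MK)"
    unfolding adj_def conv_def by (rule Bochner_Integration.integral_cnj[symmetric])
  also have "\<dots> = (\<integral>y. ?u (- y) \<partial>MK)" by (rule integral_CK_uminus[OF u, symmetric])
  also have "\<dots> = conv (adj f) (adj g) x" unfolding conv_def adj_def by simp
  finally show "adj (conv f g) x = conv (adj f) (adj g) x" .
qed

lemma conv_adj_zero: "conv f (adj g) 0 = L2_inner MK f g"
  by (simp add: conv_def adj_def L2_inner_def)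

lemma conv_adj_self: "conv f (adj f) 0 = of_real ((L2_norm MK f)\<^sup>2)"
  unfolding conv_adj_zero by (rule L2_inner_self)

text \<open>Cauchy-Schwarz for \<open>f\<close> and a reflected translate of \<open>g\<close>, which
  has the same norm as \<open>g\<close>. This bound of the supremum by norms is what later upgrades
  mean-square convergence to uniform convergence.\<close>

lemma conv_bound:
  assumes "f \<in> CK" "g \<in> CK"
  shows "cmod (conv f g x) \<le> L2_norm MK f * L2_norm MK g"
proof (cases "x \<in> K")
  case True
  let ?g = "\<lambda>y. cnj (g (x - y))"
  have c: "continuous_on UNIV ?g" by (intro continuous_intros CK_compose[OF assms(2)])
  have u: "(\<lambda>y. g y * cnj (g y)) \<in> CK"
    by (intro CK_mult assms continuous_intros CK_continuous)
  have "?g y = 0" if "y \<notin> K" for y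
    using that K_diff[OF True, of "x - y"] CK_supp[OF assms(2), of "x - y"] by auto
  with c have g: "?g \<in> L2 MK" by (intro CK_L2) (simp add: CK_def)
  have "complex_of_real ((L2_norm MK ?g)\<^sup>2) = (\<integral>y. g (x - y) * cnj (g (x - y)) \<partial>MK)"
    unfolding L2_inner_self[symmetric] by (simp add: L2_inner_def mult.commute)
  also have "\<dots> = (\<integral>y. g y * cnj (g y) \<partial>MK)" by (rule integral_CK_reflect[OF u True])
  also have "\<dots> = complex_of_real ((L2_norm MK g)\<^sup>2)"
    unfolding L2_inner_self[symmetric] by (simp add: L2_inner_def)
  finally have "(L2_norm MK ?g)\<^sup>2 = (L2_norm MK g)\<^sup>2" by (simp only: of_real_eq_iff)
  then have "L2_norm MK ?g = L2_norm MK g" by (rule power2_eq_imp_eq) simp_all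
  moreover have "conv f g x = L2_inner MK f ?g" by (simp add: conv_def L2_inner_def)
  ultimately show ?thesis using L2_Cauchy_Schwarz[OF CK_L2[OF assms(1)] g] by simp
next
  case False
  then show ?thesis using conv_supp[OF assms] by simp
qed

lemma L2_norm_le_sup:
  assumes "f \<in> CK" "0 \<le> b" "\<And>x. x \<in> K \<Longrightarrow> cmod (f x) \<le> b"
  shows "L2_norm MK f \<le> b"
proof -
  have "cmod (complex_of_real ((L2_norm MK f)\<^sup>2)) \<le> b\<^sup>2"
    unfolding L2_inner_self[symmetric] L2_inner_def
  proof (rule integral_MK_bound)
    show "cmod (f x * cnj (f x)) \<le> b\<^sup>2" if "x \<in> K" for x
      using assms(3)[OF that] assms(2) by (simp only: norm_mult complex_mod_cnj power2_eq_square mult_mono norm_ge_zero)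
  qed simp
  then have "(L2_norm MK f)\<^sup>2 \<le> b\<^sup>2" by (simp only: norm_of_real abs_power2)
  then show ?thesis using assms(2) by (rule power2_le_imp_le)
qed

lemma CK_norm_zero:
  assumes f: "f \<in> CK" and z: "L2_norm MK f = 0"
  shows "f = (\<lambda>_. 0)"
proof
  fix x
  have ae: "AE x in M. x \<in> K \<longrightarrow> f x = 0"
    using L2_norm_zero_iff[OF CK_L2[OF f]] z by (simp add: AE_MK)
  show "f x = 0"
  proof (rule ccontr)
    assume nz: "f x \<noteq> 0"
    then have x: "x \<in> K" using CK_supp[OF f] by auto
    have o: "open {x. f x \<noteq> 0}"
      by (intro open_Collect_neq CK_continuous[OF f] continuous_intros)
    have "open ({x. f x \<noteq> 0} \<inter> K)" using o opn by auto
    then have "emeasure M ({x. f x \<noteq> 0} \<inter> K) > 0" by (rule open_pos[of _ x]) (use nz x in auto)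
    moreover have "emeasure M ({x \<in> space M. \<not> (x \<in> K \<longrightarrow> f x = 0)}) = 0"
    proof (rule emeasure_eq_0_AE[of "\<lambda>x. \<not> (x \<in> K \<longrightarrow> f x = 0)"])
      show "AE x in M. \<not> \<not> (x \<in> K \<longrightarrow> f x = 0)" using ae by simp
    qed
    moreover have "{x \<in> space M. \<not> (x \<in> K \<longrightarrow> f x = 0)} = {x. f x \<noteq> 0} \<inter> K" by auto
    ultimately show False by simp
  qed
qed

lemma CK_norm_pos:
  assumes "f \<in> CK" "f \<noteq> (\<lambda>_. 0)"
  shows "L2_norm MK f > 0"
  using CK_norm_zero[OF assms(1)] assms(2) L2_norm_nonneg[of MK f] by (auto simp: less_le simp del: L2_norm_nonneg)

end

section \<open>Convolution powers, idempotents and the construction of characters\<close>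

context compact_open_haar
begin

lemma conv_zero_right: "conv f (\<lambda>_. 0) = (\<lambda>_. 0)"
  by (rule ext) (simp add: conv_def)

text \<open>The index is shifted by one: \<open>conv_power k n\<close> has \<open>n + 1\<close>
  factors, because the convolution algebra has no unit in general.\<close>

primrec conv_power :: "('a \<Rightarrow> complex) \<Rightarrow> nat \<Rightarrow> 'a \<Rightarrow> complex" where
  "conv_power k 0 = k"
| "conv_power k (Suc n) = conv k (conv_power k n)"

lemma conv_power_CK: "k \<in> CK \<Longrightarrow> conv_power k n \<in> CK"
  by (induction n) (auto intro: conv_CK)

lemma conv_power_add:
  assumes "k \<in> CK"
  shows "conv (conv_power k m) (conv_power k n) = conv_power k (Suc (m + n))"
proof (induction m)
  case (Suc m)
  then show ?case
    by (simp add: conv_assoc[OF assms conv_power_CK[OF assms] conv_power_CK[OF assms]])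
qed simp

lemma adj_conv_power:
  assumes "k \<in> CK" "adj k = k"
  shows "adj (conv_power k n) = conv_power k n"
  by (induction n) (simp_all add: assms adj_conv conv_power_CK)

lemma CK_uniform_limit:
  assumes v: "\<And>n. v n \<in> CK" and lim: "uniform_limit UNIV v p sequentially"
  shows "p \<in> CK"
proof -
  have "continuous_on UNIV p"
    using CK_continuous[OF v] by (intro uniform_limit_theorem[OF _ lim]) auto
  moreover have "p x = 0" if "x \<notin> K" for x
  proof -
    have "(\<lambda>n. v n x) \<longlonglongrightarrow> p x" by (rule tendsto_uniform_limitI[OF lim]) simp
    then show ?thesis using CK_supp[OF v that] by (simp add: LIMSEQ_const_iff)
  qed
  ultimately show ?thesis by (simp add: CK_def)
qed

lemma conv_uniform_limit:
  assumes v: "\<And>n. v n \<in> CK" and lim: "uniform_limit UNIV v p sequentially" and q: "q \<in> CK"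
  shows "(\<lambda>n. conv (v n) q x) \<longlonglongrightarrow> conv p q x"
proof (rule LIMSEQ_I)
  fix e :: real assume e: "e > 0"
  have p: "p \<in> CK" by (rule CK_uniform_limit[OF v lim])
  define d where "d = e / (L2_norm MK q + 1)"
  have d: "d > 0" using e by (simp add: d_def add_nonneg_pos)
  obtain N where N: "\<And>n x. n \<ge> N \<Longrightarrow> dist (v n x) (p x) < d"
    using uniform_limitD[OF lim d] by (auto simp: eventually_sequentially)
  have "norm (conv (v n) q x - conv p q x) < e" if "n \<ge> N" for n
  proof -
    have vp: "(\<lambda>x. v n x - p x) \<in> CK" by (intro CK_diff v p)
    have "conv (v n) q x - conv p q x = conv (\<lambda>x. v n x - p x) q x"
      by (simp add: conv_diff_left v p q)
    also have "norm \<dots> \<le> L2_norm MK (\<lambda>x. v n x - p x) * L2_norm MK q"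
      by (rule conv_bound[OF vp q])
    also have "\<dots> \<le> d * L2_norm MK q"
      using N[OF that] d by (intro mult_right_mono L2_norm_le_sup[OF vp]) (auto simp: dist_norm less_imp_le)
    also have "\<dots> < d * (L2_norm MK q + 1)" using d by simp
    also have "\<dots> = e" using L2_norm_nonneg[of MK q] by (simp add: d_def add_nonneg_eq_0_iff)
    finally show ?thesis .
  qed
  then show "\<exists>no. \<forall>n\<ge>no. norm (conv (v n) q x - conv p q x) < e" by blast
qed

lemma norm_power2_conv:
  assumes "adj k = k"
  shows "of_real ((L2_norm MK k)\<^sup>2) = conv k k 0"
  using conv_adj_self[of k] assms by simp

lemma conv_self_zero_bound:
  assumes "f \<in> CK" "adj f = f"
  shows "(L2_norm MK (conv f f))\<^sup>2 \<le> ((L2_norm MK f)\<^sup>2)\<^sup>2"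
proof -
  have "L2_norm MK (conv f f) \<le> (L2_norm MK f)\<^sup>2"
    using conv_bound[OF assms(1,1)] by (intro L2_norm_le_sup conv_CK assms) (auto simp: power2_eq_square)
  then show ?thesis by (intro power_mono) auto
qed

text \<open>The power method: for a hermitian \<open>k\<close> the rescaled powers of \<open>k * k\<close> converge to the
  projection onto the eigenspace of the largest eigenvalue.\<close>

lemma power_method:
  assumes k: "k \<in> CK" "adj k = k" "k \<noteq> (\<lambda>_. 0)"
  obtains l p where "l > 0" "p \<in> CK" "adj p = p" "conv p p = p" "p \<noteq> (\<lambda>_. 0)"
    "conv (conv k k) p = (\<lambda>x. of_real l * p x)"
    "\<And>q. q \<in> CK \<Longrightarrow> conv k q = k \<Longrightarrow> conv p q = p"
proof -
  define c where "c n = (L2_norm MK (conv_power k n))\<^sup>2" for n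
  have pk: "conv_power k n \<in> CK" "adj (conv_power k n) = conv_power k n" for n
    using conv_power_CK[OF k(1)] adj_conv_power[OF k(1,2)] by auto
  \<comment> \<open>Counted in factors, the squared norm of the power with \<open>n + 1\<close>
    factors is the value at 0 of the power with \<open>2 n + 2\<close> factors, because
    \<open>k\<close> is hermitian. Norms and inner products of powers are thus read off a single
    sequence.\<close>
  have c0: "complex_of_real (c n) = conv_power k (2 * n + 1) 0" for n
    unfolding c_def norm_power2_conv[OF pk(2)] conv_power_add[OF k(1)] by (simp add: mult_2)
  have inner: "L2_inner MK (conv_power k m) (conv_power k n) = conv_power k (Suc (m + n)) 0" for m n
    using conv_adj_zero[of "conv_power k m" "conv_power k n"] by (simp add: pk conv_power_add[OF k(1)])
  have convex: "(c (Suc n))\<^sup>2 \<le> c n * c (Suc (Suc n))" for n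
  proof -
    have "L2_inner MK (conv_power k n) (conv_power k (Suc (Suc n))) = complex_of_real (c (Suc n))"
      unfolding inner c0 by (simp add: mult_2 del: conv_power.simps)
    then have "\<bar>c (Suc n)\<bar> \<le> L2_norm MK (conv_power k n) * L2_norm MK (conv_power k (Suc (Suc n)))"
      using L2_Cauchy_Schwarz[OF CK_L2[OF pk(1)] CK_L2[OF pk(1)], of n "Suc (Suc n)"]
      by (simp del: conv_power.simps)
    then have "\<bar>c (Suc n)\<bar>\<^sup>2 \<le> (L2_norm MK (conv_power k n) * L2_norm MK (conv_power k (Suc (Suc n))))\<^sup>2"
      by (intro power_mono) auto
    then show ?thesis by (simp add: c_def power_mult_distrib del: conv_power.simps)
  qed
  have cpos0: "c 0 > 0" using CK_norm_pos[OF k(1,3)] by (simp add: c_def)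
  have cpos1: "c (Suc 0) > 0"
  proof -
    have "conv_power k 1 0 \<noteq> 0" using c0[of 0] cpos0 by (metis add_0 mult_0_right of_real_eq_0_iff less_irrefl)
    then have "conv_power k (Suc 0) \<noteq> (\<lambda>_. 0)" by auto
    from CK_norm_pos[OF pk(1) this] show ?thesis unfolding c_def by (rule zero_less_power)
  qed
  have cpos: "c n > 0 \<and> c (Suc n) > 0" for n
  proof (induction n)
    case (Suc n)
    then have "0 < (c (Suc n))\<^sup>2" by simp
    also have "\<dots> \<le> c n * c (Suc (Suc n))" by (rule convex)
    finally show ?case using Suc by (simp add: zero_less_mult_iff)
  qed (use cpos0 cpos1 in simp)
  have bd: "c (Suc n) \<le> c 0 * c n" for n
  proof -
    have "L2_norm MK (conv k (conv_power k n)) \<le> L2_norm MK k * L2_norm MK (conv_power k n)"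
      using conv_bound[OF k(1) pk(1)] by (intro L2_norm_le_sup conv_CK k pk) auto
    then have "(L2_norm MK (conv k (conv_power k n)))\<^sup>2 \<le> (L2_norm MK k * L2_norm MK (conv_power k n))\<^sup>2"
      by (intro power_mono) auto
    then show ?thesis by (simp add: c_def power_mult_distrib)
  qed
  have sub: "c (2 * n + 1) \<le> (c n)\<^sup>2" for n
    using conv_self_zero_bound[OF pk, of n] unfolding c_def conv_power_add[OF k(1)] by (simp add: mult_2)
  obtain l D where l: "l > 0" and D: "D \<ge> 1" and lim: "(\<lambda>n. c n / l ^ Suc n) \<longlonglongrightarrow> D"
    using log_convex_growth[OF conjunct1[OF cpos] convex bd sub] by metis
  \<comment> \<open>The power of \<open>k\<close> with \<open>2 n + 2\<close> factors, that is the
    \<open>(n + 1)\<close>-st power of \<open>k * k\<close>. Only even powers are used because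
    \<open>k\<close> may have extreme eigenvalues of both signs, which would make odd and even
    powers behave differently.\<close>
  define v where "v n x = of_real (1 / l ^ Suc n) * conv_power k (2 * n + 1) x" for n x
  define d where "d n = c n / l ^ Suc n" for n
  have v: "v n \<in> CK" for n unfolding v_def[abs_def] by (intro CK_scale pk)
  have vadj: "adj (v n) = v n" for n
  proof
    fix x
    have "adj (v n) x = of_real (1 / l ^ Suc n) * adj (conv_power k (2 * n + 1)) x"
      by (simp add: adj_def v_def del: conv_power.simps)
    then show "adj (v n) x = v n x" by (simp only: pk v_def)
  qed
  have v0: "v n 0 = of_real (d n)" for n
    unfolding v_def c0[symmetric] d_def by (simp del: power_Suc)
  have vv: "conv (v m) (v n) = v (Suc (m + n))" for m n
  proof -
    have "conv (v m) (v n) = (\<lambda>x. of_real (1 / l ^ Suc m) * (of_real (1 / l ^ Suc n) * conv_power k (Suc ((2 * m + 1) + (2 * n + 1))) x))"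
      unfolding v_def[abs_def] conv_scale_left conv_scale_right conv_power_add[OF k(1)] ..
    also have "\<dots> = v (Suc (m + n))"
    proof
      fix x
      have "Suc ((2 * m + 1) + (2 * n + 1)) = 2 * Suc (m + n) + 1" by simp
      moreover have "l ^ Suc (Suc (m + n)) = l ^ Suc m * l ^ Suc n" by (simp add: power_add)
      ultimately show "of_real (1 / l ^ Suc m) * (of_real (1 / l ^ Suc n) * conv_power k (Suc ((2 * m + 1) + (2 * n + 1))) x) = v (Suc (m + n)) x"
        unfolding v_def by (simp del: power_Suc conv_power.simps)
    qed
    finally show ?thesis .
  qed
  \<comment> \<open>Each value of \<open>d\<close> tends to \<open>D\<close>, so the right side
    tends to 0 and the rescaled powers are Cauchy in mean square.\<close>
  have vdiff: "(L2_norm MK (\<lambda>x. v n x - v m x))\<^sup>2 = d (2 * n + 1) + d (2 * m + 1) - 2 * d (n + m + 1)" for n m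
  proof -
    have "complex_of_real ((L2_norm MK (\<lambda>x. v n x - v m x))\<^sup>2) = conv (\<lambda>x. v n x - v m x) (\<lambda>x. v n x - v m x) 0"
    proof (rule norm_power2_conv, rule ext)
      fix x
      have "adj (\<lambda>x. v n x - v m x) x = adj (v n) x - adj (v m) x" by (simp add: adj_def)
      then show "adj (\<lambda>x. v n x - v m x) x = v n x - v m x" by (simp only: vadj)
    qed
    also have "\<dots> = v (Suc (n + n)) 0 - v (Suc (m + n)) 0 - (v (Suc (n + m)) 0 - v (Suc (m + m)) 0)"
      by (simp add: conv_diff_left conv_diff_right v CK_diff vv)
    also have "\<dots> = of_real (d (2 * n + 1) + d (2 * m + 1) - 2 * d (n + m + 1))"
    proof -
      have e: "Suc (n + n) = 2 * n + 1" "Suc (m + n) = n + m + 1" "Suc (n + m) = n + m + 1" "Suc (m + m) = 2 * m + 1"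
        by simp_all
      show ?thesis unfolding e v0 by simp
    qed
    finally show ?thesis by (simp only: of_real_eq_iff)
  qed
  have dlim: "d \<longlonglongrightarrow> D" using lim unfolding d_def[abs_def] .
  define B where "B = L2_norm MK (conv k k) / l"
  have B0: "B \<ge> 0" using l by (simp add: B_def)
  have kv: "conv (conv k k) (v n) = (\<lambda>x. of_real l * v (Suc n) x)" for n
  proof
    fix x
    have "conv (conv k k) (v n) = (\<lambda>x. of_real (1 / l ^ Suc n) * conv_power k (Suc (1 + (2 * n + 1))) x)"
      unfolding v_def[abs_def] conv_scale_right conv_power_add[OF k(1), symmetric] by simp
    moreover have "conv_power k (Suc (1 + (2 * n + 1))) = conv_power k (2 * Suc n + 1)" by (rule arg_cong[of _ _ "conv_power k"]) simp
    moreover have "of_real (1 / l ^ Suc n) = of_real l * complex_of_real (1 / l ^ Suc (Suc n))"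
      using l by (simp add: field_simps)
    ultimately show "conv (conv k k) (v n) x = of_real l * v (Suc n) x"
      unfolding v_def by (simp only: mult.assoc)
  qed
  \<comment> \<open>One further convolution with \<open>k * k\<close> turns the mean-square estimate
    into a uniform one, at the price of the constant \<open>B\<close>.\<close>
  have sup: "cmod (v (Suc n) x - v (Suc m) x) \<le> B * L2_norm MK (\<lambda>x. v n x - v m x)" for n m x
  proof -
    have eq: "of_real l * (v (Suc n) x - v (Suc m) x) = conv (conv k k) (\<lambda>x. v n x - v m x) x"
      by (simp add: conv_diff_right v conv_CK k kv right_diff_distrib)
    have "cmod (of_real l * (v (Suc n) x - v (Suc m) x)) \<le> L2_norm MK (conv k k) * L2_norm MK (\<lambda>x. v n x - v m x)"
      unfolding eq by (rule conv_bound[OF conv_CK[OF k(1,1)] CK_diff[OF v v]])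
    then have "l * cmod (v (Suc n) x - v (Suc m) x) \<le> L2_norm MK (conv k k) * L2_norm MK (\<lambda>x. v n x - v m x)"
      using l by (simp only: norm_mult norm_of_real abs_of_pos)
    then show ?thesis using l by (simp add: B_def field_simps)
  qed
  have "uniformly_Cauchy_on UNIV (\<lambda>n. v (Suc n))"
  proof (rule uniformly_Cauchy_onI)
    fix e :: real assume e: "e > 0"
    define h where "h = (e / (B + 1))\<^sup>2"
    have h: "h > 0" using e B0 by (simp add: h_def)
    obtain N where N: "\<And>n. n \<ge> N \<Longrightarrow> \<bar>d n - D\<bar> < h / 4"
      using LIMSEQ_D[OF dlim, of "h / 4"] h by auto
    have "dist (v (Suc m) x) (v (Suc n) x) < e" if mn: "m \<ge> N" "n \<ge> N" for m n x
    proof -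
      have "(L2_norm MK (\<lambda>x. v m x - v n x))\<^sup>2 < h"
        unfolding vdiff using N[of "2 * m + 1"] N[of "2 * n + 1"] N[of "m + n + 1"] mn by (auto simp: abs_if split: if_splits)
      then have "L2_norm MK (\<lambda>x. v m x - v n x) < e / (B + 1)"
        unfolding h_def using e B0 by (intro power2_less_imp_less[of _ "e / (B + 1)"]) auto
      then have "B * L2_norm MK (\<lambda>x. v m x - v n x) \<le> B * (e / (B + 1))"
        using B0 by (intro mult_left_mono) auto
      also have "\<dots> < e" using e B0 by (simp add: field_simps)
      finally show ?thesis using sup[of m x n] by (simp add: dist_norm)
    qed
    then show "\<exists>M. \<forall>x\<in>UNIV. \<forall>m\<ge>M. \<forall>n\<ge>M. dist (v (Suc m) x) (v (Suc n) x) < e" by blast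
  qed
  then obtain p where plim: "uniform_limit UNIV (\<lambda>n. v (Suc n)) p sequentially"
    using Cauchy_uniformly_convergent uniformly_convergent_on_def by blast
  have p: "p \<in> CK" by (rule CK_uniform_limit[OF v plim])
  have pt: "(\<lambda>n. v n x) \<longlonglongrightarrow> p x" for x
    by (rule LIMSEQ_imp_Suc, rule tendsto_uniform_limitI[OF plim]) simp
  have padj: "adj p = p"
  proof
    fix x
    have "(\<lambda>n. adj (v n) x) \<longlonglongrightarrow> adj p x" unfolding adj_def by (intro tendsto_intros pt)
    then show "adj p x = p x" unfolding vadj using pt LIMSEQ_unique by blast
  qed
  \<comment> \<open>The lower bound 1 on \<open>D\<close> enters here: it makes \<open>p\<close>
    nonzero.\<close>
  have p0: "p 0 = of_real D"
    using pt[of 0] tendsto_of_real[OF dlim, where 'a = complex] unfolding v0 by (rule LIMSEQ_unique)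
  have pv: "conv p (v n) = p" for n
  proof
    fix x
    have "(\<lambda>m. conv (v (Suc m)) (v n) x) \<longlonglongrightarrow> conv p (v n) x"
      by (rule conv_uniform_limit[OF v plim v])
    moreover have "(\<lambda>m. v (m + (n + 2)) x) \<longlonglongrightarrow> p x" by (rule LIMSEQ_ignore_initial_segment[OF pt])
    ultimately show "conv p (v n) x = p x" unfolding vv by (simp add: LIMSEQ_unique)
  qed
  have pp: "conv p p = p"
  proof
    fix x
    have "(\<lambda>m. conv (v (Suc m)) p x) \<longlonglongrightarrow> conv p p x" by (rule conv_uniform_limit[OF v plim p])
    moreover have "conv (v (Suc m)) p = p" for m using pv conv_commute[OF v p] by simp
    ultimately show "conv p p x = p x" by (simp add: LIMSEQ_const_iff)
  qed
  have eig: "conv (conv k k) p = (\<lambda>x. of_real l * p x)"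
  proof
    fix x
    have "(\<lambda>m. conv (v (Suc m)) (conv k k) x) \<longlonglongrightarrow> conv p (conv k k) x"
      by (rule conv_uniform_limit[OF v plim conv_CK[OF k(1,1)]])
    moreover have "conv (v (Suc m)) (conv k k) x = of_real l * v (m + 2) x" for m
      using fun_cong[OF kv[of "Suc m"], of x] by (simp add: conv_commute[OF v conv_CK[OF k(1,1)]])
    moreover have "(\<lambda>m. of_real l * v (m + 2) x) \<longlonglongrightarrow> of_real l * p x"
      by (intro tendsto_mult tendsto_const LIMSEQ_ignore_initial_segment[OF pt])
    ultimately have "conv p (conv k k) x = of_real l * p x" by (simp add: LIMSEQ_unique)
    then show "conv (conv k k) p x = of_real l * p x" by (simp only: conv_commute[OF conv_CK[OF k(1,1)] p])
  qed
  \<comment> \<open>An element acting as an identity on \<open>k\<close> acts as an identity on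
    \<open>p\<close>. This places the idempotent below a given one when minimality is
    invoked.\<close>
  have ideal: "conv p q = p" if q: "q \<in> CK" "conv k q = k" for q
  proof
    fix x
    have pq: "conv (conv_power k n) q = conv_power k n" for n
      by (induction n) (simp_all add: q(2) conv_assoc k q pk)
    have "conv (v n) q = v n" for n unfolding v_def[abs_def] conv_scale_left pq ..
    moreover have "(\<lambda>m. conv (v (Suc m)) q x) \<longlonglongrightarrow> conv p q x" by (rule conv_uniform_limit[OF v plim q(1)])
    ultimately have "(\<lambda>m. v (Suc m) x) \<longlonglongrightarrow> conv p q x" by simp
    then show "conv p q x = p x" using LIMSEQ_Suc[OF pt] LIMSEQ_unique by blast
  qed
  have "p \<noteq> (\<lambda>_. 0)" using p0 D by auto
  from l p padj pp this eig ideal show ?thesis by (rule that)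
qed

text \<open>On \<open>K\<close> such functions are the nonempty finite sums of distinct characters,
  and \<open>p 0\<close> counts the summands; a minimal one should therefore be a single
  character.\<close>

definition idem :: "('a \<Rightarrow> complex) \<Rightarrow> bool" where
  "idem p \<longleftrightarrow> p \<in> CK \<and> adj p = p \<and> conv p p = p \<and> p \<noteq> (\<lambda>_. 0)"

text \<open>The value at 0 is the squared norm of \<open>p\<close>. Since the norm of
  \<open>p = conv p p\<close> is at most that squared norm, a nonzero idempotent has norm at least
  1.\<close>

lemma idem_zero:
  assumes "idem p"
  shows "p 0 = of_real (Re (p 0))" "1 \<le> Re (p 0)"
proof -
  have p: "p \<in> CK" "adj p = p" "conv p p = p" "p \<noteq> (\<lambda>_. 0)" using assms by (auto simp: idem_def)
  have p0: "p 0 = of_real ((L2_norm MK p)\<^sup>2)" using norm_power2_conv[OF p(2)] p(3) by simp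
  then show "p 0 = of_real (Re (p 0))" by simp
  have pos: "(L2_norm MK p)\<^sup>2 > 0" using CK_norm_pos[OF p(1,4)] by simp
  have "(L2_norm MK p)\<^sup>2 \<le> ((L2_norm MK p)\<^sup>2)\<^sup>2" using conv_self_zero_bound[OF p(1,2)] p(3) by simp
  then have "(L2_norm MK p)\<^sup>2 * 1 \<le> (L2_norm MK p)\<^sup>2 * (L2_norm MK p)\<^sup>2"
    by (simp only: power2_eq_square mult_1_right)
  then have "1 \<le> (L2_norm MK p)\<^sup>2" by (simp only: mult_le_cancel_left_pos[OF pos])
  then show "1 \<le> Re (p 0)" using p0 by simp
qed

text \<open>If \<open>q\<close> lies strictly below \<open>p\<close>, then \<open>p - q\<close> is
  again an idempotent, so \<open>p 0\<close> exceeds \<open>q 0\<close> by at least 1. The integer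
  part of \<open>p 0\<close> thus strictly decreases, and a least value exists below any given
  idempotent.\<close>

lemma minimal_idem:
  assumes p0: "idem p0"
  obtains p where "idem p" "conv p p0 = p" "\<And>q. idem q \<Longrightarrow> conv q p = q \<Longrightarrow> q = p"
proof -
  let ?S = "\<lambda>p. idem p \<and> conv p p0 = p"
  have "?S p0" using p0 by (simp add: idem_def)
  then obtain p where p: "?S p" and min: "\<And>q. ?S q \<Longrightarrow> nat \<lfloor>Re (p 0)\<rfloor> \<le> nat \<lfloor>Re (q 0)\<rfloor>"
    using ex_has_least_nat[of ?S p0 "\<lambda>p. nat \<lfloor>Re (p 0)\<rfloor>"] by auto
  have pC: "p \<in> CK" "adj p = p" "conv p p = p" "p0 \<in> CK" using p p0 by (auto simp: idem_def)
  have "q = p" if q: "idem q" "conv q p = q" for q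
  proof (rule ccontr)
    assume ne: "q \<noteq> p"
    have qC: "q \<in> CK" "adj q = q" "conv q q = q" using q by (auto simp: idem_def)
    have "conv q p0 = conv (conv q p) p0" by (simp add: q(2))
    also have "\<dots> = conv q (conv p p0)" by (rule conv_assoc[OF qC(1) pC(1,4)])
    also have "\<dots> = q" using p q(2) by simp
    finally have "?S q" using q by simp
    let ?d = "\<lambda>x. p x - q x"
    have "adj ?d = ?d"
    proof
      fix x
      have "adj ?d x = adj p x - adj q x" by (simp add: adj_def)
      then show "adj ?d x = p x - q x" by (simp only: pC qC)
    qed
    moreover have "conv p q = q" using q(2) conv_commute[OF pC(1) qC(1)] by simp
    then have "conv ?d ?d = ?d"
      using q(2) by (simp add: conv_diff_left conv_diff_right pC qC CK_diff)
    moreover have "?d \<noteq> (\<lambda>_. 0)"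
    proof
      assume "?d = (\<lambda>_. 0)"
      then have "q x = p x" for x using fun_cong[of ?d "\<lambda>_. 0" x] by simp
      then show False using ne by auto
    qed
    ultimately have "idem ?d" using CK_diff[OF pC(1) qC(1)] by (simp add: idem_def)
    then have "Re (q 0) + 1 \<le> Re (p 0)" using idem_zero(2)[of ?d] by simp
    moreover have "1 \<le> Re (q 0)" by (rule idem_zero(2)[OF q(1)])
    ultimately have "\<lfloor>Re (q 0)\<rfloor> < \<lfloor>Re (p 0)\<rfloor>" "0 < \<lfloor>Re (p 0)\<rfloor>" by linarith+
    then have "nat \<lfloor>Re (q 0)\<rfloor> < nat \<lfloor>Re (p 0)\<rfloor>" by (simp only: zless_nat_conj)
    then show False using min[OF \<open>?S q\<close>] by linarith
  qed
  with p show ?thesis by (intro that[of p]) auto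
qed

text \<open>The power method turns every nonzero hermitian \<open>u\<close> in the ideal of \<open>p\<close> into an idempotent below \<open>p\<close>,
  so \<open>u * u\<close> is a positive multiple of \<open>p\<close>. Taking a square root factors \<open>h * h - s\<^sup>2 p\<close>, and a nonzero
  factor is invertible in the ideal.\<close>

lemma minimal_idem_hermitian:
  assumes p: "idem p" and min: "\<And>q. idem q \<Longrightarrow> conv q p = q \<Longrightarrow> q = p"
    and h: "h \<in> CK" "adj h = h" "conv h p = h"
  shows "\<exists>t. h = (\<lambda>x. t * p x)"
proof -
  have pC: "p \<in> CK" "adj p = p" "conv p p = p" using p by (auto simp: idem_def)
  have sq: "\<exists>l>0. conv u u = (\<lambda>x. complex_of_real l * p x)"
    if u: "u \<in> CK" "adj u = u" "conv u p = u" "u \<noteq> (\<lambda>_. 0)" for u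
  proof (rule power_method[OF u(1,2,4)])
    fix l q assume l: "l > 0" and q: "q \<in> CK" "adj q = q" "conv q q = q" "q \<noteq> (\<lambda>_. 0)"
      and eig: "conv (conv u u) q = (\<lambda>x. complex_of_real l * q x)"
      and ideal: "\<And>q'. q' \<in> CK \<Longrightarrow> conv u q' = u \<Longrightarrow> conv q q' = q"
    have "q = p" using min[of q] q ideal[OF pC(1) u(3)] by (simp add: idem_def)
    moreover have "conv (conv u u) p = conv u u" by (simp add: conv_assoc u pC)
    ultimately show ?thesis using l eig by auto
  qed
  show ?thesis
  proof (cases "h = (\<lambda>_. 0)")
    case True
    then show ?thesis by (intro exI[of _ 0]) auto
  next
    case False
    then obtain l where l: "l > 0" "conv h h = (\<lambda>x. complex_of_real l * p x)" using sq[OF h] by blast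
    define s where "s = complex_of_real (sqrt l)"
    have ss: "s * s = of_real l" using l(1) by (simp add: s_def of_real_mult[symmetric])
    have sc: "cnj s = s" by (simp add: s_def)
    let ?u = "\<lambda>x. h x - s * p x" and ?w = "\<lambda>x. h x + s * p x"
    have sp: "(\<lambda>x. s * p x) \<in> CK" by (intro CK_scale pC)
    have uC: "?u \<in> CK" "?w \<in> CK" by (intro CK_diff CK_add h sp)+
    have ph: "conv p h = h" using h(3) conv_commute[OF pC(1) h(1)] by simp
    have ss': "s * (s * z) = of_real l * z" for z by (simp add: ss mult.assoc[symmetric])
    have uw: "conv ?u ?w = (\<lambda>_. 0)"
      using h sp pC l(2)
      by (simp add: conv_diff_left conv_add_right conv_scale_left conv_scale_right CK_add ph distrib_left ss')
    have up: "conv ?u p = ?u" by (simp add: conv_diff_left conv_scale_left h pC sp)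
    have wp: "conv p ?w = ?w" by (simp add: conv_add_right conv_scale_right h pC sp ph)
    show ?thesis
    proof (cases "?u = (\<lambda>_. 0)")
      case True
      have "h x = s * p x" for x using fun_cong[OF True, of x] by simp
      then show ?thesis by blast
    next
      case False
      have "adj ?u = ?u"
      proof
        fix x
        have "adj ?u x = adj h x - cnj s * adj p x" by (simp add: adj_def)
        then show "adj ?u x = ?u x" by (simp only: pC h sc)
      qed
      then obtain m where m: "m > 0" "conv ?u ?u = (\<lambda>x. complex_of_real m * p x)"
        using sq[OF uC(1) _ up False] by blast
      have "(\<lambda>x. complex_of_real m * ?w x) = conv (\<lambda>x. complex_of_real m * p x) ?w"
        by (simp only: conv_scale_left wp)
      also have "\<dots> = conv (conv ?u ?u) ?w" by (simp only: m(2))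
      also have "\<dots> = conv ?u (conv ?u ?w)" by (rule conv_assoc[OF uC(1,1,2)])
      also have "\<dots> = (\<lambda>_. 0)" unfolding uw by (rule conv_zero_right)
      finally have eq: "(\<lambda>x. complex_of_real m * ?w x) = (\<lambda>_. 0)" .
      have "h x = (- s) * p x" for x
        using fun_cong[OF eq, of x] m(1) by (simp add: eq_neg_iff_add_eq_0)
      then show ?thesis by blast
    qed
  qed
qed

text \<open>The hermitian elements \<open>g + adj g\<close> and \<open>\<i> * (g - adj g)\<close>
  stay in the ideal and determine \<open>g\<close>. So the ideal of a minimal idempotent is
  one-dimensional.\<close>

lemma minimal_idem_ideal:
  assumes p: "idem p" and min: "\<And>q. idem q \<Longrightarrow> conv q p = q \<Longrightarrow> q = p"
    and g: "g \<in> CK" "conv g p = g"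
  shows "\<exists>t. g = (\<lambda>x. t * p x)"
proof -
  have pC: "p \<in> CK" "adj p = p" "conv p p = p" using p by (auto simp: idem_def)
  have ag: "adj g \<in> CK" "conv (adj g) p = adj g"
    using CK_adj[OF g(1)] adj_conv[OF g(1) pC(1)] by (simp_all add: g pC)
  let ?a = "\<lambda>x. g x + adj g x" and ?b = "\<lambda>x. \<i> * (g x - adj g x)"
  have "\<exists>t. ?a = (\<lambda>x. t * p x)"
  proof (rule minimal_idem_hermitian[OF p min])
    show "?a \<in> CK" by (intro CK_add g ag)
    show "adj ?a = ?a" by (auto simp: adj_def)
    show "conv ?a p = ?a" by (simp add: conv_add_left g ag pC)
  qed
  moreover have "\<exists>t. ?b = (\<lambda>x. t * p x)"
  proof (rule minimal_idem_hermitian[OF p min])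
    show "?b \<in> CK" by (intro CK_scale CK_diff g ag)
    show "adj ?b = ?b" by (auto simp: adj_def algebra_simps)
    show "conv ?b p = ?b" by (simp add: conv_scale_left conv_diff_left g ag pC)
  qed
  ultimately obtain s t where st: "?a = (\<lambda>x. s * p x)" "?b = (\<lambda>x. t * p x)" by blast
  have "g x = (s - \<i> * t) / 2 * p x" for x
  proof -
    have "2 * g x = ?a x - \<i> * ?b x" by (simp add: algebra_simps)
    also have "\<dots> = s * p x - \<i> * (t * p x)" using fun_cong[OF st(1), of x] fun_cong[OF st(2), of x] by simp
    finally show ?thesis by (simp add: field_simps)
  qed
  then show ?thesis by blast
qed

text \<open>The hermitian function \<open>conv f (adj f)\<close> is nonzero at 0, so the power
  method yields an idempotent, and a minimal \<open>p\<close> below it, on which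
  \<open>conv k k\<close> acts as a nonzero scalar. Translates of \<open>p\<close> stay in its
  one-dimensional ideal, so they are multiples of \<open>p\<close>; hence \<open>p\<close> divided
  by \<open>p 0\<close> is multiplicative. Orthogonality of \<open>f\<close> to this character would
  give \<open>conv f p = 0\<close> and contradict the nonzero scalar.\<close>

theorem exists_char:
  assumes f: "f \<in> CK" "f \<noteq> (\<lambda>_. 0)"
  obtains u where "u \<in> CK" "\<And>x y. x \<in> K \<Longrightarrow> y \<in> K \<Longrightarrow> u (x + y) = u x * u y"
    "\<And>x. x \<in> K \<Longrightarrow> cmod (u x) = 1" "L2_inner MK f u \<noteq> 0"
proof -
  define k where "k = conv f (adj f)"
  have kC: "k \<in> CK" unfolding k_def by (intro conv_CK CK_adj f)
  have kadj: "adj k = k"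
    unfolding k_def by (simp add: adj_conv f CK_adj conv_commute[OF CK_adj[OF f(1)] f(1)])
  have "k 0 \<noteq> 0" unfolding k_def conv_adj_self using CK_norm_pos[OF f] by simp
  then have "k \<noteq> (\<lambda>_. 0)" by auto
  then obtain l p0 where l: "l > 0" and p0: "p0 \<in> CK" "adj p0 = p0" "conv p0 p0 = p0" "p0 \<noteq> (\<lambda>_. 0)"
    and eig: "conv (conv k k) p0 = (\<lambda>x. of_real l * p0 x)"
    by (rule power_method[OF kC kadj])
  have "idem p0" using p0 by (simp add: idem_def)
  then obtain p where p: "idem p" "conv p p0 = p" and min: "\<And>q. idem q \<Longrightarrow> conv q p = q \<Longrightarrow> q = p"
    by (rule minimal_idem) (rule that)
  have pC: "p \<in> CK" "adj p = p" "conv p p = p" "p \<noteq> (\<lambda>_. 0)" using p by (auto simp: idem_def)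
  have pz: "p 0 \<noteq> 0" "cnj (p 0) = p 0"
  proof -
    show "p 0 \<noteq> 0" using idem_zero(2)[OF p(1)] by auto
    show "cnj (p 0) = p 0" by (subst (1 2) idem_zero(1)[OF p(1)]) simp
  qed
  have kkp: "conv (conv k k) p = (\<lambda>x. of_real l * p x)"
  proof -
    have p0p: "conv p0 p = p" using p(2) conv_commute[OF p0(1) pC(1)] by simp
    have "conv (conv k k) p = conv (conv k k) (conv p0 p)" by (simp only: p0p)
    also have "\<dots> = conv (conv (conv k k) p0) p" by (rule conv_assoc[OF conv_CK[OF kC kC] p0(1) pC(1), symmetric])
    also have "\<dots> = (\<lambda>x. of_real l * p x)" by (simp only: eig conv_scale_left p0p)
    finally show ?thesis .
  qed
  have mult: "p (a + x) * p 0 = p a * p x" if a: "a \<in> K" for a x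
  proof -
    let ?g = "\<lambda>x. p (a + x)"
    have g: "?g \<in> CK" by (rule CK_shift[OF pC(1) a])
    have "conv ?g p = ?g"
    proof
      fix x
      have "conv ?g p x = conv p ?g x" by (simp only: conv_commute[OF g pC(1)])
      also have "\<dots> = conv p p (a + x)" by (simp add: conv_def add_diff_eq)
      finally show "conv ?g p x = ?g x" by (simp only: pC)
    qed
    then obtain t where t: "?g = (\<lambda>x. t * p x)" using minimal_idem_ideal[OF p(1) min g] by blast
    have "p a = t * p 0" using fun_cong[OF t, of 0] by simp
    then show ?thesis using fun_cong[OF t, of x] by simp
  qed
  define u where "u x = (1 / p 0) * p x" for x
  have u: "u \<in> CK" unfolding u_def[abs_def] by (intro CK_scale pC)
  have hom: "u (x + y) = u x * u y" if "x \<in> K" "y \<in> K" for x y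
    using mult[OF that(1), of y] pz(1) by (simp add: u_def field_simps)
  have uminus: "u (- x) = cnj (u x)" for x
  proof -
    have "p (- x) = cnj (p x)" using fun_cong[OF pC(2), of x] by (simp add: adj_def) (metis complex_cnj_cnj)
    then show ?thesis using pz(2) by (simp add: u_def)
  qed
  have u0: "u 0 = 1" using pz by (simp add: u_def)
  have norm: "cmod (u x) = 1" if x: "x \<in> K" for x
  proof -
    have "u x * cnj (u x) = 1" using hom[OF x K_minus[OF x]] u0 uminus by simp
    then have "complex_of_real ((cmod (u x))\<^sup>2) = 1" by (simp only: complex_norm_square)
    then have "(cmod (u x))\<^sup>2 = 1" by (simp only: of_real_eq_1_iff)
    then show ?thesis by (simp add: power2_eq_1_iff) (use norm_ge_zero[of "u x"] in linarith)
  qed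
  have "L2_inner MK f u \<noteq> 0"
  proof
    assume z: "L2_inner MK f u = 0"
    have "conv f p = (\<lambda>_. 0)"
    proof
      fix x
      show "conv f p x = 0"
      proof (cases "x \<in> K")
        case True
        have "conv f p x = (\<integral>y. (p 0 * u x) * (f y * cnj (u y)) \<partial>MK)"
          unfolding conv_def
        proof (rule integral_MK_cong)
          fix y assume y: "y \<in> K"
          have "p (x - y) = p 0 * u (x + - y)" using pz by (simp add: u_def)
          also have "\<dots> = p 0 * u x * cnj (u y)" using hom[OF True K_minus[OF y]] uminus by simp
          finally show "f y * p (x - y) = (p 0 * u x) * (f y * cnj (u y))" by simp
        next
          show "(\<lambda>y. f y * p (x - y)) \<in> borel_measurable borel"
            by (rule CK_measurable[OF conv_integrand_CK[OF f(1) pC(1)]])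
          have "(\<lambda>y. f y * cnj (u y)) \<in> borel_measurable borel"
            by (intro borel_measurable_continuous_onI continuous_intros CK_continuous f u)
          then show "(\<lambda>y. (p 0 * u x) * (f y * cnj (u y))) \<in> borel_measurable borel" by measurable
        qed
        also have "\<dots> = (p 0 * u x) * L2_inner MK f u" by (simp add: L2_inner_def)
        finally show ?thesis using z by simp
      qed (rule conv_supp[OF f(1) pC(1)])
    qed
    then have "conv k p = (\<lambda>_. 0)"
      unfolding k_def conv_commute[OF f(1) CK_adj[OF f(1)]] conv_assoc[OF CK_adj[OF f(1)] f(1) pC(1)]
      by (simp add: conv_zero_right)
    then have "conv (conv k k) p = (\<lambda>_. 0)"
      unfolding conv_assoc[OF kC kC pC(1)] by (simp add: conv_zero_right)
    then have "of_real l * p 0 = 0" using fun_cong[OF kkp, of 0] by simp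
    then show False using l pz by simp
  qed
  from u hom norm this show ?thesis by (rule that)
qed

end

section \<open>Extension of characters\<close>

text \<open>Partially defined characters are represented by their graphs, which are subgroups of the
  product of the group with the circle.\<close>

definition char_graph :: "('g::ab_group_add \<times> complex) set \<Rightarrow> bool" where
  "char_graph R \<longleftrightarrow> (0, 1) \<in> R \<and> (\<forall>x z. (x, z) \<in> R \<longrightarrow> cmod z = 1 \<and> (- x, cnj z) \<in> R)
     \<and> (\<forall>x z y w. (x, z) \<in> R \<longrightarrow> (y, w) \<in> R \<longrightarrow> (x + y, z * w) \<in> R) \<and> (\<forall>z. (0, z) \<in> R \<longrightarrow> z = 1)"

lemma char_graphD:
  assumes "char_graph R"
  shows "(0, 1) \<in> R" "(x, z) \<in> R \<Longrightarrow> cmod z = 1" "(x, z) \<in> R \<Longrightarrow> (- x, cnj z) \<in> R"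
    "(x, z) \<in> R \<Longrightarrow> (y, w) \<in> R \<Longrightarrow> (x + y, z * w) \<in> R" "(0, z) \<in> R \<Longrightarrow> z = 1"
  using assms by (auto simp: char_graph_def)

lemma mult_cnj_eq_1: "cmod z = 1 \<Longrightarrow> z * cnj z = 1"
  by (simp add: complex_norm_square[symmetric])

lemma char_graph_unique:
  assumes R: "char_graph R" and z: "(x, z) \<in> R" and w: "(x, w) \<in> R"
  shows "z = w"
proof -
  have "(x + - x, z * cnj w) \<in> R" by (intro char_graphD(4)[OF R] char_graphD(3)[OF R] z w)
  then have "z * cnj w = 1" using char_graphD(5)[OF R] by simp
  then have "z * (w * cnj w) = w" by (metis mult.assoc mult.commute mult_1)
  then show ?thesis using mult_cnj_eq_1[OF char_graphD(2)[OF R w]] by simp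
qed

primrec nmul :: "nat \<Rightarrow> 'g::ab_group_add \<Rightarrow> 'g" where
  "nmul 0 x = 0"
| "nmul (Suc n) x = x + nmul n x"

lemma nmul_add: "nmul (m + n) x = nmul m x + nmul n x"
  by (induction m) (auto simp: add.assoc)

lemma nmul_mult: "nmul (m * n) x = nmul m (nmul n x)"
  by (induction m) (auto simp: nmul_add)

lemma char_graph_nmul: "char_graph R \<Longrightarrow> (x, z) \<in> R \<Longrightarrow> (nmul n x, z ^ n) \<in> R"
  by (induction n) (auto intro: char_graphD)

text \<open>The value at the new point is a root of the prescribed value at the first multiple lying in
  the old domain; there is more than one root, so the value can be chosen different from 1.\<close>

lemma char_graph_new_value:
  fixes x :: "'g::ab_group_add"
  assumes R: "char_graph R" and x: "x \<notin> Domain R"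
  obtains w where "cmod w = 1" "w \<noteq> 1" "\<And>n z. (nmul n x, z) \<in> R \<Longrightarrow> z = w ^ n"
proof (cases "\<exists>n>0. nmul n x \<in> Domain R")
  case False
  \<comment> \<open>No positive multiple of \<open>x\<close> meets the domain, so any value on the
    circle other than 1 is consistent with \<open>R\<close>.\<close>
  show ?thesis
  proof (rule that[of "- 1"])
    fix n z assume nz: "(nmul n x, z) \<in> R"
    then have "nmul n x \<in> Domain R" by auto
    then have "n = 0" using False by (metis gr0I)
    then show "z = (- 1) ^ n" using nz char_graphD(5)[OF R] by simp
  qed auto
next
  case True
  define k where "k = (LEAST n. n > 0 \<and> nmul n x \<in> Domain R)"
  have k: "k > 0" "nmul k x \<in> Domain R"
    using LeastI_ex[OF True] by (auto simp: k_def)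
  have kmin: "r = 0" if "r < k" "nmul r x \<in> Domain R" for r
    using not_less_Least[of r "\<lambda>n. n > 0 \<and> nmul n x \<in> Domain R"] that by (auto simp: k_def)
  have "k \<noteq> 1" using k(2) x by auto
  then have k2: "k \<ge> 2" using k(1) by simp
  obtain z0 where z0: "(nmul k x, z0) \<in> R" using k(2) by auto
  have n0: "cmod z0 = 1" by (rule char_graphD(2)[OF R z0])
  have "card {w. w ^ k = z0} = k" using n0 k(1) by (intro card_nth_roots) auto
  then have "\<not> {w. w ^ k = z0} \<subseteq> {1}"
    using k2 card_mono[of "{1::complex}" "{w. w ^ k = z0}"] by auto
  then obtain w where w: "w ^ k = z0" "w \<noteq> 1" by auto
  have "cmod w ^ k = 1" using w(1) n0 by (metis norm_power)
  then have nw: "cmod w = 1" using k(1) by (metis norm_ge_zero power_eq_1_iff less_numeral_extra(3) norm_one power_eq_imp_eq_base power_one zero_le_one)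
  show ?thesis
  proof (rule that[OF nw w(2)])
    fix n z assume nz: "(nmul n x, z) \<in> R"
    define q r where "q = n div k" and "r = n mod k"
    have n: "n = r + q * k" by (simp add: q_def r_def)
    have qk: "(nmul (q * k) x, z0 ^ q) \<in> R"
      unfolding nmul_mult by (rule char_graph_nmul[OF R z0])
    have "(nmul n x + - nmul (q * k) x, z * cnj (z0 ^ q)) \<in> R"
      by (rule char_graphD(4)[OF R nz char_graphD(3)[OF R qk]])
    then have "nmul r x \<in> Domain R" by (auto simp: n nmul_add)
    then have "r = 0" using kmin k(1) by (simp add: r_def)
    then have "n = q * k" by (simp add: n)
    then have z: "z = z0 ^ q" using char_graph_unique[OF R nz] qk by simp
    show "z = w ^ n" unfolding z w(1)[symmetric] \<open>n = q * k\<close> by (simp only: power_mult[symmetric] mult.commute)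
  qed
qed

text \<open>Integer multiples of \<open>x\<close> are written as differences of natural ones, so
  \<open>w ^ m * cnj (w ^ n)\<close> stands for the power with exponent \<open>m - n\<close>.
  Single-valuedness needs checking only over 0, where it is the consistency of \<open>w\<close> with
  \<open>R\<close>. The condition \<open>w \<noteq> 1\<close> is recorded so that the extension can
  detect a point outside a subgroup.\<close>

lemma char_graph_extend:
  fixes x :: "'g::ab_group_add"
  assumes R: "char_graph R" and x: "x \<notin> Domain R"
  obtains R' w where "char_graph R'" "R \<subseteq> R'" "(x, w) \<in> R'" "w \<noteq> 1"
proof (rule char_graph_new_value[OF R x])
  fix w assume w: "cmod w = 1" "w \<noteq> 1" and cons: "\<And>n z. (nmul n x, z) \<in> R \<Longrightarrow> z = w ^ n"
  define R' where "R' = {(y + (nmul m x - nmul n x), z * (w ^ m * cnj (w ^ n))) | y z m n. (y, z) \<in> R}"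
  have R'I: "(y + (nmul m x - nmul n x), z * (w ^ m * cnj (w ^ n))) \<in> R'" if "(y, z) \<in> R" for y z m n
    using that unfolding R'_def by blast
  have wn: "cmod (w ^ n) = 1" for n using w by (simp add: norm_power)
  have "char_graph R'"
    unfolding char_graph_def
  proof (intro conjI allI impI)
    show "(0, 1) \<in> R'" using R'I[OF char_graphD(1)[OF R], of 0 0] by simp
  next
    fix y z assume "(y, z) \<in> R'"
    then obtain u v m n where u: "(u, v) \<in> R" and e: "y = u + (nmul m x - nmul n x)" "z = v * (w ^ m * cnj (w ^ n))"
      unfolding R'_def by blast
    show "cmod z = 1" using char_graphD(2)[OF R u] w(1) by (simp add: e norm_mult norm_power)
    have "(- u + (nmul n x - nmul m x), cnj v * (w ^ n * cnj (w ^ m))) \<in> R'"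
      by (rule R'I[OF char_graphD(3)[OF R u]])
    moreover have "- u + (nmul n x - nmul m x) = - y" by (simp add: e)
    moreover have "cnj v * (w ^ n * cnj (w ^ m)) = cnj z" by (simp add: e mult.commute)
    ultimately show "(- y, cnj z) \<in> R'" by simp
  next
    fix y z y' z' assume "(y, z) \<in> R'" "(y', z') \<in> R'"
    then obtain u v m n u' v' m' n' where u: "(u, v) \<in> R" "(u', v') \<in> R"
      and e: "y = u + (nmul m x - nmul n x)" "z = v * (w ^ m * cnj (w ^ n))"
        "y' = u' + (nmul m' x - nmul n' x)" "z' = v' * (w ^ m' * cnj (w ^ n'))"
      unfolding R'_def by blast
    have "((u + u') + (nmul (m + m') x - nmul (n + n') x), (v * v') * (w ^ (m + m') * cnj (w ^ (n + n')))) \<in> R'"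
      by (rule R'I[OF char_graphD(4)[OF R u]])
    moreover have "(u + u') + (nmul (m + m') x - nmul (n + n') x) = y + y'"
      by (simp add: e nmul_add algebra_simps)
    moreover have "(v * v') * (w ^ (m + m') * cnj (w ^ (n + n'))) = z * z'"
      by (simp add: e power_add mult_ac)
    ultimately show "(y + y', z * z') \<in> R'" by simp
  next
    fix z assume "(0, z) \<in> R'"
    then obtain u v m n where u: "(u, v) \<in> R" and e: "0 = u + (nmul m x - nmul n x)" "z = v * (w ^ m * cnj (w ^ n))"
      unfolding R'_def by blast
    show "z = 1"
    proof (cases "m \<le> n")
      case True
      then obtain d where d: "n = m + d" using le_Suc_ex by blast
      have "u = nmul d x" using e(1) by (simp add: d nmul_add)
      then have "v = w ^ d" using cons u by simp
      then have "z = (w ^ n) * cnj (w ^ n)" by (simp add: e(2) d power_add mult_ac)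
      then show ?thesis using mult_cnj_eq_1[OF wn] by simp
    next
      case False
      then obtain d where d: "m = n + d" using le_Suc_ex[of n m] by auto
      have "- u = nmul d x" using e(1) by (simp add: d nmul_add neg_eq_iff_add_eq_0)
      then have "cnj v = w ^ d" using cons char_graphD(3)[OF R u] by simp
      then have "v = cnj (w ^ d)" by (metis complex_cnj_cnj)
      then have "z = (w ^ m) * cnj (w ^ m)" by (simp add: e(2) d power_add mult_ac)
      then show ?thesis using mult_cnj_eq_1[OF wn] by simp
    qed
  qed
  moreover have "R \<subseteq> R'"
  proof
    fix p assume "p \<in> R"
    then show "p \<in> R'" using R'I[of "fst p" "snd p" 0 0] by simp
  qed
  moreover have "(x, w) \<in> R'" using R'I[OF char_graphD(1)[OF R], of 1 0] by simp
  ultimately show ?thesis using w(2) by (rule that)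
qed

text \<open>A maximal extension has full domain, since any missing point could be adjoined.
  Continuity is left aside at this stage and recovered from the behaviour on an open
  subgroup.\<close>

theorem char_graph_total:
  fixes R :: "('g::ab_group_add \<times> complex) set"
  assumes R: "char_graph R"
  obtains \<phi> where "\<And>x y. \<phi> (x + y) = \<phi> x * \<phi> y" "\<And>x. cmod (\<phi> x) = 1" "\<And>x z. (x, z) \<in> R \<Longrightarrow> \<phi> x = z"
proof -
  let ?A = "{S. char_graph S \<and> R \<subseteq> S}"
  have "\<exists>S\<in>?A. \<forall>X\<in>?A. S \<subseteq> X \<longrightarrow> X = S"
  proof (rule subset_Zorn_nonempty)
    show "?A \<noteq> {}" using R by auto
    fix \<C> assume ne: "\<C> \<noteq> {}" and chain: "subset.chain ?A \<C>"
    have C: "S \<in> \<C> \<Longrightarrow> char_graph S" "S \<in> \<C> \<Longrightarrow> R \<subseteq> S" for S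
      using chain by (auto simp: subset.chain_def)
    have lin: "S \<subseteq> T \<or> T \<subseteq> S" if "S \<in> \<C>" "T \<in> \<C>" for S T
      using chain that by (auto simp: subset_chain_def)
    obtain S0 where S0: "S0 \<in> \<C>" using ne by auto
    have "char_graph (\<Union>\<C>)"
      unfolding char_graph_def
    proof (intro conjI allI impI)
      show "(0, 1) \<in> \<Union>\<C>" using char_graphD(1)[OF C(1)[OF S0]] S0 by auto
    next
      fix x z assume "(x, z) \<in> \<Union>\<C>"
      then obtain S where S: "S \<in> \<C>" "(x, z) \<in> S" by auto
      show "cmod z = 1" by (rule char_graphD(2)[OF C(1)[OF S(1)] S(2)])
      show "(- x, cnj z) \<in> \<Union>\<C>" using char_graphD(3)[OF C(1)[OF S(1)] S(2)] S(1) by auto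
    next
      fix x z y w assume "(x, z) \<in> \<Union>\<C>" "(y, w) \<in> \<Union>\<C>"
      then obtain S T where S: "S \<in> \<C>" "(x, z) \<in> S" and T: "T \<in> \<C>" "(y, w) \<in> T" by auto
      have "\<exists>U\<in>\<C>. (x, z) \<in> U \<and> (y, w) \<in> U" using lin[OF S(1) T(1)] S T by auto
      then obtain U where U: "U \<in> \<C>" "(x, z) \<in> U" "(y, w) \<in> U" by auto
      show "(x + y, z * w) \<in> \<Union>\<C>" using char_graphD(4)[OF C(1)[OF U(1)] U(2,3)] U(1) by auto
    next
      fix z :: complex assume "(0, z) \<in> \<Union>\<C>"
      then obtain S where S: "S \<in> \<C>" "(0, z) \<in> S" by auto
      show "z = 1" by (rule char_graphD(5)[OF C(1)[OF S(1)] S(2)])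
    qed
    then show "\<Union>\<C> \<in> ?A" using C(2)[OF S0] S0 by auto
  qed
  then obtain S where S: "char_graph S" "R \<subseteq> S" and max: "\<And>X. char_graph X \<Longrightarrow> R \<subseteq> X \<Longrightarrow> S \<subseteq> X \<Longrightarrow> X = S"
    by auto
  have dom: "\<exists>z. (x, z) \<in> S" for x
  proof (rule ccontr)
    assume "\<not> ?thesis"
    then have x: "x \<notin> Domain S" by auto
    show False
    proof (rule char_graph_extend[OF S(1) x])
      fix R' w assume R': "char_graph R'" "S \<subseteq> R'" "(x, w) \<in> R'"
      then have "R' = S" using max[OF R'(1)] S(2) by auto
      then show False using R'(3) x by auto
    qed
  qed
  define \<phi> where "\<phi> x = (SOME z. (x, z) \<in> S)" for x
  have \<phi>: "(x, \<phi> x) \<in> S" for x unfolding \<phi>_def using someI_ex[OF dom] .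
  show ?thesis
  proof (rule that)
    show "\<phi> (x + y) = \<phi> x * \<phi> y" for x y
      by (rule char_graph_unique[OF S(1) \<phi> char_graphD(4)[OF S(1) \<phi> \<phi>]])
    show "cmod (\<phi> x) = 1" for x by (rule char_graphD(2)[OF S(1) \<phi>])
    show "\<phi> x = z" if "(x, z) \<in> R" for x z
      using that S(2) by (intro char_graph_unique[OF S(1) \<phi>]) auto
  qed
qed

lemma hom_zero:
  fixes \<phi> :: "'g::ab_group_add \<Rightarrow> complex"
  assumes "\<And>x y. \<phi> (x + y) = \<phi> x * \<phi> y" "\<And>x. cmod (\<phi> x) = 1"
  shows "\<phi> 0 = 1"
proof -
  have "\<phi> 0 = \<phi> 0 * \<phi> 0" using assms(1)[of 0 0] by simp
  moreover have "\<phi> 0 \<noteq> 0" using assms(2)[of 0] by auto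
  ultimately show ?thesis by simp
qed

text \<open>Agreement with a continuous function on a neighbourhood of 0 gives continuity at 0, and
  the functional equation carries it to every point.\<close>

lemma hom_continuous:
  fixes \<phi> u :: "'g::topological_ab_group_add \<Rightarrow> complex"
  assumes hom: "\<And>x y. \<phi> (x + y) = \<phi> x * \<phi> y" and norm: "\<And>x. cmod (\<phi> x) = 1"
    and H: "open H" "0 \<in> H" and u: "continuous_on UNIV u" "\<And>x. x \<in> H \<Longrightarrow> \<phi> x = u x"
  shows "continuous_on UNIV \<phi>"
proof -
  have "(\<phi> \<longlongrightarrow> \<phi> a) (at a)" for a
  proof (rule Lim_transform_eventually)
    have "continuous_on UNIV (\<lambda>x. \<phi> a * u (x - a))"
      by (intro continuous_intros continuous_on_compose2[OF u(1)]) auto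
    from this[unfolded continuous_on_def, rule_format, of a]
    have "((\<lambda>x. \<phi> a * u (x - a)) \<longlongrightarrow> \<phi> a * u 0) (at a)" by simp
    moreover have "u 0 = 1" using u(2)[OF H(2)] hom_zero[of \<phi>, OF hom norm] by simp
    ultimately show "((\<lambda>x. \<phi> a * u (x - a)) \<longlongrightarrow> \<phi> a) (at a)" by simp
    have "open ((\<lambda>x. x - a) -` H)" by (intro open_vimage H continuous_intros)
    moreover have "\<phi> a * u (x - a) = \<phi> x" if "x - a \<in> H" for x
      using hom[of a "x - a"] u(2)[OF that] by simp
    ultimately show "\<forall>\<^sub>F x in at a. \<phi> a * u (x - a) = \<phi> x"
      unfolding eventually_at_topological using H(2) by (intro exI[of _ "(\<lambda>x. x - a) -` H"]) auto
  qed
  then show ?thesis by (simp add: continuous_on_def)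
qed

lemma obtain_dual:
  fixes \<phi> u :: "'g::topological_ab_group_add \<Rightarrow> complex"
  assumes "\<And>x y. \<phi> (x + y) = \<phi> x * \<phi> y" "\<And>x. cmod (\<phi> x) = 1"
    and "open H" "0 \<in> H" "continuous_on UNIV u" "\<And>x. x \<in> H \<Longrightarrow> \<phi> x = u x"
  shows "char_app (Abs_dual \<phi>) = \<phi>"
proof (rule Abs_dual_inverse)
  have "continuous_on UNIV \<phi>" by (rule hom_continuous[of \<phi> H u]) (fact assms)+
  then show "\<phi> \<in> {\<phi>. continuous_on UNIV \<phi> \<and> (\<forall>x. cmod (\<phi> x) = 1) \<and> (\<forall>x y. \<phi> (x + y) = \<phi> x * \<phi> y)}"
    using assms(1,2) by simp
qed

lemma char_extension:
  fixes H :: "'g::topological_ab_group_add set"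
  assumes H: "is_subgroup H" "open H" and u: "continuous_on UNIV u"
    "\<And>x y. x \<in> H \<Longrightarrow> y \<in> H \<Longrightarrow> u (x + y) = u x * u y" "\<And>x. x \<in> H \<Longrightarrow> cmod (u x) = 1"
  obtains \<gamma> where "\<And>x. x \<in> H \<Longrightarrow> char_app \<gamma> x = u x"
proof -
  have H': "0 \<in> H" "\<And>x y. x \<in> H \<Longrightarrow> y \<in> H \<Longrightarrow> x + y \<in> H" "\<And>x. x \<in> H \<Longrightarrow> - x \<in> H"
    using H(1) by (auto simp: is_subgroup_def)
  have u0: "u 0 = 1"
  proof -
    have "u 0 = u 0 * u 0" using u(2)[OF H'(1) H'(1)] by simp
    moreover have "u 0 \<noteq> 0" using u(3)[OF H'(1)] by auto
    ultimately show ?thesis by simp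
  qed
  have um: "u (- x) = cnj (u x)" if "x \<in> H" for x
  proof -
    have "u x * u (- x) = 1" using u(2)[OF that H'(3)[OF that]] u0 by simp
    then have "cnj (u x) * (u x * u (- x)) = cnj (u x)" by simp
    then show ?thesis using mult_cnj_eq_1[OF u(3)[OF that]] by (simp add: mult.assoc[symmetric] mult.commute[of "cnj (u x)"])
  qed
  have "char_graph {(x, u x) | x. x \<in> H}"
    unfolding char_graph_def using H' u u0 um by auto
  then obtain \<phi> where \<phi>: "\<And>x y. \<phi> (x + y) = \<phi> x * \<phi> y" "\<And>x. cmod (\<phi> x) = 1"
    "\<And>x z. (x, z) \<in> {(x, u x) | x. x \<in> H} \<Longrightarrow> \<phi> x = z"
    by (rule char_graph_total) (rule that)
  have "char_app (Abs_dual \<phi>) = \<phi>"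
    using \<phi>(3) by (intro obtain_dual[of \<phi> H u] \<phi>(1,2) H(2) H'(1) u(1)) auto
  then show ?thesis using \<phi>(3) by (intro that[of "Abs_dual \<phi>"]) auto
qed

text \<open>The trivial character of \<open>H\<close> is extended to \<open>x\<close> with a value
  other than 1, and from there to the whole group.\<close>

lemma annihilator_separates:
  fixes H :: "'g::topological_ab_group_add set"
  assumes H: "is_subgroup H" "open H" and x: "x \<notin> H"
  obtains \<gamma> where "\<gamma> \<in> annihilator H" "char_app \<gamma> x \<noteq> 1"
proof -
  have H': "0 \<in> H" "\<And>x y. x \<in> H \<Longrightarrow> y \<in> H \<Longrightarrow> x + y \<in> H" "\<And>x. x \<in> H \<Longrightarrow> - x \<in> H"
    using H(1) by (auto simp: is_subgroup_def)
  have R: "char_graph (H \<times> {1})" using H' by (auto simp: char_graph_def)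
  have "x \<notin> Domain (H \<times> {1::complex})" using x by auto
  then show ?thesis
  proof (rule char_graph_extend[OF R])
    fix R' w assume R': "char_graph R'" "H \<times> {1} \<subseteq> R'" "(x, w) \<in> R'" "w \<noteq> 1"
    obtain \<phi> where \<phi>: "\<And>x y. \<phi> (x + y) = \<phi> x * \<phi> y" "\<And>x. cmod (\<phi> x) = 1" "\<And>x z. (x, z) \<in> R' \<Longrightarrow> \<phi> x = z"
      by (rule char_graph_total[OF R'(1)]) (rule that)
    have \<phi>1: "\<phi> x = 1" if "x \<in> H" for x using that R'(2) by (intro \<phi>(3)) auto
    have "char_app (Abs_dual \<phi>) = \<phi>"
      using \<phi>1 by (intro obtain_dual[of \<phi> H "\<lambda>_. 1"] \<phi>(1,2) H(2) H'(1)) auto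
    then show ?thesis
      using \<phi>1 \<phi>(3)[OF R'(3)] R'(4) by (intro that[of "Abs_dual \<phi>"]) (auto simp: annihilator_def)
  qed
qed

section \<open>Topology of the dual group\<close>

lemma char_app_uminus_right: "char_app \<gamma> (- x) = cnj (char_app \<gamma> x)"
proof -
  have z: "char_app \<gamma> 0 = 1" by (rule hom_zero) (auto simp: char_app_add_right)
  have "char_app \<gamma> x * char_app \<gamma> (- x) = 1" using char_app_add_right[of \<gamma> x "- x"] z by simp
  then have "cnj (char_app \<gamma> x) * (char_app \<gamma> x * char_app \<gamma> (- x)) = cnj (char_app \<gamma> x)" by simp
  then show ?thesis by (simp add: mult.assoc[symmetric] mult.commute[of "cnj (char_app \<gamma> x)"])
qed

lemma char_app_zero_right [simp]: "char_app \<gamma> 0 = 1"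
  by (rule hom_zero) (auto simp: char_app_add_right)

lemma continuous_char_app: "continuous_on S (\<lambda>\<gamma>. char_app \<gamma> x)"
proof -
  have "((\<lambda>\<gamma>. char_app \<gamma> x) \<longlongrightarrow> char_app \<delta> x) (at \<delta> within S)" for \<delta>
  proof (rule tendstoI)
    fix e :: real assume "e > 0"
    then have "\<forall>\<^sub>F \<gamma> in nhds \<delta>. \<forall>y\<in>{x}. cmod (char_app \<gamma> y - char_app \<delta> y) < e"
      by (intro eventually_char_close) auto
    then have "\<forall>\<^sub>F \<gamma> in nhds \<delta>. dist (char_app \<gamma> x) (char_app \<delta> x) < e" by (simp add: dist_norm)
    then show "\<forall>\<^sub>F \<gamma> in at \<delta> within S. dist (char_app \<gamma> x) (char_app \<delta> x) < e"
      by (simp add: eventually_at_filter eventually_mono)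
  qed
  then show ?thesis by (simp add: continuous_on_def)
qed

instance dual :: (topological_ab_group_add) t2_space
proof
  fix \<gamma> \<delta> :: "'a dual" assume "\<gamma> \<noteq> \<delta>"
  then have "char_app \<gamma> \<noteq> char_app \<delta>" by (simp add: char_app_inject)
  then obtain x where x: "char_app \<gamma> x \<noteq> char_app \<delta> x" by (auto simp: fun_eq_iff)
  from hausdorff[OF this]
  obtain U V where UV: "open U" "open V" "char_app \<gamma> x \<in> U" "char_app \<delta> x \<in> V" "U \<inter> V = {}"
    by (elim exE conjE)
  show "\<exists>U V. open U \<and> open V \<and> \<gamma> \<in> U \<and> \<delta> \<in> V \<and> U \<inter> V = {}"
  proof (intro exI conjI)
    show "open ((\<lambda>\<gamma>. char_app \<gamma> x) -` U)" "open ((\<lambda>\<gamma>. char_app \<gamma> x) -` V)"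
      by (intro open_vimage UV continuous_char_app)+
  qed (use UV in auto)
qed

text \<open>While \<open>y\<close> stays within 1/2 of 1, the number \<open>y + 1\<close> has
  modulus at least 3/2. Squaring \<open>y\<close> therefore multiplies its distance from 1 by at
  least 3/2, so a nonzero distance could not stay bounded.\<close>

lemma circle_no_small_subgroups:
  fixes z :: complex
  assumes "\<And>n. cmod (z ^ 2 ^ n - 1) \<le> 1 / 2"
  shows "z = 1"
proof (rule ccontr)
  assume "z \<noteq> 1"
  then have pos: "cmod (z - 1) > 0" by simp
  have grow: "(3 / 2) ^ n * cmod (z - 1) \<le> cmod (z ^ 2 ^ n - 1)" for n
  proof (induction n)
    case (Suc n)
    let ?y = "z ^ 2 ^ n"
    have "z ^ 2 ^ Suc n - 1 = (?y - 1) * (?y + 1)"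
      by (simp add: power_mult[symmetric] mult.commute power_even_eq algebra_simps power2_eq_square)
    then have e: "cmod (z ^ 2 ^ Suc n - 1) = cmod (?y - 1) * cmod (?y + 1)" by (simp only: norm_mult)
    have "2 = cmod ((?y + 1) - (?y - 1))" by simp
    also have "\<dots> \<le> cmod (?y + 1) + cmod (?y - 1)" by (rule norm_triangle_ineq4)
    finally have "3 / 2 \<le> cmod (?y + 1)" using assms[of n] by linarith
    then have "(3 / 2) ^ n * cmod (z - 1) * (3 / 2) \<le> cmod (?y - 1) * cmod (?y + 1)"
      using Suc by (intro mult_mono) auto
    then show ?case unfolding e by (simp add: mult_ac)
  qed simp
  obtain n where "1 / cmod (z - 1) < (3 / 2) ^ n" using real_arch_pow[of "3/2"] by auto
  then have "1 < (3 / 2) ^ n * cmod (z - 1)" using pos by (simp add: field_simps)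
  with grow[of n] assms[of n] show False by linarith
qed

text \<open>The image of \<open>H\<close> under a character is closed under squaring, so it is
  trivial as soon as it lies in the ball of radius 1/2 around 1. Since \<open>H\<close> is compact,
  this condition defines a subbasic open set.\<close>

lemma annihilator_open:
  fixes H :: "'g::topological_ab_group_add set"
  assumes H: "is_subgroup H" "compact H"
  shows "open (annihilator H)"
proof -
  have H': "\<And>x y. x \<in> H \<Longrightarrow> y \<in> H \<Longrightarrow> x + y \<in> H"
    using H(1) by (auto simp: is_subgroup_def)
  have "annihilator H = {\<gamma>. char_app \<gamma> ` H \<subseteq> ball 1 (1/2)}"
  proof (intro set_eqI iffI)
    fix \<gamma> assume g: "\<gamma> \<in> {\<gamma>. char_app \<gamma> ` H \<subseteq> ball 1 (1/2)}"
    have "char_app \<gamma> x = 1" if x: "x \<in> H" for x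
    proof (rule circle_no_small_subgroups)
      fix n
      have "\<exists>y\<in>H. char_app \<gamma> y = char_app \<gamma> x ^ 2 ^ n"
      proof (induction n)
        case (Suc n)
        then obtain y where y: "y \<in> H" "char_app \<gamma> y = char_app \<gamma> x ^ 2 ^ n" by auto
        have "char_app \<gamma> (y + y) = char_app \<gamma> x ^ 2 ^ Suc n"
          by (simp add: char_app_add_right y power_add[symmetric] mult_2)
        then show ?case using H'[OF y(1) y(1)] by blast
      qed (use x in auto)
      then have "char_app \<gamma> x ^ 2 ^ n \<in> ball 1 (1/2)" using g by force
      then show "cmod (char_app \<gamma> x ^ 2 ^ n - 1) \<le> 1 / 2"
        by (simp add: dist_norm norm_minus_commute less_imp_le)
    qed
    then show "\<gamma> \<in> annihilator H" by (simp add: annihilator_def)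
  qed (auto simp: annihilator_def)
  then show ?thesis
    using H(2) by (auto simp: open_dual_def char_subbasis_def intro!: generate_topology.Basis)
qed

text \<open>The homomorphisms into the circle that are trivial on \<open>H\<close> form a closed set
  \<open>P\<close> in a product of circles, compact by Tychonoff's theorem; openness of
  \<open>H\<close> makes all of them continuous. A compact set meets finitely many cosets of
  \<open>H\<close>, on each of which members of \<open>P\<close> are constant, so pointwise
  convergence in \<open>P\<close> is uniform on compact sets and \<open>Abs_dual\<close> is
  continuous there.\<close>

lemma annihilator_compact:
  fixes H :: "'g::topological_ab_group_add set"
  assumes H: "is_subgroup H" "open H"
  shows "compact (annihilator H)"
proof -
  have H0: "0 \<in> H" using H(1) by (auto simp: is_subgroup_def)
  define P where "P = {\<phi> :: 'g \<Rightarrow> complex. (\<forall>x. cmod (\<phi> x) = 1) \<and> (\<forall>x y. \<phi> (x + y) = \<phi> x * \<phi> y) \<and> (\<forall>x\<in>H. \<phi> x = 1)}"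
  have app: "char_app (Abs_dual \<phi>) = \<phi>" if "\<phi> \<in> P" for \<phi>
    using that by (intro obtain_dual[of \<phi> H "\<lambda>_. 1"] H(2) H0) (auto simp: P_def)
  have "compact {\<phi> :: 'g \<Rightarrow> complex. \<forall>x. \<phi> x \<in> sphere 0 1}"
  proof -
    have "compactin (product_topology (\<lambda>_::'g. euclidean :: complex topology) UNIV) (PiE UNIV (\<lambda>_. sphere 0 1))"
      unfolding compactin_PiE by auto
    moreover have "PiE UNIV (\<lambda>_::'g. sphere (0::complex) 1) = {\<phi>. \<forall>x. \<phi> x \<in> sphere 0 1}"
      by (auto simp: PiE_def Pi_def)
    ultimately show ?thesis by (simp add: euclidean_product_topology compactin_euclidean_iff)
  qed
  moreover have "closed P"
  proof -
    have "P = (\<Inter>x. {\<phi>. cmod (\<phi> x) = 1}) \<inter> (\<Inter>x. \<Inter>y. {\<phi>. \<phi> (x + y) = \<phi> x * \<phi> y}) \<inter> (\<Inter>x\<in>H. {\<phi>. \<phi> x = 1})"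
      by (auto simp: P_def)
    also have "closed \<dots>"
      by (intro closed_Int closed_INT ballI closed_Collect_eq continuous_intros continuous_on_product_coordinates)
    finally show ?thesis .
  qed
  moreover have "P = {\<phi>. \<forall>x. \<phi> x \<in> sphere 0 1} \<inter> P" by (auto simp: P_def)
  ultimately have "compact P" using compact_Int_closed by metis
  moreover have "continuous_on P Abs_dual"
    unfolding continuous_on_def
  proof
    fix \<phi> assume \<phi>: "\<phi> \<in> P"
    show "(Abs_dual \<longlongrightarrow> Abs_dual \<phi>) (at \<phi> within P)"
    proof (rule tendsto_dualI)
      fix L :: "'g set" and e :: real assume L: "compact L" and e: "e > 0"
      have o: "open ((\<lambda>x. x - c) -` H)" for c by (intro open_vimage H(2) continuous_intros)
      have "L \<subseteq> (\<Union>c\<in>L. (\<lambda>x. x - c) -` H)" using H0 by auto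
      then obtain C where C: "C \<subseteq> L" "finite C" "L \<subseteq> (\<Union>c\<in>C. (\<lambda>x. x - c) -` H)"
        by (rule compactE_image[OF L o])
      have "\<forall>\<^sub>F \<psi> in at \<phi> within P. \<forall>c\<in>C. cmod (\<psi> c - \<phi> c) < e"
      proof (rule eventually_ball_finite[OF C(2)], rule ballI)
        fix c
        have "continuous_on P (\<lambda>\<psi> :: 'g \<Rightarrow> complex. \<psi> c)"
          by (rule continuous_on_subset[OF continuous_on_product_coordinates]) simp
        then have "((\<lambda>\<psi>. \<psi> c) \<longlongrightarrow> \<phi> c) (at \<phi> within P)" using \<phi> by (auto simp: continuous_on_def)
        from tendstoD[OF this e] show "\<forall>\<^sub>F \<psi> in at \<phi> within P. cmod (\<psi> c - \<phi> c) < e" by (simp add: dist_norm)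
      qed
      moreover have "\<forall>\<^sub>F \<psi> in at \<phi> within P. \<psi> \<in> P" by (simp add: eventually_at_filter)
      ultimately show "\<forall>\<^sub>F \<psi> in at \<phi> within P. \<forall>x\<in>L. cmod (char_app (Abs_dual \<psi>) x - char_app (Abs_dual \<phi>) x) < e"
      proof eventually_elim
        case (elim \<psi>)
        show ?case
        proof
          fix x assume "x \<in> L"
          then obtain c where c: "c \<in> C" "x - c \<in> H" using C(3) by auto
          have *: "g x = g c" if "g \<in> P" for g
          proof -
            have "g (c + (x - c)) = g c * g (x - c)" using that unfolding P_def by blast
            moreover have "g (x - c) = 1" using that c(2) by (auto simp: P_def)
            ultimately show ?thesis by simp
          qed
          show "cmod (char_app (Abs_dual \<psi>) x - char_app (Abs_dual \<phi>) x) < e"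
            unfolding app[OF \<phi>] app[OF elim(2)] *[OF \<phi>] *[OF elim(2)] using elim(1) c(1) by blast
        qed
      qed
    qed
  qed
  ultimately have "compact (Abs_dual ` P)" by (rule compact_continuous_image[rotated])
  moreover have "Abs_dual ` P = annihilator H"
  proof (intro set_eqI iffI)
    fix \<gamma> assume "\<gamma> \<in> annihilator H"
    then have "char_app \<gamma> \<in> P" by (auto simp: P_def annihilator_def char_app_add_right)
    then show "\<gamma> \<in> Abs_dual ` P" by (intro image_eqI[of _ _ "char_app \<gamma>"]) (simp add: char_app_inverse)
  next
    fix \<gamma> assume "\<gamma> \<in> Abs_dual ` P"
    then obtain \<phi> where "\<phi> \<in> P" "\<gamma> = Abs_dual \<phi>" by auto
    then show "\<gamma> \<in> annihilator H" using app[of \<phi>] by (auto simp: annihilator_def P_def)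
  qed
  ultimately show ?thesis by simp
qed

lemma dual_compact_open_haar:
  assumes "is_subgroup H" "compact H" "open H" "haar_measure \<nu>" "emeasure \<nu> (annihilator H) = 1"
  shows "compact_open_haar \<nu> (annihilator H)"
  using assms is_subgroup_annihilator annihilator_open[OF assms(1,2)] annihilator_compact[OF assms(1,3)]
  by (simp add: compact_open_haar_def)

text \<open>On the dual side the functions are evaluations at points of the group, and they separate
  because distinct characters differ at some point. The counterpart with the roles exchanged is the
  hard one.\<close>

lemma separating_dual:
  fixes H :: "'g::topological_ab_group_add set"
  assumes "compact_open_haar \<nu> (annihilator H)"
  shows "compact_open_haar.separating (annihilator H) (range (\<lambda>(x::'g) \<eta>. char_app \<eta> x))"
proof -
  interpret compact_open_haar \<nu> "annihilator H" by fact
  show ?thesis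
    unfolding separating_def
  proof (intro conjI ballI impI)
    show "continuous_on UNIV u" if "u \<in> range (\<lambda>(x::'g) \<eta>. char_app \<eta> x)" for u
      using that by (auto intro: continuous_char_app)
    show "(\<lambda>_. 1) \<in> range (\<lambda>(x::'g) \<eta>. char_app \<eta> x)" by (intro image_eqI[of _ _ 0]) auto
    fix u assume "u \<in> range (\<lambda>(x::'g) \<eta>. char_app \<eta> x)"
    then obtain x where x: "u = (\<lambda>\<eta>. char_app \<eta> x)" by auto
    show "(\<lambda>x. cnj (u x)) \<in> range (\<lambda>(x::'g) \<eta>. char_app \<eta> x)"
      by (intro image_eqI[of _ _ "- x"]) (auto simp: x char_app_uminus_right)
    fix v assume "v \<in> range (\<lambda>(x::'g) \<eta>. char_app \<eta> x)"
    then obtain y where y: "v = (\<lambda>\<eta>. char_app \<eta> y)" by auto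
    show "(\<lambda>x. u x * v x) \<in> range (\<lambda>(x::'g) \<eta>. char_app \<eta> x)"
      by (intro image_eqI[of _ _ "x + y"]) (auto simp: x y char_app_add_right)
  next
    fix \<eta> \<eta>' :: "'g dual" assume "\<eta> \<noteq> \<eta>'"
    then have "char_app \<eta> \<noteq> char_app \<eta>'" by (simp add: char_app_inject)
    then obtain x where "char_app \<eta> x \<noteq> char_app \<eta>' x" by auto
    then show "\<exists>u\<in>range (\<lambda>(x::'g) \<eta>. char_app \<eta> x). u \<eta> \<noteq> u \<eta>'" by auto
  qed
qed

section \<open>Separation of the points of the compact subgroup by characters\<close>

context compact_open_haar
begin

lemma exists_nonconstant_CK:
  assumes "z \<in> K" "z \<noteq> 0"
  obtains f where "f \<in> CK" "f 0 \<noteq> f z"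
proof -
  have "Hausdorff_space (euclidean :: 'a topology)"
    unfolding Hausdorff_space_def
  proof (intro allI impI)
    fix x y :: 'a assume "x \<in> topspace euclidean \<and> y \<in> topspace euclidean \<and> x \<noteq> y"
    then have "x \<noteq> y" by simp
    from hausdorff[OF this] obtain U V where "open U" "open V" "x \<in> U" "y \<in> V" "U \<inter> V = {}"
      by (elim exE conjE)
    then show "\<exists>U V. openin euclidean U \<and> openin euclidean V \<and> x \<in> U \<and> y \<in> V \<and> disjnt U V"
      by (intro exI[of _ U] exI[of _ V]) (simp add: disjnt_def)
  qed
  then have "Hausdorff_space (top_of_set K)" by (rule Hausdorff_space_subtopology)
  moreover have "compact_space (top_of_set K)" using cpt by (simp add: compact_space_subtopology)
  ultimately have "normal_space (top_of_set K)" by (intro compact_Hausdorff_or_regular_imp_normal_space) auto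
  moreover have "closedin (top_of_set K) {0}" "closedin (top_of_set K) {z}"
    using K_zero assms(1) by (auto intro!: closed_subset)
  moreover have "disjnt {0} {z}" using assms(2) by (simp add: disjnt_def)
  ultimately obtain g where g: "continuous_map (top_of_set K) euclideanreal g" "g ` {0} \<subseteq> {0::real}" "g ` {z} \<subseteq> {1}"
    by (rule Urysohn_lemma_alt)
  define f where "f x = (if x \<in> K then complex_of_real (g x) else 0)" for x
  have "continuous_on (K \<union> - K) f"
  proof (rule continuous_on_open_Un[OF opn])
    show "open (- K)" using K_closed by (simp add: open_Compl)
    have "continuous_on K (\<lambda>x. complex_of_real (g x))"
      using g(1) by (auto intro!: continuous_intros)
    then show "continuous_on K f"
      by (rule continuous_on_eq) (simp add: f_def)
    have "continuous_on (- K) (\<lambda>_. 0 :: complex)" by (rule continuous_on_const)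
    then show "continuous_on (- K) f"
      by (rule continuous_on_eq) (simp add: f_def)
  qed
  then have "f \<in> CK" by (simp add: CK_def f_def)
  moreover have "f 0 \<noteq> f z" using g K_zero assms(1) by (simp add: f_def)
  ultimately show ?thesis by (rule that)
qed

text \<open>The difference of \<open>f\<close> and its translate by \<open>z\<close> is nonzero, so
  some character \<open>u\<close> is not orthogonal to it. Its inner product with \<open>u\<close>
  is \<open>1 - u z\<close> times that of \<open>f\<close>, and hence \<open>u z\<close> is not
  1.\<close>

lemma chars_separate:
  assumes z: "z \<in> K" "z \<noteq> 0"
  obtains u where "u \<in> CK" "\<And>x y. x \<in> K \<Longrightarrow> y \<in> K \<Longrightarrow> u (x + y) = u x * u y"
    "\<And>x. x \<in> K \<Longrightarrow> cmod (u x) = 1" "u z \<noteq> 1"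
proof -
  obtain f where f: "f \<in> CK" "f 0 \<noteq> f z" by (rule exists_nonconstant_CK[OF z])
  let ?s = "\<lambda>x. f (z + x)"
  let ?g = "\<lambda>x. f x - ?s x"
  have s: "?s \<in> CK" by (rule CK_shift[OF f(1) z(1)])
  have g: "?g \<in> CK" by (rule CK_diff[OF f(1) s])
  have "?g 0 \<noteq> 0" using f(2) by simp
  then have "?g \<noteq> (\<lambda>_. 0)" by metis
  then obtain u where u: "u \<in> CK" "\<And>x y. x \<in> K \<Longrightarrow> y \<in> K \<Longrightarrow> u (x + y) = u x * u y"
    "\<And>x. x \<in> K \<Longrightarrow> cmod (u x) = 1" "L2_inner MK ?g u \<noteq> 0"
    by (rule exists_char[OF g]) (rule that)
  have "L2_inner MK ?s u = u z * L2_inner MK f u"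
  proof -
    have m: "(\<lambda>x. u z * (f x * cnj (u x))) \<in> borel_measurable borel"
      by (intro borel_measurable_continuous_onI continuous_intros CK_continuous f u)
    have "(\<integral>x. u z * (f (z + x) * cnj (u (z + x))) \<partial>MK) = (\<integral>x. u z * (f x * cnj (u x)) \<partial>MK)"
      by (rule integral_MK_shift[OF m z(1)])
    moreover have "L2_inner MK ?s u = (\<integral>x. u z * (f (z + x) * cnj (u (z + x))) \<partial>MK)"
      unfolding L2_inner_def
    proof (rule integral_MK_cong)
      fix x assume x: "x \<in> K"
      have "u z * (f (z + x) * cnj (u (z + x))) = (u z * cnj (u z)) * (f (z + x) * cnj (u x))"
        using u(2)[OF z(1) x] by simp
      also have "\<dots> = f (z + x) * cnj (u x)" using mult_cnj_eq_1[OF u(3)[OF z(1)]] by simp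
      finally show "f (z + x) * cnj (u x) = u z * (f (z + x) * cnj (u (z + x)))" by (rule sym)
    qed (intro borel_measurable_continuous_onI continuous_intros CK_continuous[OF s] CK_continuous[OF u(1)]
        CK_compose[OF f(1)] CK_compose[OF u(1)])+
    ultimately show ?thesis by (simp add: L2_inner_def)
  qed
  then have "L2_inner MK ?g u = (1 - u z) * L2_inner MK f u"
    using L2_inner_diff_left[OF CK_L2[OF f(1)] CK_L2[OF s] CK_L2[OF u(1)]] by (simp add: algebra_simps)
  then have "u z \<noteq> 1" using u(4) by auto
  with u(1-3) show ?thesis by (rule that)
qed

theorem separating_char_app: "separating (range char_app)"
  unfolding separating_def
proof (intro conjI ballI impI)
  show "continuous_on UNIV u" if "u \<in> range char_app" for u :: "'a \<Rightarrow> complex"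
    using that char_app_continuous by auto
  show "(\<lambda>_. 1) \<in> range (char_app :: 'a dual \<Rightarrow> _)" by (intro image_eqI[of _ _ 0]) auto
  fix u assume "u \<in> range (char_app :: 'a dual \<Rightarrow> _)"
  then obtain \<gamma> where x: "u = char_app \<gamma>" by auto
  show "(\<lambda>x. cnj (u x)) \<in> range char_app"
    by (intro image_eqI[of _ _ "- \<gamma>"]) (auto simp: x char_app_uminus)
  fix v assume "v \<in> range (char_app :: 'a dual \<Rightarrow> _)"
  then obtain \<delta> where y: "v = char_app \<delta>" by auto
  show "(\<lambda>x. u x * v x) \<in> range char_app"
    by (intro image_eqI[of _ _ "\<gamma> + \<delta>"]) (auto simp: x y char_app_add)
next
  fix x y assume xy: "x \<in> K" "y \<in> K" "x \<noteq> y"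
  have z: "x - y \<in> K" "x - y \<noteq> 0" using xy K_diff by auto
  obtain u where u: "u \<in> CK" "\<And>x y. x \<in> K \<Longrightarrow> y \<in> K \<Longrightarrow> u (x + y) = u x * u y"
    "\<And>x. x \<in> K \<Longrightarrow> cmod (u x) = 1" "u (x - y) \<noteq> 1"
    by (rule chars_separate[OF z]) (rule that)
  obtain \<gamma> where \<gamma>: "\<And>x. x \<in> K \<Longrightarrow> char_app \<gamma> x = u x"
    by (rule char_extension[OF subgroup opn CK_continuous[OF u(1)] u(2,3)]) (assumption | rule that)+
  have "char_app \<gamma> x = char_app \<gamma> (x - y) * char_app \<gamma> y" using char_app_add_right[of \<gamma> "x - y" y] by simp
  moreover have "char_app \<gamma> (x - y) \<noteq> 1" using \<gamma>[OF z(1)] u(4) by simp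
  moreover have "char_app \<gamma> y \<noteq> 0" by (metis cmod_char_app norm_zero zero_neq_one)
  ultimately have "char_app \<gamma> x \<noteq> char_app \<gamma> y" by simp
  then show "\<exists>u\<in>range char_app. u x \<noteq> u y" by auto
qed

end

section \<open>Plancherel's theorem\<close>

context compact_open_haar
begin

lemma emeasure_coset:
  assumes "X \<in> cosets K"
  shows "emeasure M X = 1"
proof -
  obtain a where "X = {x. x - a \<in> K}" by (rule cosetE[OF assms])
  then have "X = (\<lambda>x. a + x) ` K" by (simp add: coset_conv)
  then show ?thesis using haar_invariant[of K a] unit by simp
qed

lemma indicator_coset_L2:
  assumes X: "X \<in> cosets K" and u: "u \<in> borel_measurable borel" "\<And>x. cmod (u x) = 1"
  shows "(\<lambda>x. indicator X x * u x) \<in> L2 M" "integrable M (\<lambda>x. indicator X x * u x)"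
proof -
  have Xs [measurable]: "X \<in> sets borel" by (rule coset_sets[OF X])
  have m: "(\<lambda>x. indicator X x * u x) \<in> borel_measurable borel" using u(1) by measurable
  have i: "integrable M (\<lambda>x. indicator X x :: real)"
    using emeasure_coset[OF X] by (intro integrable_real_indicator) auto
  have "(\<lambda>x. (cmod (indicator X x * u x))\<^sup>2) = (\<lambda>x. indicator X x)"
    using u(2) by (auto simp: indicator_def norm_mult)
  then show "(\<lambda>x. indicator X x * u x) \<in> L2 M" using m i by (simp add: L2_def)
  show "integrable M (\<lambda>x. indicator X x * u x)"
    by (rule Bochner_Integration.integrable_bound[OF i]) (use m u(2) in \<open>auto simp: norm_mult indicator_def\<close>)
qed

lemma integral_coset:
  fixes f :: "'a \<Rightarrow> complex"
  assumes X: "X \<in> cosets K" "a \<in> X" and f [measurable]: "f \<in> borel_measurable borel"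
  shows "(\<integral>x. indicator X x * f x \<partial>M) = (\<integral>x. f (a + x) \<partial>MK)"
proof -
  have Xs [measurable]: "X \<in> sets borel" by (rule coset_sets[OF X(1)])
  have "(\<integral>x. indicator X x * f x \<partial>M) = (\<integral>x. indicator X (a + x) * f (a + x) \<partial>M)"
    by (rule integral_shift[symmetric]) measurable
  also have "\<dots> = (\<integral>x. indicator K x *\<^sub>R f (a + x) \<partial>M)"
    by (rule Bochner_Integration.integral_cong) (auto simp: coset_eqI[OF X] indicator_def)
  also have "\<dots> = (\<integral>x. f (a + x) \<partial>MK)" by (rule integral_MK[symmetric]) measurable
  finally show ?thesis .
qed

lemma L2_shift_integrable_MK:
  assumes f: "f \<in> L2 M"
  shows "integrable MK (\<lambda>x. f (a + x))"
proof (rule Bochner_Integration.integrable_bound)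
  have fm [measurable]: "f \<in> borel_measurable borel" using L2D(1)[OF f] by simp
  have "integrable M (\<lambda>x. (cmod (f (a + x)))\<^sup>2)"
    by (subst integrable_shift_iff[of "\<lambda>x. (cmod (f x))\<^sup>2"]) (use L2D(2)[OF f] in auto)
  then have "integrable M (\<lambda>x. indicator K x *\<^sub>R (cmod (f (a + x)))\<^sup>2)"
    by (rule integrable_mult_indicator[rotated]) simp
  then have "integrable MK (\<lambda>x. (cmod (f (a + x)))\<^sup>2)" by (subst integrable_MK) auto
  then show "integrable MK (\<lambda>x. 1 + (cmod (f (a + x)))\<^sup>2)" by simp
  have "r \<le> 1 + r\<^sup>2" for r :: real
    using sum_squares_bound[of r 1] by simp (use zero_le_power2[of r] in linarith)
  then show "AE x in MK. norm (f (a + x)) \<le> norm (1 + (cmod (f (a + x)))\<^sup>2)"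
    by (simp add: add_nonneg_nonneg)
  show "(\<lambda>x. f (a + x)) \<in> borel_measurable MK" by simp
qed

lemma AE_zero_coset:
  assumes f: "f \<in> L2 M" and X: "separating X" and z: "\<And>u. u \<in> X \<Longrightarrow> (\<integral>x. f (a + x) * u x \<partial>MK) = 0"
  shows "AE x in M. x - a \<in> K \<longrightarrow> f x = 0"
proof -
  have "AE x in MK. f (a + x) = 0"
    by (rule separating_complete[OF X L2_shift_integrable_MK[OF f] z])
  then have "AE x in M. (a + x) - a \<in> K \<longrightarrow> f (a + x) = 0" by (simp add: AE_MK)
  then show ?thesis by (rule AE_shift)
qed

end

locale plancherel =
  fixes \<mu> :: "'g::{topological_ab_group_add,t2_space} measure" and \<nu> :: "'g dual measure"
    and H :: "'g set" and C :: "'g dual set"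
  assumes G: "compact_open_haar \<mu> H" and D: "compact_open_haar \<nu> (annihilator H)"
    and C: "coset_reps (annihilator H) C"
begin

sublocale G: compact_open_haar \<mu> H by (rule G)
sublocale D: compact_open_haar \<nu> "annihilator H" by (rule D)

abbreviation "HP \<equiv> annihilator H"

lemma char_app_measurable [measurable]: "char_app \<gamma> \<in> borel_measurable borel"
  by (rule borel_measurable_continuous_onI[OF char_app_continuous])

lemma char_app_measurable' [measurable]: "(\<lambda>\<gamma>::'g dual. char_app \<gamma> x) \<in> borel_measurable borel"
  by (rule borel_measurable_continuous_onI[OF continuous_char_app])

lemma HP_const: "\<eta> \<in> HP \<Longrightarrow> x - y \<in> H \<Longrightarrow> char_app \<eta> x = char_app \<eta> y"
  using char_app_add_right[of \<eta> "x - y" y] by (simp add: annihilator_def)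

lemma coset_ex1: "Y \<in> cosets HP \<Longrightarrow> \<exists>!c. c \<in> C \<and> c \<in> Y"
  using C unfolding coset_reps_def by (rule bspec)

lemma sigma_part_unique:
  assumes "\<sigma> \<in> C" "\<gamma> - \<sigma> \<in> HP"
  shows "sigma_part H C \<gamma> = \<sigma>"
proof -
  let ?X = "{\<delta>. \<delta> - \<gamma> \<in> HP}"
  have X: "?X \<in> cosets HP" by (rule D.coset_mem)
  have 1: "sigma_part H C \<gamma> \<in> C" "sigma_part H C \<gamma> \<in> ?X"
    using sigma_part_eta_part[OF C, of \<gamma>] D.K_diff_commute[of \<gamma>] by (auto simp: eta_part_def)
  have 2: "\<sigma> \<in> ?X" using assms(2) D.K_diff_commute[of \<gamma>] by simp
  from coset_ex1[OF X] obtain c where "\<forall>y. y \<in> C \<and> y \<in> ?X \<longrightarrow> y = c" by (rule ex1E)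
  then have "sigma_part H C \<gamma> = c" "\<sigma> = c" using 1 2 assms(1) by auto
  then show ?thesis by simp
qed

lemma sigma_eta_add:
  assumes "\<sigma> \<in> C" "\<eta> \<in> HP"
  shows "sigma_part H C (\<sigma> + \<eta>) = \<sigma>" "eta_part H C (\<sigma> + \<eta>) = \<eta>"
proof -
  show s: "sigma_part H C (\<sigma> + \<eta>) = \<sigma>" using assms by (intro sigma_part_unique) auto
  show "eta_part H C (\<sigma> + \<eta>) = \<eta>" unfolding eta_part_def s by simp
qed

lemma C_diff_HP: "\<sigma> \<in> C \<Longrightarrow> \<tau> \<in> C \<Longrightarrow> \<tau> - \<sigma> \<in> HP \<longleftrightarrow> \<tau> = \<sigma>"
  using sigma_part_unique[of \<sigma> \<tau>] sigma_part_unique[of \<tau> \<tau>] D.K_zero by auto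

text \<open>The same choice as in \<open>weight\<close>, so that weights and basis functions use the
  same representative.\<close>

definition rep :: "'g set \<Rightarrow> 'g" where
  "rep X = (SOME x. x \<in> X)"

lemma rep_mem:
  assumes "X \<in> cosets H"
  shows "rep X \<in> X"
proof -
  obtain a where "a \<in> X" by (rule G.cosetE[OF assms])
  then show ?thesis unfolding rep_def by (rule someI)
qed

lemma rep_coset: "X \<in> cosets H \<Longrightarrow> x - rep X \<in> H \<longleftrightarrow> x \<in> X"
  using G.coset_eqI[OF _ rep_mem] by blast

definition wave :: "'g set \<times> 'g dual \<Rightarrow> 'g \<Rightarrow> complex" where
  "wave i x = indicator (fst i) x * char_app (snd i) x"

text \<open>The transform of \<open>wave i\<close> in closed form. On the coset of \<sigma> the
  difference from \<sigma> lies in the annihilator, so the value is that of a character of the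
  annihilator and depends on the coset of \<open>H\<close> only.\<close>

definition dwave :: "'g set \<times> 'g dual \<Rightarrow> 'g dual \<Rightarrow> complex" where
  "dwave i \<gamma> = indicator {\<delta>. \<delta> - snd i \<in> HP} \<gamma> * cnj (char_app (\<gamma> - snd i) (rep (fst i)))"

abbreviation "I \<equiv> cosets H \<times> C"

lemma wave_L2: "i \<in> I \<Longrightarrow> wave i \<in> L2 \<mu>" and wave_integrable: "i \<in> I \<Longrightarrow> integrable \<mu> (wave i)"
  unfolding wave_def[abs_def] by (auto intro!: G.indicator_coset_L2)

lemma dwave_L2: "dwave i \<in> L2 \<nu>" and dwave_integrable: "integrable \<nu> (dwave i)"
proof -
  have "(\<lambda>\<gamma>. cnj (char_app (\<gamma> - snd i) (rep (fst i)))) \<in> borel_measurable borel" by measurable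
  then show "dwave i \<in> L2 \<nu>" "integrable \<nu> (dwave i)"
    unfolding dwave_def[abs_def] by (auto intro!: D.indicator_coset_L2 D.coset_mem)
qed

lemma integral_char_MK:
  "(\<integral>h. char_app \<gamma> h \<partial>G.MK) = (if \<gamma> \<in> HP then 1 else 0)"
proof (cases "\<gamma> \<in> HP")
  case True
  then have "(\<integral>h. char_app \<gamma> h \<partial>G.MK) = (\<integral>h. 1 \<partial>G.MK)"
    by (intro G.integral_MK_cong) (auto simp: annihilator_def)
  then show ?thesis using True by simp
next
  case False
  then obtain a where "a \<in> H" "char_app \<gamma> a \<noteq> 1" by (auto simp: annihilator_def)
  then have "(\<integral>h. char_app \<gamma> h \<partial>G.MK) = 0"
    by (intro G.integral_char_zero[of _ a]) (auto simp: char_app_add_right)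
  then show ?thesis using False by simp
qed

text \<open>Off \<open>H\<close> the integral vanishes because some element of the annihilator is
  nontrivial at \<open>x\<close>. The existence of that element is where extension of characters
  from the open subgroup enters.\<close>

lemma integral_dual_char_MK:
  "(\<integral>\<eta>. char_app \<eta> x \<partial>D.MK) = (if x \<in> H then 1 else 0)"
proof (cases "x \<in> H")
  case True
  then have "(\<integral>\<eta>. char_app \<eta> x \<partial>D.MK) = (\<integral>\<eta>. 1 \<partial>D.MK)"
    by (intro D.integral_MK_cong) (auto simp: annihilator_def)
  then show ?thesis using True by simp
next
  case False
  obtain \<gamma> where "\<gamma> \<in> HP" "char_app \<gamma> x \<noteq> 1"
    by (rule annihilator_separates[OF G.subgroup G.opn False])
  then have "(\<integral>\<eta>. char_app \<eta> x \<partial>D.MK) = 0"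
    by (intro D.integral_char_zero[of _ \<gamma>]) (auto simp: char_app_add)
  then show ?thesis using False by simp
qed

lemma fourier_wave:
  assumes i: "i \<in> I"
  shows "fourier_integral \<mu> (wave i) = dwave i"
proof
  fix \<gamma>
  obtain X \<sigma> where X: "i = (X, \<sigma>)" "X \<in> cosets H" using i by auto
  have "fourier_integral \<mu> (wave i) \<gamma> = (\<integral>x. indicator X x * char_app (\<sigma> - \<gamma>) x \<partial>\<mu>)"
    unfolding fourier_integral_def wave_def X by (simp add: char_app_diff mult.assoc)
  also have "\<dots> = (\<integral>h. char_app (\<sigma> - \<gamma>) (rep X + h) \<partial>G.MK)"
    by (rule G.integral_coset[OF X(2) rep_mem[OF X(2)]]) measurable
  also have "\<dots> = char_app (\<sigma> - \<gamma>) (rep X) * (if \<sigma> - \<gamma> \<in> HP then 1 else 0)"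
    by (simp add: char_app_add_right integral_char_MK)
  also have "char_app (\<sigma> - \<gamma>) (rep X) = cnj (char_app (\<gamma> - \<sigma>) (rep X))"
    using char_app_uminus[of "\<gamma> - \<sigma>"] by simp
  finally show "fourier_integral \<mu> (wave i) \<gamma> = dwave i \<gamma>"
    by (simp add: dwave_def X indicator_def D.K_diff_commute[of \<sigma>])
qed

text \<open>Waves on different cosets have disjoint supports. On a common coset the inner product is
  the transform of one wave at the frequency of the other, which has already been computed.\<close>

lemma wave_orthonormal: "orthonormal \<mu> I wave"
  unfolding orthonormal_def
proof (intro conjI ballI)
  fix i assume "i \<in> I" then show "wave i \<in> L2 \<mu>" by (rule wave_L2)
next
  fix i j assume i: "i \<in> I" and j: "j \<in> I"
  show "L2_inner \<mu> (wave i) (wave j) = (if i = j then 1 else 0)"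
  proof (cases "fst i = fst j")
    case False
    then have "fst i \<inter> fst j = {}" using i j G.coset_eq by fastforce
    then have "wave i x * cnj (wave j x) = 0" for x by (auto simp: wave_def indicator_def)
    then have "L2_inner \<mu> (wave i) (wave j) = 0"
      unfolding L2_inner_def by (simp only: Bochner_Integration.integral_zero)
    then show ?thesis using False by auto
  next
    case True
    have "wave i x * cnj (wave j x) = wave i x * cnj (char_app (snd j) x)" for x
      using True by (auto simp: wave_def indicator_def)
    then have "L2_inner \<mu> (wave i) (wave j) = dwave i (snd j)"
      unfolding L2_inner_def fourier_wave[OF i, symmetric] fourier_integral_def by (simp only:)
    then show ?thesis using i j True C_diff_HP[of "snd i" "snd j"]
      by (auto simp: dwave_def indicator_def prod_eq_iff)
  qed
qed

lemma integral_dual_coset: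
  fixes f :: "'g dual \<Rightarrow> complex"
  assumes "f \<in> borel_measurable borel"
  shows "(\<integral>\<gamma>. indicator {\<delta>. \<delta> - \<sigma> \<in> HP} \<gamma> * f \<gamma> \<partial>\<nu>) = (\<integral>\<eta>. f (\<sigma> + \<eta>) \<partial>D.MK)"
  by (rule D.integral_coset[OF D.coset_mem assms])

lemma dwave_orthonormal: "orthonormal \<nu> I dwave"
  unfolding orthonormal_def
proof (intro conjI ballI)
  fix i show "dwave i \<in> L2 \<nu>" by (rule dwave_L2)
next
  fix i j assume i: "i \<in> I" and j: "j \<in> I"
  show "L2_inner \<nu> (dwave i) (dwave j) = (if i = j then 1 else 0)"
  proof (cases "snd i = snd j")
    case False
    have "dwave i \<gamma> * cnj (dwave j \<gamma>) = 0" for \<gamma>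
    proof -
      have "\<not> (\<gamma> - snd i \<in> HP \<and> \<gamma> - snd j \<in> HP)"
        using sigma_part_unique[of "snd i" \<gamma>] sigma_part_unique[of "snd j" \<gamma>] i j False by auto
      then show ?thesis by (auto simp: dwave_def indicator_def)
    qed
    then have "L2_inner \<nu> (dwave i) (dwave j) = 0"
      unfolding L2_inner_def by (simp only: Bochner_Integration.integral_zero)
    then show ?thesis using False by auto
  next
    case True
    let ?x = "rep (fst i)" and ?y = "rep (fst j)" and ?\<sigma> = "snd i"
    let ?f = "\<lambda>\<gamma>. cnj (char_app (\<gamma> - ?\<sigma>) ?x) * char_app (\<gamma> - ?\<sigma>) ?y"
    have "dwave i \<gamma> * cnj (dwave j \<gamma>) = indicator {\<delta>. \<delta> - ?\<sigma> \<in> HP} \<gamma> * ?f \<gamma>" for \<gamma>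
      using True by (auto simp: dwave_def indicator_def)
    then have "L2_inner \<nu> (dwave i) (dwave j) = (\<integral>\<gamma>. indicator {\<delta>. \<delta> - ?\<sigma> \<in> HP} \<gamma> * ?f \<gamma> \<partial>\<nu>)"
      unfolding L2_inner_def by (simp only:)
    also have "\<dots> = (\<integral>\<eta>. ?f (?\<sigma> + \<eta>) \<partial>D.MK)" by (rule integral_dual_coset) measurable
    also have "\<dots> = (\<integral>\<eta>. char_app \<eta> (?y - ?x) \<partial>D.MK)"
      by (rule Bochner_Integration.integral_cong)
        (simp_all add: diff_conv_add_uminus[of ?y] char_app_add_right char_app_uminus_right mult.commute del: add_uminus_conv_diff)
    also have "\<dots> = (if ?y \<in> fst i then 1 else 0)"
      using i rep_coset[of "fst i" ?y] by (auto simp: integral_dual_char_MK)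
    also have "?y \<in> fst i \<longleftrightarrow> i = j"
    proof -
      have ij: "fst i \<in> cosets H" "fst j \<in> cosets H" using i j by auto
      have "?y \<in> fst i \<longleftrightarrow> fst i = fst j"
        using G.coset_eq[OF ij _ rep_mem[OF ij(2)]] rep_mem[OF ij(2)] by auto
      then show ?thesis using True by (simp add: prod_eq_iff)
    qed
    finally show ?thesis .
  qed
qed

lemma wave_total: "total_family \<mu> I wave"
  unfolding total_family_def
proof (intro ballI impI)
  fix f assume f: "f \<in> L2 \<mu>" and z: "\<forall>i\<in>I. L2_inner \<mu> f (wave i) = 0"
  have fm [measurable]: "f \<in> borel_measurable borel" using L2D(1)[OF f] by simp
  show "AE x in \<mu>. f x = 0"
  proof (rule G.AE_zero_cosets[OF f])
    fix X assume X: "X \<in> cosets H"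
    have "AE x in \<mu>. x - rep X \<in> H \<longrightarrow> f x = 0"
    proof (rule G.AE_zero_coset[OF f G.separating_char_app])
      fix u assume "u \<in> range (char_app :: 'g dual \<Rightarrow> _)"
      then obtain \<gamma> where u: "u = char_app \<gamma>" by auto
      \<comment> \<open>The representative of \<open>- \<gamma>\<close>, because the inner product
        conjugates the wave.\<close>
      define \<sigma> where "\<sigma> = sigma_part H C (- \<gamma>)"
      have \<sigma>: "\<sigma> \<in> C" "- \<gamma> - \<sigma> \<in> HP"
        using sigma_part_eta_part[OF C, of "- \<gamma>"] by (auto simp: \<sigma>_def eta_part_def)
      have eq: "char_app \<gamma> h = cnj (char_app \<sigma> h)" if "h \<in> H" for h
      proof -
        have "char_app (- \<gamma> - \<sigma>) h = 1" using \<sigma>(2) that by (simp add: annihilator_def)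
        then have "cnj (char_app \<gamma> h) * cnj (char_app \<sigma> h) = 1" by (simp add: char_app_diff char_app_uminus)
        then have "char_app \<gamma> h * (cnj (char_app \<gamma> h) * cnj (char_app \<sigma> h)) = char_app \<gamma> h" by simp
        then show ?thesis by (simp add: mult.assoc[symmetric])
      qed
      have "0 = L2_inner \<mu> f (wave (X, \<sigma>))" using z X \<sigma>(1) by simp
      also have "\<dots> = (\<integral>x. indicator X x * (f x * cnj (char_app \<sigma> x)) \<partial>\<mu>)"
        unfolding L2_inner_def wave_def
        by (rule Bochner_Integration.integral_cong) (auto simp: indicator_def)
      also have "\<dots> = (\<integral>h. f (rep X + h) * cnj (char_app \<sigma> (rep X + h)) \<partial>G.MK)"
        by (rule G.integral_coset[OF X rep_mem[OF X]]) measurable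
      also have "\<dots> = (\<integral>h. cnj (char_app \<sigma> (rep X)) * (f (rep X + h) * u h) \<partial>G.MK)"
        by (rule G.integral_MK_cong) (auto simp: u eq char_app_add_right)
      also have "\<dots> = cnj (char_app \<sigma> (rep X)) * (\<integral>h. f (rep X + h) * u h \<partial>G.MK)" by simp
      finally show "(\<integral>h. f (rep X + h) * u h \<partial>G.MK) = 0"
        by (metis complex_cnj_zero_iff cmod_char_app mult_eq_0_iff norm_zero zero_neq_one)
    qed
    then show "AE x in \<mu>. x \<in> X \<longrightarrow> f x = 0" by (simp only: rep_coset[OF X])
  qed
qed

lemma dwave_total: "total_family \<nu> I dwave"
  unfolding total_family_def
proof (intro ballI impI)
  fix F assume F: "F \<in> L2 \<nu>" and z: "\<forall>i\<in>I. L2_inner \<nu> F (dwave i) = 0"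
  have Fm [measurable]: "F \<in> borel_measurable borel" using L2D(1)[OF F] by simp
  show "AE \<gamma> in \<nu>. F \<gamma> = 0"
  proof (rule D.AE_zero_cosets[OF F])
    fix Y assume Y: "Y \<in> cosets HP"
    obtain \<sigma> where \<sigma>: "\<sigma> \<in> C" "\<sigma> \<in> Y" using ex1_implies_ex[OF coset_ex1[OF Y]] by (elim exE conjE)
    have "AE \<gamma> in \<nu>. \<gamma> - \<sigma> \<in> HP \<longrightarrow> F \<gamma> = 0"
    proof (rule D.AE_zero_coset[OF F separating_dual[OF D]])
      fix u assume "u \<in> range (\<lambda>(x::'g) \<eta>. char_app \<eta> x)"
      then obtain x where u: "u = (\<lambda>\<eta>. char_app \<eta> x)" by auto
      define X where "X = {y. y - x \<in> H}"
      have X: "X \<in> cosets H" "x \<in> X" unfolding X_def by (rule G.coset_mem)+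
      have "0 = L2_inner \<nu> F (dwave (X, \<sigma>))" using z X \<sigma>(1) by simp
      also have "\<dots> = (\<integral>\<gamma>. indicator {\<delta>. \<delta> - \<sigma> \<in> HP} \<gamma> * (F \<gamma> * char_app (\<gamma> - \<sigma>) (rep X)) \<partial>\<nu>)"
        unfolding L2_inner_def dwave_def
        by (rule Bochner_Integration.integral_cong) (auto simp: indicator_def)
      also have "\<dots> = (\<integral>\<eta>. F (\<sigma> + \<eta>) * char_app (\<sigma> + \<eta> - \<sigma>) (rep X) \<partial>D.MK)"
        by (rule integral_dual_coset) measurable
      also have "\<dots> = (\<integral>\<eta>. F (\<sigma> + \<eta>) * u \<eta> \<partial>D.MK)"
      proof (rule D.integral_MK_cong)
        fix \<eta> assume "\<eta> \<in> HP"
        then have "char_app \<eta> (rep X) = char_app \<eta> x"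
          using G.coset_diff[OF X(1) rep_mem[OF X(1)] X(2)] by (rule HP_const)
        then show "F (\<sigma> + \<eta>) * char_app (\<sigma> + \<eta> - \<sigma>) (rep X) = F (\<sigma> + \<eta>) * u \<eta>" by (simp add: u)
      qed (simp_all add: u)
      finally show "(\<integral>\<eta>. F (\<sigma> + \<eta>) * u \<eta> \<partial>D.MK) = 0" by simp
    qed
    then show "AE \<gamma> in \<nu>. \<gamma> \<in> Y \<longrightarrow> F \<gamma> = 0" using D.coset_eqI[OF Y \<sigma>(2)] by simp
  qed
qed

text \<open>On the coset of \<open>\<sigma>\<close> the transform of an integrable function is a Fourier series whose
  coefficients are the integrals against \<open>\<sigma>\<close> over the cosets of \<open>H\<close>. This replaces Fubini's theorem,
  which is not available because the measures need not be \<open>\<sigma>\<close>-finite.\<close>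

lemma fourier_integral_dwave:
  assumes s: "integrable \<mu> s" and S: "fourier_integral \<mu> s \<in> L2 \<nu>" and X: "X \<in> cosets H" and \<sigma>: "\<sigma> \<in> C"
  shows "L2_inner \<nu> (fourier_integral \<mu> s) (dwave (X, \<sigma>)) = L2_inner \<mu> s (wave (X, \<sigma>))"
proof -
  have sm [measurable]: "s \<in> borel_measurable borel" using borel_measurable_integrable[OF s] by simp
  have Sm: "fourier_integral \<mu> s \<in> borel_measurable borel" using L2D(1)[OF S] by simp
  define a where "a Y = L2_inner \<mu> s (wave (Y, \<sigma>))" for Y
  let ?supp = "G.supp_cosets s"
  have cs: "countable ?supp" using s by (intro G.supp_cosets_countable[of s 1]) auto
  \<comment> \<open>An increasing exhaustion of the countable set of supporting cosets by finite
    sets.\<close>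
  define P where "P n = {Y \<in> ?supp. to_nat_on ?supp Y < n}" for n
  have Pfin: "finite (P n)" for n
  proof (rule finite_imageD)
    show "finite (to_nat_on ?supp ` P n)" by (rule finite_subset[of _ "{..<n}"]) (auto simp: P_def)
    show "inj_on (to_nat_on ?supp) (P n)"
      by (rule inj_on_subset[OF inj_on_to_nat_on[OF cs]]) (auto simp: P_def)
  qed
  have Psub: "P n \<subseteq> cosets H" for n using G.supp_cosets_cosets by (auto simp: P_def)
  define t where "t n x = (\<Sum>Y\<in>P n. indicator Y x * s x)" for n x
  have Ys: "Y \<in> sets borel" if "Y \<in> P n" for Y n using subsetD[OF Psub that] by (rule G.coset_sets)
  have tm [measurable]: "t n \<in> borel_measurable borel" for n
    unfolding t_def[abs_def] by (intro borel_measurable_sum borel_measurable_times borel_measurable_indicator Ys) auto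
  have t_eq: "t n x = (if \<exists>Y\<in>P n. x \<in> Y then s x else 0)" for n x
  proof (cases "\<exists>Y\<in>P n. x \<in> Y")
    case True
    then obtain Y where Y: "Y \<in> P n" "x \<in> Y" by auto
    have "t n x = (\<Sum>Z\<in>P n. if Z = Y then s x else 0)"
      unfolding t_def
    proof (rule sum.cong)
      fix Z assume Z: "Z \<in> P n"
      have "x \<in> Z \<longleftrightarrow> Z = Y" using G.coset_eq[of Z Y x] Psub[of n] Z Y by auto
      then show "indicator Z x * s x = (if Z = Y then s x else 0)" by (simp add: indicator_def)
    qed simp
    then show ?thesis using Y Pfin by auto
  next
    case False
    then have "t n x = 0" unfolding t_def by (intro sum.neutral) (auto simp: indicator_def)
    then show ?thesis using False by simp
  qed
  have t_le: "cmod (t n x) \<le> cmod (s x)" for n x by (simp add: t_eq)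
  have t_int: "integrable \<mu> (t n)" for n
    by (rule Bochner_Integration.integrable_bound[OF s]) (use t_le in auto)
  have t_lim: "(\<lambda>n. t n x) \<longlonglongrightarrow> s x" for x
  proof (cases "s x = 0")
    case True
    then have "t n x = s x" for n by (simp add: t_eq)
    then show ?thesis by simp
  next
    case False
    define Y where "Y = {y. y - x \<in> H}"
    have Y: "Y \<in> ?supp" "x \<in> Y"
      unfolding Y_def G.supp_cosets_def using G.coset_mem[of x] False by (auto intro!: exI[of _ x])
    have "\<forall>\<^sub>F n in sequentially. t n x = s x"
      using eventually_gt_at_top[of "to_nat_on ?supp Y"]
    proof eventually_elim
      case (elim n)
      then have "Y \<in> P n" using Y by (simp add: P_def)
      then show ?case using Y by (auto simp: t_eq)
    qed
    then show ?thesis by (rule tendsto_eventually)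
  qed
  have T_lim: "(\<lambda>n. fourier_integral \<mu> (t n) \<gamma>) \<longlonglongrightarrow> fourier_integral \<mu> s \<gamma>" for \<gamma>
    unfolding fourier_integral_def
  proof (rule integral_dominated_convergence[where w = "\<lambda>x. cmod (s x)"])
    show "AE x in \<mu>. (\<lambda>n. t n x * cnj (char_app \<gamma> x)) \<longlonglongrightarrow> s x * cnj (char_app \<gamma> x)"
      by (intro AE_I2 tendsto_intros t_lim)
    show "AE x in \<mu>. cmod (t n x * cnj (char_app \<gamma> x)) \<le> cmod (s x)" for n
      using t_le by (simp add: norm_mult)
  qed (use s in auto)
  \<comment> \<open>A bound uniform in \<open>n\<close> and \<gamma>. Together with the
    integrability of \<open>dwave (X, \<sigma>)\<close> it provides the dominating function on the
    dual side.\<close>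
  have T_bd: "cmod (fourier_integral \<mu> (t n) \<gamma>) \<le> (\<integral>x. cmod (s x) \<partial>\<mu>)" for n \<gamma>
  proof -
    have "cmod (fourier_integral \<mu> (t n) \<gamma>) \<le> (\<integral>x. cmod (t n x * cnj (char_app \<gamma> x)) \<partial>\<mu>)"
      unfolding fourier_integral_def by (rule integral_norm_bound)
    also have "\<dots> \<le> (\<integral>x. cmod (s x) \<partial>\<mu>)"
      using t_int s t_le by (intro integral_mono) (auto simp: norm_mult)
    finally show ?thesis .
  qed
  \<comment> \<open>The factor \<open>cnj (dwave (X, \<sigma>) \<gamma>)\<close> restricts \<gamma>
    to the coset of \<sigma>. There \<gamma> is \<sigma> times a function constant on each coset
    \<open>Y\<close>, so each piece of the transform is a coefficient times a
    \<open>dwave\<close>.\<close>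
  have T_eq: "fourier_integral \<mu> (t n) \<gamma> * cnj (dwave (X, \<sigma>) \<gamma>)
      = (\<Sum>Y\<in>P n. a Y * (dwave (Y, \<sigma>) \<gamma> * cnj (dwave (X, \<sigma>) \<gamma>)))" for n \<gamma>
  proof (cases "\<gamma> - \<sigma> \<in> HP")
    case True
    have iY: "integrable \<mu> (\<lambda>x. indicator Y x * s x * cnj (char_app \<gamma> x))" if "Y \<in> P n" for Y
      by (rule Bochner_Integration.integrable_bound[OF s])
        (use Ys[OF that] in \<open>auto simp: norm_mult indicator_def\<close>)
    have "fourier_integral \<mu> (t n) \<gamma> = (\<integral>x. (\<Sum>Y\<in>P n. indicator Y x * s x * cnj (char_app \<gamma> x)) \<partial>\<mu>)"
      unfolding fourier_integral_def t_def by (simp add: sum_distrib_right)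
    also have "\<dots> = (\<Sum>Y\<in>P n. (\<integral>x. indicator Y x * s x * cnj (char_app \<gamma> x) \<partial>\<mu>))"
      by (rule Bochner_Integration.integral_sum) (rule iY)
    also have "\<dots> = (\<Sum>Y\<in>P n. a Y * dwave (Y, \<sigma>) \<gamma>)"
    proof (rule sum.cong)
      fix Y assume "Y \<in> P n"
      then have Y: "Y \<in> cosets H" using Psub by auto
      have eq: "char_app \<gamma> x = char_app \<sigma> x * char_app (\<gamma> - \<sigma>) (rep Y)" if "x \<in> Y" for x
      proof -
        have "char_app \<gamma> x = char_app \<sigma> x * char_app (\<gamma> - \<sigma>) x"
          using char_app_add[of \<sigma> "\<gamma> - \<sigma>" x] by simp
        then show ?thesis using HP_const[OF True] rep_coset[OF Y] that by simp
      qed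
      have "(\<integral>x. indicator Y x * s x * cnj (char_app \<gamma> x) \<partial>\<mu>)
          = (\<integral>x. (s x * cnj (wave (Y, \<sigma>) x)) * cnj (char_app (\<gamma> - \<sigma>) (rep Y)) \<partial>\<mu>)"
        by (rule Bochner_Integration.integral_cong) (auto simp: indicator_def wave_def eq)
      also have "\<dots> = a Y * cnj (char_app (\<gamma> - \<sigma>) (rep Y))"
        unfolding a_def L2_inner_def by (rule integral_mult_left_zero)
      finally show "(\<integral>x. indicator Y x * s x * cnj (char_app \<gamma> x) \<partial>\<mu>) = a Y * dwave (Y, \<sigma>) \<gamma>"
        using True by (simp add: dwave_def)
    qed simp
    finally show ?thesis by (simp add: sum_distrib_right mult.assoc)
  qed (simp add: dwave_def)
  have on: "(\<integral>\<gamma>. dwave (Y, \<sigma>) \<gamma> * cnj (dwave (X, \<sigma>) \<gamma>) \<partial>\<nu>) = (if Y = X then 1 else 0)" if "Y \<in> cosets H" for Y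
  proof -
    have "(Y, \<sigma>) \<in> I" "(X, \<sigma>) \<in> I" using that X \<sigma> by auto
    then have "L2_inner \<nu> (dwave (Y, \<sigma>)) (dwave (X, \<sigma>)) = (if (Y, \<sigma>) = (X, \<sigma>) then 1 else 0)"
      using dwave_orthonormal by (simp add: orthonormal_def)
    then show ?thesis by (simp add: L2_inner_def)
  qed
  have dm [measurable]: "dwave i \<in> borel_measurable borel" for i using L2D(1)[OF dwave_L2] by simp
  have part: "(\<integral>\<gamma>. fourier_integral \<mu> (t n) \<gamma> * cnj (dwave (X, \<sigma>) \<gamma>) \<partial>\<nu>) = (if X \<in> P n then a X else 0)" for n
  proof -
    have "(\<integral>\<gamma>. fourier_integral \<mu> (t n) \<gamma> * cnj (dwave (X, \<sigma>) \<gamma>) \<partial>\<nu>)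
        = (\<Sum>Y\<in>P n. a Y * (\<integral>\<gamma>. dwave (Y, \<sigma>) \<gamma> * cnj (dwave (X, \<sigma>) \<gamma>) \<partial>\<nu>))"
      unfolding T_eq by (simp add: L2_mult_integrable dwave_L2)
    also have "\<dots> = (\<Sum>Y\<in>P n. if Y = X then a Y else 0)"
    proof (rule sum.cong)
      fix Y assume "Y \<in> P n"
      then show "a Y * (\<integral>\<gamma>. dwave (Y, \<sigma>) \<gamma> * cnj (dwave (X, \<sigma>) \<gamma>) \<partial>\<nu>) = (if Y = X then a Y else 0)"
        using on[OF subsetD[OF Psub]] by simp
    qed simp
    finally show ?thesis using Pfin by simp
  qed
  have "(\<lambda>n. \<integral>\<gamma>. fourier_integral \<mu> (t n) \<gamma> * cnj (dwave (X, \<sigma>) \<gamma>) \<partial>\<nu>) \<longlonglongrightarrow> L2_inner \<nu> (fourier_integral \<mu> s) (dwave (X, \<sigma>))"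
    unfolding L2_inner_def
  proof (rule integral_dominated_convergence[where w = "\<lambda>\<gamma>. (\<integral>x. cmod (s x) \<partial>\<mu>) * cmod (dwave (X, \<sigma>) \<gamma>)"])
    show "(\<lambda>\<gamma>. fourier_integral \<mu> s \<gamma> * cnj (dwave (X, \<sigma>) \<gamma>)) \<in> borel_measurable \<nu>"
      using Sm by simp
    show "(\<lambda>\<gamma>. fourier_integral \<mu> (t n) \<gamma> * cnj (dwave (X, \<sigma>) \<gamma>)) \<in> borel_measurable \<nu>" for n
      unfolding T_eq by simp
    show "integrable \<nu> (\<lambda>\<gamma>. (\<integral>x. cmod (s x) \<partial>\<mu>) * cmod (dwave (X, \<sigma>) \<gamma>))"
      by (intro integrable_mult_right integrable_norm dwave_integrable)
    show "AE \<gamma> in \<nu>. (\<lambda>n. fourier_integral \<mu> (t n) \<gamma> * cnj (dwave (X, \<sigma>) \<gamma>)) \<longlonglongrightarrow> fourier_integral \<mu> s \<gamma> * cnj (dwave (X, \<sigma>) \<gamma>)"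
      by (intro AE_I2 tendsto_intros T_lim)
    show "AE \<gamma> in \<nu>. cmod (fourier_integral \<mu> (t n) \<gamma> * cnj (dwave (X, \<sigma>) \<gamma>)) \<le> (\<integral>x. cmod (s x) \<partial>\<mu>) * cmod (dwave (X, \<sigma>) \<gamma>)" for n
      unfolding norm_mult complex_mod_cnj by (intro AE_I2 mult_right_mono T_bd) simp
  qed
  moreover have "(\<lambda>n. if X \<in> P n then a X else 0) \<longlonglongrightarrow> a X"
  proof (cases "X \<in> ?supp")
    case True
    have "\<forall>\<^sub>F n in sequentially. (if X \<in> P n then a X else 0) = a X"
      using eventually_gt_at_top[of "to_nat_on ?supp X"] by eventually_elim (simp add: P_def True)
    then show ?thesis by (rule tendsto_eventually)
  next
    case False
    then have "s x = 0" if "x \<in> X" for x using X that by (auto simp: G.supp_cosets_def)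
    then have "s x * cnj (wave (X, \<sigma>) x) = 0" for x by (auto simp: wave_def indicator_def)
    then have "a X = 0" unfolding a_def L2_inner_def by (simp only: Bochner_Integration.integral_zero)
    then have eq: "(\<lambda>n. if X \<in> P n then a X else 0) = (\<lambda>_. a X)" by (intro ext) simp
    show ?thesis unfolding eq by (rule tendsto_const)
  qed
  ultimately show ?thesis unfolding part a_def by (rule LIMSEQ_unique)
qed

text \<open>Equality of the coefficients in the two orthonormal bases says that \<open>F\<close> is the transform of \<open>f\<close>.\<close>

definition fourier_pair :: "('g \<Rightarrow> complex) \<Rightarrow> ('g dual \<Rightarrow> complex) \<Rightarrow> bool" where
  "fourier_pair f F \<longleftrightarrow> f \<in> L2 \<mu> \<and> F \<in> L2 \<nu> \<and> (\<forall>i\<in>I. L2_inner \<nu> F (dwave i) = L2_inner \<mu> f (wave i))"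

lemma fourier_pair_L2: "fourier_pair f F \<Longrightarrow> f \<in> L2 \<mu>" "fourier_pair f F \<Longrightarrow> F \<in> L2 \<nu>"
  by (auto simp: fourier_pair_def)

text \<open>Parseval's identity in both bases sums the same coefficients. Applied to differences,
  this isometry also yields uniqueness of transforms.\<close>

lemma fourier_pair_norm:
  assumes "fourier_pair f F"
  shows "L2_norm \<mu> f = L2_norm \<nu> F"
proof -
  have "ennreal ((L2_norm \<mu> f)\<^sup>2) = (\<Sum>\<^sub>\<infinity>i\<in>I. ennreal ((cmod (L2_inner \<mu> f (wave i)))\<^sup>2))"
    by (rule Parseval[OF wave_orthonormal wave_total fourier_pair_L2(1)[OF assms], symmetric])
  also have "\<dots> = (\<Sum>\<^sub>\<infinity>i\<in>I. ennreal ((cmod (L2_inner \<nu> F (dwave i)))\<^sup>2))"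
    using assms by (intro infsum_cong) (auto simp: fourier_pair_def)
  also have "\<dots> = ennreal ((L2_norm \<nu> F)\<^sup>2)"
    by (rule Parseval[OF dwave_orthonormal dwave_total fourier_pair_L2(2)[OF assms]])
  finally have "(L2_norm \<mu> f)\<^sup>2 = (L2_norm \<nu> F)\<^sup>2" by simp
  then show ?thesis by (rule power2_eq_imp_eq) simp_all
qed

lemma fourier_pair_add:
  assumes "fourier_pair f F" "fourier_pair g G"
  shows "fourier_pair (\<lambda>x. f x + g x) (\<lambda>x. F x + G x)"
  using assms by (auto simp: fourier_pair_def L2_add L2_inner_add_left wave_L2 dwave_L2)

lemma fourier_pair_scale:
  assumes "fourier_pair f F"
  shows "fourier_pair (\<lambda>x. c * f x) (\<lambda>x. c * F x)"
  using assms by (auto simp: fourier_pair_def L2_scale L2_inner_scale_left)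

lemma fourier_pair_diff:
  assumes "fourier_pair f F" "fourier_pair g G"
  shows "fourier_pair (\<lambda>x. f x - g x) (\<lambda>x. F x - G x)"
  using fourier_pair_add[OF assms(1) fourier_pair_scale[OF assms(2), of "-1"]] by simp

lemma fourier_pair_zero: "fourier_pair (\<lambda>_. 0) (\<lambda>_. 0)"
  by (simp add: fourier_pair_def L2_inner_def)

lemma fourier_pair_lincomb:
  assumes "\<And>j. j \<in> J \<Longrightarrow> fourier_pair (u j) (U j)"
  shows "fourier_pair (\<lambda>x. \<Sum>j\<in>J. c j * u j x) (\<lambda>x. \<Sum>j\<in>J. c j * U j x)"
  using assms
proof (induction J rule: infinite_finite_induct)
  case (insert j J)
  have "fourier_pair (\<lambda>x. c j * u j x + (\<Sum>j\<in>J. c j * u j x)) (\<lambda>x. c j * U j x + (\<Sum>j\<in>J. c j * U j x))"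
    by (intro fourier_pair_add fourier_pair_scale insert) auto
  then show ?case using insert by simp
qed (auto simp: fourier_pair_zero)

text \<open>Polarisation: pairs are closed under sums and preserve norms. Replacing one function by
  \<open>\<i>\<close> times itself then handles the imaginary part.\<close>

lemma fourier_pair_Re_inner:
  assumes "fourier_pair f F" "fourier_pair g G"
  shows "Re (L2_inner \<mu> f g) = Re (L2_inner \<nu> F G)"
  using L2_norm_add_power2[OF fourier_pair_L2(1)[OF assms(1)] fourier_pair_L2(1)[OF assms(2)]]
    L2_norm_add_power2[OF fourier_pair_L2(2)[OF assms(1)] fourier_pair_L2(2)[OF assms(2)]]
    fourier_pair_norm[OF assms(1)] fourier_pair_norm[OF assms(2)] fourier_pair_norm[OF fourier_pair_add[OF assms]] by simp

lemma fourier_pair_inner: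
  assumes "fourier_pair f F" "fourier_pair g G"
  shows "L2_inner \<mu> f g = L2_inner \<nu> F G"
  using fourier_pair_Re_inner[OF assms] fourier_pair_Re_inner[OF assms(1) fourier_pair_scale[OF assms(2), of \<i>]]
  by (simp add: complex_eq_iff L2_inner_scale_right)

lemma fourier_pair_AE_cong:
  assumes "fourier_pair f F" "G \<in> borel_measurable borel" "AE \<gamma> in \<nu>. F \<gamma> = G \<gamma>"
  shows "fourier_pair f G"
proof -
  have GL: "G \<in> L2 \<nu>" using assms by (intro L2_AE_cong[OF fourier_pair_L2(2)[OF assms(1)]]) auto
  have "L2_inner \<nu> G (dwave i) = L2_inner \<nu> F (dwave i)" for i
    unfolding L2_inner_cnj[of \<nu> _ "dwave i"] using assms(3)
    by (intro arg_cong[of _ _ cnj] L2_inner_AE_cong L2D(1)[OF dwave_L2] L2D(1)[OF GL] L2D(1)[OF fourier_pair_L2(2)[OF assms(1)]]) auto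
  then show ?thesis using assms(1) GL by (simp add: fourier_pair_def)
qed

lemma fourier_pair_unique:
  assumes "fourier_pair f F" "fourier_pair f G"
  shows "AE \<gamma> in \<nu>. F \<gamma> = G \<gamma>"
proof -
  have d: "fourier_pair (\<lambda>_. 0) (\<lambda>\<gamma>. F \<gamma> - G \<gamma>)" using fourier_pair_diff[OF assms] by simp
  have "L2_norm \<nu> (\<lambda>\<gamma>. F \<gamma> - G \<gamma>) = 0" using fourier_pair_norm[OF d] by (simp add: L2_norm_def)
  then show ?thesis using L2_norm_zero_iff[OF fourier_pair_L2(2)[OF d]] by simp
qed

lemma fourier_pair_limit:
  assumes f: "f \<in> L2 \<mu>" and F: "F \<in> L2 \<nu>"
    and s: "\<And>n. integrable \<mu> (s n) \<and> s n \<in> L2 \<mu> \<and> fourier_integral \<mu> (s n) \<in> L2 \<nu>"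
    and "(\<lambda>n. L2_norm \<mu> (\<lambda>x. s n x - f x)) \<longlonglongrightarrow> 0"
    and "(\<lambda>n. L2_norm \<nu> (\<lambda>\<gamma>. fourier_integral \<mu> (s n) \<gamma> - F \<gamma>)) \<longlonglongrightarrow> 0"
  shows "fourier_pair f F"
  unfolding fourier_pair_def
proof (intro conjI f F ballI)
  fix i assume i: "i \<in> I"
  obtain X \<sigma> where X: "i = (X, \<sigma>)" "X \<in> cosets H" "\<sigma> \<in> C" using i by auto
  have "(\<lambda>n. L2_inner \<mu> (s n) (wave i)) \<longlonglongrightarrow> L2_inner \<mu> f (wave i)"
    by (rule L2_inner_tendsto[OF _ f wave_L2[OF i] assms(4)]) (use s in simp)
  moreover have "(\<lambda>n. L2_inner \<nu> (fourier_integral \<mu> (s n)) (dwave i)) \<longlonglongrightarrow> L2_inner \<nu> F (dwave i)"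
    by (rule L2_inner_tendsto[OF _ F dwave_L2 assms(5)]) (use s in simp)
  moreover have "L2_inner \<nu> (fourier_integral \<mu> (s n)) (dwave i) = L2_inner \<mu> (s n) (wave i)" for n
    unfolding X(1) using s by (intro fourier_integral_dwave X) auto
  ultimately show "L2_inner \<nu> F (dwave i) = L2_inner \<mu> f (wave i)"
    using LIMSEQ_unique by simp
qed

text \<open>The approximating sequence consists of partial sums in the waves: they are integrable
  and square integrable, and their transforms are the same partial sums in the dual waves. The sets
  \<open>J n\<close> come from Riesz-Fischer on the dual side.\<close>

lemma fourier_L2_exists:
  assumes f: "f \<in> L2 \<mu>"
  shows "\<exists>F. F \<in> L2 \<nu> \<and> (\<exists>s :: nat \<Rightarrow> 'g \<Rightarrow> complex.
        (\<forall>n. integrable \<mu> (s n) \<and> s n \<in> L2 \<mu> \<and> fourier_integral \<mu> (s n) \<in> L2 \<nu>) \<and>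
        (\<lambda>n. L2_norm \<mu> (\<lambda>x. s n x - f x)) \<longlonglongrightarrow> 0 \<and>
        (\<lambda>n. L2_norm \<nu> (\<lambda>\<gamma>. fourier_integral \<mu> (s n) \<gamma> - F \<gamma>)) \<longlonglongrightarrow> 0)"
proof -
  define c where "c i = L2_inner \<mu> f (wave i)" for i
  have "\<exists>F J. F \<in> L2 \<nu> \<and> (\<forall>i\<in>I. L2_inner \<nu> F (dwave i) = c i) \<and> (\<forall>n::nat. finite (J n) \<and> J n \<subseteq> I)
      \<and> (\<lambda>n. L2_norm \<nu> (\<lambda>x. (\<Sum>j\<in>J n. c j * dwave j x) - F x)) \<longlonglongrightarrow> 0"
    by (rule Riesz_Fischer[OF dwave_orthonormal])
      (use Bessel(2)[OF wave_orthonormal _ _ f] in \<open>auto simp: c_def\<close>)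
  then obtain F J where F: "F \<in> L2 \<nu>" "\<forall>i\<in>I. L2_inner \<nu> F (dwave i) = c i"
    and J: "\<forall>n::nat. finite (J n) \<and> J n \<subseteq> I"
    and lim: "(\<lambda>n. L2_norm \<nu> (\<lambda>x. (\<Sum>j\<in>J n. c j * dwave j x) - F x)) \<longlonglongrightarrow> 0"
    by (elim exE conjE)
  have r: "fourier_pair f F" using f F by (simp add: fourier_pair_def c_def)
  define s where "s n x = (\<Sum>j\<in>J n. c j * wave j x)" for n x
  have JI: "j \<in> I" if "j \<in> J n" for j n using J[rule_format, of n] that by auto
  have sL: "s n \<in> L2 \<mu>" for n unfolding s_def[abs_def] by (intro L2_lincomb wave_L2 JI)
  have si: "integrable \<mu> (s n)" for n
    unfolding s_def[abs_def] by (intro Bochner_Integration.integrable_sum integrable_mult_right wave_integrable JI)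
  have sf: "fourier_integral \<mu> (s n) = (\<lambda>\<gamma>. \<Sum>j\<in>J n. c j * dwave j \<gamma>)" for n
  proof
    fix \<gamma>
    have wi: "integrable \<mu> (\<lambda>x. wave j x * cnj (char_app \<gamma> x))" if "j \<in> J n" for j
      by (rule Bochner_Integration.integrable_bound[OF wave_integrable[OF JI[OF that]]])
        (use L2D(1)[OF wave_L2[OF JI[OF that]]] in \<open>auto simp: norm_mult\<close>)
    have "fourier_integral \<mu> (s n) \<gamma> = (\<integral>x. (\<Sum>j\<in>J n. c j * (wave j x * cnj (char_app \<gamma> x))) \<partial>\<mu>)"
      unfolding fourier_integral_def s_def by (simp add: sum_distrib_right mult.assoc)
    also have "\<dots> = (\<Sum>j\<in>J n. (\<integral>x. c j * (wave j x * cnj (char_app \<gamma> x)) \<partial>\<mu>))"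
      by (intro Bochner_Integration.integral_sum integrable_mult_right wi)
    also have "\<dots> = (\<Sum>j\<in>J n. c j * fourier_integral \<mu> (wave j) \<gamma>)"
      unfolding fourier_integral_def by simp
    also have "\<dots> = (\<Sum>j\<in>J n. c j * dwave j \<gamma>)"
      using JI by (intro sum.cong refl) (simp add: fourier_wave)
    finally show "fourier_integral \<mu> (s n) \<gamma> = (\<Sum>j\<in>J n. c j * dwave j \<gamma>)" .
  qed
  have FL: "fourier_integral \<mu> (s n) \<in> L2 \<nu>" for n unfolding sf by (intro L2_lincomb dwave_L2)
  have "fourier_pair (s n) (fourier_integral \<mu> (s n))" for n
    unfolding fourier_pair_def using sL FL fourier_integral_dwave[OF si FL] by auto
  then have "fourier_pair (\<lambda>x. s n x - f x) (\<lambda>\<gamma>. fourier_integral \<mu> (s n) \<gamma> - F \<gamma>)" for n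
    by (rule fourier_pair_diff[OF _ r])
  \<comment> \<open>Convergence on the group is not proved separately: the isometry makes the two
    errors equal.\<close>
  then have eq: "L2_norm \<mu> (\<lambda>x. s n x - f x) = L2_norm \<nu> (\<lambda>\<gamma>. fourier_integral \<mu> (s n) \<gamma> - F \<gamma>)" for n
    by (rule fourier_pair_norm)
  have lim': "(\<lambda>n. L2_norm \<nu> (\<lambda>\<gamma>. fourier_integral \<mu> (s n) \<gamma> - F \<gamma>)) \<longlonglongrightarrow> 0" unfolding sf by (rule lim)
  show ?thesis
    by (intro exI[of _ F] exI[of _ s] conjI F(1) allI si sL FL lim') (unfold eq, rule lim')
qed

theorem fourier_pair_fourier_L2:
  assumes f: "f \<in> L2 \<mu>"
  shows "fourier_pair f (fourier_L2 \<mu> \<nu> f)"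
proof -
  from someI_ex[OF fourier_L2_exists[OF f]]
  obtain s where F: "fourier_L2 \<mu> \<nu> f \<in> L2 \<nu>"
    and s: "\<forall>n. integrable \<mu> (s n) \<and> s n \<in> L2 \<mu> \<and> fourier_integral \<mu> (s n) \<in> L2 \<nu>"
    and l: "(\<lambda>n. L2_norm \<mu> (\<lambda>x. s n x - f x)) \<longlonglongrightarrow> 0"
      "(\<lambda>n. L2_norm \<nu> (\<lambda>\<gamma>. fourier_integral \<mu> (s n) \<gamma> - fourier_L2 \<mu> \<nu> f \<gamma>)) \<longlonglongrightarrow> 0"
    unfolding fourier_L2_def[symmetric] by (elim exE conjE)
  show ?thesis by (rule fourier_pair_limit[OF f F _ l]) (rule spec[OF s])
qed

lemma fourier_pair_surj:
  assumes F: "F \<in> L2 \<nu>"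
  obtains f where "fourier_pair f F"
proof -
  have "\<exists>f J. f \<in> L2 \<mu> \<and> (\<forall>i\<in>I. L2_inner \<mu> f (wave i) = L2_inner \<nu> F (dwave i)) \<and> (\<forall>n::nat. finite (J n) \<and> J n \<subseteq> I)
      \<and> (\<lambda>n. L2_norm \<mu> (\<lambda>x. (\<Sum>j\<in>J n. L2_inner \<nu> F (dwave j) * wave j x) - f x)) \<longlonglongrightarrow> 0"
    by (rule Riesz_Fischer[OF wave_orthonormal]) (rule Bessel(2)[OF dwave_orthonormal _ _ F])
  then obtain f where "f \<in> L2 \<mu>" "\<forall>i\<in>I. L2_inner \<mu> f (wave i) = L2_inner \<nu> F (dwave i)"
    by (elim exE conjE)
  then show ?thesis using F by (intro that[of f]) (simp add: fourier_pair_def)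
qed

text \<open>\<open>SOME\<close> returns some function whose chosen transform agrees with
  \<open>F\<close> almost everywhere, existence being surjectivity of the transform. As pairs are
  insensitive to null sets on the dual side, \<open>F\<close> itself may replace that
  transform.\<close>

theorem fourier_pair_inv_fourier_L2:
  assumes F: "F \<in> L2 \<nu>"
  shows "fourier_pair (inv_fourier_L2 \<mu> \<nu> F) F"
proof -
  obtain f where r: "fourier_pair f F" by (rule fourier_pair_surj[OF F])
  have "f \<in> L2 \<mu> \<and> (AE \<gamma> in \<nu>. fourier_L2 \<mu> \<nu> f \<gamma> = F \<gamma>)"
    using fourier_pair_L2(1)[OF r] fourier_pair_unique[OF fourier_pair_fourier_L2[OF fourier_pair_L2(1)[OF r]] r] by simp
  then have "\<exists>f. f \<in> L2 \<mu> \<and> (AE \<gamma> in \<nu>. fourier_L2 \<mu> \<nu> f \<gamma> = F \<gamma>)" by (intro exI[of _ f])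
  from someI_ex[OF this]
  have *: "inv_fourier_L2 \<mu> \<nu> F \<in> L2 \<mu>" "AE \<gamma> in \<nu>. fourier_L2 \<mu> \<nu> (inv_fourier_L2 \<mu> \<nu> F) \<gamma> = F \<gamma>"
    unfolding inv_fourier_L2_def[symmetric] by auto
  show ?thesis
    by (rule fourier_pair_AE_cong[OF fourier_pair_fourier_L2[OF *(1)] _ *(2)]) (use L2D(1)[OF F] in simp)
qed

end

section \<open>Frames for closed spans\<close>

definition lincombs :: "'i set \<Rightarrow> ('i \<Rightarrow> 'a \<Rightarrow> complex) \<Rightarrow> ('a \<Rightarrow> complex) set" where
  "lincombs J u = {\<lambda>x. \<Sum>j\<in>I. c j * u j x | I c. finite I \<and> I \<subseteq> J}"

lemma lincombsI: "finite I \<Longrightarrow> I \<subseteq> J \<Longrightarrow> (\<lambda>x. \<Sum>j\<in>I. c j * u j x) \<in> lincombs J u"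
  by (auto simp: lincombs_def)

lemma lincombsE:
  assumes "g \<in> lincombs J u"
  obtains I c where "finite I" "I \<subseteq> J" "g = (\<lambda>x. \<Sum>j\<in>I. c j * u j x)"
  using assms by (auto simp: lincombs_def)

lemma lincombs_single: "j \<in> J \<Longrightarrow> (\<lambda>x. c * u j x) \<in> lincombs J u"
  using lincombsI[of "{j}" J "\<lambda>_. c" u] by simp

lemma lincombs_add:
  assumes "g \<in> lincombs J u" "h \<in> lincombs J u"
  shows "(\<lambda>x. g x + h x) \<in> lincombs J u"
proof -
  obtain I c where I: "finite I" "I \<subseteq> J" "g = (\<lambda>x. \<Sum>j\<in>I. c j * u j x)" by (rule lincombsE[OF assms(1)])
  obtain L d where L: "finite L" "L \<subseteq> J" "h = (\<lambda>x. \<Sum>j\<in>L. d j * u j x)" by (rule lincombsE[OF assms(2)])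
  define c' where "c' j = (if j \<in> I then c j else 0)" for j
  define d' where "d' j = (if j \<in> L then d j else 0)" for j
  have 1: "(\<Sum>j\<in>I. c j * u j x) = (\<Sum>j\<in>I \<union> L. c' j * u j x)" for x
    by (rule sum.mono_neutral_cong_left) (use I L in \<open>auto simp: c'_def\<close>)
  have 2: "(\<Sum>j\<in>L. d j * u j x) = (\<Sum>j\<in>I \<union> L. d' j * u j x)" for x
    by (rule sum.mono_neutral_cong_left) (use I L in \<open>auto simp: d'_def\<close>)
  have "(\<lambda>x. g x + h x) = (\<lambda>x. \<Sum>j\<in>I \<union> L. (c' j + d' j) * u j x)"
    unfolding I(3) L(3) 1 2 by (simp add: distrib_right sum.distrib)
  also have "\<dots> \<in> lincombs J u" using I L by (intro lincombsI) auto
  finally show ?thesis .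
qed

lemma lincombs_scale:
  assumes "g \<in> lincombs J u"
  shows "(\<lambda>x. c * g x) \<in> lincombs J u"
proof -
  obtain I d where I: "finite I" "I \<subseteq> J" "g = (\<lambda>x. \<Sum>j\<in>I. d j * u j x)" by (rule lincombsE[OF assms(1)])
  have "(\<lambda>x. c * g x) = (\<lambda>x. \<Sum>j\<in>I. (c * d j) * u j x)"
    by (simp add: I(3) sum_distrib_left mult.assoc)
  also have "\<dots> \<in> lincombs J u" using I by (intro lincombsI)
  finally show ?thesis .
qed

lemma lincombs_diff:
  assumes "g \<in> lincombs J u" "h \<in> lincombs J u"
  shows "(\<lambda>x. g x - h x) \<in> lincombs J u"
  using lincombs_add[OF assms(1) lincombs_scale[OF assms(2), of "-1"]] by simp

lemma lincombs_L2:
  assumes "\<And>j. j \<in> J \<Longrightarrow> u j \<in> L2 M" "g \<in> lincombs J u"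
  shows "g \<in> L2 M"
proof -
  obtain I c where I: "finite I" "I \<subseteq> J" "g = (\<lambda>x. \<Sum>j\<in>I. c j * u j x)" by (rule lincombsE[OF assms(2)])
  show ?thesis unfolding I(3) using I(2) assms(1) by (intro L2_lincomb) auto
qed

lemma L2_closed_span_sequence:
  assumes "g \<in> L2_closed_span M J u"
  obtains s :: "nat \<Rightarrow> 'a \<Rightarrow> complex" where "\<And>n. s n \<in> lincombs J u" "(\<lambda>n. L2_norm M (\<lambda>x. s n x - g x)) \<longlonglongrightarrow> 0"
proof -
  have "\<exists>h. h \<in> lincombs J u \<and> L2_norm M (\<lambda>x. h x - g x) < inverse (real (Suc n))" for n
  proof -
    have "inverse (real (Suc n)) > 0" by simp
    then obtain I c where "finite I" "I \<subseteq> J" "L2_norm M (\<lambda>x. g x - (\<Sum>j\<in>I. c j * u j x)) < inverse (real (Suc n))"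
      using assms unfolding L2_closed_span_def by blast
    then show ?thesis
      by (intro exI[of _ "\<lambda>x. \<Sum>j\<in>I. c j * u j x"]) (simp add: lincombsI L2_norm_diff_commute[of M _ g])
  qed
  then obtain s where s: "\<And>n. s n \<in> lincombs J u" "\<And>n. L2_norm M (\<lambda>x. s n x - g x) < inverse (real (Suc n))"
    by metis
  have "(\<lambda>n. L2_norm M (\<lambda>x. s n x - g x)) \<longlonglongrightarrow> 0"
    by (rule tendsto_sandwich[OF _ _ tendsto_const LIMSEQ_inverse_real_of_nat])
      (use less_imp_le[OF s(2)] in \<open>auto intro!: always_eventually simp del: of_nat_Suc\<close>)
  with s(1) show ?thesis by (rule that)
qed

lemma L2_closed_span_limit:
  assumes g: "g \<in> L2 M" and s: "\<And>n. s n \<in> lincombs J u" and lim: "(\<lambda>n. L2_norm M (\<lambda>x. s n x - g x)) \<longlonglongrightarrow> 0"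
  shows "g \<in> L2_closed_span M J u"
  unfolding L2_closed_span_def
proof (intro CollectI conjI allI impI g)
  fix e :: real assume "e > 0"
  then obtain n where n: "L2_norm M (\<lambda>x. s n x - g x) < e" using LIMSEQ_D[OF lim, of e] by auto
  obtain I c where I: "finite I" "I \<subseteq> J" "s n = (\<lambda>x. \<Sum>j\<in>I. c j * u j x)" by (rule lincombsE[OF s])
  have "L2_norm M (\<lambda>x. g x - (\<Sum>j\<in>I. c j * u j x)) < e"
    using n unfolding I(3) by (simp add: L2_norm_diff_commute[of M g])
  with I show "\<exists>F c. finite F \<and> F \<subseteq> J \<and> L2_norm M (\<lambda>x. g x - (\<Sum>j\<in>F. c j * u j x)) < e" by blast
qed

text \<open>The upper bound makes the analysis operator continuous, so both inequalities pass to the closure.\<close>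

lemma frame_closure:
  fixes u :: "'i \<Rightarrow> 'a \<Rightarrow> complex"
  assumes u: "\<And>j. j \<in> J \<Longrightarrow> u j \<in> L2 M" and A: "A > 0" and B: "B > 0"
    and low: "\<And>g. g \<in> lincombs J u \<Longrightarrow> ennreal (A * (L2_norm M g)\<^sup>2) \<le> (\<Sum>\<^sub>\<infinity>j\<in>J. ennreal ((cmod (L2_inner M g (u j)))\<^sup>2))"
    and upp: "\<And>g. g \<in> lincombs J u \<Longrightarrow> (\<Sum>\<^sub>\<infinity>j\<in>J. ennreal ((cmod (L2_inner M g (u j)))\<^sup>2)) \<le> ennreal (B * (L2_norm M g)\<^sup>2)"
  shows "L2_frame_with M (L2_closed_span M J u) J u A B"
proof -
  \<comment> \<open>Formulated for every limit of linear combinations, because it is applied to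
    \<open>g\<close> and also to the differences \<open>s n - g\<close>.\<close>
  have fin: "(\<Sum>j\<in>I. (cmod (L2_inner M h (u j)))\<^sup>2) \<le> B * (L2_norm M h)\<^sup>2"
    if I: "finite I" "I \<subseteq> J" and h: "h \<in> L2 M" and s: "\<And>n. s n \<in> lincombs J u"
      and lim: "(\<lambda>n. L2_norm M (\<lambda>x. s n x - h x)) \<longlonglongrightarrow> 0" for I h and s :: "nat \<Rightarrow> 'a \<Rightarrow> complex"
  proof (rule LIMSEQ_le)
    have sL: "s n \<in> L2 M" for n by (rule lincombs_L2[OF u s])
    show "(\<lambda>n. \<Sum>j\<in>I. (cmod (L2_inner M (s n) (u j)))\<^sup>2) \<longlonglongrightarrow> (\<Sum>j\<in>I. (cmod (L2_inner M h (u j)))\<^sup>2)"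
      using I(2) u by (intro tendsto_intros L2_inner_tendsto[OF sL h _ lim]) auto
    show "(\<lambda>n. B * (L2_norm M (s n))\<^sup>2) \<longlonglongrightarrow> B * (L2_norm M h)\<^sup>2"
      by (intro tendsto_intros L2_norm_tendsto[OF sL h lim])
    have "(\<Sum>j\<in>I. (cmod (L2_inner M (s n) (u j)))\<^sup>2) \<le> B * (L2_norm M (s n))\<^sup>2" for n
    proof -
      have "(\<Sum>j\<in>I. ennreal ((cmod (L2_inner M (s n) (u j)))\<^sup>2)) \<le> ennreal (B * (L2_norm M (s n))\<^sup>2)"
        using upp[OF s[of n]] I unfolding infsum_ennreal_le_iff by auto
      then show ?thesis using B by simp
    qed
    then show "\<exists>N. \<forall>n\<ge>N. (\<Sum>j\<in>I. (cmod (L2_inner M (s n) (u j)))\<^sup>2) \<le> B * (L2_norm M (s n))\<^sup>2" by blast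
  qed
  show ?thesis
    unfolding L2_frame_with_def
  proof
    fix g assume gV: "g \<in> L2_closed_span M J u"
    then have g: "g \<in> L2 M" by (simp add: L2_closed_span_def)
    obtain s :: "nat \<Rightarrow> 'a \<Rightarrow> complex" where s: "\<And>n. s n \<in> lincombs J u"
      and lim: "(\<lambda>n. L2_norm M (\<lambda>x. s n x - g x)) \<longlonglongrightarrow> 0" by (rule L2_closed_span_sequence[OF gV]) (rule that)
    have sL: "s n \<in> L2 M" for n by (rule lincombs_L2[OF u s])
    let ?S = "\<Sum>\<^sub>\<infinity>j\<in>J. ennreal ((cmod (L2_inner M g (u j)))\<^sup>2)"
    have up: "?S \<le> ennreal (B * (L2_norm M g)\<^sup>2)"
      unfolding infsum_ennreal_le_iff
    proof (intro allI impI)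
      fix I assume "finite I" "I \<subseteq> J"
      then have "(\<Sum>j\<in>I. (cmod (L2_inner M g (u j)))\<^sup>2) \<le> B * (L2_norm M g)\<^sup>2" by (rule fin[OF _ _ g s lim])
      then show "(\<Sum>j\<in>I. ennreal ((cmod (L2_inner M g (u j)))\<^sup>2)) \<le> ennreal (B * (L2_norm M g)\<^sup>2)"
        by (simp add: ennreal_leI)
    qed
    then have "?S < \<infinity>" using ennreal_less_top le_less_trans by fastforce
    then obtain r where r: "?S = ennreal r" "r \<ge> 0" by (cases ?S) auto
    define d where "d n = L2_norm M (\<lambda>x. s n x - g x)" for n
    \<comment> \<open>The coefficients of \<open>s n\<close> are those of \<open>g\<close> plus
      those of \<open>s n - g\<close>. By Minkowski's inequality for finite sums their square sums
      have root at most \<open>sqrt r\<close> plus \<open>sqrt B * d n\<close>, and the lower bound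
      for \<open>s n\<close> is compared with this.\<close>
    have bd: "A * (L2_norm M (s n))\<^sup>2 \<le> (sqrt r + sqrt B * d n)\<^sup>2" for n
    proof -
      have dL: "(\<lambda>x. s n x - g x) \<in> L2 M" by (intro L2_diff sL g)
      have "(\<Sum>\<^sub>\<infinity>j\<in>J. ennreal ((cmod (L2_inner M (s n) (u j)))\<^sup>2)) \<le> ennreal ((sqrt r + sqrt B * d n)\<^sup>2)"
        unfolding infsum_ennreal_le_iff
      proof (intro allI impI)
        fix I assume I: "finite I" "I \<subseteq> J"
        have "(\<Sum>j\<in>I. ennreal ((cmod (L2_inner M g (u j)))\<^sup>2)) \<le> ?S"
          using I infsum_ennreal_le_iff[of "\<lambda>j. ennreal ((cmod (L2_inner M g (u j)))\<^sup>2)" J ?S] by simp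
        then have 1: "L2_set (\<lambda>j. cmod (L2_inner M g (u j))) I \<le> sqrt r"
          unfolding r(1) L2_set_def using r(2) by (simp add: sum_nonneg)
        have "(\<Sum>j\<in>I. (cmod (L2_inner M (\<lambda>x. s n x - g x) (u j)))\<^sup>2) \<le> B * (d n)\<^sup>2"
          unfolding d_def
        proof (rule fin[OF I dL])
          show "(\<lambda>x. s n x - s m x) \<in> lincombs J u" for m by (intro lincombs_diff s)
          have "(\<lambda>x. (s n x - s m x) - (s n x - g x)) = (\<lambda>x. g x - s m x)" for m by auto
          then show "(\<lambda>m. L2_norm M (\<lambda>x. (s n x - s m x) - (s n x - g x))) \<longlonglongrightarrow> 0"
            using lim by (simp add: L2_norm_diff_commute[of M g])
        qed
        then have "L2_set (\<lambda>j. cmod (L2_inner M (\<lambda>x. s n x - g x) (u j))) I \<le> sqrt (B * (d n)\<^sup>2)"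
          unfolding L2_set_def by (rule real_sqrt_le_mono)
        then have 2: "L2_set (\<lambda>j. cmod (L2_inner M (\<lambda>x. s n x - g x) (u j))) I \<le> sqrt B * d n"
          by (simp add: real_sqrt_mult d_def)
        have "L2_set (\<lambda>j. cmod (L2_inner M (s n) (u j))) I
            \<le> L2_set (\<lambda>j. cmod (L2_inner M g (u j)) + cmod (L2_inner M (\<lambda>x. s n x - g x) (u j))) I"
        proof (rule L2_set_mono)
          fix j assume "j \<in> I"
          then have "u j \<in> L2 M" using I u by auto
          then have "L2_inner M (s n) (u j) = L2_inner M g (u j) + L2_inner M (\<lambda>x. s n x - g x) (u j)"
            by (simp add: L2_inner_diff_left sL g)
          then show "cmod (L2_inner M (s n) (u j)) \<le> cmod (L2_inner M g (u j)) + cmod (L2_inner M (\<lambda>x. s n x - g x) (u j))"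
            by (simp only: norm_triangle_ineq)
        qed simp
        also have "\<dots> \<le> sqrt r + sqrt B * d n"
          using L2_set_triangle_ineq[of "\<lambda>j. cmod (L2_inner M g (u j))" "\<lambda>j. cmod (L2_inner M (\<lambda>x. s n x - g x) (u j))" I] 1 2
          by linarith
        finally have "(L2_set (\<lambda>j. cmod (L2_inner M (s n) (u j))) I)\<^sup>2 \<le> (sqrt r + sqrt B * d n)\<^sup>2"
          by (intro power_mono) (auto simp: L2_set_nonneg)
        then show "(\<Sum>j\<in>I. ennreal ((cmod (L2_inner M (s n) (u j)))\<^sup>2)) \<le> ennreal ((sqrt r + sqrt B * d n)\<^sup>2)"
          unfolding L2_set_def by (simp add: sum_nonneg ennreal_leI)
      qed
      with low[OF s[of n]] have "ennreal (A * (L2_norm M (s n))\<^sup>2) \<le> ennreal ((sqrt r + sqrt B * d n)\<^sup>2)"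
        by (rule order_trans)
      then show ?thesis by simp
    qed
    have "A * (L2_norm M g)\<^sup>2 \<le> (sqrt r + sqrt B * 0)\<^sup>2"
    proof (rule LIMSEQ_le)
      show "(\<lambda>n. A * (L2_norm M (s n))\<^sup>2) \<longlonglongrightarrow> A * (L2_norm M g)\<^sup>2"
        by (intro tendsto_intros L2_norm_tendsto[OF sL g lim])
      show "(\<lambda>n. (sqrt r + sqrt B * d n)\<^sup>2) \<longlonglongrightarrow> (sqrt r + sqrt B * 0)\<^sup>2"
        unfolding d_def by (intro tendsto_intros lim)
    qed (use bd in blast)
    then have "ennreal (A * (L2_norm M g)\<^sup>2) \<le> ?S" unfolding r(1) using r(2) by (intro ennreal_leI) simp
    with up show "ennreal (A * (L2_norm M g)\<^sup>2) \<le> ?S \<and> ?S \<le> ennreal (B * (L2_norm M g)\<^sup>2)" by simp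
  qed
qed

section \<open>The spectral symbol\<close>

context plancherel
begin

text \<open>Cosets of the annihilator are open, and on each of them the map is a translation by the
  common representative.\<close>

lemma eta_part_continuous: "continuous_on UNIV (eta_part H C)"
proof -
  have "(eta_part H C \<longlongrightarrow> eta_part H C a) (at a)" for a
  proof (rule Lim_transform_eventually)
    let ?\<sigma> = "sigma_part H C a"
    have \<sigma>: "?\<sigma> \<in> C" "a - ?\<sigma> \<in> HP" using sigma_part_eta_part[OF C, of a] by (auto simp: eta_part_def)
    show "((\<lambda>\<gamma>. \<gamma> - ?\<sigma>) \<longlongrightarrow> eta_part H C a) (at a)"
      unfolding eta_part_def diff_conv_add_uminus by (intro tendsto_intros)
    have "open {\<gamma>. \<gamma> - ?\<sigma> \<in> HP}" by (rule D.coset_open[OF D.coset_mem(1)])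
    moreover have "\<gamma> - ?\<sigma> = eta_part H C \<gamma>" if "\<gamma> - ?\<sigma> \<in> HP" for \<gamma>
      using sigma_part_unique[OF \<sigma>(1) that] by (simp add: eta_part_def)
    ultimately show "\<forall>\<^sub>F \<gamma> in at a. \<gamma> - ?\<sigma> = eta_part H C \<gamma>"
      unfolding eventually_at_topological using \<sigma>(2) by (intro exI[of _ "{\<gamma>. \<gamma> - ?\<sigma> \<in> HP}"]) auto
  qed
  then show ?thesis by (simp add: continuous_on_def)
qed

lemma eta_part_measurable [measurable]: "eta_part H C \<in> borel_measurable borel"
  by (rule borel_measurable_continuous_onI[OF eta_part_continuous])

lemma eta_part_HP: "eta_part H C \<gamma> \<in> HP"
  by (rule sigma_part_eta_part(2)[OF C])

section \<open>Fourier series on the annihilator\<close>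

definition dchar :: "'g set \<Rightarrow> 'g dual \<Rightarrow> complex" where
  "dchar X \<eta> = cnj (char_app \<eta> (rep X))"

lemma dchar_measurable [measurable]: "dchar X \<in> borel_measurable borel"
  unfolding dchar_def[abs_def] by measurable

lemma cmod_dchar [simp]: "cmod (dchar X \<eta>) = 1"
  by (simp add: dchar_def)

lemma weight_dchar: "weight H C X \<gamma> = dchar X (eta_part H C \<gamma>)"
  by (simp add: weight_def dchar_def rep_def)

lemma bounded_L2_MK:
  fixes p :: "'g dual \<Rightarrow> complex"
  assumes "p \<in> borel_measurable borel" "AE \<eta> in D.MK. cmod (p \<eta>) \<le> b"
  shows "p \<in> L2 D.MK"
proof -
  have "integrable D.MK (\<lambda>\<eta>. (cmod (p \<eta>))\<^sup>2)"
  proof (rule D.MK.integrable_const_bound[of _ "b\<^sup>2"])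
    show "AE \<eta> in D.MK. norm ((cmod (p \<eta>))\<^sup>2) \<le> b\<^sup>2"
      using assms(2) by eventually_elim (simp add: power_mono)
  qed (use assms(1) in simp)
  then show ?thesis using assms(1) by (simp add: L2_def)
qed

lemma dchar_orthonormal: "orthonormal D.MK (cosets H) dchar"
  unfolding orthonormal_def
proof (intro conjI ballI)
  fix X show "dchar X \<in> L2 D.MK" by (rule bounded_L2_MK[of _ 1]) auto
next
  fix X Y assume X: "X \<in> cosets H" and Y: "Y \<in> cosets H"
  have "L2_inner D.MK (dchar X) (dchar Y) = (\<integral>\<eta>. char_app \<eta> (rep Y - rep X) \<partial>D.MK)"
    unfolding L2_inner_def dchar_def
    by (rule Bochner_Integration.integral_cong)
      (simp_all add: diff_conv_add_uminus[of "rep Y"] char_app_add_right char_app_uminus_right mult.commute del: add_uminus_conv_diff)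
  also have "\<dots> = (if rep Y \<in> X then 1 else 0)"
    using rep_coset[OF X, of "rep Y"] by (simp add: integral_dual_char_MK)
  also have "rep Y \<in> X \<longleftrightarrow> X = Y"
    using G.coset_eq[OF X Y _ rep_mem[OF Y]] rep_mem[OF Y] by auto
  finally show "L2_inner D.MK (dchar X) (dchar Y) = (if X = Y then 1 else 0)" .
qed

text \<open>On the annihilator, evaluation at a point depends only on the coset of the point modulo
  \<open>H\<close>. So the functions \<open>dchar\<close> exhaust the conjugates of all evaluations,
  which form a separating family.\<close>

lemma dchar_total: "total_family D.MK (cosets H) dchar"
  unfolding total_family_def
proof (intro ballI impI)
  fix f assume f: "f \<in> L2 D.MK" and z: "\<forall>X\<in>cosets H. L2_inner D.MK f (dchar X) = 0"
  have fm [measurable]: "f \<in> borel_measurable borel" using L2D(1)[OF f] by simp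
  have "(\<lambda>_. 1) \<in> L2 D.MK" by (rule bounded_L2_MK[of _ 1]) auto
  from L2_mult_integrable[OF f this] have fi: "integrable D.MK f" by simp
  show "AE \<eta> in D.MK. f \<eta> = 0"
  proof (rule D.separating_complete[OF separating_dual[OF D] fi])
    fix u assume "u \<in> range (\<lambda>(x::'g) \<eta>. char_app \<eta> x)"
    then obtain x where u: "u = (\<lambda>\<eta>. char_app \<eta> x)" by auto
    define X where "X = {y. y - x \<in> H}"
    have X: "X \<in> cosets H" "x \<in> X" unfolding X_def by (rule G.coset_mem)+
    have "(\<integral>\<eta>. f \<eta> * u \<eta> \<partial>D.MK) = (\<integral>\<eta>. f \<eta> * cnj (dchar X \<eta>) \<partial>D.MK)"
    proof (rule D.integral_MK_cong)
      fix \<eta> assume "\<eta> \<in> HP"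
      then have "char_app \<eta> (rep X) = char_app \<eta> x"
        using G.coset_diff[OF X(1) rep_mem[OF X(1)] X(2)] by (rule HP_const)
      then show "f \<eta> * u \<eta> = f \<eta> * cnj (dchar X \<eta>)" by (simp add: u dchar_def)
    qed (simp_all add: u)
    then show "(\<integral>\<eta>. f \<eta> * u \<eta> \<partial>D.MK) = 0" using z X(1) by (simp add: L2_inner_def)
  qed
qed

text \<open>The unordered sum over a possibly uncountable \<open>C\<close> is not visibly
  measurable. But \<open>F\<close> vanishes on all but countably many cosets of the annihilator, so
  on the annihilator the sum is the supremum \<open>S\<close> of countably many finite measurable
  sums. Its integral is the squared norm of \<open>F\<close>; it is therefore finite almost
  everywhere and has a real version \<phi>.\<close>

lemma spectral_density:
  assumes F: "F \<in> L2 \<nu>"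
  obtains \<phi> :: "'g dual \<Rightarrow> real" where "\<phi> \<in> borel_measurable borel" "\<And>\<eta>. 0 \<le> \<phi> \<eta>" "integrable D.MK \<phi>"
    "AE \<eta> in D.MK. (\<Sum>\<^sub>\<infinity>\<sigma>\<in>C. ennreal ((cmod (F (\<eta> + \<sigma>)))\<^sup>2)) = ennreal (\<phi> \<eta>)"
    "distr (density \<nu> (\<lambda>\<gamma>. ennreal ((cmod (F \<gamma>))\<^sup>2))) borel (eta_part H C) = density D.MK (\<lambda>\<eta>. ennreal (\<phi> \<eta>))"
proof -
  have Fm [measurable]: "F \<in> borel_measurable borel" using L2D(1)[OF F] by simp
  define W where "W \<gamma> = ennreal ((cmod (F \<gamma>))\<^sup>2)" for \<gamma>
  have Wm [measurable]: "W \<in> borel_measurable borel" unfolding W_def[abs_def] by measurable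
  let ?coset = "\<lambda>\<sigma>. {\<delta>. \<delta> - \<sigma> \<in> HP}"
  define C' where "C' = {\<sigma> \<in> C. ?coset \<sigma> \<in> D.supp_cosets F}"
  have inj: "inj_on ?coset C'"
  proof (rule inj_onI)
    fix \<sigma> \<tau> assume "\<sigma> \<in> C'" "\<tau> \<in> C'" and eq: "?coset \<sigma> = ?coset \<tau>"
    then have "\<sigma> \<in> C" "\<tau> \<in> C" by (auto simp: C'_def)
    moreover have "\<sigma> - \<tau> \<in> HP" using D.coset_mem(2)[of \<sigma>] unfolding eq by simp
    ultimately show "\<sigma> = \<tau>" using C_diff_HP[of \<tau> \<sigma>] by simp
  qed
  have "countable C'"
  proof (rule countable_image_inj_on[OF _ inj])
    show "countable (?coset ` C')"
      by (rule countable_subset[OF _ D.supp_cosets_L2[OF F]]) (auto simp: C'_def)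
  qed
  note cC = this
  have W0: "W (\<eta> + \<sigma>) = 0" if "\<eta> \<in> HP" "\<sigma> \<in> C" "\<sigma> \<notin> C'" for \<eta> \<sigma>
  proof -
    have "?coset \<sigma> \<notin> D.supp_cosets F" using that by (simp add: C'_def)
    moreover have "\<eta> + \<sigma> \<in> ?coset \<sigma>" using that(1) by simp
    ultimately have "F (\<eta> + \<sigma>) = 0" using D.coset_mem(1)[of \<sigma>] unfolding D.supp_cosets_def by blast
    then show ?thesis by (simp add: W_def)
  qed
  define P where "P n = {\<sigma> \<in> C'. to_nat_on C' \<sigma> < n}" for n
  have Pfin: "finite (P n)" for n
  proof (rule finite_imageD)
    show "finite (to_nat_on C' ` P n)" by (rule finite_subset[of _ "{..<n}"]) (auto simp: P_def)
    show "inj_on (to_nat_on C') (P n)"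
      by (rule inj_on_subset[OF inj_on_to_nat_on[OF cC]]) (auto simp: P_def)
  qed
  have Pmono: "P m \<subseteq> P n" if "m \<le> n" for m n using that by (auto simp: P_def)
  have PC: "P n \<subseteq> C" for n by (auto simp: P_def C'_def)
  define Q where "Q n \<eta> = (\<Sum>\<sigma>\<in>P n. W (\<eta> + \<sigma>))" for n \<eta>
  have Wsm [measurable]: "(\<lambda>\<eta>. W (\<eta> + \<sigma>)) \<in> borel_measurable borel" for \<sigma>
  proof -
    have "(\<lambda>\<eta>. W (\<sigma> + \<eta>)) \<in> borel_measurable borel" by measurable
    moreover have "(\<lambda>\<eta>. W (\<eta> + \<sigma>)) = (\<lambda>\<eta>. W (\<sigma> + \<eta>))"
      by (rule ext, rule arg_cong[of _ _ W], rule add.commute)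
    ultimately show ?thesis by simp
  qed
  have Qm [measurable]: "Q n \<in> borel_measurable borel" for n
    unfolding Q_def[abs_def] by measurable
  have Qmono: "Q m \<eta> \<le> Q n \<eta>" if "m \<le> n" for m n \<eta>
    unfolding Q_def using Pmono[OF that] Pfin by (intro sum_mono2) auto
  define S where "S \<eta> = (SUP n. Q n \<eta>)" for \<eta>
  have Sm [measurable]: "S \<in> borel_measurable borel" unfolding S_def[abs_def] by measurable
  have S_eq: "(\<Sum>\<^sub>\<infinity>\<sigma>\<in>C. W (\<eta> + \<sigma>)) = S \<eta>" if \<eta>: "\<eta> \<in> HP" for \<eta>
  proof (rule antisym)
    show "(\<Sum>\<^sub>\<infinity>\<sigma>\<in>C. W (\<eta> + \<sigma>)) \<le> S \<eta>"
      unfolding infsum_ennreal_le_iff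
    proof (intro allI impI)
      fix J assume J: "finite J" "J \<subseteq> C"
      obtain n where n: "\<forall>\<sigma>\<in>J \<inter> C'. to_nat_on C' \<sigma> < n"
        using finite_nat_set_iff_bounded[of "to_nat_on C' ` (J \<inter> C')"] J(1) by auto
      have "(\<Sum>\<sigma>\<in>J. W (\<eta> + \<sigma>)) = (\<Sum>\<sigma>\<in>J \<inter> C'. W (\<eta> + \<sigma>))"
        using J W0[OF \<eta>] by (intro sum.mono_neutral_right) auto
      also have "\<dots> \<le> Q n \<eta>"
        unfolding Q_def using n Pfin by (intro sum_mono2) (auto simp: P_def)
      also have "\<dots> \<le> S \<eta>" unfolding S_def by (rule SUP_upper) simp
      finally show "(\<Sum>\<sigma>\<in>J. W (\<eta> + \<sigma>)) \<le> S \<eta>" .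
    qed
    have "Q n \<eta> \<le> (\<Sum>\<^sub>\<infinity>\<sigma>\<in>C. W (\<eta> + \<sigma>))" for n
      using infsum_ennreal_le_iff[of "\<lambda>\<sigma>. W (\<eta> + \<sigma>)" C "\<Sum>\<^sub>\<infinity>\<sigma>\<in>C. W (\<eta> + \<sigma>)"] Pfin PC
      by (simp add: Q_def)
    then show "S \<eta> \<le> (\<Sum>\<^sub>\<infinity>\<sigma>\<in>C. W (\<eta> + \<sigma>))" unfolding S_def by (rule SUP_least)
  qed
  \<comment> \<open>Each coset is translated onto the annihilator and monotone convergence adds the
    contributions. Taking \<open>q\<close> constant 1 gives the integral of \<open>S\<close>, and
    indicators give the image measure.\<close>
  have push: "(\<integral>\<^sup>+\<gamma>. W \<gamma> * q (eta_part H C \<gamma>) \<partial>\<nu>) = (\<integral>\<^sup>+\<eta>. S \<eta> * q \<eta> \<partial>D.MK)"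
    if q [measurable]: "q \<in> borel_measurable borel" for q :: "'g dual \<Rightarrow> ennreal"
  proof -
    define w where "w \<sigma> \<gamma> = indicator (?coset \<sigma>) \<gamma> * (W \<gamma> * q (eta_part H C \<gamma>))" for \<sigma> \<gamma>
    have cs [measurable]: "?coset \<sigma> \<in> sets borel" for \<sigma> by (rule D.coset_sets[OF D.coset_mem(1)])
    have wm [measurable]: "w \<sigma> \<in> borel_measurable borel" for \<sigma> unfolding w_def[abs_def] by measurable
    have pt: "W \<gamma> * q (eta_part H C \<gamma>) = (SUP n. \<Sum>\<sigma>\<in>P n. w \<sigma> \<gamma>)" for \<gamma>
    proof -
      let ?\<sigma> = "sigma_part H C \<gamma>"
      have \<sigma>: "?\<sigma> \<in> C" "\<gamma> - ?\<sigma> \<in> HP" using sigma_part_eta_part[OF C, of \<gamma>] by (auto simp: eta_part_def)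
      have val: "(\<Sum>\<sigma>\<in>P n. w \<sigma> \<gamma>) = (if ?\<sigma> \<in> P n then W \<gamma> * q (eta_part H C \<gamma>) else 0)" for n
      proof -
        have "(\<Sum>\<sigma>\<in>P n. w \<sigma> \<gamma>) = (\<Sum>\<sigma>\<in>P n. if \<sigma> = ?\<sigma> then W \<gamma> * q (eta_part H C \<gamma>) else 0)"
        proof (rule sum.cong)
          fix \<sigma> assume "\<sigma> \<in> P n"
          then have "\<gamma> - \<sigma> \<in> HP \<longleftrightarrow> \<sigma> = ?\<sigma>" using \<sigma> sigma_part_unique[of \<sigma> \<gamma>] PC[of n] by auto
          then show "w \<sigma> \<gamma> = (if \<sigma> = ?\<sigma> then W \<gamma> * q (eta_part H C \<gamma>) else 0)"
            by (simp add: w_def indicator_def)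
        qed simp
        then show ?thesis using Pfin by simp
      qed
      show ?thesis
      proof (cases "?\<sigma> \<in> C'")
        case True
        show ?thesis
        proof (rule antisym)
          have "?\<sigma> \<in> P (Suc (to_nat_on C' ?\<sigma>))" using True by (simp add: P_def)
          then have "W \<gamma> * q (eta_part H C \<gamma>) = (\<Sum>\<sigma>\<in>P (Suc (to_nat_on C' ?\<sigma>)). w \<sigma> \<gamma>)"
            by (simp only: val if_True)
          also have "\<dots> \<le> (SUP n. \<Sum>\<sigma>\<in>P n. w \<sigma> \<gamma>)" by (rule SUP_upper) simp
          finally show "W \<gamma> * q (eta_part H C \<gamma>) \<le> (SUP n. \<Sum>\<sigma>\<in>P n. w \<sigma> \<gamma>)" .
          show "(SUP n. \<Sum>\<sigma>\<in>P n. w \<sigma> \<gamma>) \<le> W \<gamma> * q (eta_part H C \<gamma>)" by (rule SUP_least) (simp add: val)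
        qed
      next
        case False
        then have "W ((\<gamma> - ?\<sigma>) + ?\<sigma>) = 0" using \<sigma> by (intro W0) auto
        then have W\<gamma>: "W \<gamma> = 0" by simp
        have "(\<Sum>\<sigma>\<in>P n. w \<sigma> \<gamma>) = 0" for n unfolding val W\<gamma> by simp
        then show ?thesis by (simp add: W\<gamma>)
      qed
    qed
    have one: "(\<integral>\<^sup>+\<gamma>. w \<sigma> \<gamma> \<partial>\<nu>) = (\<integral>\<^sup>+\<eta>. W (\<eta> + \<sigma>) * q \<eta> \<partial>D.MK)" if \<sigma>: "\<sigma> \<in> C" for \<sigma>
    proof -
      have "(\<integral>\<^sup>+\<gamma>. w \<sigma> \<gamma> \<partial>\<nu>) = (\<integral>\<^sup>+\<eta>. w \<sigma> (\<sigma> + \<eta>) \<partial>\<nu>)"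
        by (rule D.nn_integral_shift[symmetric]) measurable
      also have "\<dots> = (\<integral>\<^sup>+\<eta>. indicator HP \<eta> * (W (\<sigma> + \<eta>) * q \<eta>) \<partial>\<nu>)"
        by (rule nn_integral_cong) (simp add: w_def indicator_def sigma_eta_add[OF \<sigma>])
      also have "\<dots> = (\<integral>\<^sup>+\<eta>. W (\<sigma> + \<eta>) * q \<eta> \<partial>D.MK)"
        by (rule D.nn_integral_MK[symmetric]) measurable
      finally show ?thesis by (simp add: add.commute)
    qed
    have "(\<integral>\<^sup>+\<gamma>. W \<gamma> * q (eta_part H C \<gamma>) \<partial>\<nu>) = (SUP n. \<integral>\<^sup>+\<gamma>. (\<Sum>\<sigma>\<in>P n. w \<sigma> \<gamma>) \<partial>\<nu>)"
      unfolding pt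
    proof (rule nn_integral_monotone_convergence_SUP)
      show "incseq (\<lambda>n \<gamma>. \<Sum>\<sigma>\<in>P n. w \<sigma> \<gamma>)"
        unfolding incseq_def le_fun_def using Pmono Pfin by (auto intro!: sum_mono2)
    qed simp
    also have "\<dots> = (SUP n. \<integral>\<^sup>+\<eta>. Q n \<eta> * q \<eta> \<partial>D.MK)"
    proof (rule SUP_cong)
      fix n
      have "(\<integral>\<^sup>+\<gamma>. (\<Sum>\<sigma>\<in>P n. w \<sigma> \<gamma>) \<partial>\<nu>) = (\<Sum>\<sigma>\<in>P n. \<integral>\<^sup>+\<gamma>. w \<sigma> \<gamma> \<partial>\<nu>)"
        by (rule nn_integral_sum) simp
      also have "\<dots> = (\<Sum>\<sigma>\<in>P n. \<integral>\<^sup>+\<eta>. W (\<eta> + \<sigma>) * q \<eta> \<partial>D.MK)"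
        using PC[of n] by (intro sum.cong one) auto
      also have "\<dots> = (\<integral>\<^sup>+\<eta>. (\<Sum>\<sigma>\<in>P n. W (\<eta> + \<sigma>) * q \<eta>) \<partial>D.MK)"
        by (rule nn_integral_sum[symmetric]) simp
      finally show "(\<integral>\<^sup>+\<gamma>. (\<Sum>\<sigma>\<in>P n. w \<sigma> \<gamma>) \<partial>\<nu>) = (\<integral>\<^sup>+\<eta>. Q n \<eta> * q \<eta> \<partial>D.MK)"
        by (simp add: Q_def sum_distrib_right)
    qed simp
    also have "\<dots> = (\<integral>\<^sup>+\<eta>. (SUP n. Q n \<eta> * q \<eta>) \<partial>D.MK)"
    proof (rule nn_integral_monotone_convergence_SUP[symmetric])
      show "incseq (\<lambda>n \<eta>. Q n \<eta> * q \<eta>)"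
        unfolding incseq_def le_fun_def using Qmono by (auto intro!: mult_right_mono)
    qed simp
    also have "\<dots> = (\<integral>\<^sup>+\<eta>. S \<eta> * q \<eta> \<partial>D.MK)"
      unfolding S_def by (simp add: SUP_mult_right_ennreal)
    finally show ?thesis .
  qed
  have "(\<integral>\<^sup>+\<eta>. S \<eta> \<partial>D.MK) = (\<integral>\<^sup>+\<gamma>. W \<gamma> \<partial>\<nu>)" using push[of "\<lambda>_. 1"] by simp
  also have "\<dots> = ennreal (\<integral>\<gamma>. (cmod (F \<gamma>))\<^sup>2 \<partial>\<nu>)"
    unfolding W_def by (rule nn_integral_eq_integral) (use L2D(2)[OF F] in auto)
  finally have fin: "(\<integral>\<^sup>+\<eta>. S \<eta> \<partial>D.MK) < \<infinity>" by simp
  have ae: "AE \<eta> in D.MK. S \<eta> \<noteq> \<infinity>" by (rule nn_integral_PInf_AE) (use fin in auto)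
  \<comment> \<open>Points with \<open>S \<eta> = \<infinity>\<close> receive the value 0; they form
    a null set for \<open>D.MK\<close>.\<close>
  define \<phi> where "\<phi> \<eta> = enn2real (S \<eta>)" for \<eta>
  have \<phi>m [measurable]: "\<phi> \<in> borel_measurable borel" unfolding \<phi>_def[abs_def] by measurable
  have S\<phi>: "AE \<eta> in D.MK. S \<eta> = ennreal (\<phi> \<eta>)"
    using ae by eventually_elim (simp add: \<phi>_def less_top)
  have \<phi>i: "integrable D.MK \<phi>"
  proof (rule integrableI_nonneg)
    have "(\<integral>\<^sup>+\<eta>. ennreal (\<phi> \<eta>) \<partial>D.MK) = (\<integral>\<^sup>+\<eta>. S \<eta> \<partial>D.MK)"
      using S\<phi> by (intro nn_integral_cong_AE) auto
    then show "(\<integral>\<^sup>+\<eta>. ennreal (\<phi> \<eta>) \<partial>D.MK) < \<infinity>" using fin by simp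
  qed (auto simp: \<phi>_def)
  have "AE \<eta> in D.MK. \<eta> \<in> HP" by (simp add: D.AE_MK)
  with S\<phi> have sym: "AE \<eta> in D.MK. (\<Sum>\<^sub>\<infinity>\<sigma>\<in>C. ennreal ((cmod (F (\<eta> + \<sigma>)))\<^sup>2)) = ennreal (\<phi> \<eta>)"
    by eventually_elim (use S_eq in \<open>simp add: W_def\<close>)
  have "distr (density \<nu> W) borel (eta_part H C) = density D.MK (\<lambda>\<eta>. ennreal (\<phi> \<eta>))"
  proof (rule measure_eqI)
    fix A assume "A \<in> sets (distr (density \<nu> W) borel (eta_part H C))"
    then have A [measurable]: "A \<in> sets borel" by simp
    have vA: "eta_part H C -` A \<in> sets borel"
      using measurable_sets[OF eta_part_measurable A] by simp
    have "emeasure (distr (density \<nu> W) borel (eta_part H C)) A = emeasure (density \<nu> W) (eta_part H C -` A)"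
      by (subst emeasure_distr) auto
    also have "\<dots> = (\<integral>\<^sup>+\<gamma>. W \<gamma> * indicator (eta_part H C -` A) \<gamma> \<partial>\<nu>)"
      using vA by (subst emeasure_density) auto
    also have "\<dots> = (\<integral>\<^sup>+\<gamma>. W \<gamma> * indicator A (eta_part H C \<gamma>) \<partial>\<nu>)"
      by (intro nn_integral_cong) (simp add: indicator_def)
    also have "\<dots> = (\<integral>\<^sup>+\<eta>. S \<eta> * indicator A \<eta> \<partial>D.MK)" by (rule push) measurable
    also have "\<dots> = (\<integral>\<^sup>+\<eta>. ennreal (\<phi> \<eta>) * indicator A \<eta> \<partial>D.MK)"
      using S\<phi> by (intro nn_integral_cong_AE) auto
    also have "\<dots> = emeasure (density D.MK (\<lambda>\<eta>. ennreal (\<phi> \<eta>))) A"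
      by (subst emeasure_density) auto
    finally show "emeasure (distr (density \<nu> W) borel (eta_part H C)) A = emeasure (density D.MK (\<lambda>\<eta>. ennreal (\<phi> \<eta>))) A" .
  qed simp
  from \<phi>m _ \<phi>i sym this[unfolded W_def[abs_def]] show ?thesis by (rule that) (simp add: \<phi>_def)
qed

end

section \<open>The frame theorem on the Fourier side\<close>

text \<open>Everything here takes place on the dual side: \<open>F\<close> is the transform of the
  generator, \<phi> a finite-valued version of its symbol, and the image measure identity
  \<open>push\<close> is the link between them.\<close>

locale spectral_frame = plancherel +
  fixes F :: "'a dual \<Rightarrow> complex" and \<phi> :: "'a dual \<Rightarrow> real"
  assumes F: "F \<in> L2 \<nu>" and \<phi>_measurable [measurable]: "\<phi> \<in> borel_measurable borel"
    and \<phi>_nonneg: "\<And>\<eta>. 0 \<le> \<phi> \<eta>" and \<phi>_integrable: "integrable D.MK \<phi>"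
    and push: "distr (density \<nu> (\<lambda>\<gamma>. ennreal ((cmod (F \<gamma>))\<^sup>2))) borel (eta_part H C) = density D.MK (\<lambda>\<eta>. ennreal (\<phi> \<eta>))"
begin

lemma F_measurable [measurable]: "F \<in> borel_measurable borel"
  using L2D(1)[OF F] by simp

lemma push_integral:
  fixes p :: "'a dual \<Rightarrow> 'b::{banach, second_countable_topology}"
  assumes [measurable]: "p \<in> borel_measurable borel"
  shows "(\<integral>\<gamma>. (cmod (F \<gamma>))\<^sup>2 *\<^sub>R p (eta_part H C \<gamma>) \<partial>\<nu>) = (\<integral>\<eta>. \<phi> \<eta> *\<^sub>R p \<eta> \<partial>D.MK)"
proof -
  have "(\<integral>\<gamma>. (cmod (F \<gamma>))\<^sup>2 *\<^sub>R p (eta_part H C \<gamma>) \<partial>\<nu>)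
      = (\<integral>\<gamma>. p (eta_part H C \<gamma>) \<partial>density \<nu> (\<lambda>\<gamma>. ennreal ((cmod (F \<gamma>))\<^sup>2)))"
    by (rule integral_density[symmetric]) auto
  also have "\<dots> = (\<integral>\<eta>. p \<eta> \<partial>distr (density \<nu> (\<lambda>\<gamma>. ennreal ((cmod (F \<gamma>))\<^sup>2))) borel (eta_part H C))"
    by (rule integral_distr[symmetric]) auto
  also have "\<dots> = (\<integral>\<eta>. \<phi> \<eta> *\<^sub>R p \<eta> \<partial>D.MK)"
    unfolding push by (rule integral_density) (auto simp: \<phi>_nonneg)
  finally show ?thesis .
qed

definition T :: "'a set \<Rightarrow> 'a dual \<Rightarrow> complex" where
  "T X \<gamma> = F \<gamma> * dchar X (eta_part H C \<gamma>)"

text \<open>The map from functions on the annihilator to multiples of \<open>F\<close>. It is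
  isometric for the weight \<phi> and sends trigonometric polynomials to the span of the vectors
  \<open>T X\<close>.\<close>

definition lift :: "('a dual \<Rightarrow> complex) \<Rightarrow> 'a dual \<Rightarrow> complex" where
  "lift p \<gamma> = p (eta_part H C \<gamma>) * F \<gamma>"

lemma lift_L2:
  assumes "p \<in> borel_measurable borel" "\<And>\<eta>. \<eta> \<in> HP \<Longrightarrow> cmod (p \<eta>) \<le> b"
  shows "lift p \<in> L2 \<nu>"
  unfolding lift_def[abs_def]
  by (rule L2_bounded_mult[OF F, of _ b]) (use assms eta_part_HP in auto)

lemma T_lift: "T X = lift (dchar X)"
  by (simp add: T_def[abs_def] lift_def[abs_def] mult.commute)

lemma T_L2: "T X \<in> L2 \<nu>"
  unfolding T_lift by (rule lift_L2[of _ 1]) auto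

lemma lift_norm:
  assumes [measurable]: "p \<in> borel_measurable borel"
  shows "(L2_norm \<nu> (lift p))\<^sup>2 = (\<integral>\<eta>. \<phi> \<eta> * (cmod (p \<eta>))\<^sup>2 \<partial>D.MK)"
proof -
  have "(L2_norm \<nu> (lift p))\<^sup>2 = (\<integral>\<gamma>. (cmod (F \<gamma>))\<^sup>2 *\<^sub>R (cmod (p (eta_part H C \<gamma>)))\<^sup>2 \<partial>\<nu>)"
    unfolding L2_norm_power2 lift_def by (simp add: norm_mult power_mult_distrib mult.commute)
  also have "\<dots> = (\<integral>\<eta>. \<phi> \<eta> *\<^sub>R (cmod (p \<eta>))\<^sup>2 \<partial>D.MK)"
    by (rule push_integral[where p = "\<lambda>\<eta>. (cmod (p \<eta>))\<^sup>2"]) measurable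
  finally show ?thesis by simp
qed

lemma lift_inner:
  assumes [measurable]: "p \<in> borel_measurable borel"
  shows "L2_inner \<nu> (lift p) (T X) = L2_inner D.MK (\<lambda>\<eta>. of_real (\<phi> \<eta>) * p \<eta>) (dchar X)"
proof -
  have "lift p \<gamma> * cnj (T X \<gamma>) = (cmod (F \<gamma>))\<^sup>2 *\<^sub>R (p (eta_part H C \<gamma>) * cnj (dchar X (eta_part H C \<gamma>)))" for \<gamma>
  proof -
    have "lift p \<gamma> * cnj (T X \<gamma>) = (F \<gamma> * cnj (F \<gamma>)) * (p (eta_part H C \<gamma>) * cnj (dchar X (eta_part H C \<gamma>)))"
      by (simp add: lift_def T_def)
    then show ?thesis unfolding complex_norm_square[symmetric] scaleR_conv_of_real .
  qed
  then have "L2_inner \<nu> (lift p) (T X)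
      = (\<integral>\<gamma>. (cmod (F \<gamma>))\<^sup>2 *\<^sub>R (p (eta_part H C \<gamma>) * cnj (dchar X (eta_part H C \<gamma>))) \<partial>\<nu>)"
    unfolding L2_inner_def by (simp only:)
  also have "\<dots> = (\<integral>\<eta>. \<phi> \<eta> *\<^sub>R (p \<eta> * cnj (dchar X \<eta>)) \<partial>D.MK)"
    by (rule push_integral[where p = "\<lambda>\<eta>. p \<eta> * cnj (dchar X \<eta>)"]) measurable
  finally show ?thesis by (simp add: L2_inner_def scaleR_conv_of_real mult.assoc)
qed

text \<open>The coefficient of \<open>lift p\<close> against \<open>T X\<close> is a Fourier
  coefficient of \<phi> times \<open>p\<close>: the image of the squared modulus of \<open>F\<close>
  contributes the factor \<phi>. Squaring yields the second power of \<phi>, whereas the norm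
  contains the first.\<close>

lemma lift_frame_sum:
  assumes "p \<in> borel_measurable borel" and L: "(\<lambda>\<eta>. of_real (\<phi> \<eta>) * p \<eta>) \<in> L2 D.MK"
  shows "(\<Sum>\<^sub>\<infinity>X\<in>cosets H. ennreal ((cmod (L2_inner \<nu> (lift p) (T X)))\<^sup>2))
    = ennreal (\<integral>\<eta>. (\<phi> \<eta>)\<^sup>2 * (cmod (p \<eta>))\<^sup>2 \<partial>D.MK)"
  unfolding lift_inner[OF assms(1)] Parseval[OF dchar_orthonormal dchar_total L] L2_norm_power2
  using \<phi>_nonneg by (simp add: norm_mult power_mult_distrib)

lemma lincombs_T_lift:
  assumes "h \<in> lincombs (cosets H) T"
  obtains p b where "p \<in> borel_measurable borel" "\<And>\<eta>. cmod (p \<eta>) \<le> b" "h = lift p"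
proof -
  obtain J c where J: "finite J" "J \<subseteq> cosets H" "h = (\<lambda>x. \<Sum>j\<in>J. c j * T j x)"
    by (rule lincombsE[OF assms])
  let ?p = "\<lambda>\<eta>. \<Sum>j\<in>J. c j * dchar j \<eta>"
  show ?thesis
  proof (rule that[of ?p "\<Sum>j\<in>J. cmod (c j)"])
    show "?p \<in> borel_measurable borel" by measurable
    show "cmod (?p \<eta>) \<le> (\<Sum>j\<in>J. cmod (c j))" for \<eta>
      by (rule sum_norm_le) (simp add: norm_mult)
    show "h = lift ?p"
      unfolding J(3) lift_def[abs_def] T_def by (simp add: sum_distrib_left mult_ac)
  qed
qed

lemma lift_cspan:
  assumes "p \<in> D.cspan (range (\<lambda>(x::'a) \<eta>. char_app \<eta> x))"
  shows "lift p \<in> lincombs (cosets H) T"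
  using assms
proof induction
  case (scale u c)
  then obtain x where u: "u = (\<lambda>\<eta>. char_app \<eta> x)" by auto
  \<comment> \<open>The coset of \<open>- x\<close> and not of \<open>x\<close>, because
    \<open>dchar\<close> is a conjugated evaluation.\<close>
  define X where "X = {y. y - (- x) \<in> H}"
  have X: "X \<in> cosets H" "- x \<in> X" unfolding X_def by (rule G.coset_mem)+
  have "dchar X \<eta> = u \<eta>" if "\<eta> \<in> HP" for \<eta>
  proof -
    have "char_app \<eta> (rep X) = char_app \<eta> (- x)"
      by (rule HP_const[OF that G.coset_diff[OF X(1) rep_mem[OF X(1)] X(2)]])
    then show ?thesis by (simp add: dchar_def u char_app_uminus_right)
  qed
  then have "lift (\<lambda>\<eta>. c * u \<eta>) = (\<lambda>\<gamma>. c * T X \<gamma>)"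
    using eta_part_HP by (simp add: lift_def[abs_def] T_def mult_ac)
  then show ?case using lincombs_single[OF X(1), of c T] by simp
next
  case (add p q)
  have "lift (\<lambda>\<eta>. p \<eta> + q \<eta>) = (\<lambda>\<gamma>. lift p \<gamma> + lift q \<gamma>)"
    by (simp add: lift_def[abs_def] distrib_right)
  then show ?case using lincombs_add[OF add.IH] by simp
qed

abbreviation "V \<equiv> L2_closed_span \<nu> (cosets H) T"

text \<open>Trigonometric polynomials bounded by 1 on the annihilator converge to the indicator
  almost everywhere. Integrability of \<phi> permits dominated convergence, so the lifts converge in
  norm.\<close>

lemma lift_indicator_closed_span:
  assumes E [measurable]: "E \<in> sets borel" and EH: "E \<subseteq> HP"
  shows "lift (indicator E) \<in> V"
proof -
  obtain p :: "nat \<Rightarrow> 'a dual \<Rightarrow> complex" where p: "\<And>n. p n \<in> D.cspan (range (\<lambda>(x::'a) \<eta>. char_app \<eta> x))"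
    and p1: "\<And>n \<eta>. \<eta> \<in> HP \<Longrightarrow> cmod (p n \<eta>) \<le> 1"
    and lim: "AE \<eta> in D.MK. (\<lambda>n. p n \<eta>) \<longlonglongrightarrow> indicator E \<eta>"
    by (rule D.cspan_approx_indicator[OF separating_dual[OF D] E EH]) (rule that)
  have pm [measurable]: "p n \<in> borel_measurable borel" for n
    by (rule D.cspan_measurable[OF separating_dual[OF D] p])
  have LE: "lift (indicator E) \<in> L2 \<nu>" by (rule lift_L2[of _ 1]) (auto simp: indicator_def)
  have sq: "(L2_norm \<nu> (\<lambda>\<gamma>. lift (p n) \<gamma> - lift (indicator E) \<gamma>))\<^sup>2
      = (\<integral>\<eta>. \<phi> \<eta> * (cmod (p n \<eta> - indicator E \<eta>))\<^sup>2 \<partial>D.MK)" for n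
  proof -
    have "(\<lambda>\<gamma>. lift (p n) \<gamma> - lift (indicator E) \<gamma>) = lift (\<lambda>\<eta>. p n \<eta> - indicator E \<eta>)"
      by (simp add: lift_def[abs_def] left_diff_distrib)
    then show ?thesis using lift_norm[of "\<lambda>\<eta>. p n \<eta> - indicator E \<eta>"] by simp
  qed
  have "(\<lambda>n. \<integral>\<eta>. \<phi> \<eta> * (cmod (p n \<eta> - indicator E \<eta>))\<^sup>2 \<partial>D.MK) \<longlonglongrightarrow> (\<integral>\<eta>. 0 \<partial>D.MK)"
  \<comment> \<open>The difference of the polynomial and the indicator has modulus at most 1 + 1,
    whence the factor 4 after squaring.\<close>
  proof (rule integral_dominated_convergence[where w = "\<lambda>\<eta>. 4 * \<phi> \<eta>"])
    show "AE \<eta> in D.MK. (\<lambda>n. \<phi> \<eta> * (cmod (p n \<eta> - indicator E \<eta>))\<^sup>2) \<longlonglongrightarrow> 0"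
      using lim
    proof eventually_elim
      case (elim \<eta>)
      have "(\<lambda>n. \<phi> \<eta> * (cmod (p n \<eta> - indicator E \<eta>))\<^sup>2) \<longlonglongrightarrow> \<phi> \<eta> * (cmod (indicator E \<eta> - indicator E \<eta>))\<^sup>2"
        by (intro tendsto_intros elim)
      then show ?case by simp
    qed
    show "AE \<eta> in D.MK. norm (\<phi> \<eta> * (cmod (p n \<eta> - indicator E \<eta>))\<^sup>2) \<le> 4 * \<phi> \<eta>" for n
      unfolding D.AE_MK
    proof (intro AE_I2 impI)
      fix \<eta> assume "\<eta> \<in> HP"
      have "cmod (p n \<eta> - indicator E \<eta>) \<le> cmod (p n \<eta>) + cmod (indicator E \<eta>)" by (rule norm_triangle_ineq4)
      also have "\<dots> \<le> 2" using p1[OF \<open>\<eta> \<in> HP\<close>, of n] by (simp add: indicator_def)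
      finally have "(cmod (p n \<eta> - indicator E \<eta>))\<^sup>2 \<le> 2\<^sup>2" by (intro power_mono) auto
      then have "\<phi> \<eta> * (cmod (p n \<eta> - indicator E \<eta>))\<^sup>2 \<le> \<phi> \<eta> * 4"
        using \<phi>_nonneg[of \<eta>] by (intro mult_left_mono) auto
      then show "norm (\<phi> \<eta> * (cmod (p n \<eta> - indicator E \<eta>))\<^sup>2) \<le> 4 * \<phi> \<eta>"
        using \<phi>_nonneg[of \<eta>] by (simp add: abs_mult)
    qed
  qed (use \<phi>_integrable in auto)
  then have "(\<lambda>n. (L2_norm \<nu> (\<lambda>\<gamma>. lift (p n) \<gamma> - lift (indicator E) \<gamma>))\<^sup>2) \<longlonglongrightarrow> 0"
    by (simp add: sq)
  from tendsto_real_sqrt[OF this]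
  have "(\<lambda>n. L2_norm \<nu> (\<lambda>\<gamma>. lift (p n) \<gamma> - lift (indicator E) \<gamma>)) \<longlonglongrightarrow> 0" by simp
  then show ?thesis by (rule L2_closed_span_limit[OF LE lift_cspan[OF p]])
qed

text \<open>Testing the frame inequalities on the lift of the indicator of \<open>E\<close> compares
  the integrals of \<phi> and of its square over \<open>E\<close>. If \<open>E\<close> is taken
  where \<phi> exceeds \<open>B\<close>, or where it is positive but below \<open>A\<close>, a
  nonnegative integrand that is strictly positive on \<open>E\<close> has nonpositive integral, and
  \<open>E\<close> must be null.\<close>

lemma frame_imp_bounds:
  assumes A: "A > 0" and B: "B > 0" and fr: "L2_frame_with \<nu> V (cosets H) T A B"
  shows "AE \<eta> in D.MK. \<phi> \<eta> = 0 \<or> A \<le> \<phi> \<eta> \<and> \<phi> \<eta> \<le> B"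
proof -
  have test: "A * (\<integral>\<eta>. \<phi> \<eta> * indicator E \<eta> \<partial>D.MK) \<le> (\<integral>\<eta>. (\<phi> \<eta>)\<^sup>2 * indicator E \<eta> \<partial>D.MK)"
    "(\<integral>\<eta>. (\<phi> \<eta>)\<^sup>2 * indicator E \<eta> \<partial>D.MK) \<le> B * (\<integral>\<eta>. \<phi> \<eta> * indicator E \<eta> \<partial>D.MK)"
    if E [measurable]: "E \<in> sets borel" and EH: "E \<subseteq> HP" and b: "\<And>\<eta>. \<eta> \<in> E \<Longrightarrow> \<phi> \<eta> \<le> b" for E b
  proof -
    have ind: "(cmod (indicator E \<eta>))\<^sup>2 = indicator E \<eta>" for \<eta> by (simp add: indicator_def)
    have L: "(\<lambda>\<eta>. of_real (\<phi> \<eta>) * indicator E \<eta>) \<in> L2 D.MK"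
    proof (rule bounded_L2_MK)
      show "AE \<eta> in D.MK. cmod (of_real (\<phi> \<eta>) * indicator E \<eta>) \<le> max b 0"
        using b \<phi>_nonneg by (intro AE_I2) (auto simp: norm_mult indicator_def le_max_iff_disj)
    qed measurable
    have im: "(indicator E :: 'a dual \<Rightarrow> complex) \<in> borel_measurable borel" by measurable
    have "ennreal (A * (\<integral>\<eta>. \<phi> \<eta> * indicator E \<eta> \<partial>D.MK)) \<le> ennreal (\<integral>\<eta>. (\<phi> \<eta>)\<^sup>2 * indicator E \<eta> \<partial>D.MK)
        \<and> ennreal (\<integral>\<eta>. (\<phi> \<eta>)\<^sup>2 * indicator E \<eta> \<partial>D.MK) \<le> ennreal (B * (\<integral>\<eta>. \<phi> \<eta> * indicator E \<eta> \<partial>D.MK))"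
      using fr lift_indicator_closed_span[OF E EH] unfolding L2_frame_with_def
      by (auto simp: lift_frame_sum[OF im L] lift_norm[OF im] ind)
    moreover have "0 \<le> (\<integral>\<eta>. \<phi> \<eta> * indicator E \<eta> \<partial>D.MK)" "0 \<le> (\<integral>\<eta>. (\<phi> \<eta>)\<^sup>2 * indicator E \<eta> \<partial>D.MK)"
      using \<phi>_nonneg by (auto intro!: Bochner_Integration.integral_nonneg)
    ultimately show "A * (\<integral>\<eta>. \<phi> \<eta> * indicator E \<eta> \<partial>D.MK) \<le> (\<integral>\<eta>. (\<phi> \<eta>)\<^sup>2 * indicator E \<eta> \<partial>D.MK)"
      "(\<integral>\<eta>. (\<phi> \<eta>)\<^sup>2 * indicator E \<eta> \<partial>D.MK) \<le> B * (\<integral>\<eta>. \<phi> \<eta> * indicator E \<eta> \<partial>D.MK)"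
      using B by auto
  qed
  have int: "integrable D.MK (\<lambda>\<eta>. (\<phi> \<eta>) ^ k * indicator E \<eta>)"
    if E [measurable]: "E \<in> sets borel" and b: "\<And>\<eta>. \<eta> \<in> E \<Longrightarrow> \<phi> \<eta> \<le> b" for E b k
  proof (rule D.MK.integrable_const_bound)
    show "AE \<eta> in D.MK. norm ((\<phi> \<eta>) ^ k * indicator E \<eta>) \<le> max 0 b ^ k"
      using b \<phi>_nonneg by (intro AE_I2) (auto simp: indicator_def le_max_iff_disj intro!: power_mono)
  qed simp
  have HPs [measurable]: "HP \<in> sets borel" by (rule D.K_sets)
  have upper: "AE \<eta> in D.MK. \<not> (\<eta> \<in> HP \<and> B < \<phi> \<eta> \<and> \<phi> \<eta> \<le> real n)" for n
  proof -
    define E where "E = {\<eta> \<in> HP. B < \<phi> \<eta> \<and> \<phi> \<eta> \<le> real n}"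
    have E [measurable]: "E \<in> sets borel"
    proof -
      have "E = HP \<inter> {\<eta>. B < \<phi> \<eta> \<and> \<phi> \<eta> \<le> real n}" by (auto simp: E_def)
      then show ?thesis by simp
    qed
    have Eb: "\<phi> \<eta> \<le> real n" if "\<eta> \<in> E" for \<eta> using that by (simp add: E_def)
    have i: "integrable D.MK (\<lambda>\<eta>. (\<phi> \<eta>)\<^sup>2 * indicator E \<eta>)" "integrable D.MK (\<lambda>\<eta>. \<phi> \<eta> * indicator E \<eta>)"
      using int[OF E Eb, of 2] int[OF E Eb, of 1] by auto
    have "(\<integral>\<eta>. (\<phi> \<eta>)\<^sup>2 * indicator E \<eta> - B * (\<phi> \<eta> * indicator E \<eta>) \<partial>D.MK) \<le> 0"
      using test(2)[OF E _ Eb] i by (auto simp: E_def)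
    moreover have nn: "0 \<le> (\<phi> \<eta>)\<^sup>2 * indicator E \<eta> - B * (\<phi> \<eta> * indicator E \<eta>)" for \<eta>
      using \<phi>_nonneg[of \<eta>] by (auto simp: indicator_def E_def power2_eq_square intro!: mult_right_mono)
    ultimately have "(\<integral>\<eta>. (\<phi> \<eta>)\<^sup>2 * indicator E \<eta> - B * (\<phi> \<eta> * indicator E \<eta>) \<partial>D.MK) = 0"
      by (intro antisym Bochner_Integration.integral_nonneg) auto
    then have "AE \<eta> in D.MK. (\<phi> \<eta>)\<^sup>2 * indicator E \<eta> - B * (\<phi> \<eta> * indicator E \<eta>) = 0"
      using i nn by (subst (asm) integral_nonneg_eq_0_iff_AE) auto
    then show ?thesis
    proof eventually_elim
      case (elim \<eta>)
      show ?case
      proof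
        assume a: "\<eta> \<in> HP \<and> B < \<phi> \<eta> \<and> \<phi> \<eta> \<le> real n"
        then have "\<phi> \<eta> * (\<phi> \<eta> - B) = 0" using elim by (simp add: E_def power2_eq_square algebra_simps)
        then show False using a B by auto
      qed
    qed
  qed
  have lower: "AE \<eta> in D.MK. \<not> (\<eta> \<in> HP \<and> 0 < \<phi> \<eta> \<and> \<phi> \<eta> < A)"
  proof -
    define E where "E = {\<eta> \<in> HP. 0 < \<phi> \<eta> \<and> \<phi> \<eta> < A}"
    have E [measurable]: "E \<in> sets borel"
    proof -
      have "E = HP \<inter> {\<eta>. 0 < \<phi> \<eta> \<and> \<phi> \<eta> < A}" by (auto simp: E_def)
      then show ?thesis by simp
    qed
    have Eb: "\<phi> \<eta> \<le> A" if "\<eta> \<in> E" for \<eta> using that by (simp add: E_def)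
    have i: "integrable D.MK (\<lambda>\<eta>. (\<phi> \<eta>)\<^sup>2 * indicator E \<eta>)" "integrable D.MK (\<lambda>\<eta>. \<phi> \<eta> * indicator E \<eta>)"
      using int[OF E Eb, of 2] int[OF E Eb, of 1] by auto
    have "(\<integral>\<eta>. A * (\<phi> \<eta> * indicator E \<eta>) - (\<phi> \<eta>)\<^sup>2 * indicator E \<eta> \<partial>D.MK) \<le> 0"
      using test(1)[OF E _ Eb] i by (auto simp: E_def)
    moreover have nn: "0 \<le> A * (\<phi> \<eta> * indicator E \<eta>) - (\<phi> \<eta>)\<^sup>2 * indicator E \<eta>" for \<eta>
      using \<phi>_nonneg[of \<eta>] by (auto simp: indicator_def E_def power2_eq_square intro!: mult_right_mono)
    ultimately have "(\<integral>\<eta>. A * (\<phi> \<eta> * indicator E \<eta>) - (\<phi> \<eta>)\<^sup>2 * indicator E \<eta> \<partial>D.MK) = 0"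
      by (intro antisym Bochner_Integration.integral_nonneg) auto
    then have "AE \<eta> in D.MK. A * (\<phi> \<eta> * indicator E \<eta>) - (\<phi> \<eta>)\<^sup>2 * indicator E \<eta> = 0"
      using i nn by (subst (asm) integral_nonneg_eq_0_iff_AE) auto
    then show ?thesis
    proof eventually_elim
      case (elim \<eta>)
      show ?case
      proof
        assume a: "\<eta> \<in> HP \<and> 0 < \<phi> \<eta> \<and> \<phi> \<eta> < A"
        then have "\<phi> \<eta> * (A - \<phi> \<eta>) = 0" using elim by (simp add: E_def power2_eq_square algebra_simps)
        then show False using a by auto
      qed
    qed
  qed
  have "AE \<eta> in D.MK. \<forall>n. \<not> (\<eta> \<in> HP \<and> B < \<phi> \<eta> \<and> \<phi> \<eta> \<le> real n)"
    unfolding AE_all_countable using upper by blast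
  moreover have "AE \<eta> in D.MK. \<eta> \<in> HP" by (simp add: D.AE_MK)
  ultimately show ?thesis using lower
  proof eventually_elim
    case (elim \<eta>)
    obtain n where "\<phi> \<eta> \<le> real n" using real_arch_simple by blast
    with elim(1,2) have "\<phi> \<eta> \<le> B" by (meson not_less)
    moreover have "\<phi> \<eta> = 0 \<or> A \<le> \<phi> \<eta>" using elim(2,3) \<phi>_nonneg[of \<eta>] by auto
    ultimately show ?case by auto
  qed
qed

text \<open>The upper bound makes \<phi> times \<open>p\<close> square integrable, so the frame sum
  can be computed. Then \<open>A * \<phi>\<close>, the square of \<phi> and
  \<open>B * \<phi>\<close> are ordered pointwise almost everywhere, trivially so where \<phi> is
  0.\<close>

lemma bounds_imp_frame:
  assumes A: "A > 0" and B: "B > 0" and ae: "AE \<eta> in D.MK. \<phi> \<eta> = 0 \<or> A \<le> \<phi> \<eta> \<and> \<phi> \<eta> \<le> B"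
  shows "L2_frame_with \<nu> V (cosets H) T A B"
proof (rule frame_closure[OF T_L2 A B])
  have le: "A * (L2_norm \<nu> g)\<^sup>2 \<le> s \<and> s \<le> B * (L2_norm \<nu> g)\<^sup>2
      \<and> (\<Sum>\<^sub>\<infinity>X\<in>cosets H. ennreal ((cmod (L2_inner \<nu> g (T X)))\<^sup>2)) = ennreal s"
    if p [measurable]: "p \<in> borel_measurable borel" and b: "\<And>\<eta>. cmod (p \<eta>) \<le> b" and g: "g = lift p"
      and s: "s = (\<integral>\<eta>. (\<phi> \<eta>)\<^sup>2 * (cmod (p \<eta>))\<^sup>2 \<partial>D.MK)" for g p b s
  proof -
    have b0: "0 \<le> b" using order_trans[OF norm_ge_zero b] .
    have L: "(\<lambda>\<eta>. of_real (\<phi> \<eta>) * p \<eta>) \<in> L2 D.MK"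
    proof (rule bounded_L2_MK)
      show "AE \<eta> in D.MK. cmod (of_real (\<phi> \<eta>) * p \<eta>) \<le> B * b"
        using ae
      proof eventually_elim
        case (elim \<eta>)
        then have "\<bar>\<phi> \<eta>\<bar> \<le> B" using B \<phi>_nonneg[of \<eta>] by auto
        then show ?case unfolding norm_mult norm_of_real using b by (intro mult_mono) auto
      qed
    qed measurable
    have i2: "integrable D.MK (\<lambda>\<eta>. (\<phi> \<eta>)\<^sup>2 * (cmod (p \<eta>))\<^sup>2)"
      using L2D(2)[OF L] by (simp add: norm_mult power_mult_distrib)
    have i1: "integrable D.MK (\<lambda>\<eta>. \<phi> \<eta> * (cmod (p \<eta>))\<^sup>2)"
    proof (rule Bochner_Integration.integrable_bound)
      show "integrable D.MK (\<lambda>\<eta>. b\<^sup>2 * \<phi> \<eta>)" using \<phi>_integrable by simp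
      show "AE \<eta> in D.MK. norm (\<phi> \<eta> * (cmod (p \<eta>))\<^sup>2) \<le> norm (b\<^sup>2 * \<phi> \<eta>)"
        using \<phi>_nonneg b by (intro AE_I2) (auto simp: abs_mult mult.commute[of "b\<^sup>2"] intro!: mult_left_mono power_mono)
    qed simp
    have "A * (\<integral>\<eta>. \<phi> \<eta> * (cmod (p \<eta>))\<^sup>2 \<partial>D.MK) = (\<integral>\<eta>. A * (\<phi> \<eta> * (cmod (p \<eta>))\<^sup>2) \<partial>D.MK)" by simp
    also have "\<dots> \<le> s"
      unfolding s
    proof (rule integral_mono_AE[OF _ i2])
      show "AE \<eta> in D.MK. A * (\<phi> \<eta> * (cmod (p \<eta>))\<^sup>2) \<le> (\<phi> \<eta>)\<^sup>2 * (cmod (p \<eta>))\<^sup>2"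
        using ae
      proof eventually_elim
        case (elim \<eta>)
        then have "A * \<phi> \<eta> \<le> (\<phi> \<eta>)\<^sup>2" using \<phi>_nonneg[of \<eta>] by (auto simp: power2_eq_square intro: mult_right_mono)
        then have "A * \<phi> \<eta> * (cmod (p \<eta>))\<^sup>2 \<le> (\<phi> \<eta>)\<^sup>2 * (cmod (p \<eta>))\<^sup>2" by (rule mult_right_mono) simp
        then show ?case by (simp add: mult.assoc)
      qed
    qed (use i1 in simp)
    finally have 1: "A * (L2_norm \<nu> g)\<^sup>2 \<le> s" unfolding g lift_norm[OF p] .
    have "s \<le> (\<integral>\<eta>. B * (\<phi> \<eta> * (cmod (p \<eta>))\<^sup>2) \<partial>D.MK)"
      unfolding s
    proof (rule integral_mono_AE[OF i2])
      show "AE \<eta> in D.MK. (\<phi> \<eta>)\<^sup>2 * (cmod (p \<eta>))\<^sup>2 \<le> B * (\<phi> \<eta> * (cmod (p \<eta>))\<^sup>2)"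
        using ae
      proof eventually_elim
        case (elim \<eta>)
        then have "(\<phi> \<eta>)\<^sup>2 \<le> B * \<phi> \<eta>" using \<phi>_nonneg[of \<eta>] by (auto simp: power2_eq_square intro: mult_right_mono)
        then have "(\<phi> \<eta>)\<^sup>2 * (cmod (p \<eta>))\<^sup>2 \<le> B * \<phi> \<eta> * (cmod (p \<eta>))\<^sup>2" by (rule mult_right_mono) simp
        then show ?case by (simp add: mult.assoc)
      qed
    qed (use i1 in simp)
    then have 2: "s \<le> B * (L2_norm \<nu> g)\<^sup>2" unfolding g lift_norm[OF p] by simp
    show ?thesis using 1 2 lift_frame_sum[OF p L] unfolding g s by simp
  qed
  fix g assume "g \<in> lincombs (cosets H) T"
  then obtain p b where p: "p \<in> borel_measurable borel" "\<And>\<eta>. cmod (p \<eta>) \<le> b" "g = lift p"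
    by (rule lincombs_T_lift) (rule that)
  note * = le[OF p refl]
  show "ennreal (A * (L2_norm \<nu> g)\<^sup>2) \<le> (\<Sum>\<^sub>\<infinity>X\<in>cosets H. ennreal ((cmod (L2_inner \<nu> g (T X)))\<^sup>2))"
    "(\<Sum>\<^sub>\<infinity>X\<in>cosets H. ennreal ((cmod (L2_inner \<nu> g (T X)))\<^sup>2)) \<le> ennreal (B * (L2_norm \<nu> g)\<^sup>2)"
    using * by (auto intro: ennreal_leI)
qed

end

section \<open>Transfer of the frame property to the group\<close>

context plancherel
begin

lemma fourier_pair_closed_span:
  assumes u: "\<And>j. j \<in> J \<Longrightarrow> fourier_pair (u j) (U j)" and g: "fourier_pair g G"
  shows "g \<in> L2_closed_span \<mu> J u \<longleftrightarrow> G \<in> L2_closed_span \<nu> J U"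
proof -
  have "L2_norm \<mu> (\<lambda>x. g x - (\<Sum>j\<in>I. c j * u j x)) = L2_norm \<nu> (\<lambda>x. G x - (\<Sum>j\<in>I. c j * U j x))"
    if "I \<subseteq> J" for I c
    using that by (intro fourier_pair_norm fourier_pair_diff[OF g] fourier_pair_lincomb u) auto
  then show ?thesis using fourier_pair_L2[OF g] unfolding L2_closed_span_def
    by (simp cong: conj_cong)
qed

text \<open>Pairs preserve norms, inner products and membership in closed spans. One direction picks
  a preimage by surjectivity, the other takes the chosen transform; in both the two inequalities are
  carried over verbatim.\<close>

lemma fourier_pair_frame_with:
  assumes u: "\<And>j. j \<in> J \<Longrightarrow> fourier_pair (u j) (U j)"
  shows "L2_frame_with \<mu> (L2_closed_span \<mu> J u) J u A B \<longleftrightarrow> L2_frame_with \<nu> (L2_closed_span \<nu> J U) J U A B"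
proof -
  have sum: "(\<Sum>\<^sub>\<infinity>j\<in>J. ennreal ((cmod (L2_inner \<mu> g (u j)))\<^sup>2)) = (\<Sum>\<^sub>\<infinity>j\<in>J. ennreal ((cmod (L2_inner \<nu> G (U j)))\<^sup>2))"
    if "fourier_pair g G" for g G
    by (intro infsum_cong) (simp add: fourier_pair_inner[OF that u])
  show ?thesis
  proof
    assume fr: "L2_frame_with \<mu> (L2_closed_span \<mu> J u) J u A B"
    show "L2_frame_with \<nu> (L2_closed_span \<nu> J U) J U A B"
      unfolding L2_frame_with_def
    proof
      fix G assume G: "G \<in> L2_closed_span \<nu> J U"
      then have "G \<in> L2 \<nu>" by (simp add: L2_closed_span_def)
      then obtain g where g: "fourier_pair g G" by (rule fourier_pair_surj)
      have "g \<in> L2_closed_span \<mu> J u" using fourier_pair_closed_span[of J u U, OF u g] G by simp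
      then show "ennreal (A * (L2_norm \<nu> G)\<^sup>2) \<le> (\<Sum>\<^sub>\<infinity>j\<in>J. ennreal ((cmod (L2_inner \<nu> G (U j)))\<^sup>2))
          \<and> (\<Sum>\<^sub>\<infinity>j\<in>J. ennreal ((cmod (L2_inner \<nu> G (U j)))\<^sup>2)) \<le> ennreal (B * (L2_norm \<nu> G)\<^sup>2)"
        using fr unfolding L2_frame_with_def sum[OF g, symmetric] fourier_pair_norm[OF g, symmetric] by (rule bspec[rotated])
    qed
  next
    assume fr: "L2_frame_with \<nu> (L2_closed_span \<nu> J U) J U A B"
    show "L2_frame_with \<mu> (L2_closed_span \<mu> J u) J u A B"
      unfolding L2_frame_with_def
    proof
      fix g assume g': "g \<in> L2_closed_span \<mu> J u"
      then have g: "fourier_pair g (fourier_L2 \<mu> \<nu> g)" by (intro fourier_pair_fourier_L2) (simp add: L2_closed_span_def)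
      have "fourier_L2 \<mu> \<nu> g \<in> L2_closed_span \<nu> J U" using fourier_pair_closed_span[of J u U, OF u g] g' by simp
      then show "ennreal (A * (L2_norm \<mu> g)\<^sup>2) \<le> (\<Sum>\<^sub>\<infinity>j\<in>J. ennreal ((cmod (L2_inner \<mu> g (u j)))\<^sup>2))
          \<and> (\<Sum>\<^sub>\<infinity>j\<in>J. ennreal ((cmod (L2_inner \<mu> g (u j)))\<^sup>2)) \<le> ennreal (B * (L2_norm \<mu> g)\<^sup>2)"
        using fr unfolding L2_frame_with_def sum[OF g] fourier_pair_norm[OF g] by (rule bspec[rotated])
    qed
  qed
qed

theorem frame_iff_spectral_bounds:
  assumes f: "f \<in> L2 \<mu>" and A: "A > 0" and B: "B > 0"
    and N: "N = {\<eta> \<in> HP. spectral_symbol \<mu> \<nu> C f \<eta> = 0}"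
  shows "L2_frame_with \<mu> (translation_space \<mu> \<nu> H C f) (cosets H) (\<lambda>X. translation \<mu> \<nu> H C X f) A B
    \<longleftrightarrow> (AE \<eta>\<in>HP - N in \<nu>. ennreal A \<le> spectral_symbol \<mu> \<nu> C f \<eta> \<and> spectral_symbol \<mu> \<nu> C f \<eta> \<le> ennreal B)"
proof -
  let ?F = "fourier_L2 \<mu> \<nu> f"
  have F: "?F \<in> L2 \<nu>" by (rule fourier_pair_L2(2)[OF fourier_pair_fourier_L2[OF f]])
  obtain \<phi> :: "'g dual \<Rightarrow> real" where \<phi>: "\<phi> \<in> borel_measurable borel" "\<And>\<eta>. 0 \<le> \<phi> \<eta>" "integrable D.MK \<phi>"
    and sym: "AE \<eta> in D.MK. (\<Sum>\<^sub>\<infinity>\<sigma>\<in>C. ennreal ((cmod (?F (\<eta> + \<sigma>)))\<^sup>2)) = ennreal (\<phi> \<eta>)"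
    and push: "distr (density \<nu> (\<lambda>\<gamma>. ennreal ((cmod (?F \<gamma>))\<^sup>2))) borel (eta_part H C) = density D.MK (\<lambda>\<eta>. ennreal (\<phi> \<eta>))"
    by (rule spectral_density[OF F]) (rule that)
  interpret spectral_frame \<mu> \<nu> H C ?F \<phi>
    by unfold_locales (fact F \<phi> push)+
  \<comment> \<open>The product of the transform of \<open>f\<close> with a weight of modulus 1 is
    square integrable, so the inverse transform chosen in the translation really has this product as
    its transform.\<close>
  have tr: "fourier_pair (translation \<mu> \<nu> H C X f) (T X)" for X
    using fourier_pair_inv_fourier_L2[OF T_L2[of X]] by (simp add: translation_def weight_dchar T_def[abs_def])
  have "L2_frame_with \<mu> (translation_space \<mu> \<nu> H C f) (cosets H) (\<lambda>X. translation \<mu> \<nu> H C X f) A B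
      \<longleftrightarrow> L2_frame_with \<nu> V (cosets H) T A B"
    unfolding translation_space_def by (rule fourier_pair_frame_with) (rule tr)
  also have "\<dots> \<longleftrightarrow> (AE \<eta> in D.MK. \<phi> \<eta> = 0 \<or> A \<le> \<phi> \<eta> \<and> \<phi> \<eta> \<le> B)"
    using frame_imp_bounds[OF A B] bounds_imp_frame[OF A B] by (rule iffI)
  also have "\<dots> \<longleftrightarrow> (AE \<eta> in D.MK. spectral_symbol \<mu> \<nu> C f \<eta> = 0
      \<or> ennreal A \<le> spectral_symbol \<mu> \<nu> C f \<eta> \<and> spectral_symbol \<mu> \<nu> C f \<eta> \<le> ennreal B)"
  proof (rule eventually_cong[OF sym])
    fix \<eta> assume "(\<Sum>\<^sub>\<infinity>\<sigma>\<in>C. ennreal ((cmod (?F (\<eta> + \<sigma>)))\<^sup>2)) = ennreal (\<phi> \<eta>)"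
    then have "spectral_symbol \<mu> \<nu> C f \<eta> = ennreal (\<phi> \<eta>)" by (simp add: spectral_symbol_def)
    then show "(\<phi> \<eta> = 0 \<or> A \<le> \<phi> \<eta> \<and> \<phi> \<eta> \<le> B) \<longleftrightarrow> (spectral_symbol \<mu> \<nu> C f \<eta> = 0
      \<or> ennreal A \<le> spectral_symbol \<mu> \<nu> C f \<eta> \<and> spectral_symbol \<mu> \<nu> C f \<eta> \<le> ennreal B)"
      using \<phi>(2)[of \<eta>] B by (simp add: ennreal_eq_0_iff)
  qed
  \<comment> \<open>Membership of \<eta> in the annihilator comes from \<open>D.AE_MK\<close>, and
    the alternative of a vanishing symbol is what the removal of \<open>N\<close> expresses.\<close>
  also have "\<dots> \<longleftrightarrow> (AE \<eta>\<in>HP - N in \<nu>. ennreal A \<le> spectral_symbol \<mu> \<nu> C f \<eta> \<and> spectral_symbol \<mu> \<nu> C f \<eta> \<le> ennreal B)"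
    unfolding D.AE_MK by (rule AE_cong) (auto simp: N)
  finally show ?thesis .
qed

end

theorem theorem4p5:
  fixes \<mu> :: "('g :: {topological_ab_group_add, t2_space}) measure"
    and \<nu> :: "'g dual measure"
    and H :: "'g set" and C N :: "'g dual set" and f :: "'g \<Rightarrow> complex"
  assumes "locally_compact_space (euclidean :: 'g topology)"
    and "is_subgroup H" and "compact H" and "open H"
    and "haar_measure \<mu>" and "emeasure \<mu> H = 1"
    and "haar_measure \<nu>" and "emeasure \<nu> (annihilator H) = 1"
    and "coset_reps (annihilator H) C"
    and "f \<in> L2 \<mu>"
    and N_eq: "N = {\<eta> \<in> annihilator H. spectral_symbol \<mu> \<nu> C f \<eta> = 0}"
  shows "(\<forall>A>0. \<forall>B>0.
            L2_frame_with \<mu> (translation_space \<mu> \<nu> H C f) (cosets H) (\<lambda>X. translation \<mu> \<nu> H C X f) A B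
            \<longleftrightarrow> (AE \<eta>\<in>annihilator H - N in \<nu>.
                   ennreal A \<le> spectral_symbol \<mu> \<nu> C f \<eta> \<and> spectral_symbol \<mu> \<nu> C f \<eta> \<le> ennreal B))
       \<and> (L2_frame \<mu> (translation_space \<mu> \<nu> H C f) (cosets H) (\<lambda>X. translation \<mu> \<nu> H C X f)
            \<longleftrightarrow> (\<exists>A>0. \<exists>B>0. AE \<eta>\<in>annihilator H - N in \<nu>.
                   ennreal A \<le> spectral_symbol \<mu> \<nu> C f \<eta> \<and> spectral_symbol \<mu> \<nu> C f \<eta> \<le> ennreal B))"
proof -
  interpret plancherel \<mu> \<nu> H C
    using assms(2-9) dual_compact_open_haar[of H \<nu>] by (simp add: plancherel_def compact_open_haar_def)
  note frame = frame_iff_spectral_bounds[OF assms(10) _ _ N_eq]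
  show ?thesis
  proof
    show "\<forall>A>0. \<forall>B>0.
            L2_frame_with \<mu> (translation_space \<mu> \<nu> H C f) (cosets H) (\<lambda>X. translation \<mu> \<nu> H C X f) A B
            \<longleftrightarrow> (AE \<eta>\<in>annihilator H - N in \<nu>.
                   ennreal A \<le> spectral_symbol \<mu> \<nu> C f \<eta> \<and> spectral_symbol \<mu> \<nu> C f \<eta> \<le> ennreal B)"
      by (intro allI impI frame)
    show "L2_frame \<mu> (translation_space \<mu> \<nu> H C f) (cosets H) (\<lambda>X. translation \<mu> \<nu> H C X f)
            \<longleftrightarrow> (\<exists>A>0. \<exists>B>0. AE \<eta>\<in>annihilator H - N in \<nu>.
                   ennreal A \<le> spectral_symbol \<mu> \<nu> C f \<eta> \<and> spectral_symbol \<mu> \<nu> C f \<eta> \<le> ennreal B)"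
      unfolding L2_frame_def by (simp only: frame cong: conj_cong)
  qed
qed

end
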